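(* Let $n\ge 1$, $N=2n$, and let $X\subseteq\mathbb{P}^N=\mathbb{P}^N_{\mathbb{C}}$ be an $n$-dimensional subvariety. If $\operatorname{Tan}X=\mathbb{P}^N$, then a generic point $P\in\mathbb{P}^N$ is uniquely determined by the ramification locus $R(\pi_P)\subseteq X$ of the linear projection $\pi_P:X\to\mathbb{P}^{N-1}$ from $P$. That is, there is a nonempty Zariski open subset $U\subseteq\mathbb{P}^N\setminus X$ such that for every $P\in U$ and every $Q\in\mathbb{P}^N\setminus X$, if $R(\pi_Q)=R(\pi_P)$ then $Q=P$.
   Context: The base field is $\mathbb{C}$. A subvariety means an irreducible reduced closed subvariety. For a smooth point $x\in X$, $t_xX\subseteq\mathbb{P}^N$ denotes the projective (embedded) tangent space of $X$ at $x$, an $n$-dimensional linear subspace of $\mathbb{P}^N$. The tangent variety $\operatorname{Tan}X\subseteq\mathbb{P}^N$ is the closure of the union of all $t_xX$, where $x$ runs over the smooth points of $X$. For $P\in\mathbb{P}^N\setminus X$, $\pi_P:X\to\mathbb{P}^{N-1}$ is the restriction to $X$ of the linear projection $\mathbb{P}^N\setminus\{P\}\to\mathbb{P}^{N-1}$ with center $P$. Its ramification locus $R(\pi_P)$ is the closed subset of $X$ where $\pi_P$ is not unramified, i.e. the support of $\Omega^1_{X/\mathbb{P}^{N-1}}$; a smooth point $x$ of $X$ lies in $R(\pi_P)$ if and only if $P\in t_xX$. *)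

theory Defs
  imports
    "HOL-Analysis.Analysis"
    "HOL-Algebra.Module"
    "HOL-Algebra.QuotRing"
    "HOL-Library.Poly_Mapping"
    "HOL-Library.Function_Algebras"
    "HOL-Library.Extended_Nat"
begin

section \<open>Homogeneous polynomials\<close>

type_synonym cpoly = "(nat \<Rightarrow>\<^sub>0 nat) \<Rightarrow>\<^sub>0 complex"

definition monom_eval :: "(nat \<Rightarrow>\<^sub>0 nat) \<Rightarrow> (nat \<Rightarrow> complex) \<Rightarrow> complex" where
  "monom_eval m v = (\<Prod>i\<in>Poly_Mapping.keys m. v i ^ Poly_Mapping.lookup m i)"

definition peval :: "cpoly \<Rightarrow> (nat \<Rightarrow> complex) \<Rightarrow> complex" where
  "peval F v = (\<Sum>m\<in>Poly_Mapping.keys F. Poly_Mapping.lookup F m * monom_eval m v)"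

text \<open>Homogeneous of degree \<open>d\<close> in the variables \<open>x\<^sub>0, \<dots>, x\<^sub>N\<close>; the zero polynomial is
  homogeneous of every degree.\<close>

definition homogeneous :: "nat \<Rightarrow> nat \<Rightarrow> cpoly \<Rightarrow> bool" where
  "homogeneous N d F \<longleftrightarrow> (\<forall>m\<in>Poly_Mapping.keys F. Poly_Mapping.keys m \<subseteq> {..N} \<and>
     (\<Sum>i\<in>Poly_Mapping.keys m. Poly_Mapping.lookup m i) = d)"

definition partial_eval :: "nat \<Rightarrow> cpoly \<Rightarrow> (nat \<Rightarrow> complex) \<Rightarrow> complex" where
  "partial_eval i F v = deriv (\<lambda>t. peval F (v(i := t))) (v i)"

lemma monom_eval_superset:
  assumes "finite A" "Poly_Mapping.keys m \<subseteq> A"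
  shows "monom_eval m v = (\<Prod>i\<in>A. v i ^ Poly_Mapping.lookup m i)"
  unfolding monom_eval_def
  by (rule prod.mono_neutral_left) (use assms in \<open>auto simp: in_keys_iff\<close>)

lemma monom_eval_add: "monom_eval (m + m') v = monom_eval m v * monom_eval m' v"
proof -
  let ?A = "Poly_Mapping.keys m \<union> Poly_Mapping.keys m'"
  have "monom_eval (m + m') v = (\<Prod>i\<in>?A. v i ^ Poly_Mapping.lookup (m + m') i)"
    by (rule monom_eval_superset) (use Poly_Mapping.keys_add[of m m'] in auto)
  also have "\<dots> = monom_eval m v * monom_eval m' v"
    by (simp add: monom_eval_superset[of ?A] lookup_add power_add prod.distrib)
  finally show ?thesis .
qed

lemma peval_superset:
  assumes "finite A" "Poly_Mapping.keys F \<subseteq> A"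
  shows "peval F v = (\<Sum>m\<in>A. Poly_Mapping.lookup F m * monom_eval m v)"
  unfolding peval_def
  by (rule sum.mono_neutral_left) (use assms in \<open>auto simp: in_keys_iff\<close>)

lemma peval_zero [simp]: "peval 0 v = 0"
  by (simp add: peval_def)

lemma peval_add: "peval (F + G) v = peval F v + peval G v"
proof -
  let ?A = "Poly_Mapping.keys F \<union> Poly_Mapping.keys G"
  have "peval (F + G) v = (\<Sum>m\<in>?A. Poly_Mapping.lookup (F + G) m * monom_eval m v)"
    by (rule peval_superset) (use Poly_Mapping.keys_add[of F G] in auto)
  also have "\<dots> = peval F v + peval G v"
    by (simp add: peval_superset[of ?A] lookup_add algebra_simps sum.distrib)
  finally show ?thesis .
qed

lemma peval_sum: "peval (\<Sum>i\<in>I. f i) v = (\<Sum>i\<in>I. peval (f i) v)"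
  by (induction I rule: infinite_finite_induct) (auto simp: peval_add)

lemma peval_single: "peval (Poly_Mapping.single m c) v = c * monom_eval m v"
  by (cases "c = 0") (auto simp: peval_def)

lemma cpoly_sum_single:
  fixes F :: cpoly
  shows "F = (\<Sum>m\<in>Poly_Mapping.keys F. Poly_Mapping.single m (Poly_Mapping.lookup F m))"
  by (rule poly_mapping_eqI)
     (auto simp: Poly_Mapping.lookup_sum lookup_single when_def in_keys_iff
        if_distrib sum.delta cong: if_cong)

lemma peval_mult: "peval (F * G) v = peval F v * peval G v"
proof -
  let ?s = "\<lambda>F m. Poly_Mapping.single m (Poly_Mapping.lookup F m) :: cpoly"
  have "peval (F * G) v =
      peval ((\<Sum>m\<in>Poly_Mapping.keys F. ?s F m) * (\<Sum>m\<in>Poly_Mapping.keys G. ?s G m)) v"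
    by (rule arg_cong2[of _ _ _ _ "\<lambda>a b. peval (a * b) v"]) (rule cpoly_sum_single)+
  also have "\<dots> = peval F v * peval G v"
    by (simp add: sum_product mult_single peval_sum peval_single monom_eval_add)
       (simp add: peval_def sum_product algebra_simps)
  finally show ?thesis .
qed

lemma homogeneous_mult:
  assumes "homogeneous N d F" "homogeneous N e G"
  shows "homogeneous N (d + e) (F * G)"
  unfolding homogeneous_def
proof
  fix k assume "k \<in> Poly_Mapping.keys (F * G)"
  then obtain m m' where k: "k = m + m'" "m \<in> Poly_Mapping.keys F" "m' \<in> Poly_Mapping.keys G"
    using keys_mult[of F G] by auto
  let ?A = "Poly_Mapping.keys m \<union> Poly_Mapping.keys m'"
  have sup: "(\<Sum>i\<in>Poly_Mapping.keys n. Poly_Mapping.lookup n i) =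
      (\<Sum>i\<in>?A. Poly_Mapping.lookup n i)"
    if "Poly_Mapping.keys n \<subseteq> ?A" for n :: "nat \<Rightarrow>\<^sub>0 nat"
    by (rule sum.mono_neutral_left) (use that in \<open>auto simp: in_keys_iff\<close>)
  have kk: "Poly_Mapping.keys k \<subseteq> ?A"
    using k(1) Poly_Mapping.keys_add[of m m'] by simp
  have "(\<Sum>i\<in>Poly_Mapping.keys k. Poly_Mapping.lookup k i) = d + e"
    using assms k sup[of m] sup[of m'] sup[OF kk]
    by (auto simp: homogeneous_def lookup_add sum.distrib)
  moreover have "?A \<subseteq> {..N}"
    using assms k by (auto simp: homogeneous_def)
  ultimately show "Poly_Mapping.keys k \<subseteq> {..N} \<and>
      (\<Sum>i\<in>Poly_Mapping.keys k. Poly_Mapping.lookup k i) = d + e"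
    using kk by blast
qed


section \<open>Projective space and its Zariski topology\<close>

text \<open>\<open>\<complex>\<^bsup>N+1\<^esup>\<close> is modelled by sequences vanishing beyond index \<open>N\<close>, and a point of
  \<open>\<P>\<^sup>N\<close> is the set of all its homogeneous coordinate vectors (a scaling class of nonzero vectors).\<close>

type_synonym point = "(nat \<Rightarrow> complex) set"

definition cvec :: "nat \<Rightarrow> (nat \<Rightarrow> complex) set" where
  "cvec N = {v. \<forall>i>N. v i = 0}"

definition cscale :: "complex \<Rightarrow> (nat \<Rightarrow> complex) \<Rightarrow> (nat \<Rightarrow> complex)" where
  "cscale c v = (\<lambda>i. c * v i)"

interpretation cfun: vector_space cscale
  by unfold_locales (simp_all add: cscale_def fun_eq_iff distrib_left distrib_right mult.assoc)

definition ppoint :: "(nat \<Rightarrow> complex) \<Rightarrow> point" where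
  "ppoint v = {cscale c v | c. c \<noteq> 0}"

definition pspace :: "nat \<Rightarrow> point set" where
  "pspace N = {ppoint v | v. v \<in> cvec N \<and> v \<noteq> 0}"

definition vanishes_at :: "cpoly \<Rightarrow> point \<Rightarrow> bool" where
  "vanishes_at F x \<longleftrightarrow> (\<forall>v\<in>x. peval F v = 0)"

definition zero_locus :: "nat \<Rightarrow> cpoly set \<Rightarrow> point set" where
  "zero_locus N S = {x \<in> pspace N. \<forall>F\<in>S. vanishes_at F x}"

definition zariski_closed :: "nat \<Rightarrow> point set \<Rightarrow> bool" where
  "zariski_closed N Z \<longleftrightarrow> (\<exists>S. (\<forall>F\<in>S. \<exists>d. homogeneous N d F) \<and> Z = zero_locus N S)"

definition zariski :: "nat \<Rightarrow> point topology" where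
  "zariski N = topology (\<lambda>U. U \<subseteq> pspace N \<and> zariski_closed N (pspace N - U))"

lemma monom_eval_scale:
  "monom_eval m (cscale c v) =
     c ^ (\<Sum>i\<in>Poly_Mapping.keys m. Poly_Mapping.lookup m i) * monom_eval m v"
  unfolding monom_eval_def cscale_def power_mult_distrib prod.distrib power_sum ..

lemma peval_scale:
  assumes "homogeneous N d F"
  shows "peval F (cscale c v) = c ^ d * peval F v"
  unfolding peval_def sum_distrib_left
proof (rule sum.cong)
  fix m assume "m \<in> Poly_Mapping.keys F"
  then have "(\<Sum>i\<in>Poly_Mapping.keys m. Poly_Mapping.lookup m i) = d"
    using assms unfolding homogeneous_def by blast
  then show "Poly_Mapping.lookup F m * monom_eval m (cscale c v) =
      c ^ d * (Poly_Mapping.lookup F m * monom_eval m v)"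
    unfolding monom_eval_scale by (simp only: ac_simps)
qed rule

lemma vanishes_at_iff:
  assumes "homogeneous N d F"
  shows "vanishes_at F (ppoint v) \<longleftrightarrow> peval F v = 0"
proof
  assume "vanishes_at F (ppoint v)"
  moreover have "cscale 1 v \<in> ppoint v"
    unfolding ppoint_def using one_neq_zero by blast
  ultimately have "peval F (cscale 1 v) = 0"
    unfolding vanishes_at_def by blast
  then show "peval F v = 0"
    unfolding peval_scale[OF assms] by simp
next
  assume "peval F v = 0"
  then have "peval F (cscale c v) = 0" for c
    unfolding peval_scale[OF assms] by simp
  then show "vanishes_at F (ppoint v)"
    unfolding vanishes_at_def ppoint_def by blast
qed

lemma vanishes_at_mult:
  assumes "homogeneous N d F" "homogeneous N e G" "x \<in> pspace N"
  shows "vanishes_at (F * G) x \<longleftrightarrow> vanishes_at F x \<or> vanishes_at G x"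
proof -
  obtain v where "x = ppoint v"
    using assms(3) unfolding pspace_def by blast
  then show ?thesis
    by (simp only: vanishes_at_iff[OF assms(1)] vanishes_at_iff[OF assms(2)]
        vanishes_at_iff[OF homogeneous_mult[OF assms(1,2)]] peval_mult mult_eq_0_iff)
qed

lemma zariski_closed_Un:
  assumes "zariski_closed N Z" "zariski_closed N Z'"
  shows "zariski_closed N (Z \<union> Z')"
proof -
  from assms(1) obtain S where S: "\<forall>F\<in>S. \<exists>d. homogeneous N d F" "Z = zero_locus N S"
    unfolding zariski_closed_def by (elim exE conjE)
  from assms(2) obtain S' where S': "\<forall>F\<in>S'. \<exists>d. homogeneous N d F" "Z' = zero_locus N S'"
    unfolding zariski_closed_def by (elim exE conjE)
  let ?T = "{F * G | F G. F \<in> S \<and> G \<in> S'}"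
  have mult: "vanishes_at (F * G) x \<longleftrightarrow> vanishes_at F x \<or> vanishes_at G x"
    if "F \<in> S" "G \<in> S'" "x \<in> pspace N" for F G x
  proof -
    from bspec[OF S(1) that(1)] obtain d where d: "homogeneous N d F" ..
    from bspec[OF S'(1) that(2)] obtain e where e: "homogeneous N e G" ..
    show ?thesis by (rule vanishes_at_mult[OF d e that(3)])
  qed
  have "\<forall>H\<in>?T. \<exists>d. homogeneous N d H"
  proof
    fix H assume "H \<in> ?T"
    then obtain F G where H: "H = F * G" "F \<in> S" "G \<in> S'" by blast
    from bspec[OF S(1) H(2)] obtain d where d: "homogeneous N d F" ..
    from bspec[OF S'(1) H(3)] obtain e where e: "homogeneous N e G" ..
    show "\<exists>d. homogeneous N d H"
      unfolding H(1) by (rule exI) (rule homogeneous_mult[OF d e])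
  qed
  moreover have "Z \<union> Z' = zero_locus N ?T"
  proof (intro Set.set_eqI iffI)
    fix x assume "x \<in> Z \<union> Z'"
    then show "x \<in> zero_locus N ?T"
      using mult by (auto simp: S S' zero_locus_def)
  next
    fix x assume x: "x \<in> zero_locus N ?T"
    then have "vanishes_at F x \<or> vanishes_at G x" if "F \<in> S" "G \<in> S'" for F G
      using that mult[of F G x] by (auto simp: zero_locus_def)
    then show "x \<in> Z \<union> Z'"
      using x by (auto simp: S S' zero_locus_def)
  qed
  ultimately show ?thesis
    unfolding zariski_closed_def by (intro exI conjI)
qed

lemma zariski_closed_Inter:
  assumes "\<And>i. i \<in> I \<Longrightarrow> zariski_closed N (Z i)"
  shows "zariski_closed N (pspace N \<inter> (\<Inter>i\<in>I. Z i))"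
proof -
  have "\<forall>i\<in>I. \<exists>S. (\<forall>F\<in>S. \<exists>d. homogeneous N d F) \<and> Z i = zero_locus N S"
    using assms by (simp add: zariski_closed_def)
  then obtain S where
    S: "\<forall>i\<in>I. (\<forall>F\<in>S i. \<exists>d. homogeneous N d F) \<and> Z i = zero_locus N (S i)"
    by (rule bchoice[THEN exE])
  have "pspace N \<inter> (\<Inter>i\<in>I. Z i) = zero_locus N (\<Union>i\<in>I. S i)"
    using S unfolding zero_locus_def by blast
  moreover have "\<forall>F\<in>(\<Union>i\<in>I. S i). \<exists>d. homogeneous N d F"
    using S by blast
  ultimately show ?thesis
    unfolding zariski_closed_def by (intro exI conjI)
qed

lemma istopology_zariski:
  "istopology (\<lambda>U. U \<subseteq> pspace N \<and> zariski_closed N (pspace N - U))"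
  unfolding istopology_def
proof (intro conjI allI impI)
  fix U V assume "U \<subseteq> pspace N \<and> zariski_closed N (pspace N - U)"
    and "V \<subseteq> pspace N \<and> zariski_closed N (pspace N - V)"
  then show "zariski_closed N (pspace N - U \<inter> V)"
    unfolding Diff_Int using zariski_closed_Un by blast
next
  fix K assume K: "\<forall>U\<in>K. U \<subseteq> pspace N \<and> zariski_closed N (pspace N - U)"
  have "pspace N - \<Union>K = pspace N \<inter> (\<Inter>U\<in>K. pspace N - U)"
    by auto
  then show "zariski_closed N (pspace N - \<Union>K)"
    using zariski_closed_Inter[of K N "\<lambda>U. pspace N - U"] K by simp
qed auto

lemma openin_zariski:
  "openin (zariski N) U \<longleftrightarrow> U \<subseteq> pspace N \<and> zariski_closed N (pspace N - U)"
  unfolding zariski_def topology_inverse'[OF istopology_zariski] ..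

lemma topspace_zariski: "topspace (zariski N) = pspace N"
proof -
  have hom: "homogeneous N 0 1"
    by (simp add: homogeneous_def)
  have one: "peval 1 v = 1" for v
    by (simp add: peval_def monom_eval_def)
  have "\<not> vanishes_at 1 x" if "x \<in> pspace N" for x
    using that vanishes_at_iff[OF hom] one unfolding pspace_def by force
  then have "zero_locus N {1} = {}"
    unfolding zero_locus_def by blast
  with hom have "zariski_closed N {}"
    unfolding zariski_closed_def by (metis singletonD)
  then show ?thesis
    unfolding topspace_def openin_zariski by auto
qed

lemma closedin_zariski: "closedin (zariski N) Z \<longleftrightarrow> zariski_closed N Z"
proof -
  have "Z \<subseteq> pspace N" if "zariski_closed N Z"
    using that by (auto simp: zariski_closed_def zero_locus_def)
  then show ?thesis
    by (auto simp: closedin_def topspace_zariski openin_zariski double_diff)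
qed


section \<open>Irreducibility and dimension\<close>

definition irreducible_space :: "'a topology \<Rightarrow> bool" where
  "irreducible_space T \<longleftrightarrow> topspace T \<noteq> {} \<and>
     (\<forall>A B. closedin T A \<and> closedin T B \<and> A \<union> B = topspace T \<longrightarrow>
        A = topspace T \<or> B = topspace T)"

definition krull_dim :: "'a topology \<Rightarrow> enat" where
  "krull_dim T = Sup {enat k | k. \<exists>Z :: nat \<Rightarrow> 'a set.
     (\<forall>i\<le>k. closedin T (Z i) \<and> irreducible_space (subtopology T (Z i))) \<and>
     (\<forall>i<k. Z i \<subset> Z (Suc i))}"

text \<open>A reduced closed subscheme of \<open>\<P>\<^sup>N\<close> over \<open>\<complex>\<close> is determined by its set of closed points.\<close>

definition subvariety :: "nat \<Rightarrow> point set \<Rightarrow> bool" where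
  "subvariety N X \<longleftrightarrow> closedin (zariski N) X \<and> irreducible_space (subtopology (zariski N) X)"

definition var_dim :: "nat \<Rightarrow> point set \<Rightarrow> enat" where
  "var_dim N X = krull_dim (subtopology (zariski N) X)"


section \<open>Embedded tangent spaces and the tangent variety\<close>

text \<open>The linear subspace of \<open>\<complex>\<^bsup>N+1\<^esup>\<close> over the embedded tangent space, cut out by the
  differentials at \<open>x\<close> of all forms in the homogeneous ideal of \<open>X\<close>.\<close>

definition affine_tangent_space :: "nat \<Rightarrow> point set \<Rightarrow> point \<Rightarrow> (nat \<Rightarrow> complex) set" where
  "affine_tangent_space N X x = {w \<in> cvec N. \<forall>F d. homogeneous N d F \<and> (\<forall>y\<in>X. vanishes_at F y) \<longrightarrow>
     (\<forall>v\<in>x. (\<Sum>i\<le>N. partial_eval i F v * w i) = 0)}"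

definition tangent_space :: "nat \<Rightarrow> point set \<Rightarrow> point \<Rightarrow> point set" where
  "tangent_space N X x = {y \<in> pspace N. y \<subseteq> affine_tangent_space N X x}"

text \<open>Smoothness by the Jacobian criterion: the embedded tangent space has (projective) dimension
  \<open>dim X\<close>, i.e. the linear space over it has dimension \<open>dim X + 1\<close>.\<close>

definition smooth_point :: "nat \<Rightarrow> point set \<Rightarrow> point \<Rightarrow> bool" where
  "smooth_point N X x \<longleftrightarrow> x \<in> X \<and> enat (cfun.dim (affine_tangent_space N X x)) = var_dim N X + 1"

definition tangent_variety :: "nat \<Rightarrow> point set \<Rightarrow> point set" where
  "tangent_variety N X =
     zariski N closure_of (\<Union>x\<in>{x. smooth_point N X x}. tangent_space N X x)"


section \<open>Local rings\<close>

text \<open>Functions that are regular near \<open>x\<close>, i.e. on a neighbourhood of \<open>x\<close> in \<open>X\<close> given by a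
  quotient of forms of equal degree. Their values away from this neighbourhood are irrelevant;
  the ideal of functions vanishing near \<open>x\<close> is divided out to obtain germs.\<close>

definition regular_near :: "nat \<Rightarrow> point set \<Rightarrow> point \<Rightarrow> (point \<Rightarrow> complex) \<Rightarrow> bool" where
  "regular_near N X x f \<longleftrightarrow> (\<exists>d F G W. homogeneous N d F \<and> homogeneous N d G \<and>
     openin (zariski N) W \<and> x \<in> W \<and>
     (\<forall>y\<in>W \<inter> X. \<forall>v\<in>y. peval G v \<noteq> 0 \<and> f y = peval F v / peval G v))"

definition regular_ring :: "nat \<Rightarrow> point set \<Rightarrow> point \<Rightarrow> (point \<Rightarrow> complex) ring" where
  "regular_ring N X x = \<lparr>carrier = {f. regular_near N X x f},
     mult = (\<lambda>f g y. f y * g y), one = (\<lambda>_. 1), zero = (\<lambda>_. 0), add = (\<lambda>f g y. f y + g y)\<rparr>"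

definition germ_ideal :: "nat \<Rightarrow> point set \<Rightarrow> point \<Rightarrow> (point \<Rightarrow> complex) set" where
  "germ_ideal N X x =
     {f. \<exists>W. openin (zariski N) W \<and> x \<in> W \<and> (\<forall>y\<in>W \<inter> X. f y = 0)} \<inter> carrier (regular_ring N X x)"

definition local_ring :: "nat \<Rightarrow> point set \<Rightarrow> point \<Rightarrow> (point \<Rightarrow> complex) set ring" where
  "local_ring N X x = regular_ring N X x Quot germ_ideal N X x"

text \<open>For a morphism \<open>f\<close> from \<open>X \<subseteq> \<P>\<^sup>N\<close>, the ring homomorphism from the local ring of the target
  at \<open>f x\<close> to that of \<open>X\<close> at \<open>x\<close>, sending the germ of \<open>g\<close> to the germ of \<open>g \<circ> f\<close>.\<close>

definition pullback :: "nat \<Rightarrow> point set \<Rightarrow> point \<Rightarrow> (point \<Rightarrow> point) \<Rightarrow>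
    (point \<Rightarrow> complex) set \<Rightarrow> (point \<Rightarrow> complex) set" where
  "pullback N X x f C =
     the_elem ((\<lambda>g. germ_ideal N X x +>\<^bsub>regular_ring N X x\<^esub> (g \<circ> f)) ` C)"


section \<open>Kaehler differentials and the ramification locus\<close>

definition free_module :: "('b, 'm) ring_scheme \<Rightarrow> 's set \<Rightarrow> ('b, 's \<Rightarrow> 'b) module" where
  "free_module R S = \<lparr>
     carrier = {h. (\<forall>s. h s \<in> carrier R) \<and> (\<forall>s. s \<notin> S \<longrightarrow> h s = \<zero>\<^bsub>R\<^esub>) \<and>
                   finite {s. h s \<noteq> \<zero>\<^bsub>R\<^esub>}},
     mult = undefined, one = undefined,
     zero = (\<lambda>_. \<zero>\<^bsub>R\<^esub>), add = (\<lambda>h k s. h s \<oplus>\<^bsub>R\<^esub> k s),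
     smult = (\<lambda>r h s. r \<otimes>\<^bsub>R\<^esub> h s)\<rparr>"

definition free_gen :: "('b, 'm) ring_scheme \<Rightarrow> 's \<Rightarrow> 's \<Rightarrow> 'b" where
  "free_gen R s = (\<lambda>t. if t = s then \<one>\<^bsub>R\<^esub> else \<zero>\<^bsub>R\<^esub>)"

definition submodule_gen :: "('b, 'm) ring_scheme \<Rightarrow> ('b, 'e) module \<Rightarrow> 'e set \<Rightarrow> 'e set" where
  "submodule_gen R M E = \<Inter>{H. submodule H R M \<and> E \<subseteq> H}"

text \<open>The module \<open>\<Omega>\<^sup>1\<^bsub>B/A\<^esub>\<close> of a ring homomorphism \<open>\<phi>: A \<rightarrow> B\<close>: the free \<open>B\<close>-module on symbols
  \<open>db\<close> modulo additivity, the Leibniz rule, and \<open>d(\<phi> a) = 0\<close>. Only its underlying group is kept.\<close>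

definition kaehler_relators ::
    "('a, 'k) ring_scheme \<Rightarrow> ('b, 'm) ring_scheme \<Rightarrow> ('a \<Rightarrow> 'b) \<Rightarrow> ('b \<Rightarrow> 'b) set" where
  "kaehler_relators A B \<phi> = (let M = free_module B (carrier B); d = free_gen B in
     {d (b \<oplus>\<^bsub>B\<^esub> c) \<ominus>\<^bsub>M\<^esub> (d b \<oplus>\<^bsub>M\<^esub> d c) | b c. b \<in> carrier B \<and> c \<in> carrier B} \<union>
     {d (b \<otimes>\<^bsub>B\<^esub> c) \<ominus>\<^bsub>M\<^esub> (b \<odot>\<^bsub>M\<^esub> d c \<oplus>\<^bsub>M\<^esub> c \<odot>\<^bsub>M\<^esub> d b) | b c. b \<in> carrier B \<and> c \<in> carrier B} \<union>
     {d (\<phi> a) | a. a \<in> carrier A})"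

definition kaehler_differentials ::
    "('a, 'k) ring_scheme \<Rightarrow> ('b, 'm) ring_scheme \<Rightarrow> ('a \<Rightarrow> 'b) \<Rightarrow> ('b \<Rightarrow> 'b) set monoid" where
  "kaehler_differentials A B \<phi> = (let M = free_module B (carrier B) in
     M A_Mod submodule_gen B M (kaehler_relators A B \<phi>))"

text \<open>The support of \<open>\<Omega>\<^sup>1\<^bsub>X/\<P>\<^sup>M\<^esub>\<close> for a morphism \<open>f\<close> from \<open>X \<subseteq> \<P>\<^sup>N\<close> to \<open>\<P>\<^sup>M\<close>: the points where its
  stalk is nonzero.\<close>

definition ramification_locus :: "nat \<Rightarrow> point set \<Rightarrow> nat \<Rightarrow> (point \<Rightarrow> point) \<Rightarrow> point set" where
  "ramification_locus N X M f = {x \<in> X.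
     let \<Omega> = kaehler_differentials (local_ring M (pspace M) (f x)) (local_ring N X x)
               (pullback N X x f)
     in carrier \<Omega> \<noteq> {\<one>\<^bsub>\<Omega>\<^esub>}}"


section \<open>Linear projections\<close>

definition mat_app :: "nat \<Rightarrow> nat \<Rightarrow> (nat \<Rightarrow> nat \<Rightarrow> complex) \<Rightarrow> (nat \<Rightarrow> complex) \<Rightarrow> nat \<Rightarrow> complex" where
  "mat_app M N A v = (\<lambda>j. if j \<le> M then (\<Sum>i\<le>N. A j i * v i) else 0)"

text \<open>The linear projection \<open>\<P>\<^sup>N \<setminus> {P} \<rightarrow> \<P>\<^bsup>N-1\<^esup>\<close> is determined by \<open>P\<close> up to automorphisms of
  \<open>\<P>\<^bsup>N-1\<^esup>\<close>: it is induced by any linear map \<open>\<complex>\<^bsup>N+1\<^esup> \<rightarrow> \<complex>\<^sup>N\<close> whose kernel is the line \<open>P\<close>.\<close>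

definition linear_projection :: "nat \<Rightarrow> point \<Rightarrow> (point \<Rightarrow> point) \<Rightarrow> bool" where
  "linear_projection N P f \<longleftrightarrow> (\<exists>A.
     (\<forall>v\<in>cvec N. mat_app (N - 1) N A v = 0 \<longleftrightarrow> v = 0 \<or> v \<in> P) \<and>
     (\<forall>x\<in>pspace N - {P}. f x = mat_app (N - 1) N A ` x))"

end

(* Let C be the affine cone over X. A point x lies in R(pi_P) iff P is tangent to X at x: a tangent
   vector q spanning P annihilates all functions pulled back along pi_P and so defines a derivation
   on the module of differentials; if q is not tangent, every coordinate differs from a pulled back
   function by a multiple of one function t, so the differentials are generated by dt, and the
   derivative along q of an equation of X not killed by q is a unit annihilating dt.

   It remains to show that a generic P lies on two tangent spaces of C that meet only in the line P.
   Tangent spaces of C have dimension n + 1 in a space of dimension 2n + 1. As Tan X is everything,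
   the second fundamental form at a generic x is nondegenerate in a generic tangent direction, and
   following a formal arc out of x produces points y whose tangent space meets that of x only in a
   line close to this direction. So for generic (x, y) the tangent spaces meet in a line spanned by
   some phi(x, y), with the second fundamental forms at x and at y nondegenerate in the direction
   phi. They are the components of the differential of phi modulo phi, hence (c, x, y) -> c phi(x, y)
   is dominant, and its image contains a nonempty open set. *)
theory Submission
  imports Defs "HOL-Computational_Algebra.Formal_Power_Series" "HOL-Computational_Algebra.Fundamental_Theorem_Algebra"
begin

section \<open>Polynomial functions\<close>

text \<open>Everything runs on the cone with polynomial functions in place of ideals and schemes.
  Irreducibility is used as \<open>prime_on\<close>: two functions, neither identically zero, have a
  common point of nonvanishing, so finitely many generic conditions can be imposed together.
  Dimension enters as n + 1 algebraically independent functions, obtained from a chain of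
  subvarieties, and as the dimension of the tangent spaces in \<open>dense\<close>. The obstacle is
  transversality: at a pair (x, x) the two tangent spaces coincide, and no second explicit point of
  C is at hand. Hence the formal arc. Taylor expansion along it is a ring homomorphism into power
  series, an integral domain, so linear algebra can be done there; a pivot that is nonzero as a
  power series is nonzero at some actual pair of points of C. Convergence is never an issue. A
  dominant map is treated by adjoining one variable at a time: lifting tangent vectors rests on
  characteristic zero, lifting points on algebraic closedness. The second lift turns dominance into
  an open set of values that are really attained.\<close>

inductive_set polyfun :: "nat \<Rightarrow> ((nat \<Rightarrow> complex) \<Rightarrow> complex) set" for m where
  const: "(\<lambda>_. c) \<in> polyfun m"
| coord: "i < m \<Longrightarrow> (\<lambda>v. v i) \<in> polyfun m"
| add: "f \<in> polyfun m \<Longrightarrow> g \<in> polyfun m \<Longrightarrow> (\<lambda>v. f v + g v) \<in> polyfun m"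
| mult: "f \<in> polyfun m \<Longrightarrow> g \<in> polyfun m \<Longrightarrow> (\<lambda>v. f v * g v) \<in> polyfun m"

lemma polyfun_minus: "f \<in> polyfun m \<Longrightarrow> (\<lambda>v. - f v) \<in> polyfun m"
  using polyfun.mult[OF polyfun.const[of "-1"]] by force

lemma polyfun_diff:
  "f \<in> polyfun m \<Longrightarrow> g \<in> polyfun m \<Longrightarrow> (\<lambda>v. f v - g v) \<in> polyfun m"
  using polyfun.add[OF _ polyfun_minus] by fastforce

lemma polyfun_sum:
  "(\<And>i. i \<in> I \<Longrightarrow> f i \<in> polyfun m) \<Longrightarrow> (\<lambda>v. \<Sum>i\<in>I. f i v) \<in> polyfun m"
  by (induction I rule: infinite_finite_induct) (auto intro: polyfun.intros)

lemma polyfun_prod: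
  "(\<And>i. i \<in> I \<Longrightarrow> f i \<in> polyfun m) \<Longrightarrow> (\<lambda>v. \<Prod>i\<in>I. f i v) \<in> polyfun m"
  by (induction I rule: infinite_finite_induct) (auto intro: polyfun.intros)

lemma polyfun_power: "f \<in> polyfun m \<Longrightarrow> (\<lambda>v. f v ^ k) \<in> polyfun m"
  by (induction k) (auto intro: polyfun.intros)

lemmas polyfun_intros = polyfun.intros polyfun_minus polyfun_diff polyfun_sum polyfun_prod polyfun_power

text \<open>The reason for taking functions of infinite sequences: a function of few variables is
  literally one of more variables, so adjoining or dropping a variable needs no conversion.\<close>

lemma polyfun_mono: "f \<in> polyfun m \<Longrightarrow> m \<le> k \<Longrightarrow> f \<in> polyfun k"
  by (induction rule: polyfun.induct) (auto intro: polyfun.intros)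

lemma polyfun_cong: "f \<in> polyfun m \<Longrightarrow> (\<And>i. i < m \<Longrightarrow> v i = w i) \<Longrightarrow> f v = f w"
  by (induction rule: polyfun.induct) auto

lemma polyfun_compose:
  "f \<in> polyfun k \<Longrightarrow> (\<And>i. i < k \<Longrightarrow> (\<lambda>z. g z i) \<in> polyfun m) \<Longrightarrow> (\<lambda>z. f (g z)) \<in> polyfun m"
  by (induction rule: polyfun.induct) (auto intro: polyfun.intros)

text \<open>The analytic derivative is taken so that \<open>partial_eval\<close> from the definition
  of tangent spaces is an instance.\<close>

definition pd :: "nat \<Rightarrow> ((nat \<Rightarrow> complex) \<Rightarrow> complex) \<Rightarrow> (nat \<Rightarrow> complex) \<Rightarrow> complex" where
  "pd i f v = deriv (\<lambda>t. f (v(i := t))) (v i)"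

lemma polyfun_has_pd:
  "f \<in> polyfun m \<Longrightarrow> ((\<lambda>t. f (v(i := t))) has_field_derivative pd i f v) (at (v i))"
proof -
  assume "f \<in> polyfun m"
  then have "(\<lambda>t. f (v(i := t))) field_differentiable at (v i)"
  proof (induction rule: polyfun.induct)
    case (coord j)
    have "((\<lambda>t. (v(i := t)) j) has_field_derivative (if j = i then 1 else 0)) (at (v i))"
      by (cases "j = i") (auto intro!: derivative_eq_intros)
    then show ?case unfolding field_differentiable_def by blast
  qed (simp_all add: field_differentiable_add field_differentiable_mult)
  then show ?thesis
    unfolding pd_def by (rule field_differentiable_derivI)
qed

lemma pd_const [simp]: "pd i (\<lambda>_. c) = (\<lambda>_. 0)"
  by (simp add: pd_def fun_eq_iff)

lemma pd_coord: "pd i (\<lambda>v. v j) = (\<lambda>_. if i = j then 1 else 0)"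
proof
  fix v :: "nat \<Rightarrow> complex"
  have "((\<lambda>t. (v(i := t)) j) has_field_derivative (if i = j then 1 else 0)) (at (v i))"
    by (cases "i = j") (auto intro!: derivative_eq_intros)
  then show "pd i (\<lambda>v. v j) v = (if i = j then 1 else 0)"
    unfolding pd_def by (rule DERIV_imp_deriv)
qed

lemma pd_add:
  assumes "f \<in> polyfun m" "g \<in> polyfun m"
  shows "pd i (\<lambda>v. f v + g v) = (\<lambda>v. pd i f v + pd i g v)"
proof
  fix v
  show "pd i (\<lambda>v. f v + g v) v = pd i f v + pd i g v"
    unfolding pd_def[of i "\<lambda>v. f v + g v"]
    by (rule DERIV_imp_deriv, rule DERIV_add) (rule assms[THEN polyfun_has_pd])+
qed

lemma pd_mult:
  assumes "f \<in> polyfun m" "g \<in> polyfun m"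
  shows "pd i (\<lambda>v. f v * g v) = (\<lambda>v. f v * pd i g v + g v * pd i f v)"
proof
  fix v
  have "((\<lambda>t. f (v(i := t)) * g (v(i := t))) has_field_derivative
      pd i f v * g (v(i := v i)) + pd i g v * f (v(i := v i))) (at (v i))"
    by (rule DERIV_mult) (rule assms[THEN polyfun_has_pd])+
  then show "pd i (\<lambda>v. f v * g v) v = f v * pd i g v + g v * pd i f v"
    unfolding pd_def[of i "\<lambda>v. f v * g v"] by (auto dest!: DERIV_imp_deriv simp: algebra_simps)
qed

lemma pd_polyfun: "f \<in> polyfun m \<Longrightarrow> pd i f \<in> polyfun m"
proof (induction rule: polyfun.induct)
  case (coord j)
  then show ?case by (auto simp: pd_coord intro: polyfun.intros)
qed (auto simp: pd_add pd_mult intro!: polyfun.intros)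

lemma pd_outside: "f \<in> polyfun m \<Longrightarrow> m \<le> i \<Longrightarrow> pd i f = (\<lambda>_. 0)"
  by (induction rule: polyfun.induct) (auto simp: pd_coord pd_add pd_mult)

text \<open>The differential of \<open>f\<close> at \<open>v\<close> applied to \<open>u\<close>.
  The bound \<open>m\<close> may exceed the number of variables of \<open>f\<close>
  (\<open>dd_mono\<close>), and coordinates of \<open>u\<close> from \<open>m\<close> on are
  ignored.\<close>

definition dd :: "nat \<Rightarrow> ((nat \<Rightarrow> complex) \<Rightarrow> complex) \<Rightarrow> (nat \<Rightarrow> complex) \<Rightarrow> (nat \<Rightarrow> complex) \<Rightarrow> complex" where
  "dd m f v u = (\<Sum>i<m. pd i f v * u i)"

lemma dd_const [simp]: "dd m (\<lambda>_. c) v u = 0"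
  by (simp add: dd_def)

lemma dd_coord: "dd m (\<lambda>v. v j) v u = (if j < m then u j else 0)"
  by (simp add: dd_def pd_coord if_distrib[of "\<lambda>x. x * _"] sum.delta cong: if_cong)

lemma dd_add: "f \<in> polyfun m \<Longrightarrow> g \<in> polyfun m \<Longrightarrow>
    dd k (\<lambda>v. f v + g v) v u = dd k f v u + dd k g v u"
  by (simp add: dd_def pd_add algebra_simps sum.distrib)

lemma dd_mult: "f \<in> polyfun m \<Longrightarrow> g \<in> polyfun m \<Longrightarrow>
    dd k (\<lambda>v. f v * g v) v u = f v * dd k g v u + g v * dd k f v u"
  by (simp add: dd_def pd_mult algebra_simps sum.distrib sum_distrib_left)

lemma dd_minus: "f \<in> polyfun m \<Longrightarrow> dd k (\<lambda>v. - f v) v u = - dd k f v u"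
  using dd_mult[OF polyfun.const[of "-1"], of f m k v u] by simp

lemma dd_diff: "f \<in> polyfun m \<Longrightarrow> g \<in> polyfun m \<Longrightarrow>
    dd k (\<lambda>v. f v - g v) v u = dd k f v u - dd k g v u"
  using dd_add[OF _ polyfun_minus, of f m g k v u] by (simp add: dd_minus)

lemma dd_sum: "(\<And>i. i \<in> I \<Longrightarrow> f i \<in> polyfun m) \<Longrightarrow>
    dd k (\<lambda>v. \<Sum>i\<in>I. f i v) v u = (\<Sum>i\<in>I. dd k (f i) v u)"
proof (induction I rule: infinite_finite_induct)
  case (insert i I)
  then show ?case
    using dd_add[of "f i" m "\<lambda>v. \<Sum>i\<in>I. f i v" k v u] polyfun_sum[of I f m] by simp
qed auto

lemma dd_lin_add: "dd m f v (\<lambda>i. u i + w i) = dd m f v u + dd m f v w"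
  by (simp add: dd_def algebra_simps sum.distrib)

lemma dd_lin_scale: "dd m f v (\<lambda>i. c * u i) = c * dd m f v u"
  by (simp add: dd_def algebra_simps sum_distrib_left)

lemma dd_lin_zero [simp]: "dd m f v (\<lambda>i. 0) = 0"
  by (simp add: dd_def)

lemma dd_lin_sum: "dd m f v (\<lambda>i. \<Sum>j\<in>I. w j i) = (\<Sum>j\<in>I. dd m f v (w j))"
  unfolding dd_def by (simp add: sum_distrib_left) (rule sum.swap)

lemma dd_mono: "f \<in> polyfun m \<Longrightarrow> m \<le> k \<Longrightarrow> dd k f v u = dd m f v u"
  unfolding dd_def by (rule sum.mono_neutral_right) (auto simp: pd_outside)

lemma dd_cong:
  assumes "f \<in> polyfun m" "\<And>i. i < m \<Longrightarrow> v i = w i" "\<And>i. i < m \<Longrightarrow> u i = u' i"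
  shows "dd m f v u = dd m f w u'"
  unfolding dd_def
  by (rule sum.cong) (auto simp: assms(3) polyfun_cong[OF pd_polyfun[OF assms(1)] assms(2)])

lemma polyfun_dd:
  assumes "f \<in> polyfun m" "\<And>i. i < m \<Longrightarrow> (\<lambda>v. u v i) \<in> polyfun m"
  shows "(\<lambda>v. dd m f v (u v)) \<in> polyfun m"
  unfolding dd_def using assms by (intro polyfun_intros pd_polyfun) auto

lemma dd_compose:
  assumes "f \<in> polyfun k" "\<And>i. i < k \<Longrightarrow> (\<lambda>z. g z i) \<in> polyfun m"
  shows "dd m (\<lambda>z. f (g z)) z u = dd k f (g z) (\<lambda>i. dd m (\<lambda>z. g z i) z u)"
  using assms(1)
proof (induction rule: polyfun.induct)
  case (coord i)
  then show ?case by (simp add: dd_coord)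
next
  case (add f h)
  then show ?case
    by (simp add: dd_add[OF polyfun_compose[OF add.hyps(1) assms(2)] polyfun_compose[OF add.hyps(2) assms(2)]]
        dd_add[of f k h])
next
  case (mult f h)
  then show ?case
    by (simp add: dd_mult[OF polyfun_compose[OF mult.hyps(1) assms(2)] polyfun_compose[OF mult.hyps(2) assms(2)]]
        dd_mult[of f k h])
qed auto

text \<open>Reduction to one variable: on a line, \<open>f\<close> is a univariate polynomial whose
  derivative is \<open>dd\<close> in the direction of the line. Taylor expansion, irreducibility of
  affine space and the Euler vector all rest on this.\<close>

lemma polyfun_line:
  assumes "f \<in> polyfun m"
  shows "\<exists>p. \<forall>t. f (\<lambda>i. v i + t * u i) = poly p t \<and> dd m f (\<lambda>i. v i + t * u i) u = poly (pderiv p) t"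
  using assms
proof (induction rule: polyfun.induct)
  case (const c)
  show ?case by (rule exI[of _ "[:c:]"]) simp
next
  case (coord i)
  then show ?case by (intro exI[of _ "[:v i, u i:]"]) (simp add: dd_coord pderiv_pCons)
next
  case (add f g)
  then obtain p q where
    "\<forall>t. f (\<lambda>i. v i + t * u i) = poly p t \<and> dd m f (\<lambda>i. v i + t * u i) u = poly (pderiv p) t"
    "\<forall>t. g (\<lambda>i. v i + t * u i) = poly q t \<and> dd m g (\<lambda>i. v i + t * u i) u = poly (pderiv q) t"
    by blast
  then show ?case
    by (intro exI[of _ "p + q"]) (simp add: dd_add[OF add.hyps] pderiv_add)
next
  case (mult f g)
  then obtain p q where
    "\<forall>t. f (\<lambda>i. v i + t * u i) = poly p t \<and> dd m f (\<lambda>i. v i + t * u i) u = poly (pderiv p) t"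
    "\<forall>t. g (\<lambda>i. v i + t * u i) = poly q t \<and> dd m g (\<lambda>i. v i + t * u i) u = poly (pderiv q) t"
    by blast
  then show ?case
    by (intro exI[of _ "p * q"]) (simp add: dd_mult[OF mult.hyps] pderiv_mult)
qed

text \<open>Characteristic zero: a vanishing derivative forces degree 0, so induction on the degree
  applies to \<open>pderiv p\<close>.\<close>

lemma poly_pderivs_zero_imp:
  fixes p :: "complex poly"
  assumes "\<And>k. poly ((pderiv ^^ k) p) 0 = 0"
  shows "p = 0"
  using assms
proof (induction "degree p" arbitrary: p rule: less_induct)
  case less
  show ?case
  proof (cases "degree p = 0")
    case True
    then obtain c where "p = [:c:]" by (rule degree_eq_zeroE)
    then show ?thesis using less.prems[of 0] by simp
  next
    case False
    have "pderiv p = 0"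
    proof (rule less.hyps)
      show "degree (pderiv p) < degree p"
        using False by (simp add: degree_pderiv)
      show "poly ((pderiv ^^ k) (pderiv p)) 0 = 0" for k
        using less.prems[of "Suc k"] by (simp add: funpow_swap1)
    qed
    then show ?thesis
      using False by (simp add: pderiv_eq_0_iff)
  qed
qed

text \<open>A function in a family closed under partial derivatives, all of whose members vanish at
  some point, has trivial Taylor expansion there.\<close>

lemma polyfun_zero_of_pd_closed:
  assumes Z: "\<And>f. f \<in> Z \<Longrightarrow> f \<in> polyfun m"
    and van: "\<And>f. f \<in> Z \<Longrightarrow> f P = 0"
    and cl: "\<And>f u. f \<in> Z \<Longrightarrow> (\<lambda>v. dd m f v u) \<in> Z"
    and f: "f \<in> Z"
  shows "f v = 0"
proof -
  define u where "u = (\<lambda>i. v i - P i)"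
  have ex: "\<exists>p. (\<forall>t. f (\<lambda>i. P i + t * u i) = poly p t)" if "f \<in> Z" for f
    using polyfun_line[OF Z[OF that], of P u] by blast
  have pw: "poly ((pderiv ^^ k) p) 0 = 0"
    if "f \<in> Z" "\<forall>t. f (\<lambda>i. P i + t * u i) = poly p t" for f p k
    using that
  proof (induction k arbitrary: f p)
    case 0
    then show ?case using van[of f] by (metis (no_types, lifting) add.right_neutral eq_id_iff funpow_0 mult_zero_left ext)
  next
    case (Suc k)
    obtain q where q: "\<forall>t. f (\<lambda>i. P i + t * u i) = poly q t \<and>
        dd m f (\<lambda>i. P i + t * u i) u = poly (pderiv q) t"
      using polyfun_line[OF Z[OF Suc.prems(1)], of P u] by blast
    then have "p = q" using Suc.prems(2) by (simp flip: poly_eq_poly_eq_iff add: fun_eq_iff)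
    then show ?case
      using Suc.IH[OF cl[OF Suc.prems(1), of u], of "pderiv p"] q by (simp add: funpow_swap1)
  qed
  obtain p where p: "\<forall>t. f (\<lambda>i. P i + t * u i) = poly p t" using ex[OF f] by blast
  have "p = 0" by (rule poly_pderivs_zero_imp) (rule pw[OF f p])
  then have "f (\<lambda>i. P i + 1 * u i) = 0" using p by (metis poly_0)
  then show ?thesis by (simp add: u_def)
qed

section \<open>Homogeneous components and cones\<close>

lemma homogeneous_add:
  "homogeneous N d F \<Longrightarrow> homogeneous N d G \<Longrightarrow> homogeneous N d (F + G)"
  using Poly_Mapping.keys_add[of F G] unfolding homogeneous_def by blast

lemma homogeneous_zero: "homogeneous N d 0"
  by (simp add: homogeneous_def)

lemma homogeneous_sum:
  "(\<And>i. i \<in> I \<Longrightarrow> homogeneous N d (F i)) \<Longrightarrow> homogeneous N d (\<Sum>i\<in>I. F i)"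
  by (induction I rule: infinite_finite_induct) (auto intro: homogeneous_add simp: homogeneous_zero)

lemma homogeneous_const: "homogeneous N 0 (Poly_Mapping.single 0 c)"
  by (simp add: homogeneous_def)

lemma homogeneous_coord: "i \<le> N \<Longrightarrow>
    homogeneous N 1 (Poly_Mapping.single (Poly_Mapping.single i 1) 1)"
  by (simp add: homogeneous_def)

lemma peval_const: "peval (Poly_Mapping.single 0 c) v = c"
  by (simp add: peval_single monom_eval_def)

lemma peval_coord: "peval (Poly_Mapping.single (Poly_Mapping.single i 1) 1) v = v i"
  by (simp add: peval_single monom_eval_def)

lemma peval_polyfun: "homogeneous N d F \<Longrightarrow> peval F \<in> polyfun (Suc N)"
  unfolding peval_def monom_eval_def homogeneous_def
  by (intro polyfun_intros) (auto simp: less_Suc_eq_le)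

lemma partial_eval_pd: "partial_eval i F v = pd i (peval F) v"
  unfolding partial_eval_def pd_def ..

text \<open>The bridge from functions back to forms, through which every statement about zero loci
  passes. The induction only yields some finite family of forms; they are sorted by degree at the
  end.\<close>

lemma polyfun_homogeneous_sum:
  assumes "f \<in> polyfun (Suc N)"
  shows "\<exists>D F. (\<forall>d. homogeneous N d (F d)) \<and> (\<forall>v. f v = (\<Sum>d<D. peval (F d) v))"
proof -
  have "\<exists>I deg F. finite (I :: nat set) \<and> (\<forall>i\<in>I. homogeneous N (deg i) (F i)) \<and>
      (\<forall>v. f v = (\<Sum>i\<in>I. peval (F i) v))"
    using assms
  proof (induction rule: polyfun.induct)
    case (const c)
    show ?case
      by (rule exI[of _ "{0}"], rule exI[of _ "\<lambda>_. 0"], rule exI[of _ "\<lambda>_. Poly_Mapping.single 0 c"])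
        (simp add: homogeneous_const peval_const)
  next
    case (coord i)
    show ?case
      by (rule exI[of _ "{0}"], rule exI[of _ "\<lambda>_. 1"],
          rule exI[of _ "\<lambda>_. Poly_Mapping.single (Poly_Mapping.single i 1) 1"])
        (use homogeneous_coord[of i N] peval_coord[of i] coord in \<open>auto simp: less_Suc_eq_le\<close>)
  next
    case (add f g)
    then obtain I deg F J deg' G where
      F: "finite (I :: nat set)" "\<forall>i\<in>I. homogeneous N (deg i) (F i)" "\<forall>v. f v = (\<Sum>i\<in>I. peval (F i) v)" and
      G: "finite (J :: nat set)" "\<forall>i\<in>J. homogeneous N (deg' i) (G i)" "\<forall>v. g v = (\<Sum>i\<in>J. peval (G i) v)"
      by metis
    \<comment> \<open>Even and odd numbers serve as the disjoint union of the two index sets;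
      products use \<open>prod_encode\<close> in the same way.\<close>
    let ?K = "(\<lambda>i. 2 * i) ` I \<union> (\<lambda>i. 2 * i + 1) ` J"
    let ?h = "\<lambda>i. if even i then F (i div 2) else G (i div 2)"
    have "f v + g v = (\<Sum>i\<in>?K. peval (?h i) v)" for v
    proof -
      have "(\<Sum>i\<in>?K. peval (?h i) v) =
          (\<Sum>i\<in>(\<lambda>i. 2 * i) ` I. peval (?h i) v) + (\<Sum>i\<in>(\<lambda>i. 2 * i + 1) ` J. peval (?h i) v)"
        by (rule sum.union_disjoint) (use F(1) G(1) in \<open>auto, presburger\<close>)
      also have "\<dots> = f v + g v"
        by (subst (1 2) sum.reindex) (auto simp: F(3) G(3) inj_on_def)
      finally show ?thesis ..
    qed
    then show ?case
      by (intro exI[of _ ?K], intro exI[of _ "\<lambda>i. if even i then deg (i div 2) else deg' (i div 2)"],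
          intro exI[of _ ?h]) (use F G in auto)
  next
    case (mult f g)
    then obtain I deg F J deg' G where
      F: "finite (I :: nat set)" "\<forall>i\<in>I. homogeneous N (deg i) (F i)" "\<forall>v. f v = (\<Sum>i\<in>I. peval (F i) v)" and
      G: "finite (J :: nat set)" "\<forall>i\<in>J. homogeneous N (deg' i) (G i)" "\<forall>v. g v = (\<Sum>i\<in>J. peval (G i) v)"
      by metis
    let ?K = "prod_encode ` (I \<times> J)"
    let ?h = "\<lambda>i. case prod_decode i of (i, j) \<Rightarrow> F i * G j"
    have "f v * g v = (\<Sum>i\<in>?K. peval (?h i) v)" for v
      by (subst sum.reindex)
        (auto simp: F(3) G(3) sum_product sum.cartesian_product peval_mult case_prod_beta
          intro: inj_on_subset[OF inj_prod_encode])
    then show ?case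
      by (intro exI[of _ ?K], intro exI[of _ "\<lambda>i. case prod_decode i of (i, j) \<Rightarrow> deg i + deg' j"],
          intro exI[of _ ?h]) (use F G in \<open>auto intro: homogeneous_mult\<close>)
  qed
  then obtain I deg F where
    F: "finite (I :: nat set)" "\<forall>i\<in>I. homogeneous N (deg i) (F i)" "\<forall>v. f v = (\<Sum>i\<in>I. peval (F i) v)"
    by blast
  obtain D where D: "deg ` I \<subseteq> {..<D}"
    using F(1) by (metis finite_imageI finite_nat_iff_bounded)
  have "f v = (\<Sum>d<D. peval (\<Sum>i | i \<in> I \<and> deg i = d. F i) v)" for v
    unfolding F(3)[rule_format] peval_sum by (rule sum.group[OF F(1) _ D, symmetric]) simp
  moreover have "homogeneous N d (\<Sum>i | i \<in> I \<and> deg i = d. F i)" for d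
    by (rule homogeneous_sum) (use F(2) in auto)
  ultimately show ?thesis
    by (intro exI[of _ D] exI[of _ "\<lambda>d. \<Sum>i | i \<in> I \<and> deg i = d. F i"]) simp
qed

text \<open>Infinitely many roots make the product of the two univariate polynomials zero. With
  \<open>E = 1\<close> and \<open>b\<close> constantly 1 this is the statement for a single
  polynomial.\<close>

lemma coeffs_zero_of_nonzero_args:
  fixes a :: "nat \<Rightarrow> complex"
  assumes "\<And>c. c \<noteq> 0 \<Longrightarrow> (\<Sum>d<D. a d * c ^ d) * (\<Sum>d<E. b d * c ^ d) = 0"
  shows "(\<forall>d<D. a d = 0) \<or> (\<forall>d<E. b d = 0)"
proof -
  define p where "p a D = (\<Sum>d<D. monom (a d) d)" for a :: "nat \<Rightarrow> complex" and D
  have ev: "poly (p a D) c = (\<Sum>d<D. a d * c ^ d)" for a D c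
    by (simp add: p_def poly_sum poly_monom)
  have co: "coeff (p a D) d = a d" if "d < D" for a D d
    using that by (simp add: p_def coeff_sum)
  have "p a D * p b E = 0"
  proof (rule ccontr)
    assume "p a D * p b E \<noteq> 0"
    then have "finite {c. poly (p a D * p b E) c = 0}" by (rule poly_roots_finite)
    moreover have "- {0} \<subseteq> {c. poly (p a D * p b E) c = 0}"
      using assms by (auto simp: ev)
    ultimately have "finite (- {0 :: complex})" by (rule rev_finite_subset)
    then show False by (simp add: infinite_UNIV_char_0)
  qed
  then show ?thesis using co by (metis coeff_0 mult_eq_0_iff)
qed

section \<open>Points of projective space and their coordinate vectors\<close>

lemma ppoint_mem: "v \<in> ppoint v"
  unfolding ppoint_def cscale_def by (auto intro!: exI[of _ 1])

lemma ppoint_scale: "c \<noteq> 0 \<Longrightarrow> ppoint (cscale c v) = ppoint v"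
proof -
  assume c: "c \<noteq> 0"
  have "cscale d v = cscale (d / c) (cscale c v)" for d
    using c by (simp add: cscale_def)
  moreover have "cscale d (cscale c v) = cscale (d * c) v" for d
    by (simp add: cscale_def mult.assoc)
  moreover have "d / c \<noteq> 0" "d * c \<noteq> 0" if "d \<noteq> 0" for d
    using that c by auto
  ultimately show ?thesis
    unfolding ppoint_def by (intro Set.equalityI subsetI) (elim CollectE exE conjE, blast)+
qed

lemma ppoint_eq:
  assumes "w \<in> ppoint v"
  shows "ppoint w = ppoint v"
proof -
  from assms obtain c where "w = cscale c v" "c \<noteq> 0"
    unfolding ppoint_def by (elim CollectE exE conjE)
  then show ?thesis by (simp add: ppoint_scale)
qed

lemma cscale_cvec: "v \<in> cvec N \<Longrightarrow> cscale c v \<in> cvec N"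
  by (auto simp: cscale_def cvec_def)

lemma pspace_rep: "x \<in> pspace N \<Longrightarrow> v \<in> x \<Longrightarrow> v \<in> cvec N \<and> v \<noteq> 0 \<and> x = ppoint v"
proof -
  assume "x \<in> pspace N" "v \<in> x"
  then obtain w c where "w \<in> cvec N" "w \<noteq> 0" "x = ppoint w" "v = cscale c w" "c \<noteq> 0"
    unfolding pspace_def ppoint_def by blast
  then show ?thesis
    by (simp add: cscale_cvec ppoint_scale)
qed

lemma pspace_nonempty: "x \<in> pspace N \<Longrightarrow> \<exists>v. v \<in> x"
  unfolding pspace_def using ppoint_mem by blast

lemma Union_pspace: "X \<subseteq> pspace N \<Longrightarrow> v \<in> \<Union>X \<longleftrightarrow> v \<in> cvec N \<and> v \<noteq> 0 \<and> ppoint v \<in> X"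
proof
  assume X: "X \<subseteq> pspace N" and "v \<in> \<Union>X"
  then obtain x where x: "x \<in> X" "v \<in> x" by blast
  with X have "x \<in> pspace N" by blast
  from pspace_rep[OF this x(2)] x(1) show "v \<in> cvec N \<and> v \<noteq> 0 \<and> ppoint v \<in> X" by simp
qed (use ppoint_mem in blast)

lemma Union_pspace_scale: "X \<subseteq> pspace N \<Longrightarrow> v \<in> \<Union>X \<Longrightarrow> c \<noteq> 0 \<Longrightarrow> cscale c v \<in> \<Union>X"
  by (simp add: Union_pspace cscale_cvec ppoint_scale del: Union_iff)

text \<open>Along the multiples \<open>c x\<close>, which stay on the cone, \<open>f\<close> is a
  polynomial in \<open>c\<close> whose coefficients are the values of the components at
  \<open>x\<close>.\<close>

lemma homogeneous_component_vanishes: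
  assumes X: "X \<subseteq> pspace N" and F: "\<forall>d. homogeneous N d (F d)"
    and f: "\<forall>v. f v = (\<Sum>d<D. peval (F d) v)" and van: "\<forall>x\<in>\<Union>X. f x = 0"
    and "d < D" and "x \<in> \<Union>X"
  shows "peval (F d) x = 0"
proof -
  have "(\<Sum>d<D. peval (F d) x * c ^ d) * (\<Sum>d<1. 1 * c ^ d) = 0" if "c \<noteq> 0" for c
  proof -
    have "f (cscale c x) = 0"
      using van Union_pspace_scale[OF X \<open>x \<in> \<Union>X\<close> that] by blast
    moreover have "peval (F d) (cscale c x) = c ^ d * peval (F d) x" for d
      using F by (intro peval_scale) blast
    ultimately show ?thesis using f by (simp add: mult.commute)
  qed
  from coeffs_zero_of_nonzero_args[OF this] show ?thesis using \<open>d < D\<close> by auto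
qed

text \<open>The Zariski tangent space at \<open>v\<close> of the closure of \<open>S\<close>. Only
  the first \<open>m\<close> coordinates of \<open>w\<close> are restricted; later ones are
  arbitrary, hence the intersection with \<open>cvec N\<close> in \<open>tang\<close>.\<close>

definition tv :: "(nat \<Rightarrow> complex) set \<Rightarrow> nat \<Rightarrow> (nat \<Rightarrow> complex) \<Rightarrow> (nat \<Rightarrow> complex) set" where
  "tv S m v = {w. \<forall>f\<in>polyfun m. (\<forall>x\<in>S. f x = 0) \<longrightarrow> dd m f v w = 0}"

text \<open>The chain rule for scaling. The factor \<open>c\<close> stays on the left so that no
  exponent \<open>d - 1\<close> occurs, which would be wrong for \<open>d = 0\<close>.\<close>

lemma dd_homogeneous_scale:
  assumes F: "homogeneous N d F" and c: "c \<noteq> 0"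
  shows "dd m (peval F) (cscale c v) w * c = c ^ d * dd m (peval F) v w"
proof -
  have "pd i (peval F) (cscale c v) * c = c ^ d * pd i (peval F) v" for i
  proof -
    let ?g = "\<lambda>t. peval F (v(i := t))"
    let ?h = "\<lambda>t. peval F ((cscale c v)(i := t))"
    have h: "?h (c * t) = c ^ d * ?g t" for t
    proof -
      have "(cscale c v)(i := c * t) = cscale c (v(i := t))"
        by (auto simp: cscale_def fun_eq_iff)
      then show ?thesis by (simp add: peval_scale[OF F])
    qed
    have "((\<lambda>t. ?h (c * t)) has_field_derivative pd i (peval F) (cscale c v) * c) (at (v i))"
    proof -
      have "(?h has_field_derivative pd i (peval F) (cscale c v)) (at (c * v i))"
        using polyfun_has_pd[OF peval_polyfun[OF F], of "cscale c v" i] by (simp only: cscale_def)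
      from DERIV_chain2[OF this DERIV_cmult_Id] show ?thesis by simp
    qed
    moreover have "((\<lambda>t. ?h (c * t)) has_field_derivative c ^ d * pd i (peval F) v) (at (v i))"
      unfolding h using DERIV_cmult[OF polyfun_has_pd[OF peval_polyfun[OF F]], of "c ^ d" v i] by simp
    ultimately show ?thesis by (rule DERIV_unique)
  qed
  then have "pd i (peval F) (cscale c v) * w i * c = c ^ d * (pd i (peval F) v * w i)" for i
    by (metis mult.assoc mult.commute)
  then show ?thesis
    unfolding dd_def sum_distrib_left sum_distrib_right by (rule sum.cong[OF refl])
qed

lemma tv_iff_homogeneous:
  assumes X: "X \<subseteq> pspace N"
  shows "w \<in> tv (\<Union>X) (Suc N) v \<longleftrightarrow>
    (\<forall>F d. homogeneous N d F \<longrightarrow> (\<forall>x\<in>\<Union>X. peval F x = 0) \<longrightarrow> dd (Suc N) (peval F) v w = 0)"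
proof
  assume "w \<in> tv (\<Union>X) (Suc N) v"
  then show "\<forall>F d. homogeneous N d F \<longrightarrow> (\<forall>x\<in>\<Union>X. peval F x = 0) \<longrightarrow> dd (Suc N) (peval F) v w = 0"
    unfolding tv_def using peval_polyfun by blast
next
  assume H: "\<forall>F d. homogeneous N d F \<longrightarrow> (\<forall>x\<in>\<Union>X. peval F x = 0) \<longrightarrow> dd (Suc N) (peval F) v w = 0"
  have "dd (Suc N) f v w = 0" if f: "f \<in> polyfun (Suc N)" and van: "\<forall>x\<in>\<Union>X. f x = 0" for f
  proof -
    obtain D F where F: "\<forall>d. homogeneous N d (F d)" "\<forall>v. f v = (\<Sum>d<D. peval (F d) v)"
      using polyfun_homogeneous_sum[OF f] by blast
    have fe: "f = (\<lambda>v. \<Sum>d<D. peval (F d) v)" using F(2) by blast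
    have "dd (Suc N) f v w = (\<Sum>d<D. dd (Suc N) (peval (F d)) v w)"
      unfolding fe by (rule dd_sum) (use F(1) peval_polyfun in blast)
    also have "\<dots> = 0"
      by (rule sum.neutral)
        (use H F(1) homogeneous_component_vanishes[OF X F van] in blast)
    finally show ?thesis .
  qed
  then show "w \<in> tv (\<Union>X) (Suc N) v" unfolding tv_def by blast
qed

text \<open>Homogeneous components of an equation of the cone are again equations, so testing with
  all polynomial functions adds nothing; scaling of differentials makes the choice of coordinate
  vector irrelevant.\<close>

lemma affine_tangent_space_tv:
  assumes X: "X \<subseteq> pspace N"
  shows "affine_tangent_space N X (ppoint v) = cvec N \<inter> tv (\<Union>X) (Suc N) v"
proof -
  have sc: "(\<forall>u\<in>ppoint v. dd (Suc N) (peval F) u w = 0) \<longleftrightarrow> dd (Suc N) (peval F) v w = 0"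
    if "homogeneous N d F" for F d w
  proof
    assume "dd (Suc N) (peval F) v w = 0"
    then have "dd (Suc N) (peval F) (cscale c v) w * c = 0" if "c \<noteq> 0" for c
      using dd_homogeneous_scale[OF \<open>homogeneous N d F\<close> that] by simp
    then show "\<forall>u\<in>ppoint v. dd (Suc N) (peval F) u w = 0"
      unfolding ppoint_def by auto
  qed (use ppoint_mem in blast)
  have pe: "(\<Sum>i\<le>N. partial_eval i F u * w i) = dd (Suc N) (peval F) u w" for F u w
    by (simp add: dd_def partial_eval_pd lessThan_Suc_atMost)
  have va: "(\<forall>y\<in>X. vanishes_at F y) \<longleftrightarrow> (\<forall>x\<in>\<Union>X. peval F x = 0)" for F
    unfolding vanishes_at_def by blast
  show ?thesis
    unfolding affine_tangent_space_def pe va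
    by (rule Set.set_eqI) (simp only: mem_Collect_eq Int_iff tv_iff_homogeneous[OF X], metis sc)
qed

lemma zariski_closed_subset: "zariski_closed N Z \<Longrightarrow> Z \<subseteq> pspace N"
  by (auto simp: zariski_closed_def zero_locus_def)

lemma zariski_closed_mem:
  assumes Z: "zariski_closed N Z" and v: "v \<in> cvec N" "v \<noteq> 0"
    and van: "\<And>f. f \<in> polyfun (Suc N) \<Longrightarrow> (\<forall>x\<in>\<Union>Z. f x = 0) \<Longrightarrow> f v = 0"
  shows "v \<in> \<Union>Z"
proof -
  obtain S where S: "\<forall>F\<in>S. \<exists>d. homogeneous N d F" "Z = zero_locus N S"
    using Z unfolding zariski_closed_def by blast
  have "vanishes_at F (ppoint v)" if "F \<in> S" for F
  proof -
    from bspec[OF S(1) that] obtain d where d: "homogeneous N d F" ..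
    have "peval F v = 0"
      by (rule van[OF peval_polyfun[OF d]]) (use that S(2) in \<open>auto simp: zero_locus_def vanishes_at_def\<close>)
    then show ?thesis by (simp add: vanishes_at_iff[OF d])
  qed
  then have "ppoint v \<in> Z"
    using v by (auto simp: S(2) zero_locus_def pspace_def)
  then show ?thesis using ppoint_mem by blast
qed

lemma zariski_closed_hypersurface:
  assumes "homogeneous N d F"
  shows "zariski_closed N {x \<in> pspace N. vanishes_at F x}"
  unfolding zariski_closed_def
  by (rule exI[of _ "{F}"]) (use assms in \<open>auto simp: zero_locus_def\<close>)

section \<open>Prime function families\<close>

text \<open>The functions of \<open>A\<close> that vanish on \<open>S\<close> behave like a prime
  ideal. \<open>A\<close> is a parameter because products of sets are first treated with functions
  of pairs.\<close>

definition prime_on :: "'a set \<Rightarrow> ('a \<Rightarrow> complex) set \<Rightarrow> bool" where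
  "prime_on S A \<longleftrightarrow> S \<noteq> {} \<and> (\<forall>f\<in>A. \<forall>g\<in>A. (\<forall>x\<in>S. f x * g x = 0) \<longrightarrow>
     (\<forall>x\<in>S. f x = 0) \<or> (\<forall>x\<in>S. g x = 0))"

lemma prime_onD:
  assumes "prime_on S A" "f \<in> A" "g \<in> A" "x \<in> S" "f x \<noteq> 0" "y \<in> S" "g y \<noteq> 0"
  shows "\<exists>z\<in>S. f z \<noteq> 0 \<and> g z \<noteq> 0"
proof (rule ccontr)
  assume "\<not> ?thesis"
  then have "\<forall>x\<in>S. f x * g x = 0" by auto
  then have "(\<forall>x\<in>S. f x = 0) \<or> (\<forall>x\<in>S. g x = 0)"
    using assms(1-3) unfolding prime_on_def by simp
  then show False using assms(4-7) by auto
qed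

lemma prime_onI:
  assumes "S \<noteq> {}"
    and "\<And>f g x y. f \<in> A \<Longrightarrow> g \<in> A \<Longrightarrow> x \<in> S \<Longrightarrow> f x \<noteq> 0 \<Longrightarrow> y \<in> S \<Longrightarrow> g y \<noteq> 0 \<Longrightarrow> \<exists>z\<in>S. f z \<noteq> 0 \<and> g z \<noteq> 0"
  shows "prime_on S A"
  unfolding prime_on_def
proof (intro conjI ballI impI)
  fix f g assume "f \<in> A" "g \<in> A" and van: "\<forall>x\<in>S. f x * g x = 0"
  show "(\<forall>x\<in>S. f x = 0) \<or> (\<forall>x\<in>S. g x = 0)"
  proof (rule ccontr)
    assume "\<not> ?thesis"
    then obtain x y where "x \<in> S" "f x \<noteq> 0" "y \<in> S" "g y \<noteq> 0" by auto
    from assms(2)[OF \<open>f \<in> A\<close> \<open>g \<in> A\<close> this] van show False by auto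
  qed
qed (rule assms)

text \<open>An identity that holds where \<open>h\<close> is nonzero holds on all of
  \<open>S\<close>: the standard passage from generic points to all points.\<close>

lemma prime_on_cancel:
  assumes "prime_on S A" "h \<in> A" "f \<in> A" "x \<in> S" "h x \<noteq> 0"
    and "\<And>y. y \<in> S \<Longrightarrow> h y \<noteq> 0 \<Longrightarrow> f y = 0" and "y \<in> S"
  shows "f y = 0"
proof (rule ccontr)
  assume "f y \<noteq> 0"
  from prime_onD[OF assms(1-5) \<open>y \<in> S\<close> this] assms(6) show False by auto
qed

text \<open>A product of irreducible sets is irreducible: vary the second coordinate until both
  functions are nonzero over their own first coordinates, then find a common first
  coordinate.\<close>

lemma prime_on_Times:
  assumes "prime_on S A" "prime_on T B"
  shows "prime_on (S \<times> T) {f. (\<forall>y\<in>T. (\<lambda>x. f (x, y)) \<in> A) \<and> (\<forall>x\<in>S. (\<lambda>y. f (x, y)) \<in> B)}"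
proof (rule prime_onI)
  show "S \<times> T \<noteq> {}" using assms by (auto simp: prime_on_def)
next
  fix f g p q
  assume *: "f \<in> {f. (\<forall>y\<in>T. (\<lambda>x. f (x, y)) \<in> A) \<and> (\<forall>x\<in>S. (\<lambda>y. f (x, y)) \<in> B)}"
    "g \<in> {f. (\<forall>y\<in>T. (\<lambda>x. f (x, y)) \<in> A) \<and> (\<forall>x\<in>S. (\<lambda>y. f (x, y)) \<in> B)}"
    "p \<in> S \<times> T" "f p \<noteq> 0" "q \<in> S \<times> T" "g q \<noteq> 0"
  obtain x1 y1 x2 y2 where [simp]: "p = (x1, y1)" "q = (x2, y2)" by (cases p, cases q)
  obtain y0 where y0: "y0 \<in> T" "f (x1, y0) \<noteq> 0" "g (x2, y0) \<noteq> 0"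
    using prime_onD[OF assms(2), of "\<lambda>y. f (x1, y)" "\<lambda>y. g (x2, y)" y1 y2] * by auto
  then obtain x0 where "x0 \<in> S" "f (x0, y0) \<noteq> 0" "g (x0, y0) \<noteq> 0"
    using prime_onD[OF assms(1), of "\<lambda>x. f (x, y0)" "\<lambda>x. g (x, y0)" x1 x2] * by auto
  then show "\<exists>z\<in>S \<times> T. f z \<noteq> 0 \<and> g z \<noteq> 0" using y0 by blast
qed

text \<open>On the line joining the two points of nonvanishing, both functions are nonzero
  univariate polynomials, and so is their product.\<close>

lemma prime_on_UNIV: "prime_on UNIV (polyfun m)"
proof (rule prime_onI)
  fix f g :: "(nat \<Rightarrow> complex) \<Rightarrow> complex" and a b
  assume f: "f \<in> polyfun m" "f a \<noteq> 0" and g: "g \<in> polyfun m" "g b \<noteq> 0"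
  define u where "u = (\<lambda>i. b i - a i)"
  from polyfun_line[OF f(1), of a u] obtain p where p: "f (\<lambda>i. a i + t * u i) = poly p t" for t
    by metis
  from polyfun_line[OF g(1), of a u] obtain q where q: "g (\<lambda>i. a i + t * u i) = poly q t" for t
    by metis
  have "poly p 0 \<noteq> 0" "poly q 1 \<noteq> 0"
    using f(2) g(2) p[of 0] q[of 1] by (auto simp: u_def)
  then have "p * q \<noteq> 0" by auto
  then obtain t where "poly (p * q) t \<noteq> 0" using poly_all_0_iff_0 by blast
  then have "f (\<lambda>i. a i + t * u i) \<noteq> 0 \<and> g (\<lambda>i. a i + t * u i) \<noteq> 0" using p q by simp
  then show "\<exists>z\<in>UNIV. f z \<noteq> 0 \<and> g z \<noteq> 0" by blast
qed simp

text \<open>Topological irreducibility speaks about forms only. For general functions one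
  nonvanishing component of each is chosen; the point found for these components is then
  rescaled.\<close>

lemma irreducible_prime_on:
  assumes X: "zariski_closed N X" and irr: "irreducible_space (subtopology (zariski N) X)"
  shows "prime_on (\<Union>X) (polyfun (Suc N))"
proof (rule prime_onI)
  have XP: "X \<subseteq> pspace N" by (rule zariski_closed_subset[OF X])
  have top: "topspace (subtopology (zariski N) X) = X"
    using XP by (auto simp: topspace_zariski)
  show "\<Union>X \<noteq> {}"
    using irr XP pspace_nonempty unfolding irreducible_space_def top by fastforce
  have hom: "(\<forall>x\<in>\<Union>X. peval F x = 0) \<or> (\<forall>x\<in>\<Union>X. peval G x = 0)"
    if F: "homogeneous N d F" and G: "homogeneous N e G" and van: "\<forall>x\<in>\<Union>X. peval F x * peval G x = 0"
    for F G d e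
  proof -
    let ?A = "X \<inter> {x \<in> pspace N. vanishes_at F x}" and ?B = "X \<inter> {x \<in> pspace N. vanishes_at G x}"
    have cl: "closedin (subtopology (zariski N) X) ?A" "closedin (subtopology (zariski N) X) ?B"
      using zariski_closed_hypersurface[OF F] zariski_closed_hypersurface[OF G]
      by (auto simp: closedin_subtopology closedin_zariski)
    have "x \<in> ?A \<union> ?B" if "x \<in> X" for x
    proof -
      have xp: "x \<in> pspace N" using that XP by blast
      then obtain v where v: "v \<in> x" using pspace_nonempty by blast
      then have "peval F v = 0 \<or> peval G v = 0" using van that by (metis UnionI mult_eq_0_iff)
      then show ?thesis
        using that xp vanishes_at_iff[OF F, of v] vanishes_at_iff[OF G, of v] pspace_rep[OF xp v] by auto
    qed
    then have "?A \<union> ?B = X" by blast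
    then have "?A = X \<or> ?B = X"
      using irr cl unfolding irreducible_space_def top by blast
    then show ?thesis unfolding vanishes_at_def by blast
  qed
  fix f g x y
  assume f: "f \<in> polyfun (Suc N)" and g: "g \<in> polyfun (Suc N)"
    and x: "x \<in> \<Union>X" "f x \<noteq> 0" and y: "y \<in> \<Union>X" "g y \<noteq> 0"
  obtain D F where F: "\<forall>d. homogeneous N d (F d)" "\<forall>v. f v = (\<Sum>d<D. peval (F d) v)"
    using polyfun_homogeneous_sum[OF f] by blast
  obtain E G where G: "\<forall>d. homogeneous N d (G d)" "\<forall>v. g v = (\<Sum>d<E. peval (G d) v)"
    using polyfun_homogeneous_sum[OF g] by blast
  have "(\<Sum>d<D. peval (F d) x) \<noteq> 0" using x(2) F(2) by simp
  then obtain d where d: "d < D" "peval (F d) x \<noteq> 0"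
    by (rule sum.not_neutral_contains_not_neutral) simp
  have "(\<Sum>d<E. peval (G d) y) \<noteq> 0" using y(2) G(2) by simp
  then obtain e where e: "e < E" "peval (G e) y \<noteq> 0"
    by (rule sum.not_neutral_contains_not_neutral) simp
  have "\<not> (\<forall>z\<in>\<Union>X. peval (F d) z * peval (G e) z = 0)"
    using hom[OF F(1)[rule_format] G(1)[rule_format]] d(2) e(2) x(1) y(1) by blast
  then obtain z where z: "z \<in> \<Union>X" "peval (F d) z * peval (G e) z \<noteq> 0" by blast
  \<comment> \<open>At \<open>c z\<close> both functions are polynomials in \<open>c\<close> with a
    nonzero coefficient, so almost every \<open>c\<close> avoids cancellation among the
    components.\<close>
  have "\<exists>c. c \<noteq> 0 \<and> (\<Sum>d<D. peval (F d) z * c ^ d) * (\<Sum>d<E. peval (G d) z * c ^ d) \<noteq> 0"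
  proof (rule ccontr)
    assume "\<not> ?thesis"
    then have "(\<forall>d<D. peval (F d) z = 0) \<or> (\<forall>d<E. peval (G d) z = 0)"
      by (intro coeffs_zero_of_nonzero_args) auto
    then have "peval (F d) z = 0 \<or> peval (G e) z = 0" using d(1) e(1) by blast
    then show False using z(2) by simp
  qed
  then obtain c where c: "c \<noteq> 0" "(\<Sum>d<D. peval (F d) z * c ^ d) * (\<Sum>d<E. peval (G d) z * c ^ d) \<noteq> 0"
    by (elim exE conjE)
  have "peval (F d) (cscale c z) = peval (F d) z * c ^ d" "peval (G d) (cscale c z) = peval (G d) z * c ^ d" for d
    using peval_scale[OF F(1)[rule_format]] peval_scale[OF G(1)[rule_format]] by (simp_all add: mult.commute)
  then have "f (cscale c z) \<noteq> 0 \<and> g (cscale c z) \<noteq> 0"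
    using c by (simp add: F(2) G(2))
  then show "\<exists>z\<in>\<Union>X. f z \<noteq> 0 \<and> g z \<noteq> 0"
    using Union_pspace_scale[OF XP z(1) c(1)] by blast
qed

section \<open>Elimination of one variable\<close>

text \<open>Polynomials in the variable \<open>j\<close> with \<open>D\<close> terms, that is of
  degree below \<open>D\<close>; the coefficients are meant to be functions of the earlier
  variables.\<close>

definition tsum :: "nat \<Rightarrow> nat \<Rightarrow> (nat \<Rightarrow> (nat \<Rightarrow> complex) \<Rightarrow> complex) \<Rightarrow> (nat \<Rightarrow> complex) \<Rightarrow> complex" where
  "tsum j D c v = (\<Sum>i<D. c i v * v j ^ i)"

lemma tsum_polyfun: "(\<And>i. c i \<in> polyfun j) \<Longrightarrow> tsum j D c \<in> polyfun (Suc j)"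
  unfolding tsum_def[abs_def] by (intro polyfun_intros polyfun_mono[where m = j and k = "Suc j"]) auto

lemma polyfun_upd_outside: "f \<in> polyfun j \<Longrightarrow> f (v(j := t)) = f v"
  by (rule polyfun_cong) auto

lemma tsum_upd: "(\<And>i. c i \<in> polyfun j) \<Longrightarrow> tsum j D c (v(j := t)) = (\<Sum>i<D. c i v * t ^ i)"
  by (simp add: tsum_def polyfun_upd_outside)

lemma polyfun_tsum:
  assumes "f \<in> polyfun (Suc j)"
  shows "\<exists>D c. (\<forall>i. c i \<in> polyfun j) \<and> f = tsum j D c"
proof -
  define R where "R = {f. \<exists>D c. (\<forall>i. c i \<in> polyfun j) \<and> f = tsum j D c}"
  have R: "tsum j D c \<in> R" if "\<And>i. c i \<in> polyfun j" for D c
    unfolding R_def using that by blast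
  have add: "(\<lambda>v. f v + g v) \<in> R" if fg: "f \<in> R" "g \<in> R" for f g
  proof -
    obtain D c where c: "\<forall>i. c i \<in> polyfun j" "f = tsum j D c" using fg(1) unfolding R_def by blast
    obtain E d where d: "\<forall>i. d i \<in> polyfun j" "g = tsum j E d" using fg(2) unfolding R_def by blast
    let ?c = "\<lambda>i v. (if i < D then c i v else 0) + (if i < E then d i v else 0)"
    have "tsum j (max D E) ?c v = f v + g v" for v
    proof -
      have "(\<Sum>i<max D E. (if i < D then c i v else 0) * v j ^ i) = (\<Sum>i<D. c i v * v j ^ i)"
        by (rule sum.mono_neutral_cong_right) auto
      moreover have "(\<Sum>i<max D E. (if i < E then d i v else 0) * v j ^ i) = (\<Sum>i<E. d i v * v j ^ i)"
        by (rule sum.mono_neutral_cong_right) auto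
      ultimately show ?thesis by (simp add: tsum_def c d distrib_right sum.distrib)
    qed
    then have eq: "tsum j (max D E) ?c = (\<lambda>v. f v + g v)" by (rule ext)
    have "(\<lambda>v. if i < D then c i v else 0) \<in> polyfun j" "(\<lambda>v. if i < E then d i v else 0) \<in> polyfun j" for i
      using c(1) d(1) by (cases "i < D", simp_all add: polyfun.const) (cases "i < E", simp_all add: polyfun.const)
    then have "?c i \<in> polyfun j" for i by (intro polyfun.add)
    then have "tsum j (max D E) ?c \<in> R" by (intro R)
    then show ?thesis unfolding eq .
  qed
  have zero: "(\<lambda>_. 0) \<in> R" using R[of "\<lambda>_ _. 0" 0] by (simp add: tsum_def[abs_def] polyfun.const)
  have sum: "(\<lambda>v. \<Sum>i<D. f i v) \<in> R" if "\<And>i. f i \<in> R" for f :: "nat \<Rightarrow> (nat \<Rightarrow> complex) \<Rightarrow> complex" and D :: nat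
    by (induction D) (auto intro: zero add that)
  have coef: "(\<lambda>v. a v * f v) \<in> R" if a: "a \<in> polyfun j" and f: "f \<in> R" for a f
  proof -
    obtain D c where c: "\<forall>i. c i \<in> polyfun j" "f = tsum j D c" using f unfolding R_def by blast
    have "tsum j D (\<lambda>i v. a v * c i v) \<in> R" by (rule R) (auto intro: polyfun.mult a c(1)[rule_format])
    then show ?thesis by (simp add: tsum_def[abs_def] c(2) sum_distrib_left mult.assoc)
  qed
  have shift: "(\<lambda>v. v j * f v) \<in> R" if f: "f \<in> R" for f
  proof -
    obtain D c where c: "\<forall>i. c i \<in> polyfun j" "f = tsum j D c" using f unfolding R_def by blast
    have eq: "tsum j (Suc D) (\<lambda>i. case i of 0 \<Rightarrow> (\<lambda>_. 0) | Suc i \<Rightarrow> c i) = (\<lambda>v. v j * f v)"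
      by (simp add: tsum_def[abs_def] c(2) sum.lessThan_Suc_shift sum_distrib_left algebra_simps del: sum.lessThan_Suc)
    have "tsum j (Suc D) (\<lambda>i. case i of 0 \<Rightarrow> (\<lambda>_. 0) | Suc i \<Rightarrow> c i) \<in> R"
      by (rule R) (auto split: nat.split intro: polyfun.const c(1)[rule_format])
    then show ?thesis unfolding eq .
  qed
  have pow: "(\<lambda>v. v j ^ i * f v) \<in> R" if f: "f \<in> R" for f i
  proof (induction i)
    case (Suc i)
    from shift[OF this] show ?case by (simp add: mult.assoc)
  qed (simp add: f)
  have poly_R: "f \<in> R" if f: "f \<in> polyfun j" for f
  proof -
    have "tsum j 1 (\<lambda>_. f) \<in> R" by (rule R) (rule f)
    then show ?thesis by (simp add: tsum_def[abs_def])
  qed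
  have "f \<in> R" using assms
  proof (induction rule: polyfun.induct)
    case (coord i)
    show ?case
    proof (cases "i = j")
      case True
      then show ?thesis using shift[OF poly_R[OF polyfun.const[of 1]]] by simp
    next
      case False
      then show ?thesis using coord by (intro poly_R polyfun.coord) simp
    qed
  next
    case (mult f g)
    obtain D c where c: "\<forall>i. c i \<in> polyfun j" "f = tsum j D c" using mult.IH(1) unfolding R_def by blast
    have "(\<lambda>v. \<Sum>i<D. c i v * (v j ^ i * g v)) \<in> R"
      by (rule sum) (rule coef[OF c(1)[rule_format] pow[OF mult.IH(2)]])
    then show ?case by (simp add: c(2) tsum_def sum_distrib_right mult.assoc)
  qed (simp_all add: poly_R polyfun.const add)
  then show ?thesis unfolding R_def by simp
qed

text \<open>Division by \<open>g\<close> of formal degree \<open>e\<close> without denominators, at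
  the price of a power of the leading coefficient. Truncated subtraction in \<open>D - e\<close>
  gives the quotient 0 when \<open>D\<close> is at most \<open>e\<close>.\<close>

lemma tsum_pseudo_division:
  assumes g: "\<And>i. g i \<in> polyfun j" and c: "\<And>i. c i \<in> polyfun j"
  shows "\<exists>k q r. (\<forall>i. q i \<in> polyfun j) \<and> (\<forall>i. r i \<in> polyfun j) \<and>
    (\<forall>v. g e v ^ k * tsum j D c v = tsum j (D - e) q v * tsum j (Suc e) g v + tsum j e r v)"
  using c
proof (induction D arbitrary: c)
  case 0
  show ?case
    by (rule exI[of _ 0], rule exI[of _ "\<lambda>_ _. 0"], rule exI[of _ "\<lambda>_ _. 0"])
      (simp add: tsum_def polyfun.const)
next
  case (Suc d)
  show ?case
  proof (cases "Suc d \<le> e")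
    case True
    have "tsum j (Suc d) c v = tsum j e (\<lambda>i v. if i < Suc d then c i v else 0) v" for v
      unfolding tsum_def by (rule sum.mono_neutral_cong_left) (use True in auto)
    moreover have "(\<lambda>v. if i < Suc d then c i v else 0) \<in> polyfun j" for i
      by (cases "i < Suc d") (simp_all add: polyfun.const Suc.prems)
    ultimately show ?thesis
      apply -
      apply (rule exI[of _ 0], rule exI[of _ "\<lambda>_ _. 0"],
          rule exI[of _ "\<lambda>i v. if i < Suc d then c i v else 0"])
      apply (simp add: tsum_def[of j _ "\<lambda>_ _. 0"] polyfun.const)
      done
  next
    case False
    then have ed: "e \<le> d" by simp
    \<comment> \<open>The numerator after cancelling the top term: leading coefficient of
      \<open>g\<close> times \<open>c\<close>, minus the shifted multiple of
      \<open>g\<close>.\<close>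
    define c' where "c' = (\<lambda>i v. g e v * c i v - (if d - e \<le> i then c d v * g (i - (d - e)) v else 0))"
    have c': "c' i \<in> polyfun j" for i
      unfolding c'_def by (cases "d - e \<le> i") (simp_all add: g Suc.prems polyfun_intros)
    from Suc.IH[of c', OF c'] obtain k q r where
      q: "\<forall>i. q i \<in> polyfun j" and r: "\<forall>i. r i \<in> polyfun j" and
      eq: "\<forall>v. g e v ^ k * tsum j d c' v = tsum j (d - e) q v * tsum j (Suc e) g v + tsum j e r v"
      by (elim exE conjE)
    have red: "g e v * tsum j (Suc d) c v = c d v * v j ^ (d - e) * tsum j (Suc e) g v + tsum j d c' v" for v
    proof -
      have "(\<Sum>i<Suc d. (if d - e \<le> i then c d v * g (i - (d - e)) v else 0) * v j ^ i) =
          (\<Sum>i\<in>{d - e..<Suc d}. c d v * g (i - (d - e)) v * v j ^ i)"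
        by (rule sum.mono_neutral_cong_right) auto
      also have "\<dots> = (\<Sum>i\<in>{0..<Suc e}. c d v * g i v * v j ^ (i + (d - e)))"
        using sum.shift_bounds_nat_ivl[of "\<lambda>i. c d v * g (i - (d - e)) v * v j ^ i" 0 "d - e" "Suc e"] ed
        by (simp add: Suc_diff_le[symmetric])
      also have "\<dots> = c d v * v j ^ (d - e) * tsum j (Suc e) g v"
        by (simp add: tsum_def sum_distrib_left power_add algebra_simps atLeast0LessThan del: sum.lessThan_Suc)
      finally have "g e v * tsum j (Suc d) c v = c d v * v j ^ (d - e) * tsum j (Suc e) g v +
          tsum j (Suc d) c' v"
        by (simp add: tsum_def c'_def left_diff_distrib sum_subtractf sum_distrib_left mult.assoc del: sum.lessThan_Suc)
      moreover have "c' d v = 0" using ed by (simp add: c'_def)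
      ultimately show ?thesis by (simp add: tsum_def)
    qed
    define q' where "q' = (\<lambda>i v. if i = d - e then g e v ^ k * c d v else q i v)"
    have q': "q' i \<in> polyfun j" for i
      unfolding q'_def by (cases "i = d - e") (simp_all add: q g Suc.prems polyfun_intros)
    have tq: "tsum j (Suc d - e) q' v = g e v ^ k * c d v * v j ^ (d - e) + tsum j (d - e) q v" for v
      using ed by (simp add: tsum_def q'_def Suc_diff_le)
    have "g e v ^ Suc k * tsum j (Suc d) c v = tsum j (Suc d - e) q' v * tsum j (Suc e) g v + tsum j e r v" for v
    proof -
      have "g e v ^ Suc k * tsum j (Suc d) c v = g e v ^ k * (g e v * tsum j (Suc d) c v)"
        by (simp add: ac_simps)
      also have "\<dots> = g e v ^ k * c d v * v j ^ (d - e) * tsum j (Suc e) g v + g e v ^ k * tsum j d c' v"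
        unfolding red by (simp add: algebra_simps)
      also have "\<dots> = tsum j (Suc d - e) q' v * tsum j (Suc e) g v + tsum j e r v"
        unfolding eq[rule_format] tq by (simp add: algebra_simps)
      finally show ?thesis .
    qed
    then show ?thesis using q' r by blast
  qed
qed

lemma tsum_chop:
  assumes "i0 < D" "x \<in> V" "c i0 x \<noteq> (0::complex)"
  shows "\<exists>e<D. (\<exists>x\<in>V. c e x \<noteq> 0) \<and> (\<forall>x\<in>V. tsum j (Suc e) c x = tsum j D c x)"
  using assms
proof (induction D)
  case (Suc D)
  show ?case
  proof (cases "\<exists>x\<in>V. c D x \<noteq> 0")
    case False
    then have eq: "\<forall>x\<in>V. tsum j (Suc D) c x = tsum j D c x" by (simp add: tsum_def)
    have "i0 < D" using Suc.prems False by (metis less_antisym)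
    from Suc.IH[OF this Suc.prems(2,3)] show ?thesis using eq less_Suc_eq by auto
  qed auto
qed simp

lemma prime_on_mono: "prime_on V B \<Longrightarrow> A \<subseteq> B \<Longrightarrow> prime_on V A"
  unfolding prime_on_def by (simp add: subset_iff)

lemma prime_on_polyfun_le: "prime_on V (polyfun m) \<Longrightarrow> k \<le> m \<Longrightarrow> prime_on V (polyfun k)"
  by (rule prime_on_mono) (auto intro: polyfun_mono)

text \<open>Coordinate \<open>j\<close>, restricted to \<open>V\<close>, is transcendental over the
  functions of the earlier coordinates.\<close>

definition trans_over :: "(nat \<Rightarrow> complex) set \<Rightarrow> nat \<Rightarrow> bool" where
  "trans_over V j \<longleftrightarrow> (\<forall>D c. (\<forall>i. c i \<in> polyfun j) \<longrightarrow> (\<forall>x\<in>V. tsum j D c x = 0) \<longrightarrow>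
     (\<forall>i<D. \<forall>x\<in>V. c i x = 0))"

text \<open>The minimal polynomial of coordinate \<open>j\<close> over the earlier ones, with
  denominators cleared; its degree is \<open>e\<close>. Minimality says that every relation with at
  most \<open>e\<close> terms is trivial on \<open>V\<close>.\<close>

definition min_poly :: "(nat \<Rightarrow> complex) set \<Rightarrow> nat \<Rightarrow> nat \<Rightarrow> (nat \<Rightarrow> (nat \<Rightarrow> complex) \<Rightarrow> complex) \<Rightarrow> bool" where
  "min_poly V j e g \<longleftrightarrow> (\<forall>i. g i \<in> polyfun j) \<and> (\<forall>x\<in>V. tsum j (Suc e) g x = 0) \<and> (\<exists>x\<in>V. g e x \<noteq> 0) \<and>
     (\<forall>D c. D \<le> e \<longrightarrow> (\<forall>i. c i \<in> polyfun j) \<longrightarrow> (\<forall>x\<in>V. tsum j D c x = 0) \<longrightarrow>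
       (\<forall>i<D. \<forall>x\<in>V. c i x = 0))"

lemma trans_or_min_poly: "trans_over V j \<or> (\<exists>e g. min_poly V j e g)"
proof -
  define Q where "Q e g \<longleftrightarrow> (\<forall>i. g i \<in> polyfun j) \<and> (\<forall>x\<in>V. tsum j (Suc e) g x = 0) \<and> (\<exists>x\<in>V. g e x \<noteq> 0)"
    for e g
  have key: "\<exists>e<D. Q e c" if "\<forall>i. c i \<in> polyfun j" "\<forall>x\<in>V. tsum j D c x = 0" "i < D" "x \<in> V" "c i x \<noteq> 0"
    for D c i x
    using tsum_chop[where c = c, OF that(3-5), of j] that(1,2) unfolding Q_def by auto
  show ?thesis
  proof (cases "\<exists>e g. Q e g")
    case False
    then show ?thesis unfolding trans_over_def using key by blast
  next
    case True
    define e where "e = (LEAST e. \<exists>g. Q e g)"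
    obtain g where g: "Q e g" using LeastI_ex[OF True] unfolding e_def by blast
    have least: "\<not> Q e' g'" if "e' < e" for e' g' using not_less_Least[OF that[unfolded e_def]] by blast
    have "min_poly V j e g"
      unfolding min_poly_def
    proof (intro conjI allI impI ballI)
      fix D c i x
      assume a: "D \<le> e" "\<forall>i. c i \<in> polyfun j" "\<forall>x\<in>V. tsum j D c x = 0" "i < D" "x \<in> V"
      show "c i x = 0"
      proof (rule ccontr)
        assume "c i x \<noteq> 0"
        from key[OF a(2-5) this] obtain e' where "e' < D" "Q e' c" by blast
        with a(1) least show False by simp
      qed
    qed (use g in \<open>simp_all add: Q_def\<close>)
    then show ?thesis by blast
  qed
qed

lemma min_polyD:
  assumes "min_poly V j e g" "D \<le> e" "\<And>i. c i \<in> polyfun j" "\<And>x. x \<in> V \<Longrightarrow> tsum j D c x = 0" "i < D" "x \<in> V"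
  shows "c i x = 0"
  using assms unfolding min_poly_def by simp

lemma min_poly_pos: "min_poly V j e g \<Longrightarrow> 0 < e"
  unfolding min_poly_def tsum_def by (cases e) auto

text \<open>After multiplication by a power of the leading coefficient, each equation of
  \<open>V\<close> becomes a multiple of the minimal polynomial plus an equation with all
  coefficients vanishing on \<open>V\<close>: by minimality the remainder of the pseudo-division is
  trivial.\<close>

lemma min_poly_reduce:
  assumes g: "min_poly V j e g" and f: "f \<in> polyfun (Suc j)" "\<forall>x\<in>V. f x = 0"
  shows "\<exists>k q r. q \<in> polyfun (Suc j) \<and> (\<forall>i. r i \<in> polyfun j) \<and> (\<forall>i<e. \<forall>x\<in>V. r i x = 0) \<and>
    (\<forall>v. g e v ^ k * f v = q v * tsum j (Suc e) g v + tsum j e r v)"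
proof -
  have gp: "g i \<in> polyfun j" for i using g by (simp add: min_poly_def)
  obtain D c where c: "\<forall>i. c i \<in> polyfun j" "f = tsum j D c" using polyfun_tsum[OF f(1)] by blast
  obtain k q r where q: "\<forall>i. q i \<in> polyfun j" and r: "\<forall>i. r i \<in> polyfun j" and
    eq: "\<forall>v. g e v ^ k * tsum j D c v = tsum j (D - e) q v * tsum j (Suc e) g v + tsum j e r v"
    using tsum_pseudo_division[of g j c e D, OF gp c(1)[rule_format]] by (elim exE conjE)
  have "\<forall>x\<in>V. tsum j e r x = 0"
  proof
    fix x assume "x \<in> V"
    then have "f x = 0" "tsum j (Suc e) g x = 0" using f(2) g by (auto simp: min_poly_def)
    then show "tsum j e r x = 0" using eq[rule_format, of x] c(2) by simp
  qed
  then have "\<forall>i<e. \<forall>x\<in>V. r i x = 0" using min_polyD[OF g order_refl, of r] r by simp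
  moreover have "tsum j (D - e) q \<in> polyfun (Suc j)" using q by (intro tsum_polyfun) blast
  ultimately show ?thesis
    using r eq c(2) by (intro exI[of _ k], intro exI[of _ "tsum j (D - e) q"], intro exI[of _ r]) simp
qed

section \<open>Lifting tangent vectors and points\<close>

lemma dd_Suc_upd:
  "dd (Suc j) f v (\<tau>(j := s)) = dd j f v \<tau> + pd j f v * s"
  by (simp add: dd_def)

lemma dd_tsum_zero:
  assumes r: "\<And>i. r i \<in> polyfun j" and "\<And>i. i < e \<Longrightarrow> r i v = 0" "\<And>i. i < e \<Longrightarrow> dd j (r i) v \<tau> = 0"
  shows "dd (Suc j) (tsum j e r) v (\<tau>(j := s)) = 0"
proof -
  have rp: "r i \<in> polyfun (Suc j)" for i by (rule polyfun_mono[OF r]) simp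
  have pw: "(\<lambda>v. v j ^ i) \<in> polyfun (Suc j)" for i by (intro polyfun_intros) simp
  have "tsum j e r = (\<lambda>v. \<Sum>i<e. r i v * v j ^ i)" by (simp add: fun_eq_iff tsum_def)
  then have "dd (Suc j) (tsum j e r) v (\<tau>(j := s)) =
      (\<Sum>i<e. dd (Suc j) (\<lambda>v. r i v * v j ^ i) v (\<tau>(j := s)))"
    using dd_sum[of "{..<e}" "\<lambda>i v. r i v * v j ^ i" "Suc j" "Suc j" v "\<tau>(j := s)"]
      polyfun.mult[OF rp pw] by simp
  also have "\<dots> = 0"
  proof (rule sum.neutral, rule ballI)
    fix i assume i: "i \<in> {..<e}"
    have "dd (Suc j) (r i) v (\<tau>(j := s)) = 0"
      using assms(3) i by (simp add: dd_Suc_upd pd_outside[OF r])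
    then show "dd (Suc j) (\<lambda>v. r i v * v j ^ i) v (\<tau>(j := s)) = 0"
      using assms(2) i by (simp add: dd_mult[OF rp pw])
  qed
  finally show ?thesis .
qed

lemma pd_tsum:
  assumes g: "\<And>i. g i \<in> polyfun j"
  shows "pd j (tsum j (Suc e) g) v = tsum j e (\<lambda>i v. of_nat (Suc i) * g (Suc i) v) v"
proof -
  have "((\<lambda>t. \<Sum>i<Suc e. g i v * t ^ i) has_field_derivative
      (\<Sum>i<Suc e. g i v * (of_nat i * v j ^ (i - Suc 0)))) (at (v j))"
    by (auto intro!: derivative_eq_intros sum.cong)
  then have "pd j (tsum j (Suc e) g) v = (\<Sum>i<Suc e. g i v * (of_nat i * v j ^ (i - Suc 0)))"
    unfolding pd_def tsum_upd[OF g] by (rule DERIV_imp_deriv)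
  also have "\<dots> = tsum j e (\<lambda>i v. of_nat (Suc i) * g (Suc i) v) v"
    unfolding sum.lessThan_Suc_shift tsum_def by (auto intro!: sum.cong simp: algebra_simps)
  finally show ?thesis .
qed

text \<open>In the transcendental case the new component is free, and 0 is taken. In the algebraic
  case implicit differentiation of the minimal polynomial determines it, wherever the derivative and
  the leading coefficient are nonzero.\<close>

lemma tangent_lift_step:
  assumes V: "prime_on V (polyfun (Suc j))"
  shows "\<exists>h\<in>polyfun (Suc j). (\<exists>x\<in>V. h x \<noteq> 0) \<and> (\<forall>v\<in>V. h v \<noteq> 0 \<longrightarrow>
    (\<forall>\<tau>\<in>tv V j v. \<exists>s. \<tau>(j := s) \<in> tv V (Suc j) v))"
proof (cases "trans_over V j")
  case True
  have "\<tau>(j := 0) \<in> tv V (Suc j) v" if v: "v \<in> V" and \<tau>: "\<tau> \<in> tv V j v" for v \<tau>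
    unfolding tv_def
  proof (intro CollectI ballI impI)
    fix f assume f: "f \<in> polyfun (Suc j)" "\<forall>x\<in>V. f x = 0"
    obtain D c where c: "\<forall>i. c i \<in> polyfun j" "f = tsum j D c" using polyfun_tsum[OF f(1)] by blast
    have van: "\<forall>i<D. \<forall>x\<in>V. c i x = 0"
      using True[unfolded trans_over_def, rule_format, of c D] c f(2) by simp
    show "dd (Suc j) f v (\<tau>(j := 0)) = 0"
      unfolding c(2)
    proof (rule dd_tsum_zero)
      show "c i v = 0" if "i < D" for i using van that v by blast
      show "dd j (c i) v \<tau> = 0" if "i < D" for i
        using \<tau> c(1) van that unfolding tv_def by blast
    qed (use c in blast)
  qed
  moreover have "V \<noteq> {}" using V by (simp add: prime_on_def)
  ultimately show ?thesis
    by (intro bexI[of _ "\<lambda>_. 1"]) (auto intro: polyfun.const)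
next
  case False
  then obtain e g where g: "min_poly V j e g" using trans_or_min_poly by blast
  have gp: "g i \<in> polyfun j" for i using g by (simp add: min_poly_def)
  let ?G = "tsum j (Suc e) g"
  have G: "?G \<in> polyfun (Suc j)" by (rule tsum_polyfun) (rule gp)
  have ge: "g e \<in> polyfun (Suc j)" by (rule polyfun_mono[OF gp]) simp
  have pdG: "pd j ?G \<in> polyfun (Suc j)" by (rule pd_polyfun) (rule G)
  let ?h = "\<lambda>v. g e v * pd j ?G v"
  \<comment> \<open>Separability: the derivative has \<open>e\<close> terms and top coefficient
    \<open>e\<close> times \<open>g e\<close>; if it vanished on \<open>V\<close>, minimality would
    make \<open>g e\<close> vanish there.\<close>
  have "\<exists>x\<in>V. pd j ?G x \<noteq> 0"
  proof (rule ccontr)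
    assume "\<not> ?thesis"
    then have "\<forall>x\<in>V. tsum j e (\<lambda>i v. of_nat (Suc i) * g (Suc i) v) x = 0"
      by (simp add: pd_tsum[OF gp])
    moreover have "(\<lambda>v. of_nat (Suc i) * g (Suc i) v) \<in> polyfun j" for i
      by (intro polyfun_intros gp)
    ultimately have "of_nat (Suc i) * g (Suc i) x = 0" if "i < e" "x \<in> V" for i x
      using min_polyD[OF g order_refl, of "\<lambda>i v. of_nat (Suc i) * g (Suc i) v" i x] that by simp
    from this[of "e - 1"] have "\<forall>x\<in>V. g e x = 0"
      using min_poly_pos[OF g] by (simp del: of_nat_Suc)
    then show False using g by (simp add: min_poly_def)
  qed
  then obtain x where x: "x \<in> V" "pd j ?G x \<noteq> 0" by blast
  obtain y where y: "y \<in> V" "g e y \<noteq> 0" using g by (auto simp: min_poly_def)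
  have "\<exists>z\<in>V. g e z \<noteq> 0 \<and> pd j ?G z \<noteq> 0"
    by (rule prime_onD[where f = "g e" and g = "pd j ?G", OF V ge pdG y x])
  then have "\<exists>x\<in>V. ?h x \<noteq> 0" by auto
  moreover have "\<exists>s. \<tau>(j := s) \<in> tv V (Suc j) v"
    if v: "v \<in> V" "?h v \<noteq> 0" and \<tau>: "\<tau> \<in> tv V j v" for v \<tau>
  proof
    let ?s = "- dd j ?G v \<tau> / pd j ?G v"
    have dG: "dd (Suc j) ?G v (\<tau>(j := ?s)) = 0" using v(2) by (simp add: dd_Suc_upd)
    show "\<tau>(j := ?s) \<in> tv V (Suc j) v"
      unfolding tv_def
    proof (intro CollectI ballI impI)
      fix f assume f: "f \<in> polyfun (Suc j)" "\<forall>x\<in>V. f x = 0"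
      obtain k q r where q: "q \<in> polyfun (Suc j)" and r: "\<forall>i. r i \<in> polyfun j" "\<forall>i<e. \<forall>x\<in>V. r i x = 0"
        and eq: "\<forall>v. g e v ^ k * f v = q v * ?G v + tsum j e r v"
        using min_poly_reduce[OF g f] by (elim exE conjE)
      have gk: "(\<lambda>v. g e v ^ k) \<in> polyfun (Suc j)" by (intro polyfun_intros ge)
      have qG: "(\<lambda>v. q v * ?G v) \<in> polyfun (Suc j)" by (intro polyfun_intros q G)
      have rr: "tsum j e r \<in> polyfun (Suc j)" by (rule tsum_polyfun) (simp add: r)
      have fv: "f v = 0" "?G v = 0" using f(2) v(1) g by (auto simp: min_poly_def)
      have "dd (Suc j) (tsum j e r) v (\<tau>(j := ?s)) = 0"
        by (rule dd_tsum_zero) (use r v(1) \<tau> in \<open>auto simp: tv_def\<close>)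
      moreover have "(\<lambda>v. g e v ^ k * f v) = (\<lambda>v. q v * ?G v + tsum j e r v)"
        using eq by blast
      then have "dd (Suc j) (\<lambda>v. g e v ^ k * f v) v (\<tau>(j := ?s)) =
          dd (Suc j) (\<lambda>v. q v * ?G v + tsum j e r v) v (\<tau>(j := ?s))" by simp
      ultimately have "g e v ^ k * dd (Suc j) f v (\<tau>(j := ?s)) = 0"
        using fv dG by (simp add: dd_mult[OF gk f(1)] dd_add[OF qG rr] dd_mult[OF q G])
      then show "dd (Suc j) f v (\<tau>(j := ?s)) = 0" using v(2) by simp
    qed
  qed
  ultimately show ?thesis
    by (intro bexI[of _ ?h]) (auto intro: polyfun.mult ge pdG)
qed

definition indep_coords :: "(nat \<Rightarrow> complex) set \<Rightarrow> nat \<Rightarrow> bool" where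
  "indep_coords V r \<longleftrightarrow> (\<forall>f\<in>polyfun r. (\<forall>x\<in>V. f x = 0) \<longrightarrow> (\<forall>x. f x = 0))"

text \<open>Generic smoothness in characteristic zero.\<close>

theorem tangent_lift:
  assumes "prime_on V (polyfun m)" "r \<le> m" and ind: "indep_coords V r"
  shows "\<exists>h\<in>polyfun m. (\<exists>x\<in>V. h x \<noteq> 0) \<and> (\<forall>v\<in>V. h v \<noteq> 0 \<longrightarrow>
    (\<forall>\<tau>. \<exists>\<tau>'\<in>tv V m v. \<forall>i<r. \<tau>' i = \<tau> i))"
  using \<open>r \<le> m\<close> assms(1)
proof (induction m rule: dec_induct)
  case base
  have "\<tau> \<in> tv V r v" for \<tau> v
    unfolding tv_def
  proof (intro CollectI ballI impI)
    fix f assume "f \<in> polyfun r" "\<forall>x\<in>V. f x = 0"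
    then have "f = (\<lambda>_. 0)" using ind unfolding indep_coords_def by blast
    then show "dd r f v \<tau> = 0" by simp
  qed
  moreover have "V \<noteq> {}" using base by (simp add: prime_on_def)
  ultimately show ?case by (intro bexI[of _ "\<lambda>_. 1"]) (auto intro: polyfun.const)
next
  case (step j)
  have "prime_on V (polyfun j)" by (rule prime_on_polyfun_le[OF step.prems]) simp
  from bexE[OF step.IH[OF this]] obtain h where h0: "h \<in> polyfun j"
    "(\<exists>x\<in>V. h x \<noteq> 0) \<and> (\<forall>v\<in>V. h v \<noteq> 0 \<longrightarrow> (\<forall>\<tau>. \<exists>\<tau>'\<in>tv V j v. \<forall>i<r. \<tau>' i = \<tau> i))" .
  note h = h0(1) conjunct1[OF h0(2)] conjunct2[OF h0(2)]
  from bexE[OF tangent_lift_step[OF step.prems]] obtain h' where h'0: "h' \<in> polyfun (Suc j)"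
    "(\<exists>x\<in>V. h' x \<noteq> 0) \<and> (\<forall>v\<in>V. h' v \<noteq> 0 \<longrightarrow> (\<forall>\<tau>\<in>tv V j v. \<exists>s. \<tau>(j := s) \<in> tv V (Suc j) v))" .
  note h' = h'0(1) conjunct1[OF h'0(2)] conjunct2[OF h'0(2)]
  have hS: "h \<in> polyfun (Suc j)" by (rule polyfun_mono[OF h(1)]) simp
  from h(2) obtain x where x: "x \<in> V" "h x \<noteq> 0" ..
  from h'(2) obtain y where y: "y \<in> V" "h' y \<noteq> 0" ..
  have "\<exists>z\<in>V. h z \<noteq> 0 \<and> h' z \<noteq> 0" by (rule prime_onD[where f = h and g = h' and x = x and y = y, OF step.prems hS h'(1) x y])
  moreover have "\<exists>\<tau>'\<in>tv V (Suc j) v. \<forall>i<r. \<tau>' i = \<tau> i" if v: "v \<in> V" "h v \<noteq> 0" "h' v \<noteq> 0" for v \<tau>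
  proof -
    from h(3) v obtain \<tau>' where t: "\<tau>' \<in> tv V j v" "\<forall>i<r. \<tau>' i = \<tau> i" by blast
    from h'(3) v t(1) obtain s where "\<tau>'(j := s) \<in> tv V (Suc j) v" by blast
    moreover have "\<forall>i<r. (\<tau>'(j := s)) i = \<tau> i" using t(2) step.hyps by auto
    ultimately show ?thesis by blast
  qed
  ultimately show ?case
    by (intro bexI[of _ "\<lambda>v. h v * h' v"]) (auto intro: polyfun.mult hS h'(1))
qed

text \<open>The closure as seen by the first \<open>j\<close> coordinates: the cylinder over the
  closure of the projection of \<open>V\<close>. Coordinates from \<open>j\<close> on are
  unrestricted.\<close>

definition zcl :: "(nat \<Rightarrow> complex) set \<Rightarrow> nat \<Rightarrow> (nat \<Rightarrow> complex) set" where
  "zcl V j = {a. \<forall>f\<in>polyfun j. (\<forall>x\<in>V. f x = 0) \<longrightarrow> f a = 0}"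

text \<open>In the transcendental case one nonzero coefficient of \<open>h\<close> suffices. In the
  algebraic case some multiple of \<open>h\<close> equals on \<open>V\<close> a function of the
  earlier coordinates; where that function is nonzero, \<open>h\<close> cannot vanish at any root of
  the minimal polynomial.\<close>

lemma point_lift_step:
  assumes V: "prime_on V (polyfun (Suc j))" and h: "h \<in> polyfun (Suc j)" "\<exists>x\<in>V. h x \<noteq> 0"
  shows "\<exists>u\<in>polyfun j. (\<exists>x\<in>V. u x \<noteq> 0) \<and> (\<forall>a\<in>zcl V j. u a \<noteq> 0 \<longrightarrow>
    (\<exists>t. a(j := t) \<in> zcl V (Suc j) \<and> h (a(j := t)) \<noteq> 0))"
proof -
  obtain Dh ch where ch: "\<forall>i. ch i \<in> polyfun j" "h = tsum j Dh ch" using polyfun_tsum[OF h(1)] by blast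
  have nz: "\<exists>t. (\<Sum>i<D. c i * t ^ i) \<noteq> (0::complex)" if "i0 < D" "c i0 \<noteq> 0" for c :: "nat \<Rightarrow> complex" and i0 D
    using coeffs_zero_of_nonzero_args[where a = c and D = D and E = 1 and b = "\<lambda>_. 1"] that by fastforce
  show ?thesis
  proof (cases "trans_over V j")
    case True
    have "\<exists>i<Dh. \<exists>x\<in>V. ch i x \<noteq> 0"
    proof (rule ccontr)
      assume "\<not> ?thesis"
      then have "\<forall>x\<in>V. h x = 0" by (simp add: ch(2) tsum_def)
      then show False using h(2) by simp
    qed
    then obtain i where i: "i < Dh" "\<exists>x\<in>V. ch i x \<noteq> 0" by blast
    show ?thesis
    proof (intro bexI[of _ "ch i"] conjI ballI impI)
      fix a assume a: "a \<in> zcl V j" "ch i a \<noteq> 0"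
      from nz[of i Dh "\<lambda>i. ch i a", OF i(1) a(2)] obtain t where t: "(\<Sum>i<Dh. ch i a * t ^ i) \<noteq> 0" ..
      have "a(j := t) \<in> zcl V (Suc j)"
        unfolding zcl_def
      proof (intro CollectI ballI impI)
        fix f assume f: "f \<in> polyfun (Suc j)" "\<forall>x\<in>V. f x = 0"
        obtain D c where c: "\<forall>i. c i \<in> polyfun j" "f = tsum j D c" using polyfun_tsum[OF f(1)] by blast
        have van: "\<forall>i<D. \<forall>x\<in>V. c i x = 0"
          using True[unfolded trans_over_def, rule_format, of c D] c f(2) by simp
        have "c i a = 0" if "i < D" for i
          using a(1) c(1) van that unfolding zcl_def by blast
        then show "f (a(j := t)) = 0"
          unfolding c(2) by (simp add: tsum_upd[OF c(1)[rule_format]])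
      qed
      moreover have "h (a(j := t)) \<noteq> 0"
        unfolding ch(2) using t by (simp add: tsum_upd[OF ch(1)[rule_format]])
      ultimately show "\<exists>t. a(j := t) \<in> zcl V (Suc j) \<and> h (a(j := t)) \<noteq> 0" by blast
    qed (use i ch in auto)
  next
    case False
    then obtain e g where g: "min_poly V j e g" using trans_or_min_poly by blast
    have gp: "g i \<in> polyfun j" for i using g by (simp add: min_poly_def)
    let ?G = "tsum j (Suc e) g"
    have gS: "g e \<in> polyfun (Suc j)" by (rule polyfun_mono[OF gp]) simp
    obtain y where y: "y \<in> V" "g e y \<noteq> 0" using g by (auto simp: min_poly_def)
    text \<open>Polynomials of small degree in the ideal generated by \<open>h\<close> modulo the relations on \<open>V\<close>;
      a member of degree 0 is the sought \<open>u\<close>.\<close>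
    define Q where "Q d c \<longleftrightarrow> (\<forall>i. c i \<in> polyfun j) \<and> (\<exists>x\<in>V. c d x \<noteq> 0) \<and>
      (\<exists>b\<in>polyfun (Suc j). \<forall>x\<in>V. tsum j (Suc d) c x = b x * h x)" for d c
    have red: "\<exists>d<D. Q d c" if c: "\<forall>i. c i \<in> polyfun j" and b: "b \<in> polyfun (Suc j)"
      "\<forall>x\<in>V. tsum j D c x = b x * h x" and i: "i < D" "x \<in> V" "c i x \<noteq> 0" for D c b i x
      using tsum_chop[where c = c, OF i, of j] c b unfolding Q_def by (elim exE conjE) auto
    \<comment> \<open>The pseudo-remainder of \<open>h\<close> modulo the minimal polynomial: on
      \<open>V\<close> it is a power of \<open>g e\<close> times \<open>h\<close>, hence not
      identically zero, and it has only \<open>e\<close> terms.\<close>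
    have "\<exists>d<e. \<exists>c. Q d c"
    proof -
      obtain k q r where q: "\<forall>i. q i \<in> polyfun j" and r: "\<forall>i. r i \<in> polyfun j" and
        eq: "\<forall>v. g e v ^ k * tsum j Dh ch v = tsum j (Dh - e) q v * ?G v + tsum j e r v"
        using tsum_pseudo_division[of g j ch e Dh, OF gp ch(1)[rule_format]] by (elim exE conjE)
      have gk: "(\<lambda>v. g e v ^ k) \<in> polyfun (Suc j)" by (intro polyfun_intros gS)
      have eqV: "\<forall>x\<in>V. tsum j e r x = g e x ^ k * h x"
        using eq g ch(2) by (auto simp: min_poly_def)
      obtain x where x: "x \<in> V" "h x \<noteq> 0" using h(2) by blast
      have "\<exists>z\<in>V. g e z ^ k \<noteq> 0 \<and> h z \<noteq> 0"
        by (rule prime_onD[where f = "\<lambda>v. g e v ^ k" and x = y and y = x, OF V gk h(1) y(1) _ x]) (simp add: y)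
      then obtain z where z: "z \<in> V" "tsum j e r z \<noteq> 0" using eqV by auto
      have "\<exists>i<e. r i z \<noteq> 0"
      proof (rule ccontr)
        assume "\<not> ?thesis"
        then have "tsum j e r z = 0" by (simp add: tsum_def)
        with z show False by simp
      qed
      then obtain i where "i < e" "r i z \<noteq> 0" by blast
      from red[OF r gk eqV this(1) z(1) this(2)] show ?thesis by blast
    qed
    then have ex: "\<exists>d. \<exists>c. Q d c" and exe: "\<exists>d<e. \<exists>c. Q d c" by blast+
    define d where "d = (LEAST d. \<exists>c. Q d c)"
    obtain p where p: "Q d p" using LeastI_ex[OF ex] unfolding d_def by blast
    have least: "\<not> Q d' c'" if "d' < d" for d' c' using not_less_Least[OF that[unfolded d_def]] by blast
    have de: "d < e"
      using exe least by (metis (no_types, lifting) linorder_neqE_nat order.strict_trans)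
    have pp: "p i \<in> polyfun j" for i using p by (simp add: Q_def)
    have pS: "p d \<in> polyfun (Suc j)" by (rule polyfun_mono[OF pp]) simp
    obtain b where b: "b \<in> polyfun (Suc j)" "\<forall>x\<in>V. tsum j (Suc d) p x = b x * h x"
      using p unfolding Q_def by blast
    obtain x1 where x1: "x1 \<in> V" "p d x1 \<noteq> 0" using p unfolding Q_def by blast
    \<comment> \<open>A Euclidean step. Modulo \<open>p\<close> the minimal polynomial leaves a
      multiple of \<open>h\<close> of smaller degree, which must be trivial; so quotient times
      \<open>p\<close> vanishes on \<open>V\<close>, and each factor has too few terms to be a
      relation.\<close>
    have "d = 0"
    proof (rule ccontr)
      assume "d \<noteq> 0"
      obtain k q r where q: "\<forall>i. q i \<in> polyfun j" and r: "\<forall>i. r i \<in> polyfun j" and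
        eq: "\<forall>v. p d v ^ k * ?G v = tsum j (Suc e - d) q v * tsum j (Suc d) p v + tsum j d r v"
        using tsum_pseudo_division[of p j g d "Suc e", OF pp gp] by (elim exE conjE)
      have G0: "\<forall>x\<in>V. ?G x = 0" using g by (simp add: min_poly_def)
      have qS: "tsum j (Suc e - d) q \<in> polyfun (Suc j)" by (rule tsum_polyfun) (simp add: q)
      have pSum: "tsum j (Suc d) p \<in> polyfun (Suc j)" by (rule tsum_polyfun) (simp add: pp)
      have r0: "r i x = 0" if ix: "i < d" "x \<in> V" for i x
      proof (rule ccontr)
        assume rx: "r i x \<noteq> 0"
        have "(\<lambda>v. - (tsum j (Suc e - d) q v * b v)) \<in> polyfun (Suc j)" by (intro polyfun_intros qS b)
        moreover have "\<forall>x\<in>V. tsum j d r x = - (tsum j (Suc e - d) q x * b x) * h x"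
        proof
          fix x assume "x \<in> V"
          then show "tsum j d r x = - (tsum j (Suc e - d) q x * b x) * h x"
            using eq[rule_format, of x] G0 b(2) by (simp add: algebra_simps add_eq_0_iff)
        qed
        ultimately obtain d' where "d' < d" "Q d' r" using red[OF r _ _ ix rx] by blast
        with least show False by blast
      qed
      have "\<forall>x\<in>V. tsum j (Suc e - d) q x * tsum j (Suc d) p x = 0"
      proof
        fix x assume "x \<in> V"
        then show "tsum j (Suc e - d) q x * tsum j (Suc d) p x = 0"
          using eq[rule_format, of x] G0 r0 by (simp add: tsum_def[of j d r])
      qed
      then consider "\<forall>x\<in>V. tsum j (Suc e - d) q x = 0" | "\<forall>x\<in>V. tsum j (Suc d) p x = 0"
        using V qS pSum unfolding prime_on_def by blast
      then show False
      proof cases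
        case 1
        have q0: "q i x = 0" if "i < Suc e - d" "x \<in> V" for i x
        proof -
          have "Suc e - d \<le> e" using \<open>d \<noteq> 0\<close> by simp
          then show ?thesis using min_polyD[OF g, of "Suc e - d" q i x] q 1 that by simp
        qed
        \<comment> \<open>The coefficients of quotient and remainder do not depend on coordinate
          \<open>j\<close>, so they also vanish at \<open>z(j := t)\<close> for every
          \<open>t\<close>, off \<open>V\<close>. There the minimal polynomial would vanish
          identically in \<open>t\<close> although \<open>g e z\<close> is nonzero.\<close>
        obtain z where z: "z \<in> V" "p d z \<noteq> 0" "g e z \<noteq> 0"
          using prime_onD[where f = "p d" and g = "g e" and x = x1 and y = y, OF V pS gS x1 y] by blast
        from nz[of e "Suc e" "\<lambda>i. g i z", OF _ z(3)] obtain t where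
          t: "(\<Sum>i<Suc e. g i z * t ^ i) \<noteq> 0" by blast
        have "p d (z(j := t)) ^ k * ?G (z(j := t)) = 0"
          unfolding eq[rule_format] tsum_upd[OF q[rule_format]] tsum_upd[OF r[rule_format]]
          using q0 r0 z(1) by simp
        then show False
          using t z(2) by (simp add: tsum_upd[OF gp] polyfun_upd_outside[OF pp] del: sum.lessThan_Suc)
      next
        case 2
        have "Suc d \<le> e" using de by simp
        from min_polyD[where c = p and i = d and x = x1, OF g this] show False using 2 x1 pp by simp
      qed
    qed
    have p0: "tsum j (Suc d) p v = p 0 v" for v using \<open>d = 0\<close> by (simp add: tsum_def)
    \<comment> \<open>The factor \<open>p 0\<close> keeps \<open>h\<close> nonzero;
      \<open>g e\<close> makes the minimal polynomial over \<open>a\<close> nonconstant, so that it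
      has a root, and permits cancelling its powers.\<close>
    let ?u = "\<lambda>v. p 0 v * g e v"
    show ?thesis
    proof (intro bexI[of _ ?u] conjI ballI impI)
      show "?u \<in> polyfun j" by (intro polyfun_intros pp gp)
      show "\<exists>x\<in>V. ?u x \<noteq> 0"
        using prime_onD[where f = "p d" and g = "g e" and x = x1 and y = y, OF V pS gS x1 y] \<open>d = 0\<close> by auto
      fix a assume a: "a \<in> zcl V j" "?u a \<noteq> 0"
      define P where "P = (\<Sum>i<Suc e. monom (g i a) i)"
      have Pev: "poly P t = ?G (a(j := t))" for t
        by (simp add: P_def poly_sum poly_monom tsum_upd[OF gp] del: sum.lessThan_Suc)
      have "coeff P e = g e a" by (simp add: P_def coeff_sum)
      then have "degree P \<noteq> 0" using a(2) min_poly_pos[OF g] le_degree[of P e] by auto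
      then have "\<not> constant (poly P)" by (simp add: constant_degree)
      from fundamental_theorem_of_algebra[OF this] obtain t where "poly P t = 0" ..
      then have Gt: "?G (a(j := t)) = 0" by (simp add: Pev)
      have mem: "a(j := t) \<in> zcl V (Suc j)"
        unfolding zcl_def
      proof (intro CollectI ballI impI)
        fix f assume f: "f \<in> polyfun (Suc j)" "\<forall>x\<in>V. f x = 0"
        obtain k q r where q: "q \<in> polyfun (Suc j)" and r: "\<forall>i. r i \<in> polyfun j" "\<forall>i<e. \<forall>x\<in>V. r i x = 0"
          and eq: "\<forall>v. g e v ^ k * f v = q v * ?G v + tsum j e r v"
          using min_poly_reduce[OF g f] by (elim exE conjE)
        have "r i a = 0" if "i < e" for i
          using a(1) r that unfolding zcl_def by blast
        then have "g e (a(j := t)) ^ k * f (a(j := t)) = 0"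
          unfolding eq[rule_format] Gt tsum_upd[OF r(1)[rule_format]] by simp
        then show "f (a(j := t)) = 0"
          using a(2) by (simp add: polyfun_upd_outside[OF gp])
      qed
      moreover have "h (a(j := t)) \<noteq> 0"
      proof
        assume h0: "h (a(j := t)) = 0"
        have "(\<lambda>v. tsum j (Suc d) p v - b v * h v) \<in> polyfun (Suc j)"
          by (intro polyfun_intros tsum_polyfun pp b h)
        then have "tsum j (Suc d) p (a(j := t)) - b (a(j := t)) * h (a(j := t)) = 0"
          using mem b(2) unfolding zcl_def by auto
        then have "p 0 a = 0" by (simp add: h0 p0 polyfun_upd_outside[OF pp])
        then show False using a(2) by simp
      qed
      ultimately show "\<exists>t. a(j := t) \<in> zcl V (Suc j) \<and> h (a(j := t)) \<noteq> 0" by blast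
    qed
  qed
qed

text \<open>A form of Chevalley's theorem.\<close>

theorem point_lift:
  assumes "prime_on V (polyfun m)" "r \<le> m" and "h \<in> polyfun m" "\<exists>x\<in>V. h x \<noteq> 0"
  shows "\<exists>u\<in>polyfun r. (\<exists>x\<in>V. u x \<noteq> 0) \<and> (\<forall>a\<in>zcl V r. u a \<noteq> 0 \<longrightarrow>
    (\<exists>b\<in>zcl V m. (\<forall>i<r. b i = a i) \<and> h b \<noteq> 0))"
  using \<open>r \<le> m\<close> assms(1,3,4)
proof (induction m arbitrary: h rule: dec_induct)
  case base
  then show ?case by (intro bexI[of _ h]) auto
next
  case (step j)
  from bexE[OF point_lift_step[OF step.prems]] obtain u where u0: "u \<in> polyfun j"
    "(\<exists>x\<in>V. u x \<noteq> 0) \<and> (\<forall>a\<in>zcl V j. u a \<noteq> 0 \<longrightarrow>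
      (\<exists>t. a(j := t) \<in> zcl V (Suc j) \<and> h (a(j := t)) \<noteq> 0))" .
  note u = u0(1) conjunct1[OF u0(2)] conjunct2[OF u0(2)]
  have "prime_on V (polyfun j)" by (rule prime_on_polyfun_le[OF step.prems(1)]) simp
  from bexE[OF step.IH[OF this u(1,2)]] obtain w where w0: "w \<in> polyfun r"
    "(\<exists>x\<in>V. w x \<noteq> 0) \<and> (\<forall>a\<in>zcl V r. w a \<noteq> 0 \<longrightarrow> (\<exists>b\<in>zcl V j. (\<forall>i<r. b i = a i) \<and> u b \<noteq> 0))" .
  note w = w0(1) conjunct1[OF w0(2)] conjunct2[OF w0(2)]
  have "\<exists>b\<in>zcl V (Suc j). (\<forall>i<r. b i = a i) \<and> h b \<noteq> 0" if a: "a \<in> zcl V r" "w a \<noteq> 0" for a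
  proof -
    from w(3) a obtain b where b: "b \<in> zcl V j" "\<forall>i<r. b i = a i" "u b \<noteq> 0" by blast
    from u(3) b obtain t where "b(j := t) \<in> zcl V (Suc j)" "h (b(j := t)) \<noteq> 0" by blast
    then show ?thesis using b(2) step.hyps by (intro bexI[of _ "b(j := t)"]) auto
  qed
  then show ?case using w by blast
qed

text \<open>The graph with the values placed first: statements about the first \<open>r\<close>
  coordinates become statements about the functions \<open>F\<close>.\<close>

definition graph_pt :: "nat \<Rightarrow> (nat \<Rightarrow> (nat \<Rightarrow> complex) \<Rightarrow> complex) \<Rightarrow> (nat \<Rightarrow> complex) \<Rightarrow> nat \<Rightarrow> complex" where
  "graph_pt r F z = (\<lambda>i. if i < r then F i z else z (i - r))"

lemma polyfun_graph_pt:
  assumes "f \<in> polyfun (r + k)" "\<And>i. i < r \<Longrightarrow> F i \<in> polyfun k"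
  shows "(\<lambda>z. f (graph_pt r F z)) \<in> polyfun k"
proof (rule polyfun_compose[OF assms(1)])
  fix i assume "i < r + k"
  then show "(\<lambda>z. graph_pt r F z i) \<in> polyfun k"
    unfolding graph_pt_def by (cases "i < r") (simp_all add: assms(2) polyfun.coord)
qed

lemma prime_on_graph:
  assumes D: "prime_on D (polyfun k)" and F: "\<And>i. i < r \<Longrightarrow> F i \<in> polyfun k"
  shows "prime_on (graph_pt r F ` D) (polyfun (r + k))"
proof (rule prime_onI)
  fix f g x y
  assume f: "f \<in> polyfun (r + k)" and g: "g \<in> polyfun (r + k)"
    and "x \<in> graph_pt r F ` D" "f x \<noteq> 0" "y \<in> graph_pt r F ` D" "g y \<noteq> 0"
  then obtain u v where "u \<in> D" "f (graph_pt r F u) \<noteq> 0" "v \<in> D" "g (graph_pt r F v) \<noteq> 0" by auto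
  with prime_onD[where f = "\<lambda>z. f (graph_pt r F z)" and g = "\<lambda>z. g (graph_pt r F z)" and x = u and y = v,
      OF D polyfun_graph_pt[OF f F] polyfun_graph_pt[OF g F]]
  show "\<exists>z\<in>graph_pt r F ` D. f z \<noteq> 0 \<and> g z \<noteq> 0" by auto
qed (use D in \<open>simp add: prime_on_def\<close>)

text \<open>Algebraic independence of the first \<open>r\<close> functions on \<open>D\<close>, that
  is dominance of the map they define.\<close>

definition indep_funs :: "(nat \<Rightarrow> complex) set \<Rightarrow> nat \<Rightarrow> (nat \<Rightarrow> (nat \<Rightarrow> complex) \<Rightarrow> complex) \<Rightarrow> bool" where
  "indep_funs D r F \<longleftrightarrow> (\<forall>G\<in>polyfun r. (\<forall>z\<in>D. G (\<lambda>i. F i z) = 0) \<longrightarrow> (\<forall>z. G z = 0))"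

lemma indep_coords_graph: "indep_funs D r F \<Longrightarrow> indep_coords (graph_pt r F ` D) r"
  unfolding indep_funs_def indep_coords_def
proof (intro ballI impI)
  fix f
  assume I: "\<forall>G\<in>polyfun r. (\<forall>z\<in>D. G (\<lambda>i. F i z) = 0) \<longrightarrow> (\<forall>z. G z = 0)"
    and f: "f \<in> polyfun r" "\<forall>x\<in>graph_pt r F ` D. f x = 0"
  have "f (\<lambda>i. F i z) = f (graph_pt r F z)" for z
    by (rule polyfun_cong[OF f(1)]) (simp add: graph_pt_def)
  then have "\<forall>z\<in>D. f (\<lambda>i. F i z) = 0" using f(2) by simp
  then show "\<forall>x. f x = 0" using I f(1) by blast
qed

lemma polyfun_shift:
  "f \<in> polyfun k \<Longrightarrow> (\<lambda>v. f (\<lambda>i. v (i + r))) \<in> polyfun (r + k)"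
  by (rule polyfun_compose) (auto intro: polyfun.coord)

lemma dd_shift:
  assumes "f \<in> polyfun k"
  shows "dd (r + k) (\<lambda>v. f (\<lambda>i. v (i + r))) v u = dd k f (\<lambda>i. v (i + r)) (\<lambda>i. u (i + r))"
proof -
  have "dd (r + k) (\<lambda>v. f (\<lambda>i. v (i + r))) v u =
      dd k f (\<lambda>i. v (i + r)) (\<lambda>i. dd (r + k) (\<lambda>v. v (i + r)) v u)"
    by (rule dd_compose[OF assms, where g = "\<lambda>v i. v (i + r)"]) (auto intro: polyfun.coord)
  also have "\<dots> = dd k f (\<lambda>i. v (i + r)) (\<lambda>i. u (i + r))"
    by (rule dd_cong[OF assms]) (auto simp: dd_coord)
  finally show ?thesis .
qed

lemma graph_pt_shift [simp]: "(\<lambda>i. graph_pt r F z (i + r)) = z"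
  by (simp add: graph_pt_def)

text \<open>A dominant map has a generically surjective differential. On the graph the equations
  "coordinate \<open>i\<close> equals \<open>F i\<close>" force the first components of a tangent
  vector to be the derivatives of \<open>F\<close> along the rest.\<close>

theorem tangent_lift_fun:
  assumes D: "prime_on D (polyfun k)" and F: "\<And>i. i < r \<Longrightarrow> F i \<in> polyfun k" and ind: "indep_funs D r F"
  shows "\<exists>h\<in>polyfun k. (\<exists>x\<in>D. h x \<noteq> 0) \<and> (\<forall>z\<in>D. h z \<noteq> 0 \<longrightarrow>
    (\<forall>\<tau>. \<exists>w\<in>tv D k z. \<forall>i<r. dd k (F i) z w = \<tau> i))"
proof -
  let ?V = "graph_pt r F ` D"
  from bexE[OF tangent_lift[OF prime_on_graph[OF D F] _ indep_coords_graph[OF ind], simplified]] obtain h where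
    h: "h \<in> polyfun (r + k)" and h2: "(\<exists>x\<in>D. h (graph_pt r F x) \<noteq> 0) \<and> (\<forall>v\<in>D. h (graph_pt r F v) \<noteq> 0 \<longrightarrow>
      (\<forall>\<tau>. \<exists>\<tau>'\<in>tv ?V (r + k) (graph_pt r F v). \<forall>i<r. \<tau>' i = \<tau> i))" .
  have "\<exists>w\<in>tv D k z. \<forall>i<r. dd k (F i) z w = \<tau> i" if z: "z \<in> D" "h (graph_pt r F z) \<noteq> 0" for z \<tau>
  proof -
    from h2 z obtain \<tau>' where t: "\<tau>' \<in> tv ?V (r + k) (graph_pt r F z)" "\<forall>i<r. \<tau>' i = \<tau> i" by blast
    let ?w = "\<lambda>i. \<tau>' (i + r)"
    have tz: "dd (r + k) f (graph_pt r F z) \<tau>' = 0" if "f \<in> polyfun (r + k)" "\<forall>x\<in>D. f (graph_pt r F x) = 0" for f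
      using t(1) that unfolding tv_def by auto
    have "dd k f z ?w = 0" if f: "f \<in> polyfun k" "\<forall>x\<in>D. f x = 0" for f
      using tz[OF polyfun_shift[OF f(1)]] f(2) by (simp add: dd_shift[OF f(1)])
    then have "?w \<in> tv D k z" by (simp add: tv_def)
    moreover have "dd k (F i) z ?w = \<tau> i" if i: "i < r" for i
    proof -
      have c: "(\<lambda>v. v i) \<in> polyfun (r + k)" using i by (intro polyfun.coord) simp
      note s = polyfun_shift[OF F[OF i], of r]
      have "dd (r + k) (\<lambda>v. v i - F i (\<lambda>j. v (j + r))) (graph_pt r F z) \<tau>' = 0"
        by (rule tz[OF polyfun_diff[OF c s]]) (simp add: i graph_pt_def)
      then show ?thesis
        using i t(2) by (simp add: dd_diff[OF c s] dd_shift[OF F[OF i]] dd_coord)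
    qed
    ultimately show ?thesis by blast
  qed
  then show ?thesis
    using h2 by (intro bexI[of _ "\<lambda>z. h (graph_pt r F z)"] conjI polyfun_graph_pt[OF h F]) auto
qed

text \<open>The image of a dominant map contains a nonempty open set, even after imposing
  \<open>h\<close> nonzero. The preimages lie in the closure of \<open>D\<close>; the caller must
  bring them back into \<open>D\<close>.\<close>

theorem point_lift_fun:
  assumes D: "prime_on D (polyfun k)" and F: "\<And>i. i < r \<Longrightarrow> F i \<in> polyfun k" and ind: "indep_funs D r F"
    and h: "h \<in> polyfun k" "\<exists>x\<in>D. h x \<noteq> 0"
  shows "\<exists>u\<in>polyfun r. (\<exists>x. u x \<noteq> 0) \<and> (\<forall>a. u a \<noteq> 0 \<longrightarrow>
    (\<exists>z\<in>zcl D k. (\<forall>i<r. F i z = a i) \<and> h z \<noteq> 0))"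
proof -
  let ?V = "graph_pt r F ` D"
  have "\<exists>x\<in>?V. h (\<lambda>i. x (i + r)) \<noteq> 0" using h(2) by simp
  from bexE[OF point_lift[OF prime_on_graph[OF D F] _ polyfun_shift[OF h(1)] this, where r = r, simplified]] obtain u where
    u: "u \<in> polyfun r" and u2: "(\<exists>x\<in>D. u (graph_pt r F x) \<noteq> 0) \<and> (\<forall>a\<in>zcl ?V r. u a \<noteq> 0 \<longrightarrow>
      (\<exists>b\<in>zcl ?V (r + k). (\<forall>i<r. b i = a i) \<and> h (\<lambda>i. b (i + r)) \<noteq> 0))" .
  have "\<exists>z\<in>zcl D k. (\<forall>i<r. F i z = a i) \<and> h z \<noteq> 0" if a: "u a \<noteq> 0" for a
  proof -
    have "a \<in> zcl ?V r"
      using indep_coords_graph[OF ind] unfolding zcl_def indep_coords_def by blast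
    with u2 a obtain b where b: "b \<in> zcl ?V (r + k)" "\<forall>i<r. b i = a i" "h (\<lambda>i. b (i + r)) \<noteq> 0" by blast
    have bz: "f b = 0" if "f \<in> polyfun (r + k)" "\<forall>x\<in>D. f (graph_pt r F x) = 0" for f
      using b(1) that unfolding zcl_def by auto
    let ?z = "\<lambda>i. b (i + r)"
    have "f ?z = 0" if f: "f \<in> polyfun k" "\<forall>x\<in>D. f x = 0" for f
      using bz[OF polyfun_shift[OF f(1)]] f(2) by simp
    then have "?z \<in> zcl D k" by (simp add: zcl_def)
    moreover have "F i ?z = a i" if i: "i < r" for i
    proof -
      have c: "(\<lambda>v. v i) \<in> polyfun (r + k)" using i by (intro polyfun.coord) simp
      have "b i - F i ?z = 0"
        by (rule bz[OF polyfun_diff[OF c polyfun_shift[OF F[OF i]]]]) (simp add: i graph_pt_def)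
      then show ?thesis using b(2) i by simp
    qed
    ultimately show ?thesis using b(3) by (intro bexI[of _ ?z]) simp_all
  qed
  then show ?thesis using u u2 by blast
qed

section \<open>Krull dimension and algebraic independence\<close>

lemma indep_funs_mono: "indep_funs C k f \<Longrightarrow> C \<subseteq> D \<Longrightarrow> indep_funs D k f"
  unfolding indep_funs_def
proof (intro ballI impI)
  fix G assume "\<forall>G\<in>polyfun k. (\<forall>z\<in>C. G (\<lambda>i. f i z) = 0) \<longrightarrow> (\<forall>z. G z = 0)" "C \<subseteq> D"
    and "G \<in> polyfun k" "\<forall>z\<in>D. G (\<lambda>i. f i z) = 0"
  then show "\<forall>z. G z = 0" by (simp add: subset_iff)
qed

text \<open>Given a relation that is a polynomial in \<open>F\<close>, restriction to
  \<open>C\<close> kills its constant coefficient; then \<open>F\<close> can be cancelled by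
  primality on \<open>D\<close>, and the remaining relation is shorter.\<close>

lemma indep_funs_insert:
  assumes D: "prime_on D (polyfun m)" and CD: "C \<subseteq> D" and f: "\<And>i. i < k \<Longrightarrow> f i \<in> polyfun m"
    and ind: "indep_funs C k f"
    and F: "F \<in> polyfun m" "\<forall>x\<in>C. F x = 0" "\<exists>x\<in>D. F x \<noteq> 0"
  shows "indep_funs D (Suc k) (f(k := F))"
proof -
  have c0: "\<forall>i<d. \<forall>z. c i z = 0" if "\<forall>i. c i \<in> polyfun k" "\<forall>x\<in>D. (\<Sum>i<d. c i (\<lambda>i. f i x) * F x ^ i) = 0"
    for d and c :: "nat \<Rightarrow> (nat \<Rightarrow> complex) \<Rightarrow> complex"
    using that
  proof (induction d arbitrary: c)
    case (Suc d)
    have cp: "(\<lambda>x. c i (\<lambda>i. f i x)) \<in> polyfun m" for i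
      by (rule polyfun_compose[OF Suc.prems(1)[rule_format]]) (rule f)
    have "\<forall>x\<in>C. c 0 (\<lambda>i. f i x) = 0"
    proof
      fix x assume "x \<in> C"
      then have "(\<Sum>i<Suc d. c i (\<lambda>i. f i x) * F x ^ i) = 0" "F x = 0"
        using Suc.prems(2) CD F(2) by blast+
      then show "c 0 (\<lambda>i. f i x) = 0"
        by (simp add: sum.lessThan_Suc_shift del: sum.lessThan_Suc)
    qed
    then have z: "\<forall>z. c 0 z = 0" using ind Suc.prems(1) unfolding indep_funs_def by blast
    let ?g = "\<lambda>x. \<Sum>i<d. c (Suc i) (\<lambda>i. f i x) * F x ^ i"
    have Fg: "F x * ?g x = 0" if "x \<in> D" for x
      using Suc.prems(2)[rule_format, OF that] z
      by (simp add: sum.lessThan_Suc_shift sum_distrib_left mult.left_commute del: sum.lessThan_Suc)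
    have gp: "?g \<in> polyfun m" by (intro polyfun_intros cp F(1))
    obtain x0 where x0: "x0 \<in> D" "F x0 \<noteq> 0" using F(3) by blast
    have "\<forall>x\<in>D. ?g x = 0"
    proof
      fix y assume y: "y \<in> D"
      show "?g y = 0"
        by (rule prime_on_cancel[where f = ?g and h = F and x = x0, OF D F(1) gp x0 _ y]) (use Fg in auto)
    qed
    with Suc.prems(1) have s: "\<forall>i<d. \<forall>z. c (Suc i) z = 0" by (intro Suc.IH) simp_all
    show ?case
    proof (intro allI impI)
      fix i z assume "i < Suc d"
      with z s show "c i z = 0" by (cases i) simp_all
    qed
  qed simp
  show ?thesis
    unfolding indep_funs_def
  proof (intro ballI impI allI)
    fix G z assume G: "G \<in> polyfun (Suc k)" "\<forall>z\<in>D. G (\<lambda>i. (f(k := F)) i z) = 0"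
    obtain d c where c: "\<forall>i. c i \<in> polyfun k" "G = tsum k d c" using polyfun_tsum[OF G(1)] by blast
    have "c i (\<lambda>i. (f(k := F)) i x) = c i (\<lambda>i. f i x)" for i x
      by (rule polyfun_cong[OF c(1)[rule_format]]) simp
    then have "\<forall>x\<in>D. (\<Sum>i<d. c i (\<lambda>i. f i x) * F x ^ i) = 0"
      using G(2) by (simp add: c(2) tsum_def)
    from c0[OF c(1) this] show "G z = 0" by (simp add: c(2) tsum_def)
  qed
qed

lemma zariski_closed_separate:
  assumes Z: "zariski_closed N Z" and X: "zariski_closed N X" and "Z \<subset> X"
  shows "\<exists>F\<in>polyfun (Suc N). (\<forall>x\<in>\<Union>Z. F x = 0) \<and> (\<exists>x\<in>\<Union>X. F x \<noteq> 0)"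
proof (rule ccontr)
  assume H: "\<not> ?thesis"
  have "X \<subseteq> Z"
  proof
    fix x assume x: "x \<in> X"
    then have xp: "x \<in> pspace N" using zariski_closed_subset[OF X] by blast
    then obtain v where v: "v \<in> x" using pspace_nonempty by blast
    note rep = pspace_rep[OF xp v]
    have "v \<in> \<Union>Z"
      by (rule zariski_closed_mem[OF Z]) (use rep H v x in auto)
    then obtain y where y: "y \<in> Z" "v \<in> y" by blast
    then have "y \<in> pspace N" using zariski_closed_subset[OF Z] by blast
    from pspace_rep[OF this y(2)] rep y(1) show "x \<in> Z" by simp
  qed
  with \<open>Z \<subset> X\<close> show False by blast
qed

lemma irreducible_nonempty:
  assumes "zariski_closed N Z" "irreducible_space (subtopology (zariski N) Z)"
  shows "\<exists>v. v \<in> \<Union>Z"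
  using irreducible_prime_on[OF assms] by (auto simp: prime_on_def)

text \<open>The cone over a point is a line and already carries one independent function: the origin
  of the shift from n to n + 1. A coordinate nonzero at \<open>v\<close> takes infinitely many
  values on the multiples of \<open>v\<close>.\<close>

lemma indep_funs_one:
  assumes Z: "zariski_closed N Z" and ne: "v \<in> \<Union>Z"
  shows "\<exists>f. (\<forall>i<1. f i \<in> polyfun (Suc N)) \<and> indep_funs (\<Union>Z) 1 f"
proof -
  note ZP = zariski_closed_subset[OF Z]
  have v: "v \<in> cvec N" "v \<noteq> 0" using ne Union_pspace[OF ZP] by blast+
  then obtain l where l: "v l \<noteq> 0" by (auto simp: fun_eq_iff)
  then have lN: "l \<le> N" using v(1) by (auto simp: cvec_def not_le[symmetric])
  have "indep_funs (\<Union>Z) 1 (\<lambda>_ x. x l)"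
    unfolding indep_funs_def
  proof (intro ballI impI allI)
    fix G z assume G: "G \<in> polyfun 1" "\<forall>z\<in>\<Union>Z. G (\<lambda>i. z l) = 0"
    obtain d c where c: "\<forall>i. c i \<in> polyfun 0" "G = tsum 0 d c"
      using polyfun_tsum[of G 0] G(1) by auto
    have cc: "c i x = c i y" for i x y by (rule polyfun_cong[OF c(1)[rule_format]]) simp
    have "(\<Sum>i<d. (c i z * v l ^ i) * a ^ i) * (\<Sum>i<1. 1 * a ^ i) = 0" if "a \<noteq> 0" for a
    proof -
      have "G (\<lambda>i. (cscale a v) l) = 0"
        using G(2) Union_pspace_scale[OF ZP ne that] by blast
      then have "(\<Sum>i<d. c i (\<lambda>i. a * v l) * (a * v l) ^ i) = 0"
        by (simp add: c(2) tsum_def cscale_def)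
      then show ?thesis
        using cc[of _ "\<lambda>i. a * v l" z] by (simp add: power_mult_distrib ac_simps)
    qed
    from coeffs_zero_of_nonzero_args[OF this] have "\<forall>i<d. c i z = 0" using l by auto
    then show "G z = 0" by (simp add: c(2) tsum_def)
  qed
  moreover have "(\<lambda>x. x l) \<in> polyfun (Suc N)" using lN by (intro polyfun.coord) simp
  ultimately show ?thesis by (intro exI[of _ "\<lambda>_ x. x l"]) simp
qed

lemma indep_funs_chain:
  assumes "\<forall>i\<le>k. zariski_closed N (Z i) \<and> irreducible_space (subtopology (zariski N) (Z i))"
    and "\<forall>i<k. Z i \<subset> Z (Suc i)"
  shows "\<exists>f. (\<forall>i<Suc k. f i \<in> polyfun (Suc N)) \<and> indep_funs (\<Union>(Z k)) (Suc k) f"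
  using assms
proof (induction k)
  case 0
  then have Z: "zariski_closed N (Z 0)" "irreducible_space (subtopology (zariski N) (Z 0))" by auto
  from irreducible_nonempty[OF Z] obtain v where "v \<in> \<Union>(Z 0)" ..
  from indep_funs_one[OF Z(1) this] show ?case by simp
next
  case (Suc k)
  obtain f where f: "\<forall>i<Suc k. f i \<in> polyfun (Suc N)" "indep_funs (\<Union>(Z k)) (Suc k) f"
    using Suc.IH Suc.prems by auto
  have Z: "zariski_closed N (Z k)" "zariski_closed N (Z (Suc k))"
    "irreducible_space (subtopology (zariski N) (Z (Suc k)))" "Z k \<subset> Z (Suc k)"
    using Suc.prems by auto
  from zariski_closed_separate[OF Z(1,2,4)] obtain F where
    F: "F \<in> polyfun (Suc N)" "\<forall>x\<in>\<Union>(Z k). F x = 0" "\<exists>x\<in>\<Union>(Z (Suc k)). F x \<noteq> 0" by blast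
  have "indep_funs (\<Union>(Z (Suc k))) (Suc (Suc k)) (f(Suc k := F))"
    by (rule indep_funs_insert[OF irreducible_prime_on[OF Z(2,3)] _ _ f(2) F]) (use f(1) Z(4) in auto)
  moreover have "\<forall>i<Suc (Suc k). (f(Suc k := F)) i \<in> polyfun (Suc N)"
    using f(1) F(1) by (simp add: less_Suc_eq)
  ultimately show ?case by blast
qed

text \<open>Each strict inclusion in a chain of irreducible closed sets contributes a new
  independent function, namely one vanishing on the smaller set only.\<close>

theorem indep_funs_var_dim:
  assumes X: "subvariety N X" and dim: "var_dim N X = enat n" and n: "n \<ge> 1"
  shows "\<exists>f. (\<forall>i<Suc n. f i \<in> polyfun (Suc N)) \<and> indep_funs (\<Union>X) (Suc n) f"
proof -
  let ?T = "subtopology (zariski N) X"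
  define K where "K = {k. \<exists>Z :: nat \<Rightarrow> point set.
     (\<forall>i\<le>k. closedin ?T (Z i) \<and> irreducible_space (subtopology ?T (Z i))) \<and> (\<forall>i<k. Z i \<subset> Z (Suc i))}"
  have Xc: "closedin (zariski N) X" using X by (simp add: subvariety_def)
  have "Sup {enat k | k. k \<in> K} = enat n"
    using dim unfolding var_dim_def krull_dim_def K_def by simp
  \<comment> \<open>Otherwise \<open>n - 1\<close> would bound all chain lengths;
    \<open>n \<ge> 1\<close> makes this a genuine decrease.\<close>
  have "\<exists>k\<in>K. n \<le> k"
  proof (rule ccontr)
    assume "\<not> ?thesis"
    then have "Sup {enat k | k. k \<in> K} \<le> enat (n - 1)"
      by (intro Sup_least) auto
    with \<open>Sup _ = _\<close> n show False by simp
  qed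
  then obtain k Z where k: "n \<le> k" and Z: "\<forall>i\<le>k. closedin ?T (Z i) \<and> irreducible_space (subtopology ?T (Z i))"
    "\<forall>i<k. Z i \<subset> Z (Suc i)" unfolding K_def by blast
  have Zc: "zariski_closed N (Z i) \<and> Z i \<subseteq> X \<and> irreducible_space (subtopology (zariski N) (Z i))" if "i \<le> k" for i
  proof -
    from Z(1) that have c: "closedin ?T (Z i)" and irr: "irreducible_space (subtopology ?T (Z i))" by auto
    from c have "closedin (zariski N) (Z i)" "Z i \<subseteq> X"
      by (simp_all add: closedin_closed_subtopology[OF Xc])
    moreover from this have "subtopology ?T (Z i) = subtopology (zariski N) (Z i)"
      by (simp add: subtopology_subtopology Int_absorb1)
    ultimately show ?thesis using irr by (simp add: closedin_zariski)
  qed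
  obtain f where f: "\<forall>i<Suc n. f i \<in> polyfun (Suc N)" "indep_funs (\<Union>(Z n)) (Suc n) f"
    using indep_funs_chain[of n N Z] Zc Z(2) k by auto
  have "\<Union>(Z n) \<subseteq> \<Union>X" using Zc[OF k] by blast
  from indep_funs_mono[OF f(2) this] f(1) show ?thesis by (intro exI[of _ f] conjI)
qed

section \<open>Linear algebra over polynomial functions\<close>

text \<open>Ring homomorphisms from polynomial functions to an integral domain. Evaluation at a
  point and expansion along the formal arc are both of this kind and share one elimination.\<close>

definition hom_on :: "nat \<Rightarrow> (((nat \<Rightarrow> complex) \<Rightarrow> complex) \<Rightarrow> 'f::idom) \<Rightarrow> bool" where
  "hom_on k E \<longleftrightarrow> E (\<lambda>_. 1) = 1 \<and> (\<forall>f\<in>polyfun k. \<forall>g\<in>polyfun k.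
     E (\<lambda>x. f x + g x) = E f + E g \<and> E (\<lambda>x. f x * g x) = E f * E g)"

lemma hom_on_one: "hom_on k E \<Longrightarrow> E (\<lambda>_. 1) = 1"
  by (simp add: hom_on_def)

lemma hom_on_add: "hom_on k E \<Longrightarrow> f \<in> polyfun k \<Longrightarrow> g \<in> polyfun k \<Longrightarrow> E (\<lambda>x. f x + g x) = E f + E g"
  by (simp add: hom_on_def)

lemma hom_on_mult: "hom_on k E \<Longrightarrow> f \<in> polyfun k \<Longrightarrow> g \<in> polyfun k \<Longrightarrow> E (\<lambda>x. f x * g x) = E f * E g"
  by (simp add: hom_on_def)

lemma hom_on_zero:
  assumes "hom_on k E"
  shows "E (\<lambda>_. 0) = 0"
proof -
  have "E (\<lambda>_. 0) = E (\<lambda>_. 0) + E (\<lambda>_. 0)"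
    using hom_on_add[OF assms polyfun.const[of 0] polyfun.const[of 0]] by (simp only: add_0_left)
  then show ?thesis by (simp only: add_cancel_right_right)
qed

lemma hom_on_minus:
  assumes "hom_on k E" "f \<in> polyfun k"
  shows "E (\<lambda>x. - f x) = - E f"
  using hom_on_add[OF assms(1) assms(2) polyfun_minus[OF assms(2)]] hom_on_zero[OF assms(1)]
  by (simp add: eq_neg_iff_add_eq_0 add.commute)

lemma hom_on_diff:
  assumes "hom_on k E" "f \<in> polyfun k" "g \<in> polyfun k"
  shows "E (\<lambda>x. f x - g x) = E f - E g"
  using hom_on_add[OF assms(1,2) polyfun_minus[OF assms(3)]] hom_on_minus[OF assms(1,3)] by simp

lemma hom_on_sum:
  assumes "hom_on k E" "\<And>i. i \<in> I \<Longrightarrow> f i \<in> polyfun k"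
  shows "E (\<lambda>x. \<Sum>i\<in>I. f i x) = (\<Sum>i\<in>I. E (f i))"
  using assms(2)
proof (induction I rule: infinite_finite_induct)
  case (insert i I)
  then show ?case
    using hom_on_add[OF assms(1), of "f i" "\<lambda>x. \<Sum>i\<in>I. f i x"] polyfun_sum[of I f k] by simp
qed (simp_all add: hom_on_zero[OF assms(1)])

lemma hom_on_eval: "hom_on k (\<lambda>f. f p)"
  by (simp add: hom_on_def)

text \<open>Gaussian elimination with pivots that are nonzero under \<open>E\<close>: the solution space at any point
  is parametrised by at most as many coordinates as the solution space under \<open>E\<close>.\<close>

theorem elimination:
  fixes S :: "nat set"
  assumes E: "hom_on k E" and "finite S" and "\<forall>e\<in>EE. \<forall>i. e i \<in> polyfun k"
  shows "\<exists>J h a. J \<subseteq> S \<and> h \<in> polyfun k \<and> (\<forall>i j. a i j \<in> polyfun k) \<and> E h \<noteq> 0 \<and>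
    (\<forall>i\<in>J. \<forall>j\<in>J. a i j = (if i = j then h else (\<lambda>_. 0))) \<and>
    (\<forall>v w. (\<forall>e\<in>EE. (\<Sum>i\<in>S. e i v * w i) = 0) \<longrightarrow> (\<forall>i\<in>S. h v * w i = (\<Sum>j\<in>J. a i j v * w j))) \<and>
    (\<forall>e\<in>EE. \<forall>j\<in>J. (\<Sum>i\<in>S. E (e i) * E (a i j)) = 0)"
  using assms(2,3)
proof (induction "card S" arbitrary: S EE)
  case 0
  then have S: "S = {}" by simp
  show ?case
    unfolding S by (rule exI[of _ "{}"], rule exI[of _ "\<lambda>_. 1"], rule exI[of _ "\<lambda>_ _ _. 0"])
      (simp add: polyfun.const hom_on_one[OF E])
next
  case (Suc d)
  show ?case
  proof (cases "\<forall>e\<in>EE. \<forall>i\<in>S. E (e i) = 0")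
    \<comment> \<open>Rows that vanish under \<open>E\<close> may be nonzero at points. Dropping
      them can only enlarge the parametrised space, so the claim about points is an implication,
      whereas under \<open>E\<close> the columns are genuine solutions.\<close>
    case True
    let ?a = "\<lambda>(i :: nat) (j :: nat). if i = j then (\<lambda>_ :: nat \<Rightarrow> complex. 1 :: complex) else (\<lambda>_. 0)"
    have "w i = (\<Sum>j\<in>S. ?a i j v * w j)" if "i \<in> S" for v and i :: nat and w :: "nat \<Rightarrow> complex"
    proof -
      have "(\<Sum>j\<in>S. ?a i j v * w j) = (\<Sum>j\<in>S. if j = i then w j else 0)"
        by (rule sum.cong) auto
      then show ?thesis using that Suc.prems(1) by simp
    qed
    with True show ?thesis
      by - (rule exI[of _ S], rule exI[of _ "\<lambda>_. 1"], rule exI[of _ ?a],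
        simp add: polyfun.const hom_on_one[OF E])
  next
    case False
    then obtain e c where e: "e \<in> EE" "c \<in> S" "E (e c) \<noteq> 0" by blast
    let ?S = "S - {c}"
    \<comment> \<open>Fraction-free row operation: column \<open>c\<close> of \<open>f\<close> is
      cleared with the pivot row \<open>e\<close> without dividing.\<close>
    define row where "row f = (\<lambda>i v. e c v * f i v - f c v * e i v)" for f :: "nat \<Rightarrow> (nat \<Rightarrow> complex) \<Rightarrow> complex"
    have ep: "e i \<in> polyfun k" for i using e(1) Suc.prems(2) by blast
    have fp: "f i \<in> polyfun k" if "f \<in> EE" for f i using that Suc.prems(2) by blast
    have rowp: "row f i \<in> polyfun k" if "f \<in> EE" for f i
      unfolding row_def by (intro polyfun_intros ep fp that)
    have S: "S = insert c ?S" "c \<notin> ?S" "finite ?S" using e(2) Suc.prems(1) by auto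
    have "d = card ?S" using Suc.hyps(2) e(2) by simp
    from Suc.hyps(1)[OF this S(3), of "row ` EE"] rowp obtain J h a where
      J: "J \<subseteq> ?S" and h: "h \<in> polyfun k" "E h \<noteq> 0" and a: "\<forall>i j. a i j \<in> polyfun k"
      and diag: "\<forall>i\<in>J. \<forall>j\<in>J. a i j = (if i = j then h else (\<lambda>_. 0))"
      and sol: "\<forall>v w. (\<forall>e\<in>row ` EE. (\<Sum>i\<in>?S. e i v * w i) = 0) \<longrightarrow> (\<forall>i\<in>?S. h v * w i = (\<Sum>j\<in>J. a i j v * w j))"
      and solE: "\<forall>e\<in>row ` EE. \<forall>j\<in>J. (\<Sum>i\<in>?S. E (e i) * E (a i j)) = 0"
      by auto
    let ?h = "\<lambda>v. e c v * h v"
    let ?p = "\<lambda>j v. - (\<Sum>i\<in>?S. e i v * a i j v)"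
    define a' where "a' = (\<lambda>i j. if i = c then ?p j else (\<lambda>v. e c v * a i j v))"
    have a'p: "a' i j \<in> polyfun k" for i j
      unfolding a'_def by (cases "i = c") (simp_all, (intro polyfun_intros ep a[rule_format])+)
    have Eh: "E ?h \<noteq> 0" using e(3) h by (simp add: hom_on_mult[OF E ep])
    have dia: "\<forall>i\<in>J. \<forall>j\<in>J. a' i j = (if i = j then ?h else (\<lambda>_. 0))"
      using J diag by (auto simp: a'_def)
    have sol': "\<forall>i\<in>S. ?h v * w i = (\<Sum>j\<in>J. a' i j v * w j)" if "\<forall>e\<in>EE. (\<Sum>i\<in>S. e i v * w i) = 0"
      for v and w :: "nat \<Rightarrow> complex"
    proof -
      have split: "(\<Sum>i\<in>?S. f i v * w i) = - (f c v * w c)" if "f \<in> EE" for f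
      proof -
        have "(\<Sum>i\<in>S. f i v * w i) = f c v * w c + (\<Sum>i\<in>?S. f i v * w i)"
          by (subst S(1), subst sum.insert[OF S(3,2)]) simp
        moreover have "(\<Sum>i\<in>S. f i v * w i) = 0"
          using \<open>\<forall>e\<in>EE. (\<Sum>i\<in>S. e i v * w i) = 0\<close> that by blast
        ultimately show ?thesis by (simp add: add_eq_0_iff)
      qed
      have "(\<Sum>i\<in>?S. row f i v * w i) = 0" if f: "f \<in> EE" for f
      proof -
        have "(\<Sum>i\<in>?S. row f i v * w i) = e c v * (\<Sum>i\<in>?S. f i v * w i) - f c v * (\<Sum>i\<in>?S. e i v * w i)"
          by (simp add: row_def left_diff_distrib sum_subtractf sum_distrib_left mult.assoc)
        then show ?thesis using split[OF f] split[OF e(1)] by simp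
      qed
      then have hw: "\<forall>i\<in>?S. h v * w i = (\<Sum>j\<in>J. a i j v * w j)" using sol by auto
      have "?h v * w i = (\<Sum>j\<in>J. a' i j v * w j)" if i: "i \<in> S" for i
      proof (cases "i = c")
        case False
        then have "h v * w i = (\<Sum>j\<in>J. a i j v * w j)" using hw i by blast
        then have "e c v * (h v * w i) = e c v * (\<Sum>j\<in>J. a i j v * w j)" by simp
        then show ?thesis using False by (simp add: a'_def sum_distrib_left mult.assoc)
      next
        case True
        have ec: "e c v * w c = - (\<Sum>i\<in>?S. e i v * w i)" using split[OF e(1)] by simp
        have "?h v * w c = h v * (e c v * w c)" by simp
        also have "\<dots> = - (\<Sum>i\<in>?S. e i v * (h v * w i))"
          unfolding ec by (simp add: sum_distrib_left mult.left_commute)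
        also have "(\<Sum>i\<in>?S. e i v * (h v * w i)) = (\<Sum>i\<in>?S. e i v * (\<Sum>j\<in>J. a i j v * w j))"
          by (rule sum.cong[OF refl]) (simp add: hw)
        also have "\<dots> = (\<Sum>j\<in>J. (\<Sum>i\<in>?S. e i v * a i j v) * w j)"
          unfolding sum_distrib_left sum_distrib_right by (subst sum.swap) (simp add: mult.assoc)
        also have "- \<dots> = (\<Sum>j\<in>J. a' c j v * w j)"
          by (simp add: a'_def sum_negf)
        finally show ?thesis using True by simp
      qed
      then show ?thesis by blast
    qed
    have solE': "(\<Sum>i\<in>S. E (f i) * E (a' i j)) = 0" if f: "f \<in> EE" and j: "j \<in> J" for f j
    proof -
      have ac: "E (a' c j) = - (\<Sum>i\<in>?S. E (e i) * E (a i j))"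
      proof -
        have "E (a' c j) = E (?p j)" by (simp add: a'_def)
        also have "\<dots> = - (\<Sum>i\<in>?S. E (\<lambda>v. e i v * a i j v))"
          using a ep by (subst hom_on_minus[OF E], intro polyfun_intros, simp_all)
            (subst hom_on_sum[OF E], auto intro: polyfun.mult)
        finally show ?thesis using a by (simp add: hom_on_mult[OF E ep])
      qed
      have ai: "E (a' i j) = E (e c) * E (a i j)" if "i \<in> ?S" for i
        using that a by (simp add: a'_def hom_on_mult[OF E ep])
      have ro: "E (row f i) = E (e c) * E (f i) - E (f c) * E (e i)" for i
        unfolding row_def using polyfun.mult[OF ep fp[OF f]] polyfun.mult[OF fp[OF f] ep]
        by (simp add: hom_on_diff[OF E] hom_on_mult[OF E] ep fp[OF f])
      have "(\<Sum>i\<in>S. E (f i) * E (a' i j)) = E (f c) * E (a' c j) + (\<Sum>i\<in>?S. E (f i) * (E (e c) * E (a i j)))"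
        by (subst S(1), subst sum.insert[OF S(3,2)]) (simp add: ai)
      also have "\<dots> = (\<Sum>i\<in>?S. E (row f i) * E (a i j))"
        by (simp add: ac ro left_diff_distrib sum_subtractf sum_distrib_left mult.assoc mult.left_commute)
      also have "\<dots> = 0" using solE f j by auto
      finally show ?thesis .
    qed
    have hp: "?h \<in> polyfun k" by (intro polyfun_intros ep h)
    have JS: "J \<subseteq> S" using J by blast
    show ?thesis
      by (rule exI[of _ J], rule exI[of _ ?h], rule exI[of _ a'])
        (use JS hp a'p Eh dia sol' solE' in simp)
  qed
qed

text \<open>Cross-multiplied elimination replaces division, because the lemma is also applied over
  power series, which form only an integral domain.\<close>

lemma kernel_exists:
  fixes M :: "'b \<Rightarrow> 'a \<Rightarrow> 'f::idom"
  assumes "finite B" "finite A" "card B < card A"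
  shows "\<exists>x. (\<exists>a\<in>A. x a \<noteq> 0) \<and> (\<forall>b\<in>B. (\<Sum>a\<in>A. M b a * x a) = 0)"
  using assms
proof (induction B arbitrary: A M rule: finite_induct)
  case empty
  then obtain a where "a \<in> A" by fastforce
  then show ?case by (intro exI[of _ "\<lambda>_. 1"]) auto
next
  case (insert b B)
  have cB: "card B < card A" using insert.prems insert.hyps by simp
  show ?case
  proof (cases "\<forall>a\<in>A. M b a = 0")
    case True
    from insert.IH[OF insert.prems(1) cB, of M] True show ?thesis by auto
  next
    case False
    then obtain c where c: "c \<in> A" "M b c \<noteq> 0" by blast
    let ?A = "A - {c}"
    have A: "A = insert c ?A" "c \<notin> ?A" "finite ?A" using c(1) insert.prems(1) by auto
    have "card B < card ?A" using insert.prems insert.hyps c(1) by simp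
    from insert.IH[OF A(3) this, of "\<lambda>b' a. M b c * M b' a - M b' c * M b a"] obtain y where
      y: "\<exists>a\<in>?A. y a \<noteq> 0" "\<forall>b'\<in>B. (\<Sum>a\<in>?A. (M b c * M b' a - M b' c * M b a) * y a) = 0" by auto
    define x where "x a = (if a = c then - (\<Sum>a\<in>?A. M b a * y a) else M b c * y a)" for a
    have sum_x: "(\<Sum>a\<in>A. M b' a * x a) =
        M b' c * (- (\<Sum>a\<in>?A. M b a * y a)) + (\<Sum>a\<in>?A. M b' a * (M b c * y a))" for b'
      by (subst A(1), subst sum.insert[OF A(3,2)]) (simp add: x_def)
    have "\<forall>b'\<in>insert b B. (\<Sum>a\<in>A. M b' a * x a) = 0"
    proof
      fix b' assume b': "b' \<in> insert b B"
      have eq: "(\<Sum>a\<in>A. M b' a * x a) = (\<Sum>a\<in>?A. (M b c * M b' a - M b' c * M b a) * y a)"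
        unfolding sum_x by (simp add: left_diff_distrib sum_subtractf sum_distrib_left mult.assoc mult.left_commute)
      show "(\<Sum>a\<in>A. M b' a * x a) = 0"
      proof (cases "b' = b")
        case True
        with eq show ?thesis by simp
      next
        case False
        then show ?thesis unfolding eq using b' y(2) by blast
      qed
    qed
    moreover have "\<exists>a\<in>A. x a \<noteq> 0" using y(1) c by (auto simp: x_def)
    ultimately show ?thesis by blast
  qed
qed

text \<open>Adjoin \<open>- y\<close> as an extra column: a kernel vector exists by counting, and
  injectivity forces its new entry to be nonzero.\<close>

lemma inj_imp_surj:
  fixes M :: "'b \<Rightarrow> 'a \<Rightarrow> 'f::field"
  assumes "finite B" "finite A" "card B = card A"
    and inj: "\<And>x. (\<And>b. b \<in> B \<Longrightarrow> (\<Sum>a\<in>A. M b a * x a) = 0) \<Longrightarrow> \<forall>a\<in>A. x a = 0"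
  shows "\<exists>x. \<forall>b\<in>B. (\<Sum>a\<in>A. M b a * x a) = y b"
proof -
  let ?A = "insert None (Some ` A)"
  let ?M = "\<lambda>b z. case z of None \<Rightarrow> - y b | Some a \<Rightarrow> M b a"
  have "card ?A = Suc (card A)" using assms(2) by (simp add: card_image)
  with kernel_exists[of B ?A ?M] assms(1-3) obtain z where
    z: "\<exists>a\<in>?A. z a \<noteq> 0" "\<forall>b\<in>B. (\<Sum>a\<in>?A. ?M b a * z a) = 0" by auto
  have s: "(\<Sum>a\<in>A. M b a * z (Some a)) = y b * z None" if "b \<in> B" for b
    using z(2) that assms(2) by (simp add: sum.reindex)
  have "z None \<noteq> 0"
  proof
    assume "z None = 0"
    then have "\<forall>a\<in>A. z (Some a) = 0" using s by (intro inj) simp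
    then show False using z(1) \<open>z None = 0\<close> by auto
  qed
  have "(\<Sum>a\<in>A. M b a * (z (Some a) / z None)) = y b" if "b \<in> B" for b
  proof -
    have "(\<Sum>a\<in>A. M b a * (z (Some a) / z None)) = (\<Sum>a\<in>A. M b a * z (Some a)) / z None"
      by (simp add: sum_divide_distrib)
    then show ?thesis using s[OF that] \<open>z None \<noteq> 0\<close> by simp
  qed
  then show ?thesis by (intro exI[of _ "\<lambda>a. z (Some a) / z None"] ballI)
qed

text \<open>Surjectivity gives a right inverse \<open>R\<close>; \<open>R\<close> is injective,
  hence onto by \<open>inj_imp_surj\<close>, so every \<open>x\<close> is some \<open>R y\<close>,
  and a kernel vector has \<open>y = 0\<close>.\<close>

lemma surj_imp_inj:
  fixes M :: "'b \<Rightarrow> 'a \<Rightarrow> 'f::field"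
  assumes fin: "finite B" "finite A" "card B = card A"
    and surj: "\<And>y. \<exists>x. \<forall>b\<in>B. (\<Sum>a\<in>A. M b a * x a) = y b"
    and x: "\<And>b. b \<in> B \<Longrightarrow> (\<Sum>a\<in>A. M b a * x a) = 0" and "a \<in> A"
  shows "x a = 0"
proof -
  have "\<forall>c. \<exists>r. \<forall>b\<in>B. (\<Sum>a\<in>A. M b a * r a) = (if b = c then 1 else 0)"
    by (intro allI surj)
  then obtain R where R: "\<forall>c. \<forall>b\<in>B. (\<Sum>a\<in>A. M b a * R c a) = (if b = c then 1 else 0)"
    by (rule choice[THEN exE])
  have MR: "(\<Sum>a\<in>A. M b a * (\<Sum>c\<in>B. R c a * y c)) = y b" if "b \<in> B" for y b
  proof -
    have "(\<Sum>a\<in>A. M b a * (\<Sum>c\<in>B. R c a * y c)) = (\<Sum>a\<in>A. \<Sum>c\<in>B. M b a * R c a * y c)"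
      by (simp add: sum_distrib_left mult.assoc)
    also have "\<dots> = (\<Sum>c\<in>B. (\<Sum>a\<in>A. M b a * R c a) * y c)"
      by (subst sum.swap) (simp add: sum_distrib_right)
    also have "\<dots> = (\<Sum>c\<in>B. if c = b then y c else 0)"
      using R that by (intro sum.cong) auto
    finally show ?thesis using that fin(1) by simp
  qed
  have "\<exists>y. \<forall>a\<in>A. (\<Sum>c\<in>B. R c a * y c) = x a"
  proof (rule inj_imp_surj[OF fin(2,1) fin(3)[symmetric]])
    fix y assume y: "\<And>a. a \<in> A \<Longrightarrow> (\<Sum>c\<in>B. R c a * y c) = 0"
    show "\<forall>b\<in>B. y b = 0"
    proof
      fix b assume "b \<in> B"
      from MR[OF this, of y] y show "y b = 0" by (simp cong: sum.cong)
    qed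
  qed
  then obtain y where y: "\<forall>a\<in>A. (\<Sum>c\<in>B. R c a * y c) = x a" ..
  have "y b = 0" if "b \<in> B" for b
    using MR[OF that, of y] y x[OF that] by (simp cong: sum.cong)
  then have "(\<Sum>c\<in>B. R c a * y c) = 0" by simp
  then show ?thesis using y \<open>a \<in> A\<close> by simp
qed

text \<open>With one more column than rows, deleting a column \<open>l\<close> where the kernel
  vector \<open>\<kappa>\<close> is nonzero keeps the matrix surjective, so the remaining square
  matrix is injective.\<close>

lemma kernel_line:
  fixes M :: "'b \<Rightarrow> 'a \<Rightarrow> 'f::field"
  assumes fin: "finite B" "finite A" "card A = Suc (card B)"
    and surj: "\<And>y. \<exists>x. \<forall>b\<in>B. (\<Sum>a\<in>A. M b a * x a) = y b"
    and \<kappa>: "\<And>b. b \<in> B \<Longrightarrow> (\<Sum>a\<in>A. M b a * \<kappa> a) = 0" "l \<in> A" "\<kappa> l \<noteq> 0"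
    and x: "\<And>b. b \<in> B \<Longrightarrow> (\<Sum>a\<in>A. M b a * x a) = 0" "x l = 0" and "a \<in> A"
  shows "x a = 0"
proof (cases "a = l")
  case False
  let ?A = "A - {l}"
  have A: "A = insert l ?A" "l \<notin> ?A" "finite ?A" using \<kappa>(2) fin(2) by auto
  have split: "(\<Sum>a\<in>A. M b a * z a) = M b l * z l + (\<Sum>a\<in>?A. M b a * z a)" for b z
    by (subst A(1), subst sum.insert[OF A(3,2)]) simp
  show ?thesis
  proof (rule surj_imp_inj[of B ?A M x a])
    show "card B = card ?A" using fin \<kappa>(2) by simp
    fix y
    from surj[of y] obtain z where z: "\<forall>b\<in>B. (\<Sum>a\<in>A. M b a * z a) = y b" ..
    let ?z = "\<lambda>a. z a - z l / \<kappa> l * \<kappa> a"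
    have "(\<Sum>a\<in>A. M b a * ?z a) = y b" if "b \<in> B" for b
    proof -
      have "(\<Sum>a\<in>A. M b a * ?z a) = (\<Sum>a\<in>A. M b a * z a) - z l / \<kappa> l * (\<Sum>a\<in>A. M b a * \<kappa> a)"
        by (simp add: right_diff_distrib sum_subtractf sum_distrib_left mult.left_commute)
      then show ?thesis using z \<kappa>(1) that by simp
    qed
    moreover have "?z l = 0" using \<kappa>(3) by simp
    ultimately show "\<exists>x. \<forall>b\<in>B. (\<Sum>a\<in>?A. M b a * x a) = y b"
      unfolding split by (intro exI[of _ ?z]) auto
  next
    show "(\<Sum>a\<in>?A. M b a * x a) = 0" if "b \<in> B" for b
      using x(1)[OF that] x(2) unfolding split by simp
  qed (use fin A False \<open>a \<in> A\<close> in auto)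
qed (use x in simp)

section \<open>Tangent charts of a cone\<close>

declare sum.lessThan_Suc [simp del]

text \<open>A pair of points as one sequence, so that a function on a product is again a
  \<open>polyfun\<close>.\<close>

definition join :: "nat \<Rightarrow> (nat \<Rightarrow> complex) \<Rightarrow> (nat \<Rightarrow> complex) \<Rightarrow> nat \<Rightarrow> complex" where
  "join k x y = (\<lambda>i. if i < k then x i else y (i - k))"

lemma join_shift [simp]: "(\<lambda>i. join k x y (i + k)) = y"
  by (simp add: join_def)

lemma join_less [simp]: "i < k \<Longrightarrow> join k x y i = x i"
  by (simp add: join_def)

lemma join_ge [simp]: "join k x y (i + k) = y i" "join k x y (k + i) = y i"
  by (simp_all add: join_def)

lemma polyfun_join_left: "f \<in> polyfun k \<Longrightarrow> f (join k x y) = f x"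
  by (rule polyfun_cong) auto

lemma polyfun_join1:
  assumes "f \<in> polyfun (k + l)"
  shows "(\<lambda>x. f (join k x y)) \<in> polyfun k"
proof (rule polyfun_compose[OF assms])
  fix i assume "i < k + l"
  then show "(\<lambda>x. join k x y i) \<in> polyfun k"
    by (cases "i < k") (auto simp: join_def intro: polyfun.intros)
qed

lemma polyfun_join2:
  assumes "f \<in> polyfun (k + l)"
  shows "(\<lambda>y. f (join k x y)) \<in> polyfun l"
proof (rule polyfun_compose[OF assms])
  fix i assume "i < k + l"
  then show "(\<lambda>y. join k x y i) \<in> polyfun l"
    by (cases "i < k") (auto simp: join_def intro: polyfun.intros)
qed

lemma prime_on_join:
  assumes A: "prime_on A (polyfun k)" and B: "prime_on B (polyfun l)"
  shows "prime_on ((\<lambda>(x, y). join k x y) ` (A \<times> B)) (polyfun (k + l))"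
proof (rule prime_onI)
  note P = prime_on_Times[OF A B]
  show "(\<lambda>(x, y). join k x y) ` (A \<times> B) \<noteq> {}" using A B by (simp add: prime_on_def)
  fix f g u v
  assume f: "f \<in> polyfun (k + l)" and g: "g \<in> polyfun (k + l)"
    and "u \<in> (\<lambda>(x, y). join k x y) ` (A \<times> B)" "f u \<noteq> 0" "v \<in> (\<lambda>(x, y). join k x y) ` (A \<times> B)" "g v \<noteq> 0"
  then obtain p q where p: "p \<in> A \<times> B" "f (join k (fst p) (snd p)) \<noteq> 0"
    and q: "q \<in> A \<times> B" "g (join k (fst q) (snd q)) \<noteq> 0"
    by (auto simp: case_prod_beta)
  let ?f = "\<lambda>f p. f (join k (fst p) (snd p))"
  have "\<exists>z\<in>A \<times> B. ?f f z \<noteq> 0 \<and> ?f g z \<noteq> 0"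
    by (rule prime_onD[where f = "?f f" and g = "?f g" and x = p and y = q, OF P _ _ p q])
      (simp_all add: polyfun_join1[OF f] polyfun_join1[OF g] polyfun_join2[OF f] polyfun_join2[OF g])
  then show "\<exists>z\<in>(\<lambda>(x, y). join k x y) ` (A \<times> B). f z \<noteq> 0 \<and> g z \<noteq> 0"
    by (auto simp: case_prod_beta)
qed

lemma dd_join_left:
  assumes f: "f \<in> polyfun k"
  shows "dd (k + l) f (join k x y) w = dd k f x w"
  by (subst dd_mono[OF f]) (auto intro: dd_cong[OF f])

lemma tvD: "w \<in> tv S m v \<Longrightarrow> f \<in> polyfun m \<Longrightarrow> (\<And>x. x \<in> S \<Longrightarrow> f x = 0) \<Longrightarrow> dd m f v w = 0"
  by (simp add: tv_def)

lemma tvI: "(\<And>f. f \<in> polyfun m \<Longrightarrow> (\<And>x. x \<in> S \<Longrightarrow> f x = 0) \<Longrightarrow> dd m f v w = 0) \<Longrightarrow> w \<in> tv S m v"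
  by (simp add: tv_def)

lemma tv_join_left:
  assumes "w \<in> tv ((\<lambda>(x, y). join k x y) ` (A \<times> B)) (k + l) (join k x y)" "y \<in> B"
  shows "w \<in> tv A k x"
  unfolding tv_def
proof (intro CollectI ballI impI)
  fix f assume f: "f \<in> polyfun k" "\<forall>x\<in>A. f x = 0"
  have "f \<in> polyfun (k + l)" by (rule polyfun_mono[OF f(1)]) simp
  moreover have "\<forall>z\<in>(\<lambda>(x, y). join k x y) ` (A \<times> B). f z = 0"
    using f(2) by (auto simp: polyfun_join_left[OF f(1)])
  ultimately have "dd (k + l) f (join k x y) w = 0" using assms(1) unfolding tv_def by blast
  then show "dd k f x w = 0" by (simp add: dd_join_left[OF f(1)])
qed

text \<open>Split the vector into its two halves; with the other argument frozen, an equation of the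
  product is an equation of one factor.\<close>

lemma tv_join:
  assumes u: "u \<in> tv A k x" "x \<in> A" and w: "w \<in> tv B l y" "y \<in> B"
  shows "join k u w \<in> tv ((\<lambda>(x, y). join k x y) ` (A \<times> B)) (k + l) (join k x y)"
  unfolding tv_def
proof (intro CollectI ballI impI)
  fix f assume f: "f \<in> polyfun (k + l)" and "\<forall>z\<in>(\<lambda>(x, y). join k x y) ` (A \<times> B). f z = 0"
  then have van: "f (join k x y) = 0" if "x \<in> A" "y \<in> B" for x y using that by auto
  have "dd k (\<lambda>x. f (join k x y)) x u = 0"
    by (rule tvD[OF u(1) polyfun_join1[OF f]]) (rule van[OF _ w(2)])
  moreover have "dd k (\<lambda>x. f (join k x y)) x u = dd (k + l) f (join k x y) (join k u (\<lambda>_. 0))"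
  proof -
    have "dd k (\<lambda>x. f (join k x y)) x u =
        dd (k + l) f (join k x y) (\<lambda>i. dd k (\<lambda>x. join k x y i) x u)"
    proof (rule dd_compose[OF f])
      fix i assume "i < k + l"
      then show "(\<lambda>x. join k x y i) \<in> polyfun k"
        by (cases "i < k") (auto simp: join_def intro: polyfun.intros)
    qed
    also have "(\<lambda>i. dd k (\<lambda>x. join k x y i) x u) = join k u (\<lambda>_. 0)"
      by (rule ext) (simp add: join_def dd_coord)
    finally show ?thesis .
  qed
  moreover have "dd l (\<lambda>y. f (join k x y)) y w = 0"
    by (rule tvD[OF w(1) polyfun_join2[OF f]]) (rule van[OF u(2)])
  moreover have "dd l (\<lambda>y. f (join k x y)) y w = dd (k + l) f (join k x y) (join k (\<lambda>_. 0) w)"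
  proof -
    have "dd l (\<lambda>y. f (join k x y)) y w =
        dd (k + l) f (join k x y) (\<lambda>i. dd l (\<lambda>y. join k x y i) y w)"
    proof (rule dd_compose[OF f])
      fix i assume "i < k + l"
      then show "(\<lambda>y. join k x y i) \<in> polyfun l"
        by (cases "i < k") (auto simp: join_def intro: polyfun.intros)
    qed
    also have "\<dots> = dd (k + l) f (join k x y) (join k (\<lambda>_. 0) w)"
      by (rule dd_cong[OF f]) (auto simp: join_def dd_coord)
    finally show ?thesis .
  qed
  moreover have "join k u w = (\<lambda>i. join k u (\<lambda>_. 0) i + join k (\<lambda>_. 0) w i)"
    by (auto simp: join_def)
  ultimately show "dd (k + l) f (join k x y) (join k u w) = 0"
    by (simp add: dd_lin_add)
qed

lemma tv_cong:
  assumes "w \<in> tv S m v" "\<And>i. i < m \<Longrightarrow> w i = w' i"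
  shows "w' \<in> tv S m v"
proof -
  have "dd m f v w' = dd m f v w" for f
    unfolding dd_def using assms(2) by simp
  then show ?thesis using assms(1) by (simp add: tv_def)
qed

lemma tv_lincomb: "(\<And>j. j \<in> I \<Longrightarrow> w j \<in> tv S m v) \<Longrightarrow> (\<lambda>i. \<Sum>j\<in>I. w j i * c j) \<in> tv S m v"
  unfolding tv_def by (simp add: dd_lin_sum dd_lin_scale mult.commute[of "w _ _"])

text \<open>The Lie bracket of the vector fields \<open>q\<close> and \<open>p\<close>.\<close>

lemma dd_bracket:
  assumes p: "\<And>i. i < m \<Longrightarrow> (\<lambda>x. p x i) \<in> polyfun m" and q: "\<And>i. i < m \<Longrightarrow> (\<lambda>x. q x i) \<in> polyfun m"
    and f: "f \<in> polyfun m"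
  shows "dd m (\<lambda>x. dd m f x (p x)) x (q x) - dd m (\<lambda>x. dd m f x (q x)) x (p x) =
    dd m f x (\<lambda>i. dd m (\<lambda>x. p x i) x (q x) - dd m (\<lambda>x. q x i) x (p x))"
  using f
proof (induction rule: polyfun.induct)
  case (coord i)
  then show ?case by (simp add: dd_coord)
next
  case (add f g)
  note P = polyfun_dd[OF add.hyps(1) p] polyfun_dd[OF add.hyps(2) p]
    polyfun_dd[OF add.hyps(1) q] polyfun_dd[OF add.hyps(2) q]
  show ?case
    by (simp add: dd_add[OF add.hyps] dd_add[OF P(1,2)] dd_add[OF P(3,4)] add.IH[symmetric])
next
  case (mult f g)
  note P = polyfun_dd[OF mult.hyps(1) p] polyfun_dd[OF mult.hyps(2) p]
    polyfun_dd[OF mult.hyps(1) q] polyfun_dd[OF mult.hyps(2) q]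
  note M = polyfun.mult[OF mult.hyps(1) P(2)] polyfun.mult[OF mult.hyps(2) P(1)]
    polyfun.mult[OF mult.hyps(1) P(4)] polyfun.mult[OF mult.hyps(2) P(3)]
  have lhs: "dd m (\<lambda>x. dd m (\<lambda>v. f v * g v) x (p x)) x (q x) =
      dd m f x (q x) * dd m g x (p x) + f x * dd m (\<lambda>x. dd m g x (p x)) x (q x) +
      (dd m g x (q x) * dd m f x (p x) + g x * dd m (\<lambda>x. dd m f x (p x)) x (q x))"
    by (simp add: dd_mult[OF mult.hyps] dd_add[OF M(1,2)] dd_mult[OF mult.hyps(1) P(2)]
        dd_mult[OF mult.hyps(2) P(1)])
  have rhs: "dd m (\<lambda>x. dd m (\<lambda>v. f v * g v) x (q x)) x (p x) =
      dd m f x (p x) * dd m g x (q x) + f x * dd m (\<lambda>x. dd m g x (q x)) x (p x) +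
      (dd m g x (p x) * dd m f x (q x) + g x * dd m (\<lambda>x. dd m f x (q x)) x (p x))"
    by (simp add: dd_mult[OF mult.hyps] dd_add[OF M(3,4)] dd_mult[OF mult.hyps(1) P(4)]
        dd_mult[OF mult.hyps(2) P(3)])
  show ?case
    unfolding lhs rhs unfolding dd_mult[OF mult.hyps] mult.IH[symmetric] by (simp add: algebra_simps)
qed simp

definition tang :: "(nat \<Rightarrow> complex) set \<Rightarrow> nat \<Rightarrow> (nat \<Rightarrow> complex) \<Rightarrow> (nat \<Rightarrow> complex) set" where
  "tang C N p = cvec N \<inter> tv C (Suc N) p"

text \<open>All that the geometric argument retains of X: \<open>prime\<close> is irreducibility,
  \<open>closed\<close> closedness, \<open>indep\<close> the lower bound for the dimension.
  \<open>dense\<close> expresses that the tangent variety fills the space; in it, smoothness is the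
  condition that the tangent space has dimension n + 1.\<close>

locale tangential_cone =
  fixes C :: "(nat \<Rightarrow> complex) set" and N n :: nat
  assumes N_eq: "N = 2 * n" and n_pos: "n \<ge> 1"
    and prime: "prime_on C (polyfun (Suc N))"
    and in_cvec: "C \<subseteq> cvec N"
    and nonzero: "x \<in> C \<Longrightarrow> x \<noteq> 0"
    and scaled: "x \<in> C \<Longrightarrow> c \<noteq> 0 \<Longrightarrow> cscale c x \<in> C"
    and closed: "v \<in> cvec N \<Longrightarrow> v \<noteq> 0 \<Longrightarrow> v \<in> zcl C (Suc N) \<Longrightarrow> v \<in> C"
    and indep: "\<exists>f. (\<forall>i<Suc n. f i \<in> polyfun (Suc N)) \<and> indep_funs C (Suc n) f"
    and dense: "G \<in> polyfun (Suc N) \<Longrightarrow>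
      (\<And>p w. p \<in> C \<Longrightarrow> cfun.dim (tang C N p) = Suc n \<Longrightarrow> w \<in> tang C N p \<Longrightarrow> G w = 0) \<Longrightarrow> G z = 0"
begin

text \<open>The tangent equations in solved form over \<open>h \<noteq> 0\<close>: a tangent vector
  is determined by its coordinates in \<open>J\<close>, and the columns of \<open>a\<close> are
  polynomial vector fields tangent along all of C. Rows beyond N are zero, so that the columns lie
  in \<open>cvec N\<close>.\<close>

definition chart :: "nat set \<Rightarrow> ((nat \<Rightarrow> complex) \<Rightarrow> complex) \<Rightarrow> (nat \<Rightarrow> nat \<Rightarrow> (nat \<Rightarrow> complex) \<Rightarrow> complex) \<Rightarrow> bool" where
  "chart J h a \<longleftrightarrow> J \<subseteq> {..<Suc N} \<and> card J = Suc n \<and> h \<in> polyfun (Suc N) \<and>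
    (\<forall>i j. a i j \<in> polyfun (Suc N)) \<and>
    (\<forall>i\<in>J. \<forall>j\<in>J. a i j = (if i = j then h else (\<lambda>_. 0))) \<and>
    (\<forall>i j. Suc N \<le> i \<longrightarrow> a i j = (\<lambda>_. 0)) \<and>
    (\<forall>x. \<forall>w\<in>tv C (Suc N) x. \<forall>i<Suc N. h x * w i = (\<Sum>j\<in>J. a i j x * w j)) \<and>
    (\<forall>x\<in>C. \<forall>j\<in>J. (\<lambda>i. a i j x) \<in> tv C (Suc N) x)"

lemma sum_fun_at: "(\<Sum>x\<in>A. g x) i = (\<Sum>x\<in>A. g x (i :: nat) :: complex)"
  by (induction A rule: infinite_finite_induct) auto

text \<open>Elimination with evaluation at \<open>p\<close> as \<open>E\<close>, applied to the
  differentials of all equations. At \<open>p\<close> the columns are a basis of the tangent space,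
  which gives the size of \<open>J\<close>.\<close>

lemma chart_exists:
  assumes p: "p \<in> C" "cfun.dim (tang C N p) = Suc n"
  shows "\<exists>J h a. chart J h a \<and> h p \<noteq> 0"
proof -
  define EE where "EE = {\<lambda>i. pd i f | f. f \<in> polyfun (Suc N) \<and> (\<forall>x\<in>C. f x = 0)}"
  have tv_iff: "w \<in> tv C (Suc N) x \<longleftrightarrow> (\<forall>e\<in>EE. (\<Sum>i\<in>{..<Suc N}. e i x * w i) = 0)" for w x
    by (auto simp: tv_def EE_def dd_def)
  have "\<forall>e\<in>EE. \<forall>i. e i \<in> polyfun (Suc N)"
    unfolding EE_def using pd_polyfun by blast
  from elimination[OF hom_on_eval[of "Suc N" p] _ this, of "{..<Suc N}"] obtain J h a0 where
    J: "J \<subseteq> {..<Suc N}" and h: "h \<in> polyfun (Suc N)" "h p \<noteq> 0" and a0: "\<forall>i j. a0 i j \<in> polyfun (Suc N)"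
    and diag0: "\<forall>i\<in>J. \<forall>j\<in>J. a0 i j = (if i = j then h else (\<lambda>_. 0))"
    and sol0: "\<forall>v w. (\<forall>e\<in>EE. (\<Sum>i\<in>{..<Suc N}. e i v * w i) = 0) \<longrightarrow> (\<forall>i\<in>{..<Suc N}. h v * w i = (\<Sum>j\<in>J. a0 i j v * w j))"
    and E0: "\<forall>e\<in>EE. \<forall>j\<in>J. (\<Sum>i\<in>{..<Suc N}. e i p * a0 i j p) = 0"
    by auto
  define a where "a i j = (if i < Suc N then a0 i j else (\<lambda>_. 0))" for i j
  have a: "a i j \<in> polyfun (Suc N)" for i j
    unfolding a_def using a0 by (simp add: polyfun.const)
  have diag: "a i j = (if i = j then h else (\<lambda>_. 0))" if "i \<in> J" "j \<in> J" for i j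
    using that J diag0 by (auto simp: a_def)
  have a_out: "a i j = (\<lambda>_. 0)" if "Suc N \<le> i" for i j using that by (simp add: a_def)
  have sol: "h x * w i = (\<Sum>j\<in>J. a i j x * w j)" if "w \<in> tv C (Suc N) x" "i < Suc N" for x w i
    using sol0 that unfolding tv_iff a_def by auto
  have finJ: "finite J" using J finite_subset by blast
  have ap: "(\<lambda>i. a i j p) \<in> tang C N p" if j: "j \<in> J" for j
  proof -
    have "(\<lambda>i. a0 i j p) \<in> tv C (Suc N) p" using E0 j unfolding tv_iff by blast
    then have "(\<lambda>i. a i j p) \<in> tv C (Suc N) p" by (rule tv_cong) (simp add: a_def)
    then show ?thesis by (auto simp: tang_def cvec_def a_def)
  qed
  let ?b = "\<lambda>j i. a i j p"
  have inj: "inj_on ?b J"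
  proof (rule inj_onI)
    fix j l assume jl: "j \<in> J" "l \<in> J" "?b j = ?b l"
    then have "a j j p = a j l p" by meson
    then show "j = l" using jl(1,2) diag h(2) by (auto split: if_splits)
  qed
  have at: "(\<Sum>j\<in>J. a l j p * c j) = h p * c l" if "l \<in> J" for l and c :: "nat \<Rightarrow> complex"
  proof -
    have "(\<Sum>j\<in>J. a l j p * c j) = (\<Sum>j\<in>J. if j = l then h p * c j else 0)"
      by (rule sum.cong) (use that diag in auto)
    then show ?thesis using that finJ by simp
  qed
  have "cfun.dim (tang C N p) = card (?b ` J)"
  proof (rule cfun.dim_unique)
    show "?b ` J \<subseteq> tang C N p" using ap by blast
    show "tang C N p \<subseteq> cfun.span (?b ` J)"
    proof
      fix w assume w: "w \<in> tang C N p"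
      have "w = (\<Sum>j\<in>J. cscale (w j / h p) (?b j))"
      proof (rule ext)
        fix i
        show "w i = (\<Sum>j\<in>J. cscale (w j / h p) (?b j)) i"
        proof (cases "i < Suc N")
          case True
          have "h p * w i = (\<Sum>j\<in>J. a i j p * w j)" using w True sol by (simp add: tang_def)
          then have "w i = (\<Sum>j\<in>J. a i j p * w j) / h p" using h(2) by (simp add: field_simps)
          then show ?thesis by (simp add: sum_fun_at cscale_def sum_divide_distrib mult.commute)
        next
          case False
          then show ?thesis using w by (simp add: sum_fun_at cscale_def a_def tang_def cvec_def)
        qed
      qed
      also have "\<dots> \<in> cfun.span (?b ` J)"
        by (intro cfun.span_sum cfun.span_scale cfun.span_base) simp
      finally show "w \<in> cfun.span (?b ` J)" .
    qed
    show "cfun.independent (?b ` J)"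
    proof (rule cfun.independent_if_scalars_zero)
      fix f x assume s: "(\<Sum>x\<in>?b ` J. cscale (f x) x) = 0" and x: "x \<in> ?b ` J"
      then obtain l where l: "l \<in> J" "x = ?b l" by blast
      have "(\<Sum>j\<in>J. cscale (f (?b j)) (?b j)) = 0"
        using s by (simp add: sum.reindex[OF inj])
      then have "(\<Sum>j\<in>J. cscale (f (?b j)) (?b j)) l = 0" by simp
      then have "(\<Sum>j\<in>J. a l j p * f (?b j)) = 0" by (simp add: sum_fun_at cscale_def mult.commute)
      then show "f x = 0" using at[OF l(1), of "\<lambda>j. f (?b j)"] h(2) l(2) by simp
    qed (use finJ in simp)
  qed simp
  then have cardJ: "card J = Suc n" using p(2) card_image[OF inj] by simp
  have at': "(\<Sum>j\<in>J. a l j x * c j) = h x * c l" if "l \<in> J" for l x and c :: "nat \<Rightarrow> complex"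
  proof -
    have "(\<Sum>j\<in>J. a l j x * c j) = (\<Sum>j\<in>J. if j = l then h x * c j else 0)"
      by (rule sum.cong) (use that diag in auto)
    then show ?thesis using that finJ by simp
  qed
  text \<open>Generically the tangent space maps onto \<open>\<complex>\<^bsup>n+1\<^esup>\<close> by the differentials of \<open>n + 1\<close> independent
    functions; being injected into \<open>\<complex>\<^sup>J\<close> by coordinates it is then the full graph over \<open>\<complex>\<^sup>J\<close>.\<close>
  obtain f where f: "\<And>i. i < Suc n \<Longrightarrow> f i \<in> polyfun (Suc N)" "indep_funs C (Suc n) f"
    using indep by blast
  from bexE[OF tangent_lift_fun[OF prime f]] obtain hT where hT: "hT \<in> polyfun (Suc N)" and hT2:
    "(\<exists>x\<in>C. hT x \<noteq> 0) \<and> (\<forall>z\<in>C. hT z \<noteq> 0 \<longrightarrow>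
      (\<forall>\<tau>. \<exists>w\<in>tv C (Suc N) z. \<forall>i<Suc n. dd (Suc N) (f i) z w = \<tau> i))" .
  have gen: "(\<lambda>i. a i j x) \<in> tv C (Suc N) x" if x: "x \<in> C" "h x \<noteq> 0" "hT x \<noteq> 0" and j: "j \<in> J" for x j
  proof -
    have "\<forall>l. \<exists>w. w \<in> tv C (Suc N) x \<and> (\<forall>i<Suc n. dd (Suc N) (f i) x w = (if i = l then 1 else 0))"
    proof
      fix l
      from hT2 x(1,3) have "\<forall>\<tau>. \<exists>w\<in>tv C (Suc N) x. \<forall>i<Suc n. dd (Suc N) (f i) x w = \<tau> i" by blast
      from this[rule_format, of "\<lambda>i. if i = l then 1 else 0"]
      show "\<exists>w. w \<in> tv C (Suc N) x \<and> (\<forall>i<Suc n. dd (Suc N) (f i) x w = (if i = l then 1 else 0))"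
        by (elim bexE) (intro exI conjI)
    qed
    from choice[OF this] obtain W where W: "\<forall>l. W l \<in> tv C (Suc N) x \<and>
      (\<forall>i<Suc n. dd (Suc N) (f i) x (W l) = (if i = l then 1 else 0))" ..
    have comb: "(\<lambda>i. \<Sum>l<Suc n. W l i * y l) \<in> tv C (Suc N) x" for y
      by (rule tv_lincomb) (use W in blast)
    have ddW: "dd (Suc N) (f i) x (\<lambda>i. \<Sum>l<Suc n. W l i * y l) = y i" if "i < Suc n" for i y
    proof -
      have "dd (Suc N) (f i) x (\<lambda>i. \<Sum>l<Suc n. W l i * y l) = (\<Sum>l<Suc n. y l * dd (Suc N) (f i) x (W l))"
        by (simp add: dd_lin_sum dd_lin_scale mult.commute[of "W _ _"])
      also have "\<dots> = (\<Sum>l<Suc n. if l = i then y l else 0)"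
        by (rule sum.cong) (use W that in auto)
      finally show ?thesis using that by simp
    qed
    have "\<exists>y. \<forall>b\<in>J. (\<Sum>l\<in>{..<Suc n}. W l b * y l) = (if b = j then 1 else 0)"
    proof (rule inj_imp_surj[where M = "\<lambda>b l. W l b"])
      fix y assume y: "\<And>b. b \<in> J \<Longrightarrow> (\<Sum>l<Suc n. W l b * y l) = 0"
      have "(\<Sum>l<Suc n. W l i * y l) = 0" if "i < Suc N" for i
      proof -
        have "h x * (\<Sum>l<Suc n. W l i * y l) = (\<Sum>j\<in>J. a i j x * (\<Sum>l<Suc n. W l j * y l))"
          using sol[OF comb that, of y] by simp
        then show ?thesis using x(2) y by simp
      qed
      then have eq: "dd (Suc N) (f i) x (\<lambda>i. \<Sum>l<Suc n. W l i * y l) = 0" for i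
        by (simp add: dd_def)
      show "\<forall>l\<in>{..<Suc n}. y l = 0"
      proof
        fix l assume "l \<in> {..<Suc n}"
        with ddW[of l y] eq[of l] show "y l = 0" by simp
      qed
    qed (use finJ cardJ in auto)
    then obtain y where y: "\<forall>b\<in>J. (\<Sum>l\<in>{..<Suc n}. W l b * y l) = (if b = j then 1 else 0)" ..
    let ?w = "\<lambda>i. \<Sum>l<Suc n. W l i * y l"
    have "h x * ?w i = a i j x" if i: "i < Suc N" for i
    proof -
      have "h x * ?w i = (\<Sum>l\<in>J. a i l x * ?w l)" by (rule sol[OF comb i])
      also have "\<dots> = (\<Sum>l\<in>J. if l = j then a i l x else 0)"
        by (rule sum.cong[OF refl]) (use y in auto)
      finally show ?thesis using j finJ by simp
    qed
    moreover have "(\<lambda>i. h x * ?w i) \<in> tv C (Suc N) x"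
      using comb[of y] unfolding tv_def by (simp add: dd_lin_scale)
    ultimately show ?thesis by (auto intro: tv_cong)
  qed
  \<comment> \<open>Tangency is a polynomial condition, so by primality it spreads from the points
    where \<open>h\<close> and \<open>hT\<close> are nonzero to all of C.\<close>
  have "(\<lambda>i. a i j x) \<in> tv C (Suc N) x" if "x \<in> C" "j \<in> J" for x j
    unfolding tv_def
  proof (intro CollectI ballI impI)
    fix F assume F: "F \<in> polyfun (Suc N)" "\<forall>x\<in>C. F x = 0"
    from hT2 obtain x1 where x1: "x1 \<in> C" "hT x1 \<noteq> 0" by blast
    obtain x2 where x2: "x2 \<in> C" "h x2 * hT x2 \<noteq> 0"
      using prime_onD[where f = h and g = hT and x = p and y = x1, OF prime h(1) hT p(1) h(2) x1] by auto
    show "dd (Suc N) F x (\<lambda>i. a i j x) = 0"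
    proof (rule prime_on_cancel[where h = "\<lambda>x. h x * hT x" and f = "\<lambda>x. dd (Suc N) F x (\<lambda>i. a i j x)" and x = x2,
          OF prime _ _ x2 _ \<open>x \<in> C\<close>])
      show "(\<lambda>x. h x * hT x) \<in> polyfun (Suc N)" by (intro polyfun.mult h hT)
      show "(\<lambda>x. dd (Suc N) F x (\<lambda>i. a i j x)) \<in> polyfun (Suc N)"
        by (rule polyfun_dd[OF F(1)]) (rule a)
      show "dd (Suc N) F y (\<lambda>i. a i j y) = 0" if "y \<in> C" "h y * hT y \<noteq> 0" for y
        by (rule tvD[OF gen[OF that(1) _ _ \<open>j \<in> J\<close>] F(1)]) (use that(2) F(2) in auto)
    qed
  qed
  then have "chart J h a"
    unfolding chart_def using J cardJ h(1) a diag a_out sol by (intro conjI) simp_all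
  then show ?thesis using h(2) by blast
qed

end

section \<open>Tangent fields and tangent equations in a fixed chart\<close>

lemma join_Suc [simp]: "join (Suc k) x y (Suc (k + i)) = y i"
  by (simp add: join_def)

locale charted = tangential_cone +
  fixes J :: "nat set" and h :: "(nat \<Rightarrow> complex) \<Rightarrow> complex" and a :: "nat \<Rightarrow> nat \<Rightarrow> (nat \<Rightarrow> complex) \<Rightarrow> complex"
  assumes is_chart: "chart J h a" and h_nonzero: "\<exists>x\<in>C. h x \<noteq> 0"
begin

definition K :: "nat set" where "K = {..<Suc N} - J"

text \<open>\<open>om s\<close> is a tangent vector field; over \<open>h \<noteq> 0\<close> these fields span the tangent spaces,
  which are cut out by the linear forms \<open>lam k\<close>.\<close>

definition om :: "(nat \<Rightarrow> complex) \<Rightarrow> nat \<Rightarrow> (nat \<Rightarrow> complex) \<Rightarrow> complex" where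
  "om s i x = (\<Sum>j\<in>J. a i j x * s j)"

definition lam :: "nat \<Rightarrow> (nat \<Rightarrow> complex) \<Rightarrow> (nat \<Rightarrow> complex) \<Rightarrow> complex" where
  "lam k x w = h x * w k - (\<Sum>j\<in>J. a k j x * w j)"

lemma J_sub: "J \<subseteq> {..<Suc N}" and cardJ: "card J = Suc n" and h_poly: "h \<in> polyfun (Suc N)"
  and a_poly: "a i j \<in> polyfun (Suc N)" and a_out: "Suc N \<le> i \<Longrightarrow> a i j x = 0"
  using is_chart unfolding chart_def by simp_all

lemma a_diag: "i \<in> J \<Longrightarrow> j \<in> J \<Longrightarrow> a i j x = (if i = j then h x else 0)"
  using is_chart unfolding chart_def by simp

lemma a_sol: "w \<in> tv C (Suc N) x \<Longrightarrow> i < Suc N \<Longrightarrow> h x * w i = (\<Sum>j\<in>J. a i j x * w j)"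
  using is_chart unfolding chart_def by simp

lemma a_tv: "x \<in> C \<Longrightarrow> j \<in> J \<Longrightarrow> (\<lambda>i. a i j x) \<in> tv C (Suc N) x"
  using is_chart unfolding chart_def by simp

lemma finJ: "finite J"
  using J_sub finite_subset by blast

lemma finK: "finite K"
  by (simp add: K_def)

text \<open>Here N = 2n enters: there are as many tangent equations as tangent directions modulo the
  ruling of the cone, so the second fundamental form in one fixed direction can be
  nondegenerate.\<close>

lemma cardK: "card K = n"
  unfolding K_def using J_sub cardJ N_eq by (subst card_Diff_subset[OF finJ]) auto

lemma JM: "j \<in> J \<Longrightarrow> j < Suc N"
  using J_sub by auto

lemma KM: "k \<in> K \<Longrightarrow> k < Suc N"
  by (simp add: K_def)

lemma om_poly: "om s i \<in> polyfun (Suc N)"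
  unfolding om_def[abs_def] by (intro polyfun_intros a_poly)

lemma om_J: "i \<in> J \<Longrightarrow> om s i x = h x * s i"
proof -
  assume i: "i \<in> J"
  have "om s i x = (\<Sum>j\<in>J. if j = i then h x * s j else 0)"
    unfolding om_def by (rule sum.cong) (use i a_diag in auto)
  then show ?thesis using i finJ by simp
qed

lemma om_out: "Suc N \<le> i \<Longrightarrow> om s i x = 0"
  by (simp add: om_def a_out)

lemma om_tv: "x \<in> C \<Longrightarrow> (\<lambda>i. om s i x) \<in> tv C (Suc N) x"
  unfolding om_def by (rule tv_lincomb) (rule a_tv)

lemma om_tang: "x \<in> C \<Longrightarrow> (\<lambda>i. om s i x) \<in> tang C N x"
  by (simp add: tang_def om_tv cvec_def om_out)

lemma tang_om: "w \<in> tang C N x \<Longrightarrow> h x * w i = om w i x"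
proof -
  assume w: "w \<in> tang C N x"
  show ?thesis
  proof (cases "i < Suc N")
    case True
    then show ?thesis using w a_sol[of w x i] by (simp add: tang_def om_def)
  next
    case False
    then show ?thesis using w by (simp add: tang_def cvec_def om_out)
  qed
qed

lemma om_scale: "om (\<lambda>j. c * s j) i x = c * om s i x"
  by (simp add: om_def sum_distrib_left mult.left_commute)

lemma tang_om_divide: "w \<in> tang C N x \<Longrightarrow> h x \<noteq> 0 \<Longrightarrow> w = (\<lambda>i. om (\<lambda>j. inverse (h x) * w j) i x)"
  unfolding om_scale using tang_om[of w x] by (simp add: fun_eq_iff field_simps)

lemma lam_tv: "w \<in> tv C (Suc N) x \<Longrightarrow> k < Suc N \<Longrightarrow> lam k x w = 0"
  by (simp add: lam_def a_sol)

lemma lam_om: "x \<in> C \<Longrightarrow> k < Suc N \<Longrightarrow> lam k x (\<lambda>i. om s i x) = 0"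
  by (rule lam_tv[OF om_tv])

lemma lam_diff: "lam k x (\<lambda>i. u i - w i) = lam k x u - lam k x w"
  by (simp add: lam_def algebra_simps sum_subtractf)

lemma lam_scale: "lam k x (\<lambda>i. c * w i) = c * lam k x w"
  by (simp add: lam_def algebra_simps sum_distrib_left)

lemma lam_sum: "lam k x (\<lambda>i. \<Sum>j\<in>I. w j i) = (\<Sum>j\<in>I. lam k x (w j))"
proof -
  have "(\<Sum>l\<in>J. a k l x * (\<Sum>j\<in>I. w j l)) = (\<Sum>j\<in>I. \<Sum>l\<in>J. a k l x * w j l)"
    by (subst sum.swap) (simp add: sum_distrib_left)
  then show ?thesis by (simp add: lam_def sum_distrib_left sum_subtractf)
qed

lemma lam_poly:
  assumes "\<And>i. i < Suc N \<Longrightarrow> (\<lambda>x. w x i) \<in> polyfun (Suc N)" "k < Suc N"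
  shows "(\<lambda>x. lam k x (w x)) \<in> polyfun (Suc N)"
  unfolding lam_def using assms JM by (intro polyfun_intros h_poly a_poly) auto

lemma tang_iff_lam:
  assumes x: "x \<in> C" "h x \<noteq> 0" and w: "w \<in> cvec N"
  shows "w \<in> tang C N x \<longleftrightarrow> (\<forall>k\<in>K. lam k x w = 0)"
proof
  assume "w \<in> tang C N x"
  then show "\<forall>k\<in>K. lam k x w = 0" by (auto simp: tang_def K_def intro: lam_tv)
next
  assume L: "\<forall>k\<in>K. lam k x w = 0"
  have "h x * w i = om w i x" for i
  proof (cases "i < Suc N")
    case True
    show ?thesis
    proof (cases "i \<in> J")
      case False
      then show ?thesis using L True by (simp add: K_def lam_def om_def)
    qed (simp add: om_J)
  next
    case False
    then show ?thesis using w by (simp add: cvec_def om_out)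
  qed
  then have "w = (\<lambda>i. om (\<lambda>j. inverse (h x) * w j) i x)"
    unfolding om_scale using x(2) by (simp add: fun_eq_iff field_simps)
  then show "w \<in> tang C N x" using om_tang[OF x(1)] by metis
qed

lemma cancel:
  assumes "f \<in> polyfun (Suc N)" "\<And>y. y \<in> C \<Longrightarrow> h y \<noteq> 0 \<Longrightarrow> f y = 0" "x \<in> C"
  shows "f x = 0"
proof -
  obtain x0 where x0: "x0 \<in> C" "h x0 \<noteq> 0" using h_nonzero by blast
  show ?thesis
    by (rule prime_on_cancel[where h = h and f = f and x = x0, OF prime h_poly assms(1) x0 assms(2,3)])
qed

text \<open>\<open>dense\<close> involves points where \<open>h\<close> may vanish. Such a point has
  a chart of its own; the fields of that chart are tangent where \<open>h\<close> is nonzero, and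
  primality carries the vanishing of \<open>G\<close> along them over to the point.\<close>

lemma om_dense:
  assumes G: "G \<in> polyfun (Suc N)" and van: "\<And>x s. x \<in> C \<Longrightarrow> G (\<lambda>i. om s i x) = 0"
  shows "G z = 0"
proof (rule dense[OF G])
  have on_h: "G w = 0" if "x \<in> C" "h x \<noteq> 0" "w \<in> tang C N x" for x w
    using tang_om_divide[OF that(3,2)] van[OF that(1)] by metis
  fix p w assume p: "p \<in> C" "cfun.dim (tang C N p) = Suc n" and w: "w \<in> tang C N p"
  obtain J' h' a' where c': "chart J' h' a'" and h': "h' p \<noteq> 0"
    using chart_exists[OF p] by blast
  then interpret c: charted C N n J' h' a'
    by unfold_locales (use p(1) in auto)
  have poly: "(\<lambda>x. G (\<lambda>i. c.om s i x)) \<in> polyfun (Suc N)" for s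
    by (rule polyfun_compose[OF G]) (rule c.om_poly)
  have "G (\<lambda>i. c.om s i p) = 0" for s
    by (rule cancel[OF poly _ p(1)]) (auto intro: on_h c.om_tang)
  then show "G w = 0" using c.tang_om_divide[OF w h'] by metis
qed

abbreviation trunc :: "(nat \<Rightarrow> complex) \<Rightarrow> nat \<Rightarrow> complex" where
  "trunc w \<equiv> (\<lambda>i. if i < Suc N then w i else 0)"

lemma om_dd: "dd (Suc N) (om s i) x u = (\<Sum>j\<in>J. dd (Suc N) (a i j) x u * s j)"
proof -
  have e: "dd (Suc N) (\<lambda>x. a i j x * s j) x u = dd (Suc N) (a i j) x u * s j" for j
    using dd_mult[OF a_poly[of i j] polyfun.const[of "s j"], of "Suc N" x u] by simp
  show ?thesis
    unfolding om_def[abs_def] e[symmetric] by (rule dd_sum[where m = "Suc N"]) (intro polyfun_intros a_poly)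
qed

text \<open>Since the tangent variety is everything, the map \<open>(x, s) \<mapsto> om s x\<close> is generically submersive.\<close>

lemma submersive_point:
  "\<exists>x0\<in>C. h x0 \<noteq> 0 \<and> (\<exists>s0. \<forall>y. \<exists>u\<in>tang C N x0. \<forall>k\<in>K.
     lam k x0 (\<lambda>i. dd (Suc N) (om s0 i) x0 u) = y k)"
proof -
  let ?M = "Suc N"
  let ?D = "(\<lambda>(x, y). join ?M x y) ` (C \<times> UNIV)"
  note PD = prime_on_join[OF prime prime_on_UNIV, of ?M]
  let ?F = "\<lambda>i z. \<Sum>j\<in>J. a i j z * z (?M + j)"
  have am: "a i j \<in> polyfun (?M + ?M)" for i j by (rule polyfun_mono[OF a_poly]) simp
  have sm: "j \<in> J \<Longrightarrow> (\<lambda>z. z (?M + j)) \<in> polyfun (?M + ?M)" for j using JM by (intro polyfun.coord) simp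
  have F: "?F i \<in> polyfun (?M + ?M)" for i
    by (intro polyfun_intros am sm)
  have Fj: "?F i (join ?M x s) = om s i x" for i x s
    by (simp add: om_def polyfun_join_left[OF a_poly])
  have ind: "indep_funs ?D ?M ?F"
    unfolding indep_funs_def
  proof (intro ballI impI allI)
    fix G z assume G: "G \<in> polyfun ?M" "\<forall>z\<in>?D. G (\<lambda>i. ?F i z) = 0"
    show "G z = 0"
    proof (rule om_dense[OF G(1)])
      fix x s assume "x \<in> C"
      then have "join ?M x s \<in> ?D" by auto
      with G(2) have "G (\<lambda>i. ?F i (join ?M x s)) = 0" by blast
      then show "G (\<lambda>i. om s i x) = 0" unfolding Fj .
    qed
  qed
  from bexE[OF tangent_lift_fun[OF PD F ind]] obtain g where g: "g \<in> polyfun (?M + ?M)" and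
    g2: "(\<exists>x\<in>?D. g x \<noteq> 0) \<and> (\<forall>z\<in>?D. g z \<noteq> 0 \<longrightarrow>
      (\<forall>\<tau>. \<exists>w\<in>tv ?D (?M + ?M) z. \<forall>i<?M. dd (?M + ?M) (?F i) z w = \<tau> i))" .
  from g2 obtain z1 where z1: "z1 \<in> ?D" "g z1 \<noteq> 0" by blast
  obtain x1 where x1: "x1 \<in> C" "h x1 \<noteq> 0" using h_nonzero by blast
  have hm: "h \<in> polyfun (?M + ?M)" by (rule polyfun_mono[OF h_poly]) simp
  have z2: "join ?M x1 (\<lambda>_. 0) \<in> ?D" "h (join ?M x1 (\<lambda>_. 0)) \<noteq> 0"
    using x1 by (auto simp: polyfun_join_left[OF h_poly])
  obtain z where z: "z \<in> ?D" "g z \<noteq> 0" "h z \<noteq> 0"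
    using prime_onD[where f = g and g = h and x = z1 and y = "join ?M x1 (\<lambda>_. 0)", OF PD g hm z1 z2] by blast
  then obtain x0 s0 where x0: "x0 \<in> C" and zj: "z = join ?M x0 s0" by auto
  have h0: "h x0 \<noteq> 0" using z(3) by (simp add: zj polyfun_join_left[OF h_poly])
  have "\<exists>u\<in>tang C N x0. \<forall>k\<in>K. lam k x0 (\<lambda>i. dd ?M (om s0 i) x0 u) = y k" for y
  proof -
    \<comment> \<open>The target is chosen so that \<open>lam k x0\<close> sends it to
      \<open>y k\<close>. The part of the differential that comes from varying \<open>s\<close> is
      itself tangent and is killed by \<open>lam\<close>.\<close>
    let ?\<tau> = "\<lambda>i. if i \<in> K then y i / h x0 else 0"
    from g2 z(1,2) have "\<forall>\<tau>. \<exists>w\<in>tv ?D (?M + ?M) z. \<forall>i<?M. dd (?M + ?M) (?F i) z w = \<tau> i" by blast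
    from bexE[OF this[rule_format, of ?\<tau>]] obtain w where w: "w \<in> tv ?D (?M + ?M) (join ?M x0 s0)"
      "\<forall>i<?M. dd (?M + ?M) (?F i) (join ?M x0 s0) w = ?\<tau> i" unfolding zj .
    let ?u = "trunc w"
    have "w \<in> tv C ?M x0" by (rule tv_join_left[OF w(1)]) simp
    then have u: "?u \<in> tang C N x0"
      by (auto simp: tang_def cvec_def elim: tv_cong)
    have uw: "dd ?M f x0 w = dd ?M f x0 ?u" if "f \<in> polyfun ?M" for f
      by (rule dd_cong[OF that]) auto
    have dF: "dd (?M + ?M) (?F i) (join ?M x0 s0) w =
        dd ?M (om s0 i) x0 ?u + om (\<lambda>j. w (?M + j)) i x0" for i
    proof -
      have "dd (?M + ?M) (?F i) (join ?M x0 s0) w =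
          (\<Sum>j\<in>J. dd (?M + ?M) (\<lambda>z. a i j z * z (?M + j)) (join ?M x0 s0) w)"
        by (rule dd_sum[where m = "?M + ?M"]) (intro polyfun_intros am sm)
      also have "\<dots> = (\<Sum>j\<in>J. a i j x0 * w (?M + j) + dd ?M (a i j) x0 ?u * s0 j)"
      proof (rule sum.cong[OF refl])
        fix j assume j: "j \<in> J"
        show "dd (?M + ?M) (\<lambda>z. a i j z * z (?M + j)) (join ?M x0 s0) w =
            a i j x0 * w (?M + j) + dd ?M (a i j) x0 ?u * s0 j"
          unfolding dd_mult[OF am sm[OF j]] polyfun_join_left[OF a_poly] dd_join_left[OF a_poly]
            dd_coord uw[OF a_poly]
          using JM[OF j] by simp
      qed
      also have "\<dots> = dd ?M (om s0 i) x0 ?u + om (\<lambda>j. w (?M + j)) i x0"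
        by (simp add: om_dd sum.distrib om_def)
      finally show ?thesis .
    qed
    have "lam k x0 (\<lambda>i. dd ?M (om s0 i) x0 ?u) = y k" if k: "k \<in> K" for k
    proof -
      have t: "dd ?M (om s0 i) x0 ?u = ?\<tau> i - om (\<lambda>j. w (?M + j)) i x0" if "i < ?M" for i
        using w(2) dF[of i] that by simp
      have "lam k x0 (\<lambda>i. dd ?M (om s0 i) x0 ?u) = lam k x0 (\<lambda>i. ?\<tau> i - om (\<lambda>j. w (?M + j)) i x0)"
        unfolding lam_def using t[OF KM[OF k]] t[OF JM] by simp
      also have "\<dots> = lam k x0 ?\<tau>"
        unfolding lam_diff by (simp add: lam_om[OF x0 KM[OF k]])
      also have "\<dots> = y k"
      proof -
        have "(\<Sum>j\<in>J. a k j x0 * ?\<tau> j) = 0" by (rule sum.neutral) (auto simp: K_def)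
        then show ?thesis using k h0 by (simp add: lam_def)
      qed
      finally show ?thesis .
    qed
    then show ?thesis using u by blast
  qed
  then show ?thesis using x0 h0 by blast
qed

text \<open>Symmetry of the second fundamental form: both fields are tangent to C, hence so is their
  bracket, and \<open>lam\<close> kills it.\<close>

lemma lam_om_symmetric:
  assumes x: "x \<in> C" and k: "k < Suc N"
  shows "lam k x (\<lambda>i. dd (Suc N) (om s i) x (\<lambda>i. om r i x)) =
    lam k x (\<lambda>i. dd (Suc N) (om r i) x (\<lambda>i. om s i x))"
proof -
  let ?M = "Suc N"
  let ?b = "\<lambda>i. dd ?M (om s i) x (\<lambda>i. om r i x) - dd ?M (om r i) x (\<lambda>i. om s i x)"
  have "?b \<in> tv C ?M x"
  proof (rule tvI)
    fix f assume f: "f \<in> polyfun ?M" "\<And>x. x \<in> C \<Longrightarrow> f x = 0"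
    have van: "dd ?M f x (\<lambda>i. om s i x) = 0" if "x \<in> C" for x s
      by (rule tvD[OF om_tv[OF that] f])
    have p: "(\<lambda>x. dd ?M f x (\<lambda>i. om s i x)) \<in> polyfun ?M" for s
      by (rule polyfun_dd[OF f(1)]) (rule om_poly)
    have z: "dd ?M (\<lambda>x. dd ?M f x (\<lambda>i. om s i x)) x (\<lambda>i. om r i x) = 0" for s r
      by (rule tvD[OF om_tv[OF x] p van])
    show "dd ?M f x ?b = 0"
      using dd_bracket[of ?M "\<lambda>x i. om s i x" "\<lambda>x i. om r i x" f x] om_poly f(1) z by simp
  qed
  from lam_tv[OF this k] show ?thesis by (simp add: lam_diff)
qed

end

text \<open>The line through 0 and \<open>x\<close> lies on the cone except at 0, which is parameter
  -1, so an equation restricted to it has infinitely many roots.\<close>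

lemma (in tangential_cone) euler_tv:
  assumes x: "x \<in> C"
  shows "x \<in> tv C (Suc N) x"
proof (rule tvI)
  fix f assume f: "f \<in> polyfun (Suc N)" "\<And>x. x \<in> C \<Longrightarrow> f x = 0"
  from polyfun_line[OF f(1), of x x] obtain p where
    p: "\<forall>t. f (\<lambda>i. x i + t * x i) = poly p t \<and> dd (Suc N) f (\<lambda>i. x i + t * x i) x = poly (pderiv p) t" ..
  have z: "poly p t = 0" if "t \<noteq> - 1" for t
  proof -
    have "1 + t \<noteq> 0" using that by (simp add: add_eq_0_iff)
    from scaled[OF x this] have "(\<lambda>i. x i + t * x i) \<in> C" by (simp add: cscale_def algebra_simps)
    then show ?thesis using f(2) p by metis
  qed
  have "p = 0"
  proof (rule ccontr)
    assume "p \<noteq> 0"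
    then have "finite {t. poly p t = 0}" by (rule poly_roots_finite)
    moreover have "- {-1} \<subseteq> {t. poly p t = 0}" using z by auto
    ultimately have "finite (- {-1 :: complex})" by (rule rev_finite_subset)
    then show False by (simp add: infinite_UNIV_char_0)
  qed
  then show "dd (Suc N) f x x = 0" using p[rule_format, of 0] by simp
qed

text \<open>Dividing by the largest common power of \<open>fps_X\<close> makes the vector of
  constant terms nonzero: a nonzero solution over power series becomes a nonzero solution at
  parameter 0.\<close>

lemma fps_normalize:
  fixes z :: "'a \<Rightarrow> complex fps"
  assumes "finite A" "\<exists>a\<in>A. z a \<noteq> 0"
  shows "\<exists>m y. (\<forall>a\<in>A. z a = fps_X ^ m * y a) \<and> (\<exists>a\<in>A. fps_nth (y a) 0 \<noteq> 0)"
proof -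
  let ?B = "{a \<in> A. z a \<noteq> 0}"
  let ?m = "Min (subdegree ` z ` ?B)"
  have fin: "finite (subdegree ` z ` ?B)" "subdegree ` z ` ?B \<noteq> {}" using assms by auto
  have "?m \<in> subdegree ` z ` ?B" by (rule Min_in[OF fin])
  then obtain b where b: "b \<in> A" "z b \<noteq> 0" "?m = subdegree (z b)" by blast
  have "z a = fps_X ^ ?m * fps_shift ?m (z a)" if "a \<in> A" for a
  proof (cases "z a = 0")
    case False
    then have "?m \<le> subdegree (z a)" using that fin by (intro Min_le) auto
    then have "fps_shift ?m (z a) * fps_X ^ ?m = z a" by (rule fps_shift_times_fps_X_power)
    then show ?thesis by (simp only: mult.commute[of "fps_X ^ ?m"])
  qed simp
  moreover have "fps_nth (fps_shift ?m (z b)) 0 \<noteq> 0"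
    using b by simp
  ultimately show ?thesis using b(1) by (intro exI[of _ ?m] exI[of _ "\<lambda>a. fps_shift ?m (z a)"]) blast
qed

section \<open>The second fundamental form\<close>

context charted
begin

definition lrow :: "nat \<Rightarrow> nat \<Rightarrow> (nat \<Rightarrow> complex) \<Rightarrow> complex" where
  "lrow k i x = (if i = k then h x else 0) - (if i \<in> J then a k i x else 0)"

lemma lrow_poly: "lrow k i \<in> polyfun (Suc N)"
proof -
  have "(\<lambda>x. if i = k then h x else 0) \<in> polyfun (Suc N)" "(\<lambda>x. if i \<in> J then a k i x else 0) \<in> polyfun (Suc N)"
    by (cases "i = k"; simp add: h_poly polyfun.const) (cases "i \<in> J"; simp add: a_poly polyfun.const)
  then show ?thesis unfolding lrow_def[abs_def] by (rule polyfun_diff)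
qed

text \<open>\<open>F\<close> is abstract so that one computation serves evaluation at a point,
  constants among the power series, and expansion along the arc.\<close>

lemma sum_lrow:
  fixes F :: "((nat \<Rightarrow> complex) \<Rightarrow> complex) \<Rightarrow> 'f::idom"
  assumes F: "\<And>i. F (lrow k i) = (if i = k then F h else 0) - (if i \<in> J then F (a k i) else 0)" and k: "k < Suc N"
  shows "(\<Sum>i<Suc N. F (lrow k i) * w i) = F h * w k - (\<Sum>j\<in>J. F (a k j) * w j)"
proof -
  have "(\<Sum>i<Suc N. F (lrow k i) * w i) =
      (\<Sum>i<Suc N. if i = k then F h * w i else 0) - (\<Sum>i<Suc N. if i \<in> J then F (a k i) * w i else 0)"
    unfolding sum_subtractf[symmetric] by (rule sum.cong) (auto simp: F left_diff_distrib)
  also have "(\<Sum>i<Suc N. if i \<in> J then F (a k i) * w i else 0) = (\<Sum>j\<in>J. F (a k j) * w j)"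
    by (rule sum.mono_neutral_cong_right) (use J_sub in auto)
  finally show ?thesis using k by simp
qed

lemma lam_lrow: "k < Suc N \<Longrightarrow> lam k x w = (\<Sum>i<Suc N. lrow k i x * w i)"
  using sum_lrow[of "\<lambda>f. f x" k w] by (simp add: lam_def lrow_def)

text \<open>For \<open>u\<close>, \<open>w\<close> tangent at \<open>x\<close>, the numbers \<open>sff k x u w\<close> are (up to sign) the components of the
  second fundamental form.\<close>

definition sff :: "nat \<Rightarrow> (nat \<Rightarrow> complex) \<Rightarrow> (nat \<Rightarrow> complex) \<Rightarrow> (nat \<Rightarrow> complex) \<Rightarrow> complex" where
  "sff k x u w = (\<Sum>i<Suc N. dd (Suc N) (lrow k i) x u * w i)"

lemma dd_lam:
  assumes w: "\<And>i. i < Suc N \<Longrightarrow> (\<lambda>x. w x i) \<in> polyfun (Suc N)" and k: "k < Suc N"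
  shows "dd (Suc N) (\<lambda>x. lam k x (w x)) x u =
    sff k x u (w x) + lam k x (\<lambda>i. dd (Suc N) (\<lambda>x. w x i) x u)"
proof -
  have "dd (Suc N) (\<lambda>x. lam k x (w x)) x u = (\<Sum>i<Suc N. dd (Suc N) (\<lambda>x. lrow k i x * w x i) x u)"
    unfolding lam_lrow[OF k] by (rule dd_sum[where m = "Suc N"]) (auto intro: polyfun.mult lrow_poly w)
  also have "\<dots> = (\<Sum>i<Suc N. lrow k i x * dd (Suc N) (\<lambda>x. w x i) x u + w x i * dd (Suc N) (lrow k i) x u)"
    by (rule sum.cong[OF refl]) (simp add: dd_mult[OF lrow_poly w])
  finally show ?thesis
    by (simp add: sff_def lam_lrow[OF k] sum.distrib mult.commute add.commute)
qed

text \<open>Differentiate along \<open>u\<close> the identity that \<open>lam k\<close> annihilates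
  the field \<open>w\<close> at all points of C.\<close>

lemma sff_tangent_field:
  assumes w: "\<And>i. i < Suc N \<Longrightarrow> (\<lambda>x. w x i) \<in> polyfun (Suc N)" and k: "k < Suc N"
    and tan: "\<And>x. x \<in> C \<Longrightarrow> w x \<in> tv C (Suc N) x" and x: "x \<in> C" and u: "u \<in> tv C (Suc N) x"
  shows "sff k x u (w x) = - lam k x (\<lambda>i. dd (Suc N) (\<lambda>x. w x i) x u)"
proof -
  have "dd (Suc N) (\<lambda>x. lam k x (w x)) x u = 0"
    by (rule tvD[OF u lam_poly[OF w k]]) (auto intro: lam_tv[OF tan k])
  then show ?thesis using dd_lam[where w = w, OF w k, of x u] by (simp add: add_eq_0_iff2)
qed

lemma sff_om: "x \<in> C \<Longrightarrow> k < Suc N \<Longrightarrow> u \<in> tv C (Suc N) x \<Longrightarrow>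
    sff k x u (\<lambda>i. om s i x) = - lam k x (\<lambda>i. dd (Suc N) (om s i) x u)"
  by (rule sff_tangent_field[of "\<lambda>x i. om s i x"]) (auto intro: om_poly om_tv)

text \<open>The position vector is a tangent field with derivative \<open>u\<close> along
  \<open>u\<close>, which is tangent. So it lies in the kernel of the form: tangent spaces are
  constant along the rulings.\<close>

lemma sff_euler:
  assumes "x \<in> C" "k < Suc N" "u \<in> tv C (Suc N) x"
  shows "sff k x u x = 0"
proof -
  have "sff k x u x = - lam k x (\<lambda>i. dd (Suc N) (\<lambda>x. x i) x u)"
    by (rule sff_tangent_field[of "\<lambda>x. x"]) (auto intro: polyfun.coord euler_tv assms)
  also have "lam k x (\<lambda>i. dd (Suc N) (\<lambda>x. x i) x u) = lam k x u"
    using assms(2) JM by (simp add: lam_def dd_coord cong: sum.cong)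
  finally show ?thesis using lam_tv[OF assms(3,2)] by simp
qed

text \<open>The bracket argument of \<open>lam_om_symmetric\<close> with the Euler field in place of
  the second field.\<close>

lemma lam_om_euler:
  assumes x: "x \<in> C" and k: "k < Suc N"
  shows "lam k x (\<lambda>i. dd (Suc N) (om s i) x x) = 0"
proof -
  let ?M = "Suc N"
  have "(\<lambda>i. dd ?M (om s i) x x - dd ?M (\<lambda>x. x i) x (\<lambda>i. om s i x)) \<in> tv C ?M x"
  proof (rule tvI)
    fix f assume f: "f \<in> polyfun ?M" "\<And>x. x \<in> C \<Longrightarrow> f x = 0"
    have "dd ?M (\<lambda>x. dd ?M f x (\<lambda>i. om s i x)) x x = 0"
      by (rule tvD[OF euler_tv[OF x] polyfun_dd[OF f(1) om_poly]]) (rule tvD[OF om_tv f])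
    moreover have "dd ?M (\<lambda>x. dd ?M f x x) x (\<lambda>i. om s i x) = 0"
      by (rule tvD[OF om_tv[OF x] polyfun_dd[OF f(1) polyfun.coord]]) (auto intro: tvD[OF euler_tv f])
    ultimately show "dd ?M f x (\<lambda>i. dd ?M (om s i) x x - dd ?M (\<lambda>x. x i) x (\<lambda>i. om s i x)) = 0"
      using dd_bracket[of ?M "\<lambda>x i. om s i x" "\<lambda>x. x" f x] om_poly f(1) polyfun.coord by simp
  qed
  from lam_tv[OF this k] have "lam k x (\<lambda>i. dd ?M (om s i) x x) = lam k x (\<lambda>i. dd ?M (\<lambda>x. x i) x (\<lambda>i. om s i x))"
    by (simp add: lam_diff)
  also have "\<dots> = lam k x (\<lambda>i. om s i x)"
    using k JM by (simp add: lam_def dd_coord cong: sum.cong)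
  finally show ?thesis by (simp add: lam_om[OF x k])
qed

lemma sff_cong: "(\<And>i. i < Suc N \<Longrightarrow> w i = w' i) \<Longrightarrow> sff k x u w = sff k x u w'"
  unfolding sff_def by (rule sum.cong) auto

lemma sff_lincomb: "sff k x u (\<lambda>i. c * w i + d * v i) = c * sff k x u w + d * sff k x u v"
  by (simp add: sff_def algebra_simps sum.distrib sum_distrib_left)

lemma sff_scale: "sff k x u (\<lambda>i. c * w i) = c * sff k x u w"
  using sff_lincomb[of k x u c w 0 w] by simp

end

section \<open>A formal arc through a point where the second fundamental form is nondegenerate in
  the direction of the arc\<close>

locale arc = charted +
  fixes x0 s0 :: "nat \<Rightarrow> complex"
  assumes x0: "x0 \<in> C" and h0: "h x0 \<noteq> 0"
    and submersive: "\<exists>u\<in>tang C N x0. \<forall>k\<in>K. lam k x0 (\<lambda>i. dd (Suc N) (om s0 i) x0 u) = y k"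
begin

definition D :: "((nat \<Rightarrow> complex) \<Rightarrow> complex) \<Rightarrow> (nat \<Rightarrow> complex) \<Rightarrow> complex" where
  "D f x = dd (Suc N) f x (\<lambda>i. om s0 i x)"

text \<open>Taylor expansion along the integral curve of the vector field \<open>om s0\<close> through \<open>x0\<close>; since the
  field is tangent, this formal curve lies on \<open>C\<close>.\<close>

definition E :: "((nat \<Rightarrow> complex) \<Rightarrow> complex) \<Rightarrow> complex fps" where
  "E f = Abs_fps (\<lambda>k. (D ^^ k) f x0 / fact k)"

lemma D_poly: "f \<in> polyfun (Suc N) \<Longrightarrow> D f \<in> polyfun (Suc N)"
  unfolding D_def[abs_def] by (rule polyfun_dd) (auto intro: om_poly)

lemma Dn_poly: "f \<in> polyfun (Suc N) \<Longrightarrow> (D ^^ k) f \<in> polyfun (Suc N)"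
  by (induction k) (auto intro: D_poly)

lemma D_add: "f \<in> polyfun (Suc N) \<Longrightarrow> g \<in> polyfun (Suc N) \<Longrightarrow> D (\<lambda>x. f x + g x) = (\<lambda>x. D f x + D g x)"
  by (simp add: D_def fun_eq_iff dd_add[where m = "Suc N"])

lemma D_mult: "f \<in> polyfun (Suc N) \<Longrightarrow> g \<in> polyfun (Suc N) \<Longrightarrow>
    D (\<lambda>x. f x * g x) = (\<lambda>x. f x * D g x + g x * D f x)"
  by (simp add: D_def fun_eq_iff dd_mult[where m = "Suc N"])

lemma Dn_add: "f \<in> polyfun (Suc N) \<Longrightarrow> g \<in> polyfun (Suc N) \<Longrightarrow>
    (D ^^ k) (\<lambda>x. f x + g x) = (\<lambda>x. (D ^^ k) f x + (D ^^ k) g x)"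
  by (induction k) (simp_all add: D_add Dn_poly)

lemma E_nth: "fps_nth (E f) k = (D ^^ k) f x0 / fact k"
  by (simp add: E_def)

lemma E_deriv: "fps_deriv (E f) = E (D f)"
  by (rule fps_ext) (simp add: E_nth funpow_swap1 field_simps del: of_nat_Suc)

lemma E_add: "f \<in> polyfun (Suc N) \<Longrightarrow> g \<in> polyfun (Suc N) \<Longrightarrow> E (\<lambda>x. f x + g x) = E f + E g"
  by (rule fps_ext) (simp add: E_nth Dn_add add_divide_distrib)

text \<open>Coefficient \<open>k + 1\<close> is determined by coefficient \<open>k\<close> of the
  derivative, and \<open>fps_deriv\<close> corresponds to the derivation \<open>D\<close>; hence an
  induction on \<open>k\<close> for all pairs of functions at once.\<close>

lemma E_mult:
  assumes "f \<in> polyfun (Suc N)" "g \<in> polyfun (Suc N)"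
  shows "E (\<lambda>x. f x * g x) = E f * E g"
proof (rule fps_ext)
  fix k
  show "fps_nth (E (\<lambda>x. f x * g x)) k = fps_nth (E f * E g) k"
    using assms
  proof (induction k arbitrary: f g)
    case 0
    then show ?case by (simp add: E_nth)
  next
    case (Suc k)
    note P = D_poly[OF Suc.prems(1)] D_poly[OF Suc.prems(2)]
    have "of_nat (Suc k) * fps_nth (E (\<lambda>x. f x * g x)) (Suc k) = fps_nth (fps_deriv (E (\<lambda>x. f x * g x))) k"
      by (simp only: fps_deriv_nth Suc_eq_plus1)
    also have "\<dots> = fps_nth (E (\<lambda>x. f x * D g x) + E (\<lambda>x. g x * D f x)) k"
      unfolding E_deriv D_mult[OF Suc.prems]
      by (subst E_add) (auto intro: polyfun.mult P Suc.prems)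
    also have "\<dots> = fps_nth (E f * E (D g) + E g * E (D f)) k"
      using Suc.IH[OF Suc.prems(1) P(2)] Suc.IH[OF Suc.prems(2) P(1)] by simp
    also have "\<dots> = fps_nth (fps_deriv (E f * E g)) k"
      by (simp only: fps_deriv_mult E_deriv) (simp add: algebra_simps)
    also have "\<dots> = of_nat (Suc k) * fps_nth (E f * E g) (Suc k)"
      by (simp only: fps_deriv_nth Suc_eq_plus1)
    finally show ?case by (simp del: of_nat_Suc)
  qed
qed

lemma E_const: "E (\<lambda>_. c) = fps_const c"
proof (rule fps_ext)
  fix k
  have "(D ^^ Suc k) (\<lambda>_. c) = (\<lambda>_. 0)" for k
    by (induction k) (simp_all add: D_def[abs_def])
  then show "fps_nth (E (\<lambda>_. c)) k = fps_nth (fps_const c) k"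
    by (cases k) (simp_all only: E_nth, simp_all)
qed

lemma E_hom: "hom_on (Suc N) E"
  unfolding hom_on_def using E_add E_mult by (simp add: E_const)

lemma E_vanish:
  assumes f: "f \<in> polyfun (Suc N)" "\<And>x. x \<in> C \<Longrightarrow> f x = 0"
  shows "E f = 0"
proof (rule fps_ext)
  fix k
  have "\<forall>x\<in>C. (D ^^ k) f x = 0"
  proof (induction k)
    case (Suc k)
    show ?case
    proof
      fix x assume "x \<in> C"
      have "dd (Suc N) ((D ^^ k) f) x (\<lambda>i. om s0 i x) = 0"
        by (rule tvD[OF om_tv[OF \<open>x \<in> C\<close>] Dn_poly[OF f(1)]]) (use Suc in blast)
      then show "(D ^^ Suc k) f x = 0" by (simp add: D_def)
    qed
  qed (simp add: f)
  then show "fps_nth (E f) k = fps_nth 0 k" using x0 by (simp add: E_nth)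
qed

lemma E_zero_coeff: "fps_nth (E f) 0 = f x0"
  by (simp add: E_nth)

lemma E_first_coeff: "fps_nth (E f) 1 = dd (Suc N) f x0 (\<lambda>i. om s0 i x0)"
  by (simp add: E_nth D_def)

lemma E_h: "E h \<noteq> 0"
  using h0 E_zero_coeff[of h] by auto

text \<open>Vectors of power series are tested for tangency at the fixed point \<open>x0\<close>
  with \<open>lamF\<close>, and at the moving point of the arc with \<open>lamE\<close>.\<close>

definition lamF :: "nat \<Rightarrow> (nat \<Rightarrow> complex fps) \<Rightarrow> complex fps" where
  "lamF k w = fps_const (h x0) * w k - (\<Sum>j\<in>J. fps_const (a k j x0) * w j)"

definition lamE :: "nat \<Rightarrow> (nat \<Rightarrow> complex fps) \<Rightarrow> complex fps" where
  "lamE k w = E h * w k - (\<Sum>j\<in>J. E (a k j) * w j)"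

lemma lamF_nth: "fps_nth (lamF k w) m = lam k x0 (\<lambda>i. fps_nth (w i) m)"
  by (simp add: lamF_def lam_def fps_sum_nth)

lemma lamE_E:
  assumes w: "\<And>i. i < Suc N \<Longrightarrow> (\<lambda>x. w x i) \<in> polyfun (Suc N)" and k: "k < Suc N"
    and tan: "\<And>x. x \<in> C \<Longrightarrow> w x \<in> tv C (Suc N) x"
  shows "lamE k (\<lambda>i. E (\<lambda>x. w x i)) = 0"
proof -
  have hw: "(\<lambda>x. h x * w x k) \<in> polyfun (Suc N)" by (intro polyfun.mult h_poly w k)
  have aw: "(\<lambda>x. a k j x * w x j) \<in> polyfun (Suc N)" if "j \<in> J" for j
    by (intro polyfun.mult a_poly w JM that)
  have sw: "(\<lambda>x. \<Sum>j\<in>J. a k j x * w x j) \<in> polyfun (Suc N)" by (rule polyfun_sum) (rule aw)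
  have "E (\<lambda>x. lam k x (w x)) = E (\<lambda>x. h x * w x k) - E (\<lambda>x. \<Sum>j\<in>J. a k j x * w x j)"
    unfolding lam_def by (rule hom_on_diff[OF E_hom hw sw])
  also have "E (\<lambda>x. \<Sum>j\<in>J. a k j x * w x j) = (\<Sum>j\<in>J. E (\<lambda>x. a k j x * w x j))"
    by (rule hom_on_sum[OF E_hom]) (rule aw)
  finally have "lamE k (\<lambda>i. E (\<lambda>x. w x i)) = E (\<lambda>x. lam k x (w x))"
    unfolding lamE_def by (simp add: E_mult h_poly a_poly w k JM)
  also have "\<dots> = 0"
    by (rule E_vanish[OF lam_poly[OF w k]]) (auto intro: lam_tv[OF tan k])
  finally show ?thesis .
qed

text \<open>How fast column \<open>l\<close> of the moving tangent space leaves the tangent space at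
  \<open>x0\<close>: up to sign, the matrix of the second fundamental form with one argument in the
  direction of the arc.\<close>

definition B :: "nat \<Rightarrow> nat \<Rightarrow> complex" where
  "B k l = lam k x0 (\<lambda>i. dd (Suc N) (a i l) x0 (\<lambda>i. om s0 i x0))"

text \<open>By symmetry the roles of \<open>r\<close> and \<open>s0\<close> may be exchanged, which
  brings \<open>B\<close> into the form covered by \<open>submersive\<close>.\<close>

lemma B_apply: "k < Suc N \<Longrightarrow> (\<Sum>l\<in>J. B k l * r l) = lam k x0 (\<lambda>i. dd (Suc N) (om s0 i) x0 (\<lambda>i. om r i x0))"
proof -
  assume k: "k < Suc N"
  have "(\<Sum>l\<in>J. B k l * r l) = (\<Sum>l\<in>J. lam k x0 (\<lambda>i. r l * dd (Suc N) (a i l) x0 (\<lambda>i. om s0 i x0)))"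
    by (simp add: B_def lam_scale mult.commute)
  also have "\<dots> = lam k x0 (\<lambda>i. dd (Suc N) (om r i) x0 (\<lambda>i. om s0 i x0))"
    by (simp add: lam_sum[symmetric] om_dd mult.commute)
  finally show ?thesis by (simp add: lam_om_symmetric[OF x0 k])
qed

lemma B_surj: "\<exists>r. \<forall>k\<in>K. (\<Sum>l\<in>J. B k l * r l) = y k"
proof -
  from submersive[of y] obtain u where u: "u \<in> tang C N x0"
    "\<forall>k\<in>K. lam k x0 (\<lambda>i. dd (Suc N) (om s0 i) x0 u) = y k" ..
  let ?r = "\<lambda>j. inverse (h x0) * u j"
  have "u = (\<lambda>i. om ?r i x0)" by (rule tang_om_divide[OF u(1) h0])
  then have "\<forall>k\<in>K. (\<Sum>l\<in>J. B k l * ?r l) = y k" using u(2) by (simp add: B_apply KM)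
  then show ?thesis by (rule exI[of _ ?r])
qed

lemma x0_tang: "x0 \<in> tang C N x0"
  using euler_tv[OF x0] in_cvec x0 by (auto simp: tang_def)

lemma l_exists: "\<exists>l\<in>J. x0 l \<noteq> 0"
proof (rule ccontr)
  assume "\<not> ?thesis"
  then have "om x0 i x0 = 0" for i by (simp add: om_def)
  then have "x0 i = 0" for i using tang_om[OF x0_tang, of i] h0 by simp
  then show False using nonzero[OF x0] by (auto simp: fun_eq_iff)
qed

text \<open>A normalising coordinate: a multiple of \<open>x0\<close> whose coordinate
  \<open>l0\<close> is 0 must vanish.\<close>

definition l0 :: nat where "l0 = (SOME l. l \<in> J \<and> x0 l \<noteq> 0)"

lemma l0: "l0 \<in> J" "x0 l0 \<noteq> 0"
  using someI_ex[of "\<lambda>l. l \<in> J \<and> x0 l \<noteq> 0"] l_exists unfolding l0_def by blast+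

text \<open>\<open>B\<close> is onto with n rows and n + 1 columns, so its kernel is a line; by
  \<open>lam_om_euler\<close> it is spanned by the coordinates of \<open>x0\<close>.\<close>

lemma B_kernel:
  assumes "\<And>k. k \<in> K \<Longrightarrow> (\<Sum>l\<in>J. B k l * r l) = 0" "r l0 = 0" "l \<in> J"
  shows "r l = 0"
proof (rule kernel_line[where M = B and \<kappa> = x0 and x = r and l = l0, OF finK finJ _ B_surj _ l0 assms])
  show "card J = Suc (card K)" by (simp add: cardJ cardK)
  fix k assume k: "k \<in> K"
  have "(\<lambda>i. om x0 i x0) = (\<lambda>i. h x0 * x0 i)" using tang_om[OF x0_tang] by simp
  then show "(\<Sum>l\<in>J. B k l * x0 l) = 0"
    using lam_om_euler[OF x0 KM[OF k], of s0] by (simp add: B_apply[OF KM[OF k]] dd_lin_scale lam_scale)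
qed

text \<open>At parameter 0 the moving column is tangent at \<open>x0\<close>, so
  \<open>fps_X\<close> divides; the first-order coefficient is \<open>B\<close> by
  definition.\<close>

lemma A_factor:
  assumes k: "k \<in> K" and l: "l \<in> J"
  shows "\<exists>A. lamF k (\<lambda>i. E (a i l)) = fps_X * A \<and> fps_nth A 0 = B k l"
proof -
  let ?f = "lamF k (\<lambda>i. E (a i l))"
  have "fps_nth ?f 0 = 0"
    using lam_tv[OF a_tv[OF x0 l] KM[OF k]] by (simp add: lamF_nth E_zero_coeff)
  then have "?f = fps_X * fps_shift 1 ?f"
    by (intro fps_ext) (auto simp: fps_X_mult_nth)
  moreover have "fps_nth (fps_shift 1 ?f) 0 = B k l"
    by (simp add: lamF_nth E_first_coeff[unfolded One_nat_def] B_def)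
  ultimately show ?thesis by blast
qed

definition A :: "nat \<Rightarrow> nat \<Rightarrow> complex fps" where
  "A k l = (SOME A. lamF k (\<lambda>i. E (a i l)) = fps_X * A \<and> fps_nth A 0 = B k l)"

lemma A: "k \<in> K \<Longrightarrow> l \<in> J \<Longrightarrow> lamF k (\<lambda>i. E (a i l)) = fps_X * A k l"
  "k \<in> K \<Longrightarrow> l \<in> J \<Longrightarrow> fps_nth (A k l) 0 = B k l"
  using someI_ex[OF A_factor[of k l]] unfolding A_def by blast+

text \<open>A nonzero solution, divided by its common power of \<open>fps_X\<close> and taken at
  parameter 0, would contradict \<open>B_kernel\<close>.\<close>

lemma A_kernel:
  assumes y: "\<And>k. k \<in> K \<Longrightarrow> (\<Sum>l\<in>J. A k l * y l) = 0" "y l0 = 0" "l \<in> J"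
  shows "y l = 0"
proof (rule ccontr)
  assume "y l \<noteq> 0"
  with fps_normalize[of J y] finJ assms(3) obtain m z where
    z: "\<forall>l\<in>J. y l = fps_X ^ m * z l" and nz: "\<exists>l\<in>J. fps_nth (z l) 0 \<noteq> 0" by blast
  have "fps_nth (z l) 0 = 0" if "l \<in> J" for l
  proof (rule B_kernel[OF _ _ that])
    fix k assume k: "k \<in> K"
    have "fps_X ^ m * (\<Sum>l\<in>J. A k l * z l) = (\<Sum>l\<in>J. A k l * y l)"
      unfolding sum_distrib_left by (rule sum.cong) (simp_all add: z ac_simps)
    then have "(\<Sum>l\<in>J. A k l * z l) = 0" using y(1)[OF k] by simp
    then have "fps_nth (\<Sum>l\<in>J. A k l * z l) 0 = 0" by simp
    then show "(\<Sum>l\<in>J. B k l * fps_nth (z l) 0) = 0"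
      using k by (simp add: fps_sum_nth A(2))
  next
    have "z l0 = 0" using z l0(1) y(2) by auto
    then show "fps_nth (z l0) 0 = 0" by simp
  qed
  then show False using nz by blast
qed

lemma lamF_add: "lamF k (\<lambda>i. u i + w i) = lamF k u + lamF k w"
  by (simp add: lamF_def algebra_simps sum.distrib)

lemma lamF_diff: "lamF k (\<lambda>i. u i - w i) = lamF k u - lamF k w"
  by (simp add: lamF_def algebra_simps sum_subtractf)

lemma lamF_scale: "lamF k (\<lambda>i. c * w i) = c * lamF k w"
  by (simp add: lamF_def algebra_simps sum_distrib_left)

lemma lamF_sum: "finite I \<Longrightarrow> lamF k (\<lambda>i. \<Sum>j\<in>I. w j i) = (\<Sum>j\<in>I. lamF k (w j))"
  by (induction I rule: finite_induct) (simp_all add: lamF_add, simp add: lamF_def)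

lemma lamE_add: "lamE k (\<lambda>i. u i + w i) = lamE k u + lamE k w"
  by (simp add: lamE_def algebra_simps sum.distrib)

lemma lamE_diff: "lamE k (\<lambda>i. u i - w i) = lamE k u - lamE k w"
  by (simp add: lamE_def algebra_simps sum_subtractf)

lemma lamE_scale: "lamE k (\<lambda>i. c * w i) = c * lamE k w"
  by (simp add: lamE_def algebra_simps sum_distrib_left)

lemma lamE_sum: "finite I \<Longrightarrow> lamE k (\<lambda>i. \<Sum>j\<in>I. w j i) = (\<Sum>j\<in>I. lamE k (w j))"
  by (induction I rule: finite_induct) (simp_all add: lamE_add, simp add: lamE_def)

text \<open>Over power series the two tangent spaces meet in at most a line: a vector tangent at the
  moving point is a combination of the moving columns, and tangency at \<open>x0\<close> then says
  that its coordinates in \<open>J\<close> lie in the kernel of \<open>A\<close>.\<close>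

lemma common_tangent_unique:
  assumes F: "\<And>k. k \<in> K \<Longrightarrow> lamF k w = 0" and Ew: "\<And>k. k \<in> K \<Longrightarrow> lamE k w = 0"
    and l: "w l0 = 0" and i: "i < Suc N"
  shows "w i = 0"
proof -
  have sol: "E h * w i = (\<Sum>j\<in>J. w j * E (a i j))" if i: "i < Suc N" for i
  proof (cases "i \<in> J")
    case True
    have "E (a i j) = (if i = j then E h else 0)" if "j \<in> J" for j
    proof -
      have "a i j = (if i = j then h else (\<lambda>_. 0))"
        using a_diag[OF True that] by (simp add: fun_eq_iff)
      then show ?thesis by (simp add: hom_on_zero[OF E_hom])
    qed
    then have "(\<Sum>j\<in>J. w j * E (a i j)) = (\<Sum>j\<in>J. if i = j then w j * E h else 0)"
      by (intro sum.cong) auto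
    then show ?thesis using True finJ by (simp add: mult.commute)
  next
    case False
    then have "i \<in> K" using i by (simp add: K_def)
    from Ew[OF this] show ?thesis by (simp add: lamE_def mult.commute)
  qed
  have "w l = 0" if "l \<in> J" for l
  proof (rule A_kernel[where y = w, OF _ l that])
    fix k assume k: "k \<in> K"
    have "fps_X * (\<Sum>l\<in>J. A k l * w l) = (\<Sum>l\<in>J. w l * lamF k (\<lambda>i. E (a i l)))"
      unfolding sum_distrib_left by (rule sum.cong) (simp_all add: A(1)[OF k] ac_simps)
    also have "\<dots> = lamF k (\<lambda>i. \<Sum>l\<in>J. w l * E (a i l))"
      by (simp add: lamF_sum[OF finJ] lamF_scale)
    also have "\<dots> = lamF k (\<lambda>i. E h * w i)"
      unfolding lamF_def using sol KM[OF k] JM by (simp cong: sum.cong)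
    also have "\<dots> = 0" by (simp add: lamF_scale F[OF k])
    finally show "(\<Sum>l\<in>J. A k l * w l) = 0" by simp
  qed
  then have "E h * w i = 0" using sol[OF i] by simp
  then show ?thesis using E_h by simp
qed

text \<open>A common tangent vector of \<open>C\<close> at \<open>x0\<close> and at the point \<open>x(\<epsilon>)\<close> of the formal arc:
  a correction of higher order of \<open>2 x(\<epsilon>) - \<epsilon> x'(\<epsilon>)\<close>, which is tangent to second order at \<open>x0\<close>.\<close>

lemma common_tangent:
  obtains P t0 t1 where "\<And>k. k \<in> K \<Longrightarrow> lamF k P = 0" "\<And>k. k \<in> K \<Longrightarrow> lamE k P = 0"
    "\<And>i. i < Suc N \<Longrightarrow> fps_nth (P i) 0 = 2 * t0 * x0 i"
    "\<And>i. i < Suc N \<Longrightarrow> fps_nth (P i) 1 = t0 * om s0 i x0 + 2 * t1 * x0 i" "t0 \<noteq> 0"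
proof -
  let ?M = "Suc N"
  define X where "X i = E (\<lambda>x. x i)" for i
  \<comment> \<open>The coefficient of order m is (2 - m) times that of the arc. Order 2 drops out,
    and orders 0 and 1 are tangent at \<open>x0\<close>, so \<open>lamF k q\<close> is divisible by
    the third power of \<open>fps_X\<close>.\<close>
  define q where "q i = 2 * X i - fps_X * E (om s0 i)" for i
  have dX: "fps_deriv (X i) = E (om s0 i)" if "i < ?M" for i
    unfolding X_def E_deriv using that by (simp add: D_def[abs_def] dd_coord)
  have qn: "fps_nth (q i) m = (2 - of_nat m) * fps_nth (X i) m" if i: "i < ?M" for i m
  proof -
    have "fps_nth (fps_X * E (om s0 i)) m = of_nat m * fps_nth (X i) m"
      unfolding dX[OF i, symmetric] by (cases m) (simp_all add: fps_X_mult_nth)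
    then show ?thesis by (simp add: q_def algebra_simps numeral_fps_const)
  qed
  have X0: "fps_nth (X i) 0 = x0 i" for i by (simp add: X_def E_zero_coeff)
  have X1: "fps_nth (X i) 1 = om s0 i x0" if "i < ?M" for i
    using that by (simp add: X_def E_first_coeff[unfolded One_nat_def] dd_coord)
  have Eq: "lamE k q = 0" if k: "k \<in> K" for k
  proof -
    have "lamE k X = 0" unfolding X_def
      by (rule lamE_E[of "\<lambda>x. x", OF _ KM[OF k]]) (auto intro: polyfun.coord euler_tv)
    moreover have "lamE k (\<lambda>i. E (om s0 i)) = 0"
      by (rule lamE_E[of "\<lambda>x i. om s0 i x", OF _ KM[OF k]]) (auto intro: om_poly om_tv)
    ultimately show ?thesis unfolding q_def[abs_def] by (simp add: lamE_diff lamE_scale)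
  qed
  have Fq: "\<exists>b. lamF k q = fps_X ^ 3 * b" if k: "k \<in> K" for k
  proof
    have lc: "lam k x0 (\<lambda>i. fps_nth (q i) m) = (2 - of_nat m) * lam k x0 (\<lambda>i. fps_nth (X i) m)" for m
      using qn KM[OF k] JM unfolding lam_scale[symmetric] by (simp add: lam_def cong: sum.cong)
    have "lam k x0 (\<lambda>i. fps_nth (X i) 1) = lam k x0 (\<lambda>i. om s0 i x0)"
      unfolding lam_def using X1 KM[OF k] JM by (simp cong: sum.cong)
    then have l1: "lam k x0 (\<lambda>i. fps_nth (X i) 1) = 0" by (simp add: lam_om[OF x0 KM[OF k]])
    have l0: "lam k x0 (\<lambda>i. fps_nth (X i) 0) = 0"
      unfolding X0 by (rule lam_tv[OF euler_tv[OF x0] KM[OF k]])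
    have "fps_nth (lamF k q) m = 0" if "m < 3" for m
    proof -
      from that consider "m = 0" | "m = 1" | "m = 2" by linarith
      then show ?thesis using l0 l1 by cases (simp_all add: lamF_nth lc)
    qed
    then show "lamF k q = fps_X ^ 3 * fps_shift 3 (lamF k q)"
      by (intro fps_ext) (simp add: fps_X_power_mult_nth)
  qed
  then have "\<forall>k. \<exists>b. k \<in> K \<longrightarrow> lamF k q = fps_X ^ 3 * b" by blast
  from choice[OF this] obtain b where b: "\<forall>k. k \<in> K \<longrightarrow> lamF k q = fps_X ^ 3 * b k" ..
  let ?J = "J - {l0}"
  have Jl: "finite ?J" "card ?J = n" using finJ l0(1) cardJ by auto
  \<comment> \<open>The unknowns are the coefficient of the error \<open>b\<close> and those of the
    n columns other than \<open>l0\<close>: n + 1 unknowns for n equations.\<close>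
  let ?S = "insert None (Some ` ?J)"
  let ?m = "\<lambda>k z. case z of None \<Rightarrow> b k | Some l \<Rightarrow> A k l"
  have "card ?S = Suc n" using Jl by (simp add: card_image)
  with kernel_exists[of K ?S ?m] finK cardK Jl(1) obtain z where
    z: "\<exists>a\<in>?S. z a \<noteq> 0" "\<forall>k\<in>K. (\<Sum>a\<in>?S. ?m k a * z a) = 0" by auto
  from fps_normalize[OF _ z(1)] Jl(1) obtain m y where
    y: "\<forall>a\<in>?S. z a = fps_X ^ m * y a" and y0: "\<exists>a\<in>?S. fps_nth (y a) 0 \<noteq> 0" by blast
  have rel: "b k * y None + (\<Sum>l\<in>?J. A k l * y (Some l)) = 0" if k: "k \<in> K" for k
  proof -
    have "fps_X ^ m * (\<Sum>a\<in>?S. ?m k a * y a) = (\<Sum>a\<in>?S. ?m k a * z a)"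
      unfolding sum_distrib_left by (rule sum.cong) (simp_all add: y ac_simps)
    then have "(\<Sum>a\<in>?S. ?m k a * y a) = 0" using z(2) k by simp
    then show ?thesis using Jl(1) by (simp add: sum.reindex)
  qed
  \<comment> \<open>Otherwise the leading terms of the column coefficients would form a nonzero
    kernel vector of \<open>B\<close> with vanishing coordinate \<open>l0\<close>.\<close>
  have t0: "fps_nth (y None) 0 \<noteq> 0"
  proof
    assume N0: "fps_nth (y None) 0 = 0"
    let ?r = "\<lambda>l. if l = l0 then 0 else fps_nth (y (Some l)) 0"
    have rl: "?r l = 0" if "l \<in> J" for l
    proof (rule B_kernel[where r = ?r, OF _ _ that])
      fix k assume k: "k \<in> K"
      have "(\<Sum>l\<in>J. B k l * ?r l) = (\<Sum>l\<in>?J. B k l * fps_nth (y (Some l)) 0)"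
        by (rule sum.mono_neutral_cong_right) (use finJ in auto)
      also have "\<dots> = fps_nth (b k * y None + (\<Sum>l\<in>?J. A k l * y (Some l))) 0"
        using k by (simp add: fps_sum_nth N0 A(2))
      finally show "(\<Sum>l\<in>J. B k l * ?r l) = 0" using rel[OF k] by simp
    qed simp
    have "fps_nth (y (Some l)) 0 = 0" if "l \<in> ?J" for l using rl[of l] that by simp
    then show False using y0 N0 by auto
  qed
  \<comment> \<open>Each moving column contributes one factor \<open>fps_X\<close> under
    \<open>lamF\<close>; with the square this matches the cube in the error, and orders 0 and 1 of
    \<open>q\<close> are left untouched by the correction.\<close>
  define P where "P i = y None * q i + fps_X ^ 2 * (\<Sum>l\<in>?J. y (Some l) * E (a i l))" for i
  show ?thesis
  proof (rule that[of P "fps_nth (y None) 0" "fps_nth (y None) 1"])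
    fix k assume k: "k \<in> K"
    have s: "lamF k (\<lambda>i. \<Sum>l\<in>?J. y (Some l) * E (a i l)) = fps_X * (\<Sum>l\<in>?J. A k l * y (Some l))"
      unfolding lamF_sum[OF Jl(1)] lamF_scale sum_distrib_left
      by (rule sum.cong) (simp_all add: A(1)[OF k] ac_simps)
    have "lamF k P = y None * lamF k q + fps_X ^ 2 * lamF k (\<lambda>i. \<Sum>l\<in>?J. y (Some l) * E (a i l))"
      unfolding P_def[abs_def] lamF_add lamF_scale ..
    then have "lamF k P = fps_X ^ 3 * (b k * y None + (\<Sum>l\<in>?J. A k l * y (Some l)))"
      unfolding s b[rule_format, OF k] by (simp add: algebra_simps power3_eq_cube power2_eq_square)
    then show "lamF k P = 0" using rel[OF k] by simp
    have "lamE k (\<lambda>i. E (a i l)) = 0" if "l \<in> J" for l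
      by (rule lamE_E[of "\<lambda>x i. a i l x", OF _ KM[OF k]]) (auto intro: a_poly a_tv that)
    then show "lamE k P = 0"
      unfolding P_def[abs_def] by (simp add: lamE_add lamE_scale lamE_sum[OF Jl(1)] Eq[OF k])
  next
    fix i assume i: "i < ?M"
    have q0: "fps_nth (q i) 0 = 2 * x0 i" and q1: "fps_nth (q i) 1 = om s0 i x0"
      using qn[OF i, of 0] qn[OF i, of 1] X0 X1[OF i] by simp_all
    show "fps_nth (P i) 0 = 2 * fps_nth (y None) 0 * x0 i"
      by (simp add: P_def q0 fps_X_power_mult_nth)
    show "fps_nth (P i) 1 = fps_nth (y None) 0 * om s0 i x0 + 2 * fps_nth (y None) 1 * x0 i"
      using q0 q1 by (simp add: P_def fps_X_power_mult_nth fps_mult_nth)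
  qed (rule t0)
qed

end

section \<open>From the formal arc to a generic pair of points\<close>

context arc
begin

text \<open>Evaluation of a function of pairs at \<open>x0\<close> and the moving point of the
  arc.\<close>

definition E2 :: "((nat \<Rightarrow> complex) \<Rightarrow> complex) \<Rightarrow> complex fps" where
  "E2 f = E (\<lambda>y. f (join (Suc N) x0 y))"

lemma E2_hom: "hom_on (Suc N + Suc N) E2"
proof -
  have p: "(\<lambda>y. f (join (Suc N) x0 y)) \<in> polyfun (Suc N)" if "f \<in> polyfun (Suc N + Suc N)" for f
    by (rule polyfun_join2[OF that])
  show ?thesis
    unfolding hom_on_def E2_def
  proof (intro conjI ballI)
    show "E (\<lambda>y. 1) = 1" by (simp add: E_const)
    fix f g assume "f \<in> polyfun (Suc N + Suc N)" "g \<in> polyfun (Suc N + Suc N)"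
    note P = p[OF this(1)] p[OF this(2)]
    show "E (\<lambda>y. f (join (Suc N) x0 y) + g (join (Suc N) x0 y)) =
        E (\<lambda>y. f (join (Suc N) x0 y)) + E (\<lambda>y. g (join (Suc N) x0 y))" by (rule E_add[OF P])
    show "E (\<lambda>y. f (join (Suc N) x0 y) * g (join (Suc N) x0 y)) =
        E (\<lambda>y. f (join (Suc N) x0 y)) * E (\<lambda>y. g (join (Suc N) x0 y))" by (rule E_mult[OF P])
  qed
qed

lemma E2_left: "f \<in> polyfun (Suc N) \<Longrightarrow> E2 f = fps_const (f x0)"
  by (simp add: E2_def polyfun_join_left E_const)

lemma E2_right: "E2 (\<lambda>z. f (\<lambda>i. z (i + Suc N))) = E f"
  unfolding E2_def join_shift ..

text \<open>If solutions under \<open>E2\<close> are determined by their coordinate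
  \<open>l0\<close>, elimination leaves at most one parameter. Without any parameter,
  \<open>\<phi>\<close> is 0 and \<open>j\<close> is a dummy: the second alternative of the last
  clause.\<close>

lemma line_elimination:
  assumes rows: "\<forall>e\<in>EE. \<forall>i. e i \<in> polyfun (Suc N + Suc N)"
    and uniq: "\<forall>w. (\<forall>e\<in>EE. (\<Sum>i<Suc N. E2 (e i) * w i) = 0) \<longrightarrow> w l0 = 0 \<longrightarrow> (\<forall>i<Suc N. w i = 0)"
  shows "\<exists>g j \<phi>. g \<in> polyfun (Suc N + Suc N) \<and> j < Suc N \<and> E2 g \<noteq> 0 \<and>
    (\<forall>z w. (\<forall>e\<in>EE. (\<Sum>i<Suc N. e i z * w i) = 0) \<longrightarrow> (\<forall>i<Suc N. g z * w i = \<phi> i z * w j)) \<and>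
    (\<forall>i. \<phi> i \<in> polyfun (Suc N + Suc N)) \<and>
    (\<forall>e\<in>EE. (\<Sum>i<Suc N. E2 (e i) * E2 (\<phi> i)) = 0) \<and>
    (\<phi> j = g \<or> (\<forall>i. \<phi> i = (\<lambda>_. 0)))"
proof -
  from elimination[OF E2_hom finite_lessThan[of "Suc N"] rows] obtain J1 g a1 where
    J1: "J1 \<subseteq> {..<Suc N}" and gp: "g \<in> polyfun (Suc N + Suc N)"
    and a1: "\<forall>i j. a1 i j \<in> polyfun (Suc N + Suc N)" and gE: "E2 g \<noteq> 0"
    and diag: "\<forall>i\<in>J1. \<forall>j\<in>J1. a1 i j = (if i = j then g else (\<lambda>_. 0))"
    and sol: "\<forall>v w. (\<forall>e\<in>EE. (\<Sum>i<Suc N. e i v * w i) = 0) \<longrightarrow> (\<forall>i\<in>{..<Suc N}. g v * w i = (\<Sum>j\<in>J1. a1 i j v * w j))"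
    and solE: "\<forall>e\<in>EE. \<forall>j\<in>J1. (\<Sum>i<Suc N. E2 (e i) * E2 (a1 i j)) = 0"
    by (elim exE conjE)
  note g = gp gE
  have sol': "g v * w i = (\<Sum>j\<in>J1. a1 i j v * w j)"
    if "\<forall>e\<in>EE. (\<Sum>i<Suc N. e i v * w i) = 0" "i < Suc N" for v w i
    using sol that by simp
  note H = uniq[rule_format]
  have single: "i = j" if ij: "i \<in> J1" "j \<in> J1" for i j
  proof (rule ccontr)
    assume "i \<noteq> j"
    let ?W = "\<lambda>j i. E2 (a1 i j)"
    \<comment> \<open>The combination of two columns whose coordinate \<open>l0\<close> cancels;
      uniqueness makes it 0.\<close>
    let ?w = "\<lambda>m. ?W i l0 * ?W j m - ?W j l0 * ?W i m"
    have "?w j = 0"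
    proof (rule H[where w = ?w])
      fix e assume e: "e \<in> EE"
      have "(\<Sum>m<Suc N. E2 (e m) * ?w m) =
          ?W i l0 * (\<Sum>m<Suc N. E2 (e m) * ?W j m) - ?W j l0 * (\<Sum>m<Suc N. E2 (e m) * ?W i m)"
        unfolding sum_distrib_left sum_subtractf[symmetric] by (rule sum.cong) (simp_all add: algebra_simps)
      then show "(\<Sum>m<Suc N. E2 (e m) * ?w m) = 0" using solE e ij by simp
    qed (use J1 ij in \<open>auto simp: mult.commute\<close>)
    then have Wi: "?W i l0 = 0" using diag ij \<open>i \<noteq> j\<close> g(2) by (simp add: hom_on_zero[OF E2_hom])
    have "?W i i = 0"
      by (rule H[where w = "?W i", OF _ Wi]) (use solE ij J1 in auto)
    then show False using diag ij g(2) by simp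
  qed
  show ?thesis
  proof (cases "J1 = {}")
    case True
    show ?thesis
      apply (rule exI[of _ g], rule exI[of _ 0], rule exI[of _ "\<lambda>_ _. 0"])
      using g sol' True by (simp add: polyfun.const hom_on_zero[OF E2_hom])
  next
    case False
    then obtain j where "j \<in> J1" by blast
    then have J1j: "J1 = {j}" using single by blast
    show ?thesis
      apply (rule exI[of _ g], rule exI[of _ j], rule exI[of _ "\<lambda>i. a1 i j"])
      using g a1 sol' solE diag J1 J1j by simp
  qed
qed

lemma E_lrow: "E (lrow k i) = (if i = k then E h else 0) - (if i \<in> J then E (a k i) else 0)"
proof -
  have p: "(\<lambda>x. if i = k then h x else 0) \<in> polyfun (Suc N)" "(\<lambda>x. if i \<in> J then a k i x else 0) \<in> polyfun (Suc N)"
    by (cases "i = k"; simp add: h_poly polyfun.const) (cases "i \<in> J"; simp add: a_poly polyfun.const)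
  have "E (lrow k i) = E (\<lambda>x. if i = k then h x else 0) - E (\<lambda>x. if i \<in> J then a k i x else 0)"
    unfolding lrow_def[abs_def] by (rule hom_on_diff[OF E_hom p])
  then show ?thesis by (cases "i = k"; cases "i \<in> J") (simp_all add: hom_on_zero[OF E_hom])
qed

lemma lamE_lrow: "k < Suc N \<Longrightarrow> (\<Sum>i<Suc N. E (lrow k i) * w i) = lamE k w"
  unfolding lamE_def by (rule sum_lrow) (rule E_lrow)

lemma lamF_lrow: "k < Suc N \<Longrightarrow> (\<Sum>i<Suc N. fps_const (lrow k i x0) * w i) = lamF k w"
  unfolding lamF_def
  by (rule sum_lrow[of "\<lambda>f. fps_const (f x0)"]) (simp_all add: lrow_def)

definition sffF :: "nat \<Rightarrow> (nat \<Rightarrow> complex fps) \<Rightarrow> (nat \<Rightarrow> complex fps) \<Rightarrow> complex fps" where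
  "sffF k u w = (\<Sum>i<Suc N. \<Sum>l<Suc N. fps_const (pd l (lrow k i) x0) * (u l * w i))"

lemma sffF_nth_1: "fps_nth (sffF k u w) 1 =
    sff k x0 (\<lambda>i. fps_nth (u i) 0) (\<lambda>i. fps_nth (w i) 1) + sff k x0 (\<lambda>i. fps_nth (u i) 1) (\<lambda>i. fps_nth (w i) 0)"
proof -
  have "fps_nth (sffF k u w) 1 = (\<Sum>i<Suc N. \<Sum>l<Suc N. pd l (lrow k i) x0 *
      (fps_nth (u l) 0 * fps_nth (w i) 1 + fps_nth (u l) 1 * fps_nth (w i) 0))"
    by (simp add: sffF_def fps_sum_nth fps_mult_nth_1)
  also have "\<dots> = (\<Sum>i<Suc N. (\<Sum>l<Suc N. pd l (lrow k i) x0 * fps_nth (u l) 0) * fps_nth (w i) 1 +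
      (\<Sum>l<Suc N. pd l (lrow k i) x0 * fps_nth (u l) 1) * fps_nth (w i) 0)"
    by (rule sum.cong[OF refl]) (simp add: distrib_left sum.distrib sum_distrib_right mult.assoc)
  finally show ?thesis by (simp add: sff_def dd_def sum.distrib)
qed

lemma sffF_scale_left: "sffF k (\<lambda>i. c * u i) w = c * sffF k u w"
  unfolding sffF_def sum_distrib_left by (intro sum.cong refl) (simp add: ac_simps)

lemma sffF_scale_right: "sffF k u (\<lambda>i. c * w i) = c * sffF k u w"
  unfolding sffF_def sum_distrib_left by (intro sum.cong refl) (simp add: ac_simps)

text \<open>The constant term of \<open>P\<close> is a multiple of \<open>x0\<close> and contributes
  nothing to the form. So the information sits at order 1, where only \<open>t0\<close> times the
  direction \<open>om s0\<close> survives, and \<open>B_kernel\<close> kills the leading term of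
  \<open>u\<close>.\<close>

lemma sffF_nondegenerate:
  assumes P: "\<And>i. i < Suc N \<Longrightarrow> fps_nth (P i) 0 = 2 * t0 * x0 i"
      "\<And>i. i < Suc N \<Longrightarrow> fps_nth (P i) 1 = t0 * om s0 i x0 + 2 * t1 * x0 i" "t0 \<noteq> 0"
    and u: "\<And>k. k \<in> K \<Longrightarrow> lamF k u = 0" "\<And>k. k \<in> K \<Longrightarrow> sffF k u P = 0" "u l0 = 0" and i: "i < Suc N"
  shows "u i = 0"
proof (rule ccontr)
  assume "u i \<noteq> 0"
  with fps_normalize[of "{..<Suc N}" u] i obtain m z where
    z: "\<forall>l\<in>{..<Suc N}. u l = fps_X ^ m * z l" and nz: "\<exists>l\<in>{..<Suc N}. fps_nth (z l) 0 \<noteq> 0" by blast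
  \<comment> \<open>Cut off beyond N so that the coefficient vectors are in
    \<open>cvec N\<close>.\<close>
  define y where "y l = (if l < Suc N then z l else 0)" for l
  have uy: "u l = fps_X ^ m * y l" if "l < Suc N" for l using z that by (simp add: y_def)
  have lu: "lamF k y = 0" if k: "k \<in> K" for k
  proof -
    have "fps_X ^ m * lamF k y = lamF k u"
      unfolding lamF_scale[symmetric] using KM[OF k] JM by (simp add: lamF_def uy cong: sum.cong)
    then show ?thesis using u(1)[OF k] by simp
  qed
  have su: "sffF k y P = 0" if k: "k \<in> K" for k
  proof -
    have "fps_X ^ m * sffF k y P = sffF k u P"
      unfolding sffF_scale_left[symmetric] unfolding sffF_def by (intro sum.cong refl) (simp add: uy)
    then show ?thesis using u(2)[OF k] by simp
  qed
  let ?y = "\<lambda>m i. fps_nth (y i) m"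
  have ytang: "?y m \<in> tang C N x0" for m
  proof -
    have "?y m \<in> cvec N" by (simp add: cvec_def y_def)
    moreover have "lam k x0 (?y m) = 0" if "k \<in> K" for k using lu[OF that] by (simp flip: lamF_nth)
    ultimately show ?thesis using tang_iff_lam[OF x0 h0] by blast
  qed
  then have ytv: "?y m \<in> tv C (Suc N) x0" for m by (simp add: tang_def)
  let ?r = "\<lambda>j. inverse (h x0) * ?y 0 j"
  have y0: "?y 0 = (\<lambda>i. om ?r i x0)" by (rule tang_om_divide[OF ytang h0])
  have rl: "?r l = 0" if "l \<in> J" for l
  proof (rule B_kernel[where r = ?r, OF _ _ that])
    have "fps_X ^ m * y l0 = 0" using uy[OF JM[OF l0(1)]] u(3) by simp
    then show "?r l0 = 0" by simp
    fix k assume k: "k \<in> K"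
    have "0 = sff k x0 (?y 0) (\<lambda>i. fps_nth (P i) 1) + sff k x0 (?y 1) (\<lambda>i. fps_nth (P i) 0)"
      unfolding sffF_nth_1[symmetric] su[OF k] by simp
    also have "sff k x0 (?y 0) (\<lambda>i. fps_nth (P i) 1) = sff k x0 (?y 0) (\<lambda>i. t0 * om s0 i x0 + (2 * t1) * x0 i)"
      by (rule sff_cong) (rule P(2))
    also have "sff k x0 (?y 1) (\<lambda>i. fps_nth (P i) 0) = sff k x0 (?y 1) (\<lambda>i. (2 * t0) * x0 i + 0 * x0 i)"
      by (rule sff_cong) (simp add: P(1))
    finally have "t0 * sff k x0 (?y 0) (\<lambda>i. om s0 i x0) = 0"
      unfolding sff_lincomb using sff_euler[OF x0 KM[OF k] ytv] by simp
    then have "lam k x0 (\<lambda>i. dd (Suc N) (om s0 i) x0 (?y 0)) = 0"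
      using P(3) sff_om[OF x0 KM[OF k] ytv] by simp
    then show "(\<Sum>l\<in>J. B k l * ?r l) = 0"
      unfolding B_apply[OF KM[OF k]] y0[symmetric] .
  qed
  have "om ?r i x0 = 0" for i
    unfolding om_def
  proof (rule sum.neutral, rule ballI)
    fix j assume "j \<in> J"
    from rl[OF this] show "a i j x0 * ?r j = 0" by (simp only: mult_zero_right)
  qed
  then have y00: "?y 0 l = 0" for l using fun_cong[OF y0, of l] by simp
  from nz obtain l where l: "l < Suc N" "fps_nth (z l) 0 \<noteq> 0" by blast
  from y00[of l] l show False by (simp add: y_def)
qed

text \<open>The last clause is the nondegeneracy of the second fundamental form at \<open>x\<close> in the direction \<open>\<phi>\<close>.\<close>

lemma arc_generic_pair:
  obtains g \<phi> where "g \<in> polyfun (Suc N + Suc N)" "\<And>i. \<phi> i \<in> polyfun (Suc N + Suc N)"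
    "\<exists>x\<in>C. \<exists>y\<in>C. g (join (Suc N) x y) \<noteq> 0"
    "\<And>x y. x \<in> C \<Longrightarrow> y \<in> C \<Longrightarrow> g (join (Suc N) x y) \<noteq> 0 \<Longrightarrow> h x \<noteq> 0 \<and> h y \<noteq> 0 \<and>
       (\<lambda>i. \<phi> i (join (Suc N) x y)) \<noteq> 0 \<and>
       (\<lambda>i. \<phi> i (join (Suc N) x y)) \<in> tang C N x \<inter> tang C N y \<and>
       (\<forall>w\<in>tang C N x \<inter> tang C N y. \<exists>c. w = cscale c (\<lambda>i. \<phi> i (join (Suc N) x y))) \<and>
       (\<forall>\<eta>. \<exists>u\<in>tang C N x. \<forall>k\<in>K. sff k x u (\<lambda>i. \<phi> i (join (Suc N) x y)) = \<eta> k)"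
proof -
  let ?M = "Suc N"
  define r1 where "r1 k = (\<lambda>i z. lrow k i z)" for k
  define r2 where "r2 k = (\<lambda>i z. lrow k i (\<lambda>j. z (j + ?M)))" for k
  have lrow2: "lrow k i \<in> polyfun (?M + ?M)" for k i by (rule polyfun_mono[OF lrow_poly]) simp
  have r1p: "r1 k i \<in> polyfun (?M + ?M)" for k i unfolding r1_def by (rule lrow2)
  have r2p: "r2 k i \<in> polyfun (?M + ?M)" for k i unfolding r2_def by (rule polyfun_shift[OF lrow_poly])
  have E1: "(\<Sum>i<?M. E2 (r1 k i) * w i) = lamF k w" if "k < ?M" for k w
    using lamF_lrow[OF that] by (simp add: r1_def E2_left[OF lrow_poly])
  have E2: "(\<Sum>i<?M. E2 (r2 k i) * w i) = lamE k w" if "k < ?M" for k w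
    using lamE_lrow[OF that] unfolding r2_def E2_right .
  have v1: "(\<Sum>i<?M. r1 k i (join ?M x y) * w i) = lam k x w" if "k < ?M" for k w x y
    using lam_lrow[OF that] by (simp add: r1_def polyfun_join_left[OF lrow_poly])
  have v2: "(\<Sum>i<?M. r2 k i (join ?M x y) * w i) = lam k y w" if "k < ?M" for k w x y
    using lam_lrow[OF that] unfolding r2_def join_shift by simp
  let ?EE = "r1 ` K \<union> r2 ` K"
  have rows1: "\<forall>e\<in>?EE. \<forall>i. e i \<in> polyfun (?M + ?M)" using r1p r2p by auto
  have H1: "w i = 0" if w: "\<And>e. e \<in> ?EE \<Longrightarrow> (\<Sum>i<?M. E2 (e i) * w i) = 0" "w l0 = 0" "i < ?M" for w i
  proof (rule common_tangent_unique[where w = w, OF _ _ w(2,3)])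
    fix k assume k: "k \<in> K"
    show "lamF k w = 0" unfolding E1[OF KM[OF k], symmetric] using w(1)[of "r1 k"] k by simp
    show "lamE k w = 0" unfolding E2[OF KM[OF k], symmetric] using w(1)[of "r2 k"] k by simp
  qed
  have "\<forall>w. (\<forall>e\<in>?EE. (\<Sum>i<?M. E2 (e i) * w i) = 0) \<longrightarrow> w l0 = 0 \<longrightarrow> (\<forall>i<?M. w i = 0)"
  proof (intro allI impI)
    fix w i assume "\<forall>e\<in>?EE. (\<Sum>i<?M. E2 (e i) * w i) = 0" "w l0 = 0" "i < ?M"
    then show "w i = 0" using H1[of w i] by simp
  qed
  from line_elimination[OF rows1 this] obtain g1 j1 \<phi>0 where
    g1: "g1 \<in> polyfun (?M + ?M)" and j1: "j1 < ?M" and Eg1: "E2 g1 \<noteq> 0"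
    and sol1: "\<forall>z w. (\<forall>e\<in>?EE. (\<Sum>i<?M. e i z * w i) = 0) \<longrightarrow> (\<forall>i<?M. g1 z * w i = \<phi>0 i z * w j1)"
    and \<phi>0: "\<forall>i. \<phi>0 i \<in> polyfun (?M + ?M)"
    and solE1: "\<forall>e\<in>?EE. (\<Sum>i<?M. E2 (e i) * E2 (\<phi>0 i)) = 0"
    and alt: "\<phi>0 j1 = g1 \<or> (\<forall>i. \<phi>0 i = (\<lambda>_. 0))"
    by (elim exE conjE)
  have sol: "g1 (join ?M x y) * w i = \<phi>0 i (join ?M x y) * w j1"
    if "\<And>k. k \<in> K \<Longrightarrow> lam k x w = 0" "\<And>k. k \<in> K \<Longrightarrow> lam k y w = 0" "i < ?M" for x y w i
  proof -
    have "\<forall>e\<in>?EE. (\<Sum>i<?M. e i (join ?M x y) * w i) = 0"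
      using that(1,2) v1 v2 KM by auto
    then show ?thesis using sol1 that(3) by blast
  qed
  \<comment> \<open>2n equations in 2n + 1 unknowns: the two tangency systems always have a common
    nonzero solution.\<close>
  have ex: "\<exists>w. (\<exists>i<?M. w i \<noteq> 0) \<and> (\<forall>k\<in>K. lam k x w = 0 \<and> lam k y w = 0)" for x y
  proof -
    let ?B = "K <+> K"
    let ?m = "\<lambda>b i. case b of Inl k \<Rightarrow> lrow k i x | Inr k \<Rightarrow> lrow k i y"
    have "card ?B < card {..<?M}" using finK cardK N_eq by (simp add: card_Plus)
    with kernel_exists[of ?B "{..<?M}" ?m] finK obtain w where
      w: "\<exists>i\<in>{..<?M}. w i \<noteq> 0" "\<forall>b\<in>?B. (\<Sum>i<?M. ?m b i * w i) = 0" by auto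
    have "lam k x w = 0 \<and> lam k y w = 0" if k: "k \<in> K" for k
      using InlI[OF k, of K] InrI[OF k, of K] bspec[OF w(2), of "Inl k"] bspec[OF w(2), of "Inr k"] k by (simp add: lam_lrow[OF KM[OF k]])
    then show ?thesis using w(1) by auto
  qed
  \<comment> \<open>With no parameter, a point where \<open>g1\<close> is nonzero would have only
    the zero common solution.\<close>
  have alt': "\<phi>0 j1 = g1"
  proof (rule ccontr)
    assume "\<phi>0 j1 \<noteq> g1"
    then have z: "\<phi>0 i z = 0" for i z using alt by simp
    have "\<exists>y. g1 (join ?M x0 y) \<noteq> 0"
    proof (rule ccontr)
      assume "\<not> ?thesis"
      then have "E2 g1 = 0" by (simp add: E2_def hom_on_zero[OF E_hom])
      then show False using Eg1 by simp
    qed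
    then obtain y where y: "g1 (join ?M x0 y) \<noteq> 0" ..
    from ex[of x0 y] obtain w i where w: "i < ?M" "w i \<noteq> 0" "\<forall>k\<in>K. lam k x0 w = 0 \<and> lam k y w = 0" by blast
    from sol[of x0 w y i] w y show False by (simp add: z)
  qed
  define \<phi> where "\<phi> i = (if i < ?M then \<phi>0 i else (\<lambda>_. 0))" for i
  have \<phi>: "\<phi> i \<in> polyfun (?M + ?M)" for i unfolding \<phi>_def using \<phi>0 by (simp add: polyfun.const)
  define \<Phi> where "\<Phi> i = E2 (\<phi> i)" for i
  have \<Phi>1: "lamF k \<Phi> = 0" and \<Phi>2: "lamE k \<Phi> = 0" if k: "k \<in> K" for k
  proof -
    have "(\<Sum>i<?M. f i * \<Phi> i) = (\<Sum>i<?M. f i * E2 (\<phi>0 i))" for f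
      by (rule sum.cong) (simp_all add: \<Phi>_def \<phi>_def)
    then have "(\<Sum>i<?M. E2 (r1 k i) * \<Phi> i) = 0" "(\<Sum>i<?M. E2 (r2 k i) * \<Phi> i) = 0"
      using bspec[OF solE1, of "r1 k"] bspec[OF solE1, of "r2 k"] k by simp_all
    then show "lamF k \<Phi> = 0" "lamE k \<Phi> = 0" by (simp_all add: E1 E2 KM[OF k])
  qed
  have \<Phi>l: "\<Phi> l0 \<noteq> 0"
  proof
    assume "\<Phi> l0 = 0"
    from common_tangent_unique[OF \<Phi>1 \<Phi>2 this j1] show False
      using Eg1 alt' j1 by (simp add: \<Phi>_def \<phi>_def)
  qed
  obtain P t0 t1 where P: "\<And>k. k \<in> K \<Longrightarrow> lamF k P = 0" "\<And>k. k \<in> K \<Longrightarrow> lamE k P = 0"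
    and Pn: "\<And>i. i < ?M \<Longrightarrow> fps_nth (P i) 0 = 2 * t0 * x0 i"
      "\<And>i. i < ?M \<Longrightarrow> fps_nth (P i) 1 = t0 * om s0 i x0 + 2 * t1 * x0 i" "t0 \<noteq> 0"
    by (rule common_tangent) (rule that)
  \<comment> \<open>Both vectors are common tangents, so by uniqueness they span the same line; this
    transfers the first-order expansion of \<open>P\<close> to the vector given by
    elimination.\<close>
  have proportional: "\<Phi> l0 * P i = P l0 * \<Phi> i" if "i < ?M" for i
  proof -
    have "\<Phi> l0 * P i - P l0 * \<Phi> i = 0"
      by (rule common_tangent_unique[of "\<lambda>i. \<Phi> l0 * P i - P l0 * \<Phi> i" i, OF _ _ _ that])
        (simp_all only: lamF_diff lamE_diff lamF_scale lamE_scale P \<Phi>1 \<Phi>2, simp_all add: mult.commute)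
    then show ?thesis by simp
  qed
  define r3 where "r3 k = (\<lambda>l z. \<Sum>i<?M. pd l (lrow k i) z * \<phi> i z)" for k
  have pdp: "pd l (lrow k i) \<in> polyfun (?M + ?M)" for l k i by (rule pd_polyfun[OF lrow2])
  have r3p: "r3 k l \<in> polyfun (?M + ?M)" for k l
    unfolding r3_def by (intro polyfun_intros pdp \<phi>)
  have E3: "(\<Sum>l<?M. E2 (r3 k l) * u l) = sffF k u \<Phi>" for k u
  proof -
    have "E2 (r3 k l) = (\<Sum>i<?M. fps_const (pd l (lrow k i) x0) * \<Phi> i)" for l
    proof -
      have "E2 (r3 k l) = (\<Sum>i<?M. E2 (\<lambda>z. pd l (lrow k i) z * \<phi> i z))"
        unfolding r3_def by (rule hom_on_sum[OF E2_hom]) (intro polyfun_intros pdp \<phi>)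
      then show ?thesis
        by (simp add: hom_on_mult[OF E2_hom pdp \<phi>] E2_left[OF pd_polyfun[OF lrow_poly]] \<Phi>_def)
    qed
    then show ?thesis
      unfolding sffF_def by (subst sum.swap) (simp add: sum_distrib_right sum_distrib_left ac_simps)
  qed
  have v3: "(\<Sum>l<?M. r3 k l (join ?M x y) * u l) = sff k x u (\<lambda>i. \<phi> i (join ?M x y))" for k x y u
    unfolding r3_def sff_def dd_def sum_distrib_right
    by (subst sum.swap) (simp add: polyfun_join_left[OF pd_polyfun[OF lrow_poly]] ac_simps)
  let ?EE2 = "r1 ` K \<union> r3 ` K"
  have rows2: "\<forall>e\<in>?EE2. \<forall>i. e i \<in> polyfun (?M + ?M)" using r1p r3p by auto
  have H2: "w i = 0" if w: "\<And>e. e \<in> ?EE2 \<Longrightarrow> (\<Sum>i<?M. E2 (e i) * w i) = 0" "w l0 = 0" "i < ?M" for w i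
  proof (rule sffF_nondegenerate[where u = w, OF Pn _ _ w(2,3)])
    fix k assume k: "k \<in> K"
    show "lamF k w = 0" unfolding E1[OF KM[OF k], symmetric] using w(1)[of "r1 k"] k by simp
    have "sffF k w \<Phi> = 0" unfolding E3[symmetric] using w(1)[of "r3 k"] k by simp
    then have "sffF k w (\<lambda>i. P l0 * \<Phi> i) = 0" by (simp add: sffF_scale_right)
    moreover have "sffF k w (\<lambda>i. \<Phi> l0 * P i) = sffF k w (\<lambda>i. P l0 * \<Phi> i)"
      unfolding sffF_def by (intro sum.cong refl) (simp add: proportional)
    ultimately have "sffF k w (\<lambda>i. \<Phi> l0 * P i) = 0" by simp
    then show "sffF k w P = 0" using \<Phi>l by (simp add: sffF_scale_right)
  qed
  have "\<forall>w. (\<forall>e\<in>?EE2. (\<Sum>i<?M. E2 (e i) * w i) = 0) \<longrightarrow> w l0 = 0 \<longrightarrow> (\<forall>i<?M. w i = 0)"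
  proof (intro allI impI)
    fix w i assume "\<forall>e\<in>?EE2. (\<Sum>i<?M. E2 (e i) * w i) = 0" "w l0 = 0" "i < ?M"
    then show "w i = 0" using H2[of w i] by simp
  qed
  from line_elimination[OF rows2 this] obtain g2 j2 \<psi> where
    g2: "g2 \<in> polyfun (?M + ?M)" and j2: "j2 < ?M" and Eg2: "E2 g2 \<noteq> 0"
    and sol2: "\<forall>z w. (\<forall>e\<in>?EE2. (\<Sum>i<?M. e i z * w i) = 0) \<longrightarrow> (\<forall>i<?M. g2 z * w i = \<psi> i z * w j2)"
    by (elim exE conjE)
  have hR: "(\<lambda>z. h (\<lambda>i. z (i + ?M))) \<in> polyfun (?M + ?M)" by (rule polyfun_shift[OF h_poly])
  have hL: "h \<in> polyfun (?M + ?M)" by (rule polyfun_mono[OF h_poly]) simp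
  \<comment> \<open>The chart must be valid at both points, \<open>g1\<close> is the pivot for the
    common line and \<open>g2\<close> the pivot for nondegeneracy at \<open>x\<close>. None of these
    factors vanishes under \<open>E2\<close>.\<close>
  define g where "g z = (h z * h (\<lambda>i. z (i + ?M))) * (g1 z * g2 z)" for z
  have gp: "g \<in> polyfun (?M + ?M)" unfolding g_def[abs_def] by (intro polyfun.mult hL hR g1 g2)
  have "E2 g = (fps_const (h x0) * E h) * (E2 g1 * E2 g2)"
    unfolding g_def[abs_def] hom_on_mult[OF E2_hom polyfun.mult[OF hL hR] polyfun.mult[OF g1 g2]]
      hom_on_mult[OF E2_hom hL hR] hom_on_mult[OF E2_hom g1 g2] E2_right E2_left[OF h_poly] ..
  then have Eg: "E2 g \<noteq> 0" using h0 E_h Eg1 Eg2 by simp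
  have "\<exists>y\<in>C. g (join ?M x0 y) \<noteq> 0"
  proof (rule ccontr)
    assume "\<not> ?thesis"
    then have "E2 g = 0" unfolding E2_def by (intro E_vanish polyfun_join2[OF gp]) blast
    then show False using Eg by simp
  qed
  then have gne: "\<exists>x\<in>C. \<exists>y\<in>C. g (join ?M x y) \<noteq> 0" using x0 by blast
  show ?thesis
  proof (rule that[OF gp \<phi> gne])
    fix x y assume x: "x \<in> C" and y: "y \<in> C" and "g (join ?M x y) \<noteq> 0"
    then have hx: "h x \<noteq> 0" and hy: "h y \<noteq> 0" and g1z: "g1 (join ?M x y) \<noteq> 0" and g2z: "g2 (join ?M x y) \<noteq> 0"
      unfolding g_def polyfun_join_left[OF h_poly] join_shift by auto
    let ?v = "\<lambda>i. \<phi> i (join ?M x y)"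
    have gv: "g1 (join ?M x y) * w i = ?v i * w j1" if "w \<in> cvec N" "\<And>k. k \<in> K \<Longrightarrow> lam k x w = 0"
      "\<And>k. k \<in> K \<Longrightarrow> lam k y w = 0" for w i
      using sol[of x w y i] that by (cases "i < ?M") (simp_all add: \<phi>_def cvec_def)
    from ex[of x y] obtain w' i0 where w': "i0 < ?M" "w' i0 \<noteq> 0" "\<forall>k\<in>K. lam k x w' = 0 \<and> lam k y w' = 0" by blast
    define w where "w = trunc w'"
    have wc: "w \<in> cvec N" by (simp add: w_def cvec_def)
    have wl: "lam k x w = 0" "lam k y w = 0" if "k \<in> K" for k
    proof -
      have "lam k x w = lam k x w'" for x
        unfolding lam_def w_def using KM[OF that] JM by (simp cong: sum.cong)
      then show "lam k x w = 0" "lam k y w = 0" using w'(3) that by auto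
    qed
    note gw = gv[OF wc wl]
    have wj: "w j1 \<noteq> 0"
    proof
      assume "w j1 = 0"
      then have "w i0 = 0" using gw[of i0] g1z by simp
      then show False using w' by (simp add: w_def)
    qed
    have vw: "?v = cscale (g1 (join ?M x y) / w j1) w"
      using gw wj by (auto simp: cscale_def fun_eq_iff field_simps)
    have wt: "w \<in> tang C N x \<inter> tang C N y"
      using tang_iff_lam[OF x hx wc] tang_iff_lam[OF y hy wc] wl by blast
    have sc: "cscale c w \<in> tang C N x" if "w \<in> tang C N x" for c w x
      using that unfolding tang_def cscale_def tv_def by (auto simp: dd_lin_scale cvec_def)
    have vt: "?v \<in> tang C N x \<inter> tang C N y" unfolding vw using wt sc by blast
    have v0: "?v \<noteq> 0"
    proof
      assume "?v = 0"
      then have "?v j1 = 0" by (simp add: fun_eq_iff)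
      then show False using gw[of j1] g1z wj by simp
    qed
    have line: "\<exists>c. w = cscale c ?v" if w: "w \<in> tang C N x \<inter> tang C N y" for w
    proof -
      have "w \<in> cvec N" using w by (simp add: tang_def)
      moreover have "lam k x w = 0" "lam k y w = 0" if "k \<in> K" for k
        using w KM[OF that] by (auto simp: tang_def intro: lam_tv)
      ultimately have "g1 (join ?M x y) * w i = ?v i * w j1" for i by (rule gv)
      then have "w = cscale (w j1 / g1 (join ?M x y)) ?v"
        using g1z by (auto simp: cscale_def fun_eq_iff field_simps)
      then show ?thesis ..
    qed
    have surj: "\<exists>u\<in>tang C N x. \<forall>k\<in>K. sff k x u ?v = \<eta> k" for \<eta>
    proof -
      \<comment> \<open>The n components of the form leave a kernel line. The extra row fixes
        coordinate \<open>j2\<close>, making the system square and, by the second elimination,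
        injective.\<close>
      let ?B = "insert None (Some ` K)"
      let ?m = "\<lambda>b l. case b of None \<Rightarrow> a j2 l x | Some k \<Rightarrow> sff k x (\<lambda>i. a i l x) ?v"
      have sm: "(\<Sum>l\<in>J. ?m (Some k) l * r l) = sff k x (\<lambda>i. om r i x) ?v" for k r
      proof -
        have "dd ?M f x (\<lambda>i. om r i x) = (\<Sum>l\<in>J. dd ?M f x (\<lambda>i. a i l x) * r l)" for f
          unfolding om_def by (simp add: dd_lin_sum dd_lin_scale mult.commute[of _ "r _"])
        then have "sff k x (\<lambda>i. om r i x) ?v = (\<Sum>i<?M. \<Sum>l\<in>J. dd ?M (lrow k i) x (\<lambda>i. a i l x) * ?v i * r l)"
          unfolding sff_def by (simp add: sum_distrib_right mult.assoc mult.commute[of "\<phi> _ _"])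
        also have "\<dots> = (\<Sum>l\<in>J. sff k x (\<lambda>i. a i l x) ?v * r l)"
          unfolding sff_def by (subst sum.swap) (simp add: sum_distrib_right)
        finally show ?thesis by simp
      qed
      have "\<exists>r. \<forall>b\<in>?B. (\<Sum>l\<in>J. ?m b l * r l) = (case b of None \<Rightarrow> 0 | Some k \<Rightarrow> \<eta> k)"
      proof (rule inj_imp_surj)
        show "card ?B = card J" using finK by (simp add: card_image cardK cardJ)
        fix r assume r: "\<And>b. b \<in> ?B \<Longrightarrow> (\<Sum>l\<in>J. ?m b l * r l) = 0"
        let ?u = "\<lambda>i. om r i x"
        have u0: "?u j2 = 0" using r[of None] by (simp add: om_def)
        have "\<forall>e\<in>?EE2. (\<Sum>i<?M. e i (join ?M x y) * ?u i) = 0"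
        proof
          fix e assume "e \<in> ?EE2"
          then consider k where "k \<in> K" "e = r1 k" | k where "k \<in> K" "e = r3 k" by blast
          then show "(\<Sum>i<?M. e i (join ?M x y) * ?u i) = 0"
          proof cases
            case 1
            then show ?thesis by (simp only: v1[OF KM] lam_om[OF x KM])
          next
            case 2
            then have "sff k x ?u ?v = 0" using r[of "Some k"] unfolding sm by simp
            then show ?thesis by (simp only: 2(2) v3)
          qed
        qed
        from mp[OF spec[OF spec[OF sol2]] this] have "\<forall>i<?M. g2 (join ?M x y) * ?u i = \<psi> i (join ?M x y) * ?u j2" .
        then have "?u i = 0" if "i < ?M" for i using that g2z u0 by simp
        then show "\<forall>l\<in>J. r l = 0" using om_J[of _ r x] JM hx by auto
      qed (use finK finJ in auto)
      then obtain r where r: "\<forall>b\<in>?B. (\<Sum>l\<in>J. ?m b l * r l) = (case b of None \<Rightarrow> 0 | Some k \<Rightarrow> \<eta> k)" ..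
      have "sff k x (\<lambda>i. om r i x) ?v = \<eta> k" if "k \<in> K" for k
        using bspec[OF r, of "Some k"] that unfolding sm by simp
      then show ?thesis using om_tang[OF x] by blast
    qed
    show "h x \<noteq> 0 \<and> h y \<noteq> 0 \<and> ?v \<noteq> 0 \<and> ?v \<in> tang C N x \<inter> tang C N y \<and>
       (\<forall>w\<in>tang C N x \<inter> tang C N y. \<exists>c. w = cscale c ?v) \<and>
       (\<forall>\<eta>. \<exists>u\<in>tang C N x. \<forall>k\<in>K. sff k x u ?v = \<eta> k)"
      using hx hy v0 vt line surj by (intro conjI ballI allI)
  qed
qed

end

section \<open>A generic point lies on two tangent spaces meeting only there\<close>

lemma cscale_tang: "w \<in> tang C N x \<Longrightarrow> cscale c w \<in> tang C N x"
  unfolding tang_def cscale_def tv_def by (auto simp: dd_lin_scale cvec_def)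

context charted
begin

lemma generic_pair:
  obtains g \<phi> where "g \<in> polyfun (Suc N + Suc N)" "\<And>i. \<phi> i \<in> polyfun (Suc N + Suc N)"
    "\<exists>x\<in>C. \<exists>y\<in>C. g (join (Suc N) x y) \<noteq> 0"
    "\<And>x y. x \<in> C \<Longrightarrow> y \<in> C \<Longrightarrow> g (join (Suc N) x y) \<noteq> 0 \<Longrightarrow> h x \<noteq> 0 \<and> h y \<noteq> 0 \<and>
       (\<lambda>i. \<phi> i (join (Suc N) x y)) \<noteq> 0 \<and>
       (\<lambda>i. \<phi> i (join (Suc N) x y)) \<in> tang C N x \<inter> tang C N y \<and>
       (\<forall>w\<in>tang C N x \<inter> tang C N y. \<exists>c. w = cscale c (\<lambda>i. \<phi> i (join (Suc N) x y))) \<and>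
       (\<forall>\<eta>. \<exists>u\<in>tang C N x. \<forall>k\<in>K. sff k x u (\<lambda>i. \<phi> i (join (Suc N) x y)) = \<eta> k)"
proof -
  from submersive_point obtain x0 s0 where x0: "x0 \<in> C" "h x0 \<noteq> 0"
    "\<forall>y. \<exists>u\<in>tang C N x0. \<forall>k\<in>K. lam k x0 (\<lambda>i. dd (Suc N) (om s0 i) x0 u) = y k"
    by (elim bexE conjE exE)
  then interpret arc C N n J h a x0 s0
    by unfold_locales blast+
  show ?thesis by (rule arc_generic_pair) (rule that)
qed

text \<open>The map \<open>(c, x, y) \<mapsto> c \<phi>(x, y)\<close> is dominant because its differential is onto at generic points:
  modulo the line \<open>\<phi>\<close>, the space \<open>\<complex>\<^bsup>N+1\<^esup>\<close> is the sum of its quotients by the two tangent spaces, and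
  there the differential is given by the second fundamental forms at \<open>x\<close> and \<open>y\<close>.\<close>

theorem spanning_pair:
  "\<exists>u\<in>polyfun (Suc N). (\<exists>p. u p \<noteq> 0) \<and> (\<forall>P. u P \<noteq> 0 \<longrightarrow>
    (\<exists>x\<in>C. \<exists>y\<in>C. trunc P \<in> tang C N x \<inter> tang C N y \<and>
      (trunc P \<noteq> 0 \<longrightarrow> (\<forall>w\<in>tang C N x \<inter> tang C N y. \<exists>c. w = cscale c (trunc P)))))"
proof -
  let ?M = "Suc N"
  define M2 where "M2 = ?M + ?M"
  obtain g \<phi> where g: "g \<in> polyfun M2" and \<phi>: "\<And>i. \<phi> i \<in> polyfun M2"
    and gne: "\<exists>x\<in>C. \<exists>y\<in>C. g (join ?M x y) \<noteq> 0"
    and pair: "\<And>x y. x \<in> C \<Longrightarrow> y \<in> C \<Longrightarrow> g (join ?M x y) \<noteq> 0 \<Longrightarrow> h x \<noteq> 0 \<and> h y \<noteq> 0 \<and>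
       (\<lambda>i. \<phi> i (join ?M x y)) \<noteq> 0 \<and>
       (\<lambda>i. \<phi> i (join ?M x y)) \<in> tang C N x \<inter> tang C N y \<and>
       (\<forall>w\<in>tang C N x \<inter> tang C N y. \<exists>c. w = cscale c (\<lambda>i. \<phi> i (join ?M x y))) \<and>
       (\<forall>\<eta>. \<exists>u\<in>tang C N x. \<forall>k\<in>K. sff k x u (\<lambda>i. \<phi> i (join ?M x y)) = \<eta> k)"
    using that unfolding M2_def by (rule generic_pair)
  define v where "v x y i = \<phi> i (join ?M x y)" for x y i
  define D2 where "D2 = (\<lambda>(x, y). join ?M x y) ` (C \<times> C)"
  have PD2: "prime_on D2 (polyfun M2)" unfolding D2_def M2_def by (rule prime_on_join[OF prime prime])
  \<comment> \<open>\<open>g\<close> with the two points exchanged: \<open>generic_pair\<close>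
    gives nondegeneracy at the first point only, and it is needed at both.\<close>
  define gs where "gs z = g (join ?M (\<lambda>i. z (i + ?M)) z)" for z
  have gs: "gs \<in> polyfun M2"
    unfolding gs_def[abs_def]
  proof (rule polyfun_compose[OF g])
    fix i assume "i < M2"
    then show "(\<lambda>z. join ?M (\<lambda>i. z (i + ?M)) z i) \<in> polyfun M2"
      by (cases "i < ?M") (auto simp: join_def M2_def intro: polyfun.coord)
  qed
  have gs_join: "gs (join ?M x y) = g (join ?M y x)" for x y
    unfolding gs_def join_shift
    by (rule polyfun_cong[OF g]) (auto simp: join_def M2_def)
  define G where "G z = g z * gs z" for z
  have G: "G \<in> polyfun M2" unfolding G_def[abs_def] by (intro polyfun.mult g gs)
  obtain z2 where z2: "z2 \<in> D2" "G z2 \<noteq> 0"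
  proof -
    obtain x y where xy: "x \<in> C" "y \<in> C" "g (join ?M x y) \<noteq> 0" using gne by blast
    then have "join ?M x y \<in> D2" "join ?M y x \<in> D2" "gs (join ?M y x) \<noteq> 0" by (auto simp: D2_def gs_join)
    from prime_onD[where f = g and g = gs, OF PD2 g gs this(1) xy(3) this(2,3)]
    show ?thesis using that by (auto simp: G_def)
  qed
  have good: "h x \<noteq> 0 \<and> h y \<noteq> 0 \<and> v x y \<noteq> 0 \<and> v x y \<in> tang C N x \<inter> tang C N y \<and>
      (\<forall>w\<in>tang C N x \<inter> tang C N y. \<exists>c. w = cscale c (v x y)) \<and>
      (\<forall>\<eta>. \<exists>u\<in>tang C N x. \<forall>k\<in>K. sff k x u (v x y) = \<eta> k) \<and>
      (\<forall>\<eta>. \<exists>u\<in>tang C N y. \<forall>k\<in>K. sff k y u (v x y) = \<eta> k)"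
    if x: "x \<in> C" and y: "y \<in> C" and Gz: "G (join ?M x y) \<noteq> 0" for x y
  proof -
    have gg: "g (join ?M x y) \<noteq> 0" "g (join ?M y x) \<noteq> 0" using Gz by (auto simp: G_def gs_join)
    note p = pair[OF x y gg(1), folded v_def]
    note q = pair[OF y x gg(2), folded v_def]
    have "v y x \<in> tang C N x \<inter> tang C N y" using q by blast
    with p obtain c where c: "v y x = cscale c (v x y)" by blast
    have c0: "c \<noteq> 0"
    proof
      assume "c = 0"
      then have "v y x = 0" unfolding c by (simp add: cscale_def fun_eq_iff)
      then show False using q by blast
    qed
    \<comment> \<open>\<open>v y x\<close> spans the same line as \<open>v x y\<close>, so
      nondegeneracy at \<open>y\<close> transfers up to the scalar \<open>c\<close>.\<close>
    have "\<exists>u\<in>tang C N y. \<forall>k\<in>K. sff k y u (v x y) = \<eta> k" for \<eta>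
    proof -
      from q have "\<forall>\<eta>. \<exists>u\<in>tang C N y. \<forall>k\<in>K. sff k y u (v y x) = \<eta> k" by blast
      from bexE[OF this[rule_format, of "\<lambda>k. c * \<eta> k"]] obtain u where
        u: "u \<in> tang C N y" "\<forall>k\<in>K. sff k y u (v y x) = c * \<eta> k" .
      have "sff k y u (v y x) = c * sff k y u (v x y)" for k
        unfolding c cscale_def by (rule sff_scale)
      then have "\<forall>k\<in>K. sff k y u (v x y) = \<eta> k" using u(2) c0 by simp
      then show ?thesis by (rule bexI[OF _ u(1)])
    qed
    with p show ?thesis by blast
  qed
  define L1 where "L1 k z = (\<Sum>i<?M. lrow k i z * \<phi> i z)" for k z
  define L2 where "L2 k z = (\<Sum>i<?M. lrow k i (\<lambda>j. z (j + ?M)) * \<phi> i z)" for k z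
  have lrow2: "lrow k i \<in> polyfun M2" for k i
    unfolding M2_def by (rule polyfun_mono[OF lrow_poly]) simp
  have lrow2': "(\<lambda>z. lrow k i (\<lambda>j. z (j + ?M))) \<in> polyfun M2" for k i
    unfolding M2_def by (rule polyfun_shift[OF lrow_poly])
  have L1: "L1 k \<in> polyfun M2" for k unfolding L1_def[abs_def] by (intro polyfun_intros lrow2 \<phi>)
  have L2: "L2 k \<in> polyfun M2" for k unfolding L2_def[abs_def] by (intro polyfun_intros lrow2' \<phi>)
  have L1j: "L1 k (join ?M x y) = lam k x (v x y)" if "k < ?M" for k x y
    unfolding L1_def lam_lrow[OF that] v_def polyfun_join_left[OF lrow_poly] ..
  have L2j: "L2 k (join ?M x y) = lam k y (v x y)" if "k < ?M" for k x y
    unfolding L2_def lam_lrow[OF that] v_def join_shift ..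
  \<comment> \<open>Known at good pairs, extended to all pairs by primality, so that it may be
    differentiated along tangent vectors of the product.\<close>
  have van: "L1 k z = 0 \<and> L2 k z = 0" if k: "k < ?M" and z: "z \<in> D2" for k z
  proof -
    have *: "L1 k z = 0 \<and> L2 k z = 0" if "z \<in> D2" "G z \<noteq> 0" for z
    proof -
      from that(1) obtain x y where xy: "x \<in> C" "y \<in> C" "z = join ?M x y" by (auto simp: D2_def)
      from good[OF xy(1,2)] that(2) xy(3) have "v x y \<in> tv C ?M x" "v x y \<in> tv C ?M y" by (auto simp: tang_def)
      then show ?thesis unfolding xy(3) L1j[OF k] L2j[OF k] using lam_tv k by blast
    qed
    show ?thesis
      using prime_on_cancel[where h = G and f = "L1 k" and x = z2, OF PD2 G L1 z2 _ z]
        prime_on_cancel[where h = G and f = "L2 k" and x = z2, OF PD2 G L2 z2 _ z] * by blast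
  qed
  let ?D = "(\<lambda>(c, z). join 1 c z) ` (UNIV \<times> D2)"
  have PD: "prime_on ?D (polyfun (1 + M2))" by (rule prime_on_join[OF prime_on_UNIV PD2])
  \<comment> \<open>Coordinate 0 is the scalar \<open>c\<close>; the pair (x, y) is shifted behind
    it.\<close>
  define F where "F i z = z 0 * \<phi> i (\<lambda>j. z (j + 1))" for i z
  have c0p: "(\<lambda>z. z 0) \<in> polyfun (1 + M2)" by (intro polyfun.coord) simp
  have \<phi>s: "(\<lambda>z. \<phi> i (\<lambda>j. z (j + 1))) \<in> polyfun (1 + M2)" for i by (rule polyfun_shift[OF \<phi>])
  have F: "F i \<in> polyfun (1 + M2)" for i unfolding F_def[abs_def] by (intro polyfun.mult c0p \<phi>s)
  \<comment> \<open>Moving x by \<open>u\<close> and y by \<open>u'\<close> changes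
    \<open>\<phi>\<close> by a vector whose images under \<open>lam\<close> at x and at y can be
    prescribed independently. What remains of the target is tangent at both points, hence a multiple
    of \<open>\<phi>\<close>, and is produced by varying the scalar.\<close>
  have submersive: "\<exists>w\<in>tv ?D (1 + M2) (join 1 c (join ?M x y)). \<forall>i<?M. dd (1 + M2) (F i) (join 1 c (join ?M x y)) w = \<tau> i"
    if c: "c 0 \<noteq> 0" and x: "x \<in> C" and y: "y \<in> C" and Gz: "G (join ?M x y) \<noteq> 0" for c x y \<tau>
  proof -
    note gd = good[OF x y Gz]
    from gd have "\<forall>\<eta>. \<exists>u\<in>tang C N x. \<forall>k\<in>K. sff k x u (v x y) = \<eta> k" by blast
    from bexE[OF this[rule_format, of "\<lambda>k. - lam k x \<tau> / c 0"]] obtain u where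
      u: "u \<in> tang C N x" "\<forall>k\<in>K. sff k x u (v x y) = - lam k x \<tau> / c 0" .
    from gd have "\<forall>\<eta>. \<exists>u\<in>tang C N y. \<forall>k\<in>K. sff k y u (v x y) = \<eta> k" by blast
    from bexE[OF this[rule_format, of "\<lambda>k. - lam k y \<tau> / c 0"]] obtain u' where
      u': "u' \<in> tang C N y" "\<forall>k\<in>K. sff k y u' (v x y) = - lam k y \<tau> / c 0" .
    have t: "join ?M u u' \<in> tv D2 M2 (join ?M x y)"
      unfolding D2_def M2_def by (rule tv_join) (use u u' x y in \<open>auto simp: tang_def\<close>)
    define \<psi> where "\<psi> i = dd M2 (\<phi> i) (join ?M x y) (join ?M u u')" for i
    have d1: "lam k x \<psi> + sff k x u (v x y) = 0" if k: "k < ?M" for k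
    proof -
      have "0 = dd M2 (L1 k) (join ?M x y) (join ?M u u')"
        by (rule tvD[OF t L1, symmetric]) (rule conjunct1[OF van[OF k]])
      also have "\<dots> = (\<Sum>i<?M. dd M2 (\<lambda>z. lrow k i z * \<phi> i z) (join ?M x y) (join ?M u u'))"
        unfolding L1_def[abs_def] by (rule dd_sum[where m = M2]) (intro polyfun.mult lrow2 \<phi>)
      also have "\<dots> = (\<Sum>i<?M. lrow k i x * \<psi> i + dd ?M (lrow k i) x u * v x y i)"
      proof (rule sum.cong[OF refl])
        fix i
        have "dd M2 (lrow k i) (join ?M x y) (join ?M u u') = dd ?M (lrow k i) x u"
          unfolding M2_def dd_join_left[OF lrow_poly] by (rule dd_cong[OF lrow_poly]) auto
        then show "dd M2 (\<lambda>z. lrow k i z * \<phi> i z) (join ?M x y) (join ?M u u') =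
            lrow k i x * \<psi> i + dd ?M (lrow k i) x u * v x y i"
          unfolding dd_mult[OF lrow2 \<phi>] polyfun_join_left[OF lrow_poly] \<psi>_def v_def by simp
      qed
      also have "\<dots> = lam k x \<psi> + sff k x u (v x y)"
        by (simp add: lam_lrow[OF k] sff_def sum.distrib)
      finally show ?thesis by simp
    qed
    have d2: "lam k y \<psi> + sff k y u' (v x y) = 0" if k: "k < ?M" for k
    proof -
      have "0 = dd M2 (L2 k) (join ?M x y) (join ?M u u')"
        by (rule tvD[OF t L2, symmetric]) (rule conjunct2[OF van[OF k]])
      also have "\<dots> = (\<Sum>i<?M. dd M2 (\<lambda>z. lrow k i (\<lambda>j. z (j + ?M)) * \<phi> i z) (join ?M x y) (join ?M u u'))"
        unfolding L2_def[abs_def] by (rule dd_sum[where m = M2]) (intro polyfun.mult lrow2' \<phi>)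
      also have "\<dots> = (\<Sum>i<?M. lrow k i y * \<psi> i + dd ?M (lrow k i) y u' * v x y i)"
      proof (rule sum.cong[OF refl])
        fix i
        have "dd M2 (\<lambda>z. lrow k i (\<lambda>j. z (j + ?M))) (join ?M x y) (join ?M u u') = dd ?M (lrow k i) y u'"
          unfolding M2_def dd_shift[OF lrow_poly] join_shift ..
        then show "dd M2 (\<lambda>z. lrow k i (\<lambda>j. z (j + ?M)) * \<phi> i z) (join ?M x y) (join ?M u u') =
            lrow k i y * \<psi> i + dd ?M (lrow k i) y u' * v x y i"
          unfolding dd_mult[OF lrow2' \<phi>] join_shift \<psi>_def v_def by simp
      qed
      also have "\<dots> = lam k y \<psi> + sff k y u' (v x y)"
        by (simp add: lam_lrow[OF k] sff_def sum.distrib)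
      finally show ?thesis by simp
    qed
    let ?\<delta> = "trunc (\<lambda>i. \<tau> i - c 0 * \<psi> i)"
    have \<delta>c: "?\<delta> \<in> cvec N" by (simp add: cvec_def)
    have tr: "lam k z ?\<delta> = lam k z \<tau> - c 0 * lam k z \<psi>" if "k \<in> K" for k z
    proof -
      have "lam k z ?\<delta> = lam k z (\<lambda>i. \<tau> i - c 0 * \<psi> i)"
        unfolding lam_def using KM[OF that] JM by (simp cong: sum.cong)
      then show ?thesis by (simp add: lam_diff lam_scale)
    qed
    have "lam k x ?\<delta> = 0 \<and> lam k y ?\<delta> = 0" if k: "k \<in> K" for k
    proof -
      have "lam k x \<psi> = lam k x \<tau> / c 0" "lam k y \<psi> = lam k y \<tau> / c 0"
        using d1[OF KM[OF k]] d2[OF KM[OF k]] u(2) u'(2) k by simp_all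
      then show ?thesis unfolding tr[OF k] using c by simp
    qed
    then have "?\<delta> \<in> tang C N x \<inter> tang C N y"
      using tang_iff_lam[OF x _ \<delta>c] tang_iff_lam[OF y _ \<delta>c] gd by blast
    with gd obtain \<gamma> where \<gamma>: "?\<delta> = cscale \<gamma> (v x y)" by blast
    let ?w = "join 1 (\<lambda>_. \<gamma>) (join ?M u u')"
    have "(\<lambda>_. \<gamma>) \<in> tv UNIV 1 c"
    proof (rule tvI)
      fix f assume "f \<in> polyfun 1" "\<And>x. x \<in> UNIV \<Longrightarrow> f x = 0"
      then have "f = (\<lambda>_. 0)" by blast
      then show "dd 1 f c (\<lambda>_. \<gamma>) = 0" by simp
    qed
    then have wt: "?w \<in> tv ?D (1 + M2) (join 1 c (join ?M x y))"
      by (rule tv_join) (use t x y in \<open>auto simp: D2_def\<close>)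
    have "dd (1 + M2) (F i) (join 1 c (join ?M x y)) ?w = \<tau> i" if i: "i < ?M" for i
    proof -
      have "dd (1 + M2) (F i) (join 1 c (join ?M x y)) ?w = c 0 * \<psi> i + v x y i * \<gamma>"
        unfolding F_def[abs_def] dd_mult[OF c0p \<phi>s] dd_shift[OF \<phi>] join_shift \<psi>_def v_def dd_coord
        by simp
      moreover have "\<tau> i - c 0 * \<psi> i = \<gamma> * v x y i"
        using fun_cong[OF \<gamma>, of i] i by (simp add: cscale_def)
      ultimately show ?thesis by (simp add: algebra_simps)
    qed
    with wt show ?thesis by blast
  qed
  have ind: "indep_funs ?D ?M F"
    unfolding indep_funs_def
  proof (intro ballI impI allI)
    fix f p assume f: "f \<in> polyfun ?M" "\<forall>z\<in>?D. f (\<lambda>i. F i z) = 0"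
    \<comment> \<open>If a function vanishes on the image, surjectivity of the differential makes
      its derivatives vanish there too; so the family is closed under derivatives and the Taylor
      expansion at any image point is trivial.\<close>
    let ?Z = "{f \<in> polyfun ?M. \<forall>z\<in>?D. f (\<lambda>i. F i z) = 0}"
    have z0: "join 1 (\<lambda>_. 1) z2 \<in> ?D" using z2(1) by auto
    let ?P = "\<lambda>i. F i (join 1 (\<lambda>_. 1) z2)"
    show "f p = 0"
    proof (rule polyfun_zero_of_pd_closed[where Z = ?Z and m = ?M and P = ?P and f = f and v = p])
      fix f u assume "f \<in> ?Z"
      then have f: "f \<in> polyfun ?M" and fv: "\<And>z. z \<in> ?D \<Longrightarrow> f (\<lambda>i. F i z) = 0" by blast+
      have fp: "(\<lambda>v. dd ?M f v u) \<in> polyfun ?M" by (rule polyfun_dd[OF f]) (rule polyfun.const)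
      let ?H = "\<lambda>z. z 0 * G (\<lambda>j. z (j + 1))"
      have H: "?H \<in> polyfun (1 + M2)" by (intro polyfun.mult c0p polyfun_shift[OF G])
      have fF: "(\<lambda>z. f (\<lambda>i. F i z)) \<in> polyfun (1 + M2)" by (rule polyfun_compose[OF f]) (rule F)
      have "dd ?M f (\<lambda>i. F i z) u = 0" if "z \<in> ?D" for z
      proof (rule prime_on_cancel[where f = "\<lambda>z. dd ?M f (\<lambda>i. F i z) u" and h = ?H and x = "join 1 (\<lambda>_. 1) z2",
            OF PD H _ z0 _ _ that])
        show "(\<lambda>z. dd ?M f (\<lambda>i. F i z) u) \<in> polyfun (1 + M2)"
          by (rule polyfun_compose[OF fp]) (rule F)
        show "?H (join 1 (\<lambda>_. 1) z2) \<noteq> 0" unfolding join_shift using z2(2) by simp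
        fix z assume z: "z \<in> ?D" "?H z \<noteq> 0"
        then obtain c x y where xy: "x \<in> C" "y \<in> C" "z = join 1 c (join ?M x y)" by (auto simp: D2_def)
        have cG: "c 0 \<noteq> 0" "G (join ?M x y) \<noteq> 0" using z(2) unfolding xy(3) join_shift by auto
        from bexE[OF submersive[where c = c and x = x and y = y and \<tau> = u, OF cG(1) xy(1,2) cG(2)]]
        obtain w where w: "w \<in> tv ?D (1 + M2) z" "\<forall>i<?M. dd (1 + M2) (F i) z w = u i"
          unfolding xy(3) .
        have "0 = dd (1 + M2) (\<lambda>z. f (\<lambda>i. F i z)) z w"
          by (rule tvD[OF w(1) fF fv, symmetric])
        also have "\<dots> = dd ?M f (\<lambda>i. F i z) (\<lambda>i. dd (1 + M2) (F i) z w)"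
          by (rule dd_compose[OF f]) (rule F)
        also have "\<dots> = dd ?M f (\<lambda>i. F i z) u"
          by (rule dd_cong[OF f]) (use w(2) in auto)
        finally show "dd ?M f (\<lambda>i. F i z) u = 0" by simp
      qed
      with fp show "(\<lambda>v. dd ?M f v u) \<in> ?Z" by blast
    qed (use f z0 in auto)
  qed
  obtain x1 l where x1: "x1 \<in> C" "x1 l \<noteq> 0" "l < ?M"
  proof -
    obtain x1 where x1: "x1 \<in> C" using h_nonzero by blast
    from nonzero[OF x1] obtain l where l: "x1 l \<noteq> 0" by (auto simp: fun_eq_iff)
    have "x1 \<in> cvec N" using x1 in_cvec by blast
    then have "l < ?M" using l unfolding cvec_def by (metis (mono_tags) mem_Collect_eq not_less_eq)
    with x1 l show ?thesis by (rule that)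
  qed
  \<comment> \<open>Lifted points lie only in the closure of the product. The factor
    \<open>?co\<close> makes both components nonzero, as the assumption \<open>closed\<close>
    requires in order to return to C.\<close>
  let ?Gs = "\<lambda>z. G (\<lambda>j. z (j + 1))" and ?co = "\<lambda>z. z (1 + l) * z (1 + (?M + l))"
  have Gs: "?Gs \<in> polyfun (1 + M2)" by (rule polyfun_shift[OF G])
  have co: "?co \<in> polyfun (1 + M2)" by (intro polyfun.mult polyfun.coord) (use x1 in \<open>auto simp: M2_def\<close>)
  have a1: "join 1 (\<lambda>_. 1) z2 \<in> ?D" "?Gs (join 1 (\<lambda>_. 1) z2) \<noteq> 0"
    using z2 unfolding join_shift by auto
  have a2: "join 1 (\<lambda>_. 1) (join ?M x1 x1) \<in> ?D" "?co (join 1 (\<lambda>_. 1) (join ?M x1 x1)) \<noteq> 0"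
    unfolding join_ge(2) using x1 by (auto simp: D2_def)
  have HH: "(\<lambda>z. ?Gs z * ?co z) \<in> polyfun (1 + M2)" by (intro polyfun.mult[OF Gs co])
  have "\<exists>z\<in>?D. ?Gs z * ?co z \<noteq> 0"
    using prime_onD[where f = ?Gs and g = ?co, OF PD Gs co a1 a2] by auto
  from bexE[OF point_lift_fun[OF PD F ind HH this]] obtain u where u: "u \<in> polyfun ?M" and
    u2: "(\<exists>x. u x \<noteq> 0) \<and> (\<forall>a. u a \<noteq> 0 \<longrightarrow> (\<exists>z\<in>zcl ?D (1 + M2). (\<forall>i<?M. F i z = a i) \<and> ?Gs z * ?co z \<noteq> 0))" .
  have "\<exists>x\<in>C. \<exists>y\<in>C. trunc P \<in> tang C N x \<inter> tang C N y \<and>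
      (trunc P \<noteq> 0 \<longrightarrow> (\<forall>w\<in>tang C N x \<inter> tang C N y. \<exists>c. w = cscale c (trunc P)))" if P: "u P \<noteq> 0" for P
  proof -
    from u2 P obtain z where z: "z \<in> zcl ?D (1 + M2)" "\<forall>i<?M. F i z = P i" "?Gs z * ?co z \<noteq> 0" by blast
    have zz: "f z = 0" if "f \<in> polyfun (1 + M2)" "\<And>c x y. x \<in> C \<Longrightarrow> y \<in> C \<Longrightarrow> f (join 1 c (join ?M x y)) = 0" for f
      using z(1) that unfolding zcl_def D2_def by auto
    define x where "x = trunc (\<lambda>i. z (1 + i))"
    define y where "y = trunc (\<lambda>i. z (1 + (?M + i)))"
    have "x l \<noteq> 0" "y l \<noteq> 0" using z(3) x1(3) by (auto simp: x_def y_def)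
    then have nz: "x \<noteq> 0" "y \<noteq> 0" by (auto simp: fun_eq_iff)
    have cv: "x \<in> cvec N" "y \<in> cvec N" by (auto simp: x_def y_def cvec_def)
    have "x \<in> zcl C ?M"
      unfolding zcl_def
    proof (intro CollectI ballI impI)
      fix f assume f: "f \<in> polyfun ?M" "\<forall>x\<in>C. f x = 0"
      have "f (\<lambda>i. z (1 + i)) = 0"
      proof (rule zz)
        show "(\<lambda>z. f (\<lambda>i. z (1 + i))) \<in> polyfun (1 + M2)"
          by (rule polyfun_compose[OF f(1)]) (auto simp: M2_def intro: polyfun.coord)
        show "f (\<lambda>i. join 1 c (join ?M x y) (1 + i)) = 0" if "x \<in> C" for c x y
          unfolding join_ge(2) using f that by (simp add: polyfun_join_left[OF f(1)])
      qed
      moreover have "f x = f (\<lambda>i. z (1 + i))" by (rule polyfun_cong[OF f(1)]) (simp add: x_def)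
      ultimately show "f x = 0" by simp
    qed
    then have x: "x \<in> C" by (rule closed[OF cv(1) nz(1)])
    have "y \<in> zcl C ?M"
      unfolding zcl_def
    proof (intro CollectI ballI impI)
      fix f assume f: "f \<in> polyfun ?M" "\<forall>x\<in>C. f x = 0"
      have "f (\<lambda>i. z (1 + (?M + i))) = 0"
      proof (rule zz)
        show "(\<lambda>z. f (\<lambda>i. z (1 + (?M + i)))) \<in> polyfun (1 + M2)"
          by (rule polyfun_compose[OF f(1)]) (auto simp: M2_def intro: polyfun.coord)
        show "f (\<lambda>i. join 1 c (join ?M x y) (1 + (?M + i))) = 0" if "y \<in> C" for c x y
          unfolding join_ge(2) using f that by simp
      qed
      moreover have "f y = f (\<lambda>i. z (1 + (?M + i)))" by (rule polyfun_cong[OF f(1)]) (simp add: y_def)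
      ultimately show "f y = 0" by simp
    qed
    then have y: "y \<in> C" by (rule closed[OF cv(2) nz(2)])
    have zj: "f (\<lambda>j. z (j + 1)) = f (join ?M x y)" if "f \<in> polyfun M2" for f
    proof (rule polyfun_cong[OF that])
      fix i assume "i < M2"
      then show "z (i + 1) = join ?M x y i"
        by (cases "i < ?M") (auto simp: join_def x_def y_def M2_def)
    qed
    have "G (join ?M x y) \<noteq> 0" using z(3) zj[OF G] by auto
    note gd = good[OF x y this]
    have "v x y i = 0" if "\<not> i < ?M" for i
      using gd that by (auto simp: tang_def cvec_def)
    moreover have "P i = z 0 * v x y i" if "i < ?M" for i
      using z(2) that zj[OF \<phi>] by (auto simp: F_def v_def)
    ultimately have Pv: "trunc P = cscale (z 0) (v x y)"
      by (auto simp: cscale_def fun_eq_iff)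
    have "trunc P \<in> tang C N x \<inter> tang C N y"
      unfolding Pv using gd cscale_tang by blast
    moreover have "\<exists>c. w = cscale c (trunc P)" if "trunc P \<noteq> 0" "w \<in> tang C N x \<inter> tang C N y" for w
    proof -
      have z0: "z 0 \<noteq> 0" using that(1) unfolding Pv by (auto simp: cscale_def fun_eq_iff)
      from gd that(2) obtain c where "w = cscale c (v x y)" by blast
      then have "w = cscale (c / z 0) (trunc P)" unfolding Pv using z0 by (simp add: cscale_def)
      then show ?thesis ..
    qed
    ultimately show ?thesis using x y by blast
  qed
  then show ?thesis using u u2 by blast
qed

end

theorem (in tangential_cone) generic_spanning_pair:
  "\<exists>u\<in>polyfun (Suc N). (\<exists>p. u p \<noteq> 0) \<and> (\<forall>P\<in>cvec N. P \<noteq> 0 \<longrightarrow> u P \<noteq> 0 \<longrightarrow>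
    (\<exists>x\<in>C. \<exists>y\<in>C. P \<in> tang C N x \<inter> tang C N y \<and>
      (\<forall>w\<in>tang C N x \<inter> tang C N y. \<exists>c. w = cscale c P)))"
proof -
  have "\<exists>p\<in>C. cfun.dim (tang C N p) = Suc n"
  proof (rule ccontr)
    assume "\<not> ?thesis"
    then have "(1 :: complex) = 0"
      using dense[of "\<lambda>_. 1" undefined] polyfun.const by blast
    then show False by simp
  qed
  then obtain p where p: "p \<in> C" "cfun.dim (tang C N p) = Suc n" by blast
  from chart_exists[OF this] obtain J h a where c: "chart J h a" "h p \<noteq> 0" by blast
  interpret charted C N n J h a by unfold_locales (use c p in auto)
  from bexE[OF spanning_pair] obtain u where u: "u \<in> polyfun (Suc N)" and
    u2: "(\<exists>p. u p \<noteq> 0) \<and> (\<forall>P. u P \<noteq> 0 \<longrightarrow>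
    (\<exists>x\<in>C. \<exists>y\<in>C. trunc P \<in> tang C N x \<inter> tang C N y \<and>
      (trunc P \<noteq> 0 \<longrightarrow> (\<forall>w\<in>tang C N x \<inter> tang C N y. \<exists>c. w = cscale c (trunc P)))))" .
  have tr: "trunc P = P" if "P \<in> cvec N" for P using that by (auto simp: cvec_def)
  have "\<exists>x\<in>C. \<exists>y\<in>C. P \<in> tang C N x \<inter> tang C N y \<and>
      (\<forall>w\<in>tang C N x \<inter> tang C N y. \<exists>c. w = cscale c P)" if "P \<in> cvec N" "P \<noteq> 0" "u P \<noteq> 0" for P
    using conjunct2[OF u2, rule_format, OF that(3)] that(2) unfolding tr[OF that(1)] by simp
  then show ?thesis using u conjunct1[OF u2] by (intro bexI[of _ u] conjI ballI impI)
qed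

section \<open>Kaehler differentials\<close>

lemma free_module_simps:
  "h \<in> carrier (free_module R S) \<longleftrightarrow> (\<forall>s. h s \<in> carrier R) \<and> (\<forall>s. s \<notin> S \<longrightarrow> h s = \<zero>\<^bsub>R\<^esub>) \<and>
     finite {s. h s \<noteq> \<zero>\<^bsub>R\<^esub>}"
  "h \<oplus>\<^bsub>free_module R S\<^esub> k = (\<lambda>s. h s \<oplus>\<^bsub>R\<^esub> k s)"
  "\<zero>\<^bsub>free_module R S\<^esub> = (\<lambda>_. \<zero>\<^bsub>R\<^esub>)"
  "r \<odot>\<^bsub>free_module R S\<^esub> h = (\<lambda>s. r \<otimes>\<^bsub>R\<^esub> h s)"
  by (simp_all add: free_module_def)

lemma (in cring) free_module_module: "module R (free_module R S)"
proof (rule moduleI)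
  show "abelian_group (free_module R S)"
  proof (rule abelian_groupI)
    fix h k assume h: "h \<in> carrier (free_module R S)" and k: "k \<in> carrier (free_module R S)"
    have "{s. h s \<oplus> k s \<noteq> \<zero>} \<subseteq> {s. h s \<noteq> \<zero>} \<union> {s. k s \<noteq> \<zero>}"
      by auto
    then have "finite {s. h s \<oplus> k s \<noteq> \<zero>}"
      using h k by (auto simp: free_module_simps intro: finite_subset)
    then show "h \<oplus>\<^bsub>free_module R S\<^esub> k \<in> carrier (free_module R S)"
      using h k by (auto simp: free_module_simps)
  next
    fix h assume h: "h \<in> carrier (free_module R S)"
    have "finite {s. \<ominus> h s \<noteq> \<zero>}"
      using h by (auto simp: free_module_simps intro: rev_finite_subset)
    then have "(\<lambda>s. \<ominus> h s) \<in> carrier (free_module R S)"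
      using h by (auto simp: free_module_simps)
    moreover have "(\<lambda>s. \<ominus> h s) \<oplus>\<^bsub>free_module R S\<^esub> h = \<zero>\<^bsub>free_module R S\<^esub>"
      using h by (auto simp: free_module_simps l_neg)
    ultimately show "\<exists>k\<in>carrier (free_module R S). k \<oplus>\<^bsub>free_module R S\<^esub> h = \<zero>\<^bsub>free_module R S\<^esub>"
      by blast
  qed (auto simp: free_module_simps a_ac fun_eq_iff)
next
  fix r h assume r: "r \<in> carrier R" and h: "h \<in> carrier (free_module R S)"
  have "{s. r \<otimes> h s \<noteq> \<zero>} \<subseteq> {s. h s \<noteq> \<zero>}"
    using r by auto
  then have "finite {s. r \<otimes> h s \<noteq> \<zero>}"
    using h by (auto simp: free_module_simps intro: finite_subset)
  then show "r \<odot>\<^bsub>free_module R S\<^esub> h \<in> carrier (free_module R S)"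
    using r h by (auto simp: free_module_simps)
qed (auto simp: free_module_simps l_distr r_distr m_assoc fun_eq_iff is_cring)

lemma (in cring) free_gen_mem: "b \<in> carrier R \<Longrightarrow> free_gen R b \<in> carrier (free_module R (carrier R))"
proof -
  assume "b \<in> carrier R"
  moreover have "finite {s. free_gen R b s \<noteq> \<zero>}"
    by (rule finite_subset[of _ "{b}"]) (auto simp: free_gen_def)
  ultimately show ?thesis by (auto simp: free_module_simps free_gen_def)
qed

lemma submodule_zero_closed: "submodule H R M \<Longrightarrow> \<zero>\<^bsub>M\<^esub> \<in> H"
  using subgroup.one_closed[OF submodule.axioms(1)] by force

lemma (in module) submodule_minus_closed:
  assumes "submodule H R M" "x \<in> H" "y \<in> H"
  shows "x \<ominus>\<^bsub>M\<^esub> y \<in> H"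
  using submoduleE(3,5)[OF assms(1)] assms(2,3) by (simp add: a_minus_def)

lemma (in cring) kaehler_relators_closed:
  assumes "\<And>a. a \<in> carrier A \<Longrightarrow> \<phi> a \<in> carrier R"
  shows "kaehler_relators A R \<phi> \<subseteq> carrier (free_module R (carrier R))"
proof -
  interpret M: module R "free_module R (carrier R)" by (rule free_module_module)
  show ?thesis
    using assms by (auto simp: kaehler_relators_def Let_def free_gen_mem)
qed

text \<open>A derivation at a point gives a functional on the free module that kills all relators
  but not the symbol of \<open>x\<close>; hence that symbol survives in the quotient.\<close>

lemma (in cring) kaehler_differentials_nontrivial:
  fixes ev D :: "'a \<Rightarrow> complex"
  assumes \<phi>: "\<And>a. a \<in> carrier A \<Longrightarrow> \<phi> a \<in> carrier R"
    and ev_add: "\<And>b c. b \<in> carrier R \<Longrightarrow> c \<in> carrier R \<Longrightarrow> ev (b \<oplus> c) = ev b + ev c"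
    and ev_mult: "\<And>b c. b \<in> carrier R \<Longrightarrow> c \<in> carrier R \<Longrightarrow> ev (b \<otimes> c) = ev b * ev c"
    and ev_one: "ev \<one> = 1"
    and D_add: "\<And>b c. b \<in> carrier R \<Longrightarrow> c \<in> carrier R \<Longrightarrow> D (b \<oplus> c) = D b + D c"
    and D_mult: "\<And>b c. b \<in> carrier R \<Longrightarrow> c \<in> carrier R \<Longrightarrow> D (b \<otimes> c) = ev b * D c + ev c * D b"
    and D_phi: "\<And>a. a \<in> carrier A \<Longrightarrow> D (\<phi> a) = 0"
    and x: "x \<in> carrier R" "D x \<noteq> 0"
  shows "carrier (kaehler_differentials A R \<phi>) \<noteq> {\<one>\<^bsub>kaehler_differentials A R \<phi>\<^esub>}"
proof -
  define M where "M = free_module R (carrier R)"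
  interpret M: module R M unfolding M_def by (rule free_module_module)
  have gen: "free_gen R b \<in> carrier M" if "b \<in> carrier R" for b
    unfolding M_def by (rule free_gen_mem[OF that])
  have ev0: "ev \<zero> = 0" using ev_add[of \<zero> \<zero>] by simp
  define \<Phi> where "\<Phi> h = (\<Sum>s\<in>{s. h s \<noteq> \<zero>}. ev (h s) * D s)" for h
  have \<Phi>: "\<Phi> h = (\<Sum>s\<in>T. ev (h s) * D s)" if "finite T" "{s. h s \<noteq> \<zero>} \<subseteq> T" for h T
    unfolding \<Phi>_def by (rule sum.mono_neutral_left) (use that ev0 in auto)
  have \<Phi>_add: "\<Phi> (h \<oplus>\<^bsub>M\<^esub> k) = \<Phi> h + \<Phi> k" if "h \<in> carrier M" "k \<in> carrier M" for h k
  proof -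
    let ?T = "{s. h s \<noteq> \<zero>} \<union> {s. k s \<noteq> \<zero>}"
    have T: "finite ?T" using that by (auto simp: M_def free_module_simps)
    have "\<Phi> (h \<oplus>\<^bsub>M\<^esub> k) = (\<Sum>s\<in>?T. ev (h s \<oplus> k s) * D s)"
      unfolding M_def free_module_simps by (rule \<Phi>[OF T]) auto
    also have "\<dots> = (\<Sum>s\<in>?T. ev (h s) * D s) + (\<Sum>s\<in>?T. ev (k s) * D s)"
      using that by (simp add: M_def free_module_simps ev_add distrib_right sum.distrib)
    finally show ?thesis using \<Phi>[OF T, of h] \<Phi>[OF T, of k] by simp
  qed
  have \<Phi>_smult: "\<Phi> (r \<odot>\<^bsub>M\<^esub> h) = ev r * \<Phi> h" if "r \<in> carrier R" "h \<in> carrier M" for r h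
  proof -
    let ?T = "{s. h s \<noteq> \<zero>}"
    have T: "finite ?T" using that by (auto simp: M_def free_module_simps)
    have "\<Phi> (r \<odot>\<^bsub>M\<^esub> h) = (\<Sum>s\<in>?T. ev (r \<otimes> h s) * D s)"
      unfolding M_def free_module_simps by (rule \<Phi>[OF T]) (use that in auto)
    also have "\<dots> = ev r * (\<Sum>s\<in>?T. ev (h s) * D s)"
      using that by (simp add: M_def free_module_simps ev_mult sum_distrib_left mult.assoc)
    finally show ?thesis unfolding \<Phi>_def .
  qed
  have \<Phi>_gen: "\<Phi> (free_gen R b) = D b" for b
  proof -
    have "{s. free_gen R b s \<noteq> \<zero>} \<subseteq> {b}" by (auto simp: free_gen_def)
    from \<Phi>[OF _ this] show ?thesis using ev_one by (simp add: free_gen_def)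
  qed
  have \<Phi>0: "\<Phi> \<zero>\<^bsub>M\<^esub> = 0"
    by (simp add: \<Phi>_def M_def free_module_simps)
  have \<Phi>_inv: "\<Phi> (\<ominus>\<^bsub>M\<^esub> h) = - \<Phi> h" if "h \<in> carrier M" for h
    using \<Phi>_add[OF that M.a_inv_closed[OF that]] that \<Phi>0
    by (simp add: M.r_neg add_eq_0_iff)
  have \<Phi>_minus: "\<Phi> (h \<ominus>\<^bsub>M\<^esub> k) = \<Phi> h - \<Phi> k" if "h \<in> carrier M" "k \<in> carrier M" for h k
    using that by (simp add: a_minus_def \<Phi>_add \<Phi>_inv)
  define H where "H = {h \<in> carrier M. \<Phi> h = 0}"
  have sub: "submodule H R M"
    by (rule M.submoduleI) (auto simp: H_def \<Phi>0 \<Phi>_inv \<Phi>_add \<Phi>_smult)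
  have rel: "kaehler_relators A R \<phi> \<subseteq> H"
  proof
    fix h assume h: "h \<in> kaehler_relators A R \<phi>"
    then have "h \<in> carrier M"
      using kaehler_relators_closed[of A \<phi>] \<phi> unfolding M_def by blast
    moreover have "\<Phi> h = 0"
      using h unfolding kaehler_relators_def Let_def M_def[symmetric]
      by (auto simp: \<Phi>_minus \<Phi>_add \<Phi>_smult \<Phi>_gen gen \<phi> D_add D_mult D_phi)
    ultimately show "h \<in> H" by (simp add: H_def)
  qed
  define K where "K = submodule_gen R M (kaehler_relators A R \<phi>)"
  have "K \<subseteq> H" using sub rel unfolding K_def submodule_gen_def by blast
  then have "free_gen R x \<notin> K" using x \<Phi>_gen by (auto simp: H_def)
  have "\<zero>\<^bsub>M\<^esub> \<in> K"
    unfolding K_def submodule_gen_def by (auto intro: submodule_zero_closed)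
  then have mem: "free_gen R x \<in> K +>\<^bsub>M\<^esub> free_gen R x"
    using gen[OF x(1)] by (force simp: a_r_coset_def')
  have "K +>\<^bsub>M\<^esub> free_gen R x \<in> carrier (kaehler_differentials A R \<phi>)"
    using gen[OF x(1)]
    by (auto simp: kaehler_differentials_def Let_def M_def[symmetric] K_def[symmetric]
        A_FactGroup_def' A_RCOSETS_def')
  moreover have "\<one>\<^bsub>kaehler_differentials A R \<phi>\<^esub> = K"
    by (simp add: kaehler_differentials_def Let_def M_def[symmetric] K_def[symmetric]
        A_FactGroup_def')
  ultimately show ?thesis
    using mem \<open>free_gen R x \<notin> K\<close> by auto
qed

lemma (in cring) submodule_free_gen_all:
  assumes H: "submodule H R (free_module R (carrier R))"
    and gen: "\<And>b. b \<in> carrier R \<Longrightarrow> free_gen R b \<in> H"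
  shows "H = carrier (free_module R (carrier R))"
proof -
  define M where "M = free_module R (carrier R)"
  interpret M: module R M unfolding M_def by (rule free_module_module)
  note H = H[folded M_def]
  have "h \<in> H" if "finite T" "h \<in> carrier M" "{s. h s \<noteq> \<zero>} \<subseteq> T" for T h
    using that
  proof (induction T arbitrary: h rule: finite_induct)
    case empty
    then have "h = \<zero>\<^bsub>M\<^esub>" by (auto simp: M_def free_module_simps)
    then show ?case using submodule_zero_closed[OF H] by simp
  next
    case (insert b T)
    let ?k = "h(b := \<zero>)"
    have hb: "h b \<in> carrier R" using insert.prems by (auto simp: M_def free_module_simps)
    show ?case
    proof (cases "b \<in> carrier R")
      case True
      have "finite {s. ?k s \<noteq> \<zero>}"
        by (rule finite_subset[OF _ \<open>finite T\<close>]) (use insert.prems in auto)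
      then have "?k \<in> carrier M"
        using insert.prems by (auto simp: M_def free_module_simps)
      moreover have "{s. ?k s \<noteq> \<zero>} \<subseteq> T" using insert.prems by auto
      ultimately have k: "?k \<in> H" by (rule insert.IH)
      have g: "h b \<odot>\<^bsub>M\<^esub> free_gen R b \<in> H"
        by (rule M.submoduleE(4)[OF H hb gen[OF True]])
      have "h = ?k \<oplus>\<^bsub>M\<^esub> (h b \<odot>\<^bsub>M\<^esub> free_gen R b)"
        using insert.prems hb by (auto simp: M_def free_module_simps free_gen_def fun_eq_iff)
      then show ?thesis by (rule ssubst[of _ _ "\<lambda>h. h \<in> H"]) (rule M.submoduleE(5)[OF H k g])
    next
      case False
      then have "h b = \<zero>" using insert.prems by (auto simp: M_def free_module_simps)
      then show ?thesis using insert.IH[of h] insert.prems by auto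
    qed
  qed
  moreover have "H \<subseteq> carrier M" by (rule M.submoduleE(1)[OF H])
  ultimately show ?thesis unfolding M_def by (auto simp: free_module_simps)
qed

text \<open>Triviality is tested one submodule and one generator at a time, since the generated
  submodule is an intersection.\<close>

lemma (in cring) kaehler_differentials_trivial:
  assumes \<phi>: "\<And>a. a \<in> carrier A \<Longrightarrow> \<phi> a \<in> carrier R"
    and gen: "\<And>H b. submodule H R (free_module R (carrier R)) \<Longrightarrow> kaehler_relators A R \<phi> \<subseteq> H \<Longrightarrow>
      b \<in> carrier R \<Longrightarrow> free_gen R b \<in> H"
  shows "carrier (kaehler_differentials A R \<phi>) = {\<one>\<^bsub>kaehler_differentials A R \<phi>\<^esub>}"
proof -
  define M where "M = free_module R (carrier R)"
  interpret M: module R M unfolding M_def by (rule free_module_module)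
  have "submodule (carrier M) R M"
    by (rule M.submoduleI) auto
  moreover have "kaehler_relators A R \<phi> \<subseteq> carrier M"
    using kaehler_relators_closed \<phi> unfolding M_def by blast
  moreover have "H = carrier M" if "submodule H R M" "kaehler_relators A R \<phi> \<subseteq> H" for H
    using submodule_free_gen_all gen that unfolding M_def by blast
  ultimately have K: "submodule_gen R M (kaehler_relators A R \<phi>) = carrier M"
    unfolding submodule_gen_def by blast
  have "carrier M +>\<^bsub>M\<^esub> a = carrier M" if "a \<in> carrier M" for a
    using M.add.coset_join2[OF _ M.add.subgroup_self] that by (simp add: a_r_coset_def)
  then have "a_rcosets\<^bsub>M\<^esub> (carrier M) = {carrier M}"
    using M.zero_closed by (auto simp: A_RCOSETS_def')
  then show ?thesis
    by (simp add: kaehler_differentials_def Let_def M_def[symmetric] K A_FactGroup_def')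
qed

text \<open>Calculus of differentials modulo an arbitrary submodule \<open>H\<close> containing the
  relators; \<open>t\<close> is the element whose differential is to generate the others.\<close>

locale kaehler_submodule = cring R for R (structure) +
  fixes M H and A :: "('k, 'm) ring_scheme" and \<phi> :: "'k \<Rightarrow> 'a" and t :: 'a
  defines "M \<equiv> free_module R (carrier R)"
  assumes sub: "submodule H R M" and rel: "kaehler_relators A R \<phi> \<subseteq> H"
    and phi_closed: "a \<in> carrier A \<Longrightarrow> \<phi> a \<in> carrier R" and t: "t \<in> carrier R"
begin

sublocale M: module R M
  unfolding M_def by (rule free_module_module)

lemma gen_mem: "b \<in> carrier R \<Longrightarrow> free_gen R b \<in> carrier M"
  unfolding M_def by (rule free_gen_mem)

lemma rel_add: "b \<in> carrier R \<Longrightarrow> c \<in> carrier R \<Longrightarrow>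
    free_gen R (b \<oplus> c) \<ominus>\<^bsub>M\<^esub> (free_gen R b \<oplus>\<^bsub>M\<^esub> free_gen R c) \<in> H"
  unfolding M_def kaehler_relators_def Let_def
  by (rule subsetD[OF rel[unfolded kaehler_relators_def Let_def M_def]], rule UnI1, rule UnI1, rule CollectI, rule exI[of _ b], rule exI[of _ c], rule conjI[OF refl conjI])

lemma rel_mult: "b \<in> carrier R \<Longrightarrow> c \<in> carrier R \<Longrightarrow>
    free_gen R (b \<otimes> c) \<ominus>\<^bsub>M\<^esub> (b \<odot>\<^bsub>M\<^esub> free_gen R c \<oplus>\<^bsub>M\<^esub> c \<odot>\<^bsub>M\<^esub> free_gen R b) \<in> H"
  unfolding M_def kaehler_relators_def Let_def
  by (rule subsetD[OF rel[unfolded kaehler_relators_def Let_def M_def]], rule UnI1, rule UnI2, rule CollectI, rule exI[of _ b], rule exI[of _ c], rule conjI[OF refl conjI])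

lemma rel_phi: "a \<in> carrier A \<Longrightarrow> free_gen R (\<phi> a) \<in> H"
  unfolding M_def kaehler_relators_def Let_def
  by (rule subsetD[OF rel[unfolded kaehler_relators_def Let_def M_def]], rule UnI2, rule CollectI, rule exI[of _ a], rule conjI[OF refl])

lemma H_carrier: "x \<in> H \<Longrightarrow> x \<in> carrier M"
  using M.submoduleE(1)[OF sub] by blast

lemma H_add: "x \<in> H \<Longrightarrow> y \<in> H \<Longrightarrow> x \<oplus>\<^bsub>M\<^esub> y \<in> H"
  using M.submoduleE(5)[OF sub] by blast

lemma H_smult: "a \<in> carrier R \<Longrightarrow> x \<in> H \<Longrightarrow> a \<odot>\<^bsub>M\<^esub> x \<in> H"
  using M.submoduleE(4)[OF sub] by blast

lemma H_cancel:
  assumes "x \<ominus>\<^bsub>M\<^esub> y \<in> H" "y \<in> H" "x \<in> carrier M"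
  shows "x \<in> H"
proof -
  have "(x \<ominus>\<^bsub>M\<^esub> y) \<oplus>\<^bsub>M\<^esub> y = x"
    using assms(3) H_carrier[OF assms(2)] by (simp add: a_minus_def M.a_assoc M.l_neg)
  then show ?thesis using H_add[OF assms(1,2)] by simp
qed

lemma H_cancel':
  assumes "x \<ominus>\<^bsub>M\<^esub> y \<in> H" "x \<in> H" "y \<in> carrier M"
  shows "y \<in> H"
proof -
  have x: "x \<in> carrier M" by (rule H_carrier[OF assms(2)])
  have "x \<ominus>\<^bsub>M\<^esub> (x \<ominus>\<^bsub>M\<^esub> y) = y"
    using x assms(3) by (simp add: a_minus_def M.minus_add M.minus_minus M.r_neg2)
  then show ?thesis
    using M.submodule_minus_closed[OF sub assms(2,1)] by simp
qed

lemma minus_trans: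
  assumes "x \<in> carrier M" "y \<in> carrier M" "z \<in> carrier M" "u \<in> carrier M" "v \<in> carrier M"
    and "x \<ominus>\<^bsub>M\<^esub> (y \<oplus>\<^bsub>M\<^esub> z) \<in> H" "y \<ominus>\<^bsub>M\<^esub> u \<in> H" "z \<ominus>\<^bsub>M\<^esub> v \<in> H"
  shows "x \<ominus>\<^bsub>M\<^esub> (u \<oplus>\<^bsub>M\<^esub> v) \<in> H"
proof -
  have "(x \<ominus>\<^bsub>M\<^esub> (y \<oplus>\<^bsub>M\<^esub> z)) \<oplus>\<^bsub>M\<^esub> ((y \<ominus>\<^bsub>M\<^esub> u) \<oplus>\<^bsub>M\<^esub> (z \<ominus>\<^bsub>M\<^esub> v)) = x \<ominus>\<^bsub>M\<^esub> (u \<oplus>\<^bsub>M\<^esub> v)"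
  proof -
    have "(y \<ominus>\<^bsub>M\<^esub> u) \<oplus>\<^bsub>M\<^esub> (z \<ominus>\<^bsub>M\<^esub> v) = (y \<oplus>\<^bsub>M\<^esub> z) \<ominus>\<^bsub>M\<^esub> (u \<oplus>\<^bsub>M\<^esub> v)"
      using assms(1-5) by (simp add: a_minus_def M.minus_add M.a_ac)
    moreover have "(x \<ominus>\<^bsub>M\<^esub> p) \<oplus>\<^bsub>M\<^esub> (p \<ominus>\<^bsub>M\<^esub> r) = x \<ominus>\<^bsub>M\<^esub> r" if "p \<in> carrier M" "r \<in> carrier M" for p r
      using that assms(1) by (simp add: a_minus_def M.a_assoc M.r_neg1)
    ultimately show ?thesis using assms(1-5) by simp
  qed
  then show ?thesis using H_add[OF assms(6) H_add[OF assms(7,8)]] by simp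
qed

text \<open>\<open>follows b b'\<close> states that \<open>db = b' dt\<close> modulo \<open>H\<close>.\<close>

definition follows :: "'a \<Rightarrow> 'a \<Rightarrow> bool" where
  "follows b b' \<longleftrightarrow> b \<in> carrier R \<and> b' \<in> carrier R \<and> free_gen R b \<ominus>\<^bsub>M\<^esub> b' \<odot>\<^bsub>M\<^esub> free_gen R t \<in> H"

lemma follows_add:
  assumes "follows b b'" "follows c c'"
  shows "follows (b \<oplus> c) (b' \<oplus> c')"
  using assms minus_trans[OF _ _ _ _ _ rel_add[of b c], of "b' \<odot>\<^bsub>M\<^esub> free_gen R t" "c' \<odot>\<^bsub>M\<^esub> free_gen R t"] t
  by (auto simp: follows_def gen_mem M.smult_l_distr)

lemma follows_mult:
  assumes "follows b b'" "follows c c'"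
  shows "follows (b \<otimes> c) (b \<otimes> c' \<oplus> c \<otimes> b')"
proof -
  note b = assms(1)[unfolded follows_def] and c = assms(2)[unfolded follows_def]
  have *: "a \<odot>\<^bsub>M\<^esub> free_gen R x \<ominus>\<^bsub>M\<^esub> (a \<otimes> x') \<odot>\<^bsub>M\<^esub> free_gen R t \<in> H"
    if "follows x x'" "a \<in> carrier R" for a x x'
    using H_smult[OF that(2)] that t unfolding follows_def
    by (force simp: gen_mem a_minus_def M.smult_r_distr M.smult_r_minus M.smult_assoc1)
  show ?thesis
    using minus_trans[OF _ _ _ _ _ rel_mult[of b c] *[OF assms(2), of b] *[OF assms(1), of c]] b c t
    by (auto simp: follows_def gen_mem M.smult_l_distr)
qed

lemma follows_phi:
  assumes "a \<in> carrier A"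
  shows "follows (\<phi> a) \<zero>"
proof -
  have z: "\<ominus>\<^bsub>M\<^esub> \<zero>\<^bsub>M\<^esub> = \<zero>\<^bsub>M\<^esub>" by (rule M.minus_equality) auto
  show ?thesis
    using rel_phi[OF assms] phi_closed[OF assms] t by (simp add: follows_def gen_mem a_minus_def z)
qed

lemma follows_self: "follows t \<one>"
  using t submodule_zero_closed[OF sub]
  by (auto simp: follows_def gen_mem a_minus_def M.r_neg)

text \<open>0 = d0 = u dt modulo \<open>H\<close>, and \<open>u\<close> is a unit. That d0 is in
  \<open>H\<close> is additivity for 0 + 0.\<close>

lemma self_mem_of_unit:
  assumes u: "follows \<zero> u" and v: "v \<in> carrier R" "v \<otimes> u = \<one>"
  shows "free_gen R t \<in> H"
proof -
  have uR: "u \<in> carrier R" using u by (simp add: follows_def)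
  have z: "free_gen R \<zero> \<in> carrier M" by (simp add: gen_mem)
  have "free_gen R \<zero> \<ominus>\<^bsub>M\<^esub> (free_gen R \<zero> \<oplus>\<^bsub>M\<^esub> free_gen R \<zero>) = \<ominus>\<^bsub>M\<^esub> free_gen R \<zero>"
    using z by (simp add: a_minus_def M.minus_add M.r_neg1 M.r_neg2)
  then have "\<ominus>\<^bsub>M\<^esub> free_gen R \<zero> \<in> H" using rel_add[of \<zero> \<zero>] by simp
  from M.submoduleE(3)[OF sub this] have "free_gen R \<zero> \<in> H" using z by simp
  then have "u \<odot>\<^bsub>M\<^esub> free_gen R t \<in> H"
    using H_cancel'[of "free_gen R \<zero>" "u \<odot>\<^bsub>M\<^esub> free_gen R t"] u t by (simp add: follows_def gen_mem)
  from H_smult[OF v(1) this] show ?thesis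
    unfolding M.smult_assoc1[OF v(1) uR gen_mem[OF t], symmetric] v(2) M.smult_one[OF gen_mem[OF t]] .
qed

lemma mem_of_follows:
  assumes "follows b b'" "free_gen R t \<in> H"
  shows "free_gen R b \<in> H"
proof -
  note b = assms(1)[unfolded follows_def]
  show ?thesis
    by (rule H_cancel[OF conjunct2[OF conjunct2[OF b]] H_smult[OF _ assms(2)] gen_mem]) (use b in simp_all)
qed

lemma mem_mult:
  assumes "b \<in> carrier R" "c \<in> carrier R" "free_gen R b \<in> H" "free_gen R c \<in> H"
  shows "free_gen R (b \<otimes> c) \<in> H"
  by (rule H_cancel[OF rel_mult[OF assms(1,2)] H_add[OF H_smult[OF assms(1,4)] H_smult[OF assms(2,3)]]
        gen_mem[OF m_closed[OF assms(1,2)]]])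

text \<open>0 = d1 = b dc + c db modulo \<open>H\<close>; multiply by \<open>c\<close>, the inverse
  of \<open>b\<close>.\<close>

lemma mem_inverse:
  assumes b: "b \<in> carrier R" "free_gen R b \<in> H" and c: "c \<in> carrier R" "c \<otimes> b = \<one>"
  shows "free_gen R c \<in> H"
proof -
  have o: "free_gen R \<one> \<in> carrier M" by (simp add: gen_mem)
  have "free_gen R \<one> \<ominus>\<^bsub>M\<^esub> (free_gen R \<one> \<oplus>\<^bsub>M\<^esub> free_gen R \<one>) = \<ominus>\<^bsub>M\<^esub> free_gen R \<one>"
    using o by (simp add: a_minus_def M.minus_add M.r_neg1 M.r_neg2)
  then have "\<ominus>\<^bsub>M\<^esub> free_gen R \<one> \<in> H" using rel_mult[of \<one> \<one>] o by simp
  from M.submoduleE(3)[OF sub this] have one: "free_gen R \<one> \<in> H" using o by simp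
  have "b \<odot>\<^bsub>M\<^esub> free_gen R c \<oplus>\<^bsub>M\<^esub> c \<odot>\<^bsub>M\<^esub> free_gen R b \<in> H"
  proof (rule H_cancel'[OF _ one])
    show "free_gen R \<one> \<ominus>\<^bsub>M\<^esub> (b \<odot>\<^bsub>M\<^esub> free_gen R c \<oplus>\<^bsub>M\<^esub> c \<odot>\<^bsub>M\<^esub> free_gen R b) \<in> H"
      using rel_mult[OF b(1) c(1)] unfolding m_comm[OF b(1) c(1)] c(2) .
    show "b \<odot>\<^bsub>M\<^esub> free_gen R c \<oplus>\<^bsub>M\<^esub> c \<odot>\<^bsub>M\<^esub> free_gen R b \<in> carrier M"
      by (intro M.add.m_closed[simplified] M.smult_closed b(1) c(1) gen_mem)
  qed
  moreover have cb: "c \<odot>\<^bsub>M\<^esub> free_gen R b \<in> H" by (rule H_smult[OF c(1) b(2)])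
  ultimately have "(b \<odot>\<^bsub>M\<^esub> free_gen R c \<oplus>\<^bsub>M\<^esub> c \<odot>\<^bsub>M\<^esub> free_gen R b) \<ominus>\<^bsub>M\<^esub> c \<odot>\<^bsub>M\<^esub> free_gen R b \<in> H"
    by (rule M.submodule_minus_closed[OF sub])
  moreover have "(x \<oplus>\<^bsub>M\<^esub> y) \<ominus>\<^bsub>M\<^esub> y = x" if "x \<in> carrier M" "y \<in> carrier M" for x y
    using that by (simp add: a_minus_def M.a_assoc M.r_neg)
  ultimately have "b \<odot>\<^bsub>M\<^esub> free_gen R c \<in> H"
    using M.smult_closed[OF b(1) gen_mem[OF c(1)]] H_carrier[OF cb] by metis
  from H_smult[OF c(1) this] show ?thesis
    unfolding M.smult_assoc1[OF c(1) b(1) gen_mem[OF c(1)], symmetric] c(2) M.smult_one[OF gen_mem[OF c(1)]] .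
qed

end

section \<open>Germs of regular functions\<close>

text \<open>Regularity without an open set: the neighbourhood is the locus where the denominator is
  nonzero. \<open>near_zero\<close> treats vanishing near the point in the same way.\<close>

definition represents ::
    "nat \<Rightarrow> point set \<Rightarrow> (nat \<Rightarrow> complex) \<Rightarrow> cpoly \<Rightarrow> cpoly \<Rightarrow> (point \<Rightarrow> complex) \<Rightarrow> bool" where
  "represents N X p F G f \<longleftrightarrow> (\<exists>d. homogeneous N d F \<and> homogeneous N d G) \<and> peval G p \<noteq> 0 \<and>
     (\<forall>v\<in>\<Union>X. peval G v \<noteq> 0 \<longrightarrow> f (ppoint v) = peval F v / peval G v)"

definition near_zero :: "nat \<Rightarrow> point set \<Rightarrow> (nat \<Rightarrow> complex) \<Rightarrow> (point \<Rightarrow> complex) \<Rightarrow> bool" where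
  "near_zero N X p f \<longleftrightarrow> (\<exists>d H. homogeneous N d H \<and> peval H p \<noteq> 0 \<and>
     (\<forall>v\<in>\<Union>X. peval H v \<noteq> 0 \<longrightarrow> f (ppoint v) = 0))"

lemma representsI:
  "homogeneous N d F \<Longrightarrow> homogeneous N d G \<Longrightarrow> peval G p \<noteq> 0 \<Longrightarrow>
    (\<And>v. v \<in> \<Union>X \<Longrightarrow> peval G v \<noteq> 0 \<Longrightarrow> f (ppoint v) = peval F v / peval G v) \<Longrightarrow>
    represents N X p F G f"
  unfolding represents_def by (intro conjI exI[of _ d] ballI impI)

lemma representsE:
  assumes "represents N X p F G f"
  obtains d where "homogeneous N d F" "homogeneous N d G" "peval G p \<noteq> 0"
    "\<And>v. v \<in> \<Union>X \<Longrightarrow> peval G v \<noteq> 0 \<Longrightarrow> f (ppoint v) = peval F v / peval G v"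
proof -
  from assms have a: "\<exists>d. homogeneous N d F \<and> homogeneous N d G" and b: "peval G p \<noteq> 0"
    and c: "\<forall>v\<in>\<Union>X. peval G v \<noteq> 0 \<longrightarrow> f (ppoint v) = peval F v / peval G v"
    unfolding represents_def by simp_all
  from a obtain d where d: "homogeneous N d F \<and> homogeneous N d G" ..
  show ?thesis
    by (rule that[OF conjunct1[OF d] conjunct2[OF d] b]) (use c in blast)
qed

lemma near_zeroI:
  "homogeneous N d H \<Longrightarrow> peval H p \<noteq> 0 \<Longrightarrow>
    (\<And>v. v \<in> \<Union>X \<Longrightarrow> peval H v \<noteq> 0 \<Longrightarrow> f (ppoint v) = 0) \<Longrightarrow> near_zero N X p f"
  unfolding near_zero_def by (rule exI[of _ d], rule exI[of _ H]) (intro conjI ballI impI)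

lemma near_zeroE:
  assumes "near_zero N X p f"
  obtains d H where "homogeneous N d H" "peval H p \<noteq> 0"
    "\<And>v. v \<in> \<Union>X \<Longrightarrow> peval H v \<noteq> 0 \<Longrightarrow> f (ppoint v) = 0"
proof -
  from assms obtain d H where a: "homogeneous N d H" "peval H p \<noteq> 0"
    and c: "\<forall>v\<in>\<Union>X. peval H v \<noteq> 0 \<longrightarrow> f (ppoint v) = 0"
    unfolding near_zero_def by (elim exE conjE)
  show ?thesis by (rule that[OF a]) (use c in blast)
qed

lemma basic_open:
  assumes W: "openin (zariski N) W" and p: "p \<in> cvec N" "p \<noteq> 0" "ppoint p \<in> W"
  shows "\<exists>d H. homogeneous N d H \<and> peval H p \<noteq> 0 \<and> (\<forall>v\<in>cvec N. peval H v \<noteq> 0 \<longrightarrow> v \<noteq> 0 \<longrightarrow> ppoint v \<in> W)"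
proof -
  have "zariski_closed N (pspace N - W)" using W by (simp add: openin_zariski)
  then obtain S where S: "\<forall>F\<in>S. \<exists>d. homogeneous N d F" "pspace N - W = zero_locus N S"
    unfolding zariski_closed_def by (elim exE conjE)
  have ps: "ppoint v \<in> pspace N" if "v \<in> cvec N" "v \<noteq> 0" for v
    using that unfolding pspace_def by blast
  have "ppoint p \<notin> zero_locus N S" using S(2) p(3) by blast
  then have "\<exists>F\<in>S. \<not> vanishes_at F (ppoint p)"
    using ps[OF p(1,2)] by (simp add: zero_locus_def)
  then obtain H where H: "H \<in> S" "\<not> vanishes_at H (ppoint p)" ..
  from bspec[OF S(1) H(1)] obtain d where d: "homogeneous N d H" ..
  have "ppoint v \<in> W" if v: "v \<in> cvec N" "peval H v \<noteq> 0" "v \<noteq> 0" for v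
  proof -
    have "\<not> vanishes_at H (ppoint v)" using v(2) vanishes_at_iff[OF d] by simp
    then have "ppoint v \<notin> zero_locus N S" using H(1) by (simp add: zero_locus_def) blast
    then show ?thesis using S(2) ps[OF v(1,3)] by blast
  qed
  then show ?thesis
    using d H(2) vanishes_at_iff[OF d] by (intro exI[of _ d] exI[of _ H]) simp
qed

lemma openin_nonvanishing:
  assumes "homogeneous N d H"
  shows "openin (zariski N) {x \<in> pspace N. \<not> vanishes_at H x}"
proof -
  have "pspace N - {x \<in> pspace N. \<not> vanishes_at H x} = {x \<in> pspace N. vanishes_at H x}" by auto
  then show ?thesis
    using zariski_closed_hypersurface[OF assms] by (simp add: openin_zariski)
qed

locale pointed_set =
  fixes N :: nat and X :: "point set" and p :: "nat \<Rightarrow> complex"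
  assumes X: "X \<subseteq> pspace N" and p: "p \<in> \<Union>X"
begin

abbreviation "regular f \<equiv> regular_near N X (ppoint p) f"

abbreviation "regs \<equiv> regular_ring N X (ppoint p)"

abbreviation "locals \<equiv> local_ring N X (ppoint p)"

definition germ :: "(point \<Rightarrow> complex) \<Rightarrow> (point \<Rightarrow> complex) set" where
  "germ f = germ_ideal N X (ppoint p) +>\<^bsub>regs\<^esub> f"

lemma mem: "v \<in> \<Union>X \<Longrightarrow> v \<in> cvec N \<and> v \<noteq> 0 \<and> ppoint v \<in> X"
  using Union_pspace[OF X] by blast

lemma nonvanishing_nhd:
  assumes H: "homogeneous N d H" "peval H p \<noteq> 0"
  shows "ppoint p \<in> {x \<in> pspace N. \<not> vanishes_at H x}"
    and "y \<in> {x \<in> pspace N. \<not> vanishes_at H x} \<inter> X \<Longrightarrow> v \<in> y \<Longrightarrow> v \<in> \<Union>X \<and> y = ppoint v \<and> peval H v \<noteq> 0"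
proof -
  show "ppoint p \<in> {x \<in> pspace N. \<not> vanishes_at H x}"
    using H vanishes_at_iff[OF H(1)] mem[OF p] X by auto
  assume y: "y \<in> {x \<in> pspace N. \<not> vanishes_at H x} \<inter> X" "v \<in> y"
  with X have "y \<in> pspace N" by blast
  from pspace_rep[OF this y(2)] have "y = ppoint v" by simp
  then show "v \<in> \<Union>X \<and> y = ppoint v \<and> peval H v \<noteq> 0"
    using y vanishes_at_iff[OF H(1)] by auto
qed

lemma regular_iff: "regular f \<longleftrightarrow> (\<exists>F G. represents N X p F G f)"
proof
  assume "regular f"
  then obtain d F G W where F: "homogeneous N d F" and G: "homogeneous N d G"
    and W: "openin (zariski N) W" "ppoint p \<in> W"
    and f: "\<forall>y\<in>W \<inter> X. \<forall>v\<in>y. peval G v \<noteq> 0 \<and> f y = peval F v / peval G v"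
    unfolding regular_near_def by (elim exE conjE)
  have f: "peval G v \<noteq> 0 \<and> f (ppoint v) = peval F v / peval G v" if "ppoint v \<in> W" "v \<in> \<Union>X" for v
    using bspec[OF bspec[OF f], of "ppoint v" v] ppoint_mem mem[OF that(2)] that(1) by blast
  from basic_open[OF W(1) _ _ W(2)] mem[OF p] obtain e H where H: "homogeneous N e H" "peval H p \<noteq> 0"
    and HW: "\<forall>v\<in>cvec N. peval H v \<noteq> 0 \<longrightarrow> v \<noteq> 0 \<longrightarrow> ppoint v \<in> W" by auto
  \<comment> \<open>Expanding the fraction by \<open>H\<close> shrinks the locus of nonzero
    denominator into the given neighbourhood.\<close>
  have "represents N X p (F * H) (G * H) f"
  proof (rule representsI[OF homogeneous_mult[OF F H(1)] homogeneous_mult[OF G H(1)]])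
    show "peval (G * H) p \<noteq> 0" using f[OF W(2) p] H(2) by (simp add: peval_mult)
    fix v assume v: "v \<in> \<Union>X" "peval (G * H) v \<noteq> 0"
    then have "peval H v \<noteq> 0" by (simp add: peval_mult)
    then show "f (ppoint v) = peval (F * H) v / peval (G * H) v"
      using f[OF _ v(1)] mem[OF v(1)] HW by (simp add: peval_mult)
  qed
  then show "\<exists>F G. represents N X p F G f" by (rule exI[THEN exI[of _ "F * H"]])
next
  assume "\<exists>F G. represents N X p F G f"
  then obtain F G where "represents N X p F G f" by (elim exE)
  then obtain d where F: "homogeneous N d F" and G: "homogeneous N d G" "peval G p \<noteq> 0"
    and f: "\<And>v. v \<in> \<Union>X \<Longrightarrow> peval G v \<noteq> 0 \<Longrightarrow> f (ppoint v) = peval F v / peval G v"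
    by (rule representsE) (rule that)
  note nhd = nonvanishing_nhd[OF G]
  have "\<forall>y\<in>{x \<in> pspace N. \<not> vanishes_at G x} \<inter> X. \<forall>v\<in>y. peval G v \<noteq> 0 \<and> f y = peval F v / peval G v"
    using nhd(2) f by blast
  then show "regular f"
    unfolding regular_near_def using F G(1) openin_nonvanishing[OF G(1)] nhd(1)
    by (intro exI[of _ d] exI[of _ F] exI[of _ G] exI[of _ "{x \<in> pspace N. \<not> vanishes_at G x}"] conjI)
qed

lemma regular_of_represents: "represents N X p F G f \<Longrightarrow> regular f"
  unfolding regular_iff by (rule exI, rule exI)

lemma near_zero_iff:
  "(\<exists>W. openin (zariski N) W \<and> ppoint p \<in> W \<and> (\<forall>y\<in>W \<inter> X. f y = 0)) \<longleftrightarrow> near_zero N X p f"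
proof
  assume "\<exists>W. openin (zariski N) W \<and> ppoint p \<in> W \<and> (\<forall>y\<in>W \<inter> X. f y = 0)"
  then obtain W where W: "openin (zariski N) W" "ppoint p \<in> W" and f: "\<forall>y\<in>W \<inter> X. f y = 0"
    by (elim exE conjE)
  from basic_open[OF W(1) _ _ W(2)] mem[OF p] obtain e H where H: "homogeneous N e H" "peval H p \<noteq> 0"
    and HW: "\<forall>v\<in>cvec N. peval H v \<noteq> 0 \<longrightarrow> v \<noteq> 0 \<longrightarrow> ppoint v \<in> W" by auto
  show "near_zero N X p f"
    by (rule near_zeroI[OF H]) (use HW mem f in blast)
next
  assume "near_zero N X p f"
  then obtain d H where H: "homogeneous N d H" "peval H p \<noteq> 0"
    and f: "\<And>v. v \<in> \<Union>X \<Longrightarrow> peval H v \<noteq> 0 \<Longrightarrow> f (ppoint v) = 0"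
    by (rule near_zeroE) (rule that)
  note nhd = nonvanishing_nhd[OF H]
  have "f y = 0" if y: "y \<in> {x \<in> pspace N. \<not> vanishes_at H x} \<inter> X" for y
  proof -
    from y X have "y \<in> pspace N" by blast
    from pspace_nonempty[OF this] obtain v where v: "v \<in> y" ..
    from nhd(2)[OF y v] f show ?thesis by blast
  qed
  then show "\<exists>W. openin (zariski N) W \<and> ppoint p \<in> W \<and> (\<forall>y\<in>W \<inter> X. f y = 0)"
    using openin_nonvanishing[OF H(1)] nhd(1)
    by (intro exI[of _ "{x \<in> pspace N. \<not> vanishes_at H x}"]) blast
qed

lemma germ_ideal_iff: "f \<in> germ_ideal N X (ppoint p) \<longleftrightarrow> near_zero N X p f \<and> regular f"
  unfolding germ_ideal_def near_zero_iff by (simp add: regular_ring_def)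

lemma near_zero_add:
  assumes "near_zero N X p f" "near_zero N X p g"
  shows "near_zero N X p (\<lambda>y. f y + g y)"
proof -
  obtain d H where H: "homogeneous N d H" "peval H p \<noteq> 0"
    and f: "\<And>v. v \<in> \<Union>X \<Longrightarrow> peval H v \<noteq> 0 \<Longrightarrow> f (ppoint v) = 0"
    by (rule near_zeroE[OF assms(1)]) (rule that)
  obtain e K where K: "homogeneous N e K" "peval K p \<noteq> 0"
    and g: "\<And>v. v \<in> \<Union>X \<Longrightarrow> peval K v \<noteq> 0 \<Longrightarrow> g (ppoint v) = 0"
    by (rule near_zeroE[OF assms(2)]) (rule that)
  show ?thesis
    by (rule near_zeroI[OF homogeneous_mult[OF H(1) K(1)]])
      (use H(2) K(2) f g in \<open>auto simp: peval_mult simp del: Union_iff\<close>)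
qed

lemma near_zero_mult: "near_zero N X p f \<Longrightarrow> near_zero N X p (\<lambda>y. g y * f y)"
  by (erule near_zeroE) (rule near_zeroI, auto simp del: Union_iff)

lemma regular_const: "regular (\<lambda>_. c)"
  by (rule regular_of_represents[OF representsI[of _ 0 "Poly_Mapping.single 0 c" "Poly_Mapping.single 0 1"]])
    (auto simp: homogeneous_const homogeneous_const[of N 1, simplified]
      peval_const peval_const[of 1, simplified])

lemma regular_add:
  assumes "regular f" "regular g"
  shows "regular (\<lambda>y. f y + g y)"
proof -
  from assms obtain F G F' G' where r: "represents N X p F G f" "represents N X p F' G' g"
    unfolding regular_iff by (elim exE)
  obtain d where F: "homogeneous N d F" "homogeneous N d G" "peval G p \<noteq> 0"
    "\<And>v. v \<in> \<Union>X \<Longrightarrow> peval G v \<noteq> 0 \<Longrightarrow> f (ppoint v) = peval F v / peval G v"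
    by (rule representsE[OF r(1)]) (rule that)
  obtain e where F': "homogeneous N e F'" "homogeneous N e G'" "peval G' p \<noteq> 0"
    "\<And>v. v \<in> \<Union>X \<Longrightarrow> peval G' v \<noteq> 0 \<Longrightarrow> g (ppoint v) = peval F' v / peval G' v"
    by (rule representsE[OF r(2)]) (rule that)
  show ?thesis
  proof (rule regular_of_represents[OF representsI])
    show "homogeneous N (d + e) (F * G' + G * F')"
      by (rule homogeneous_add[OF homogeneous_mult[OF F(1) F'(2)] homogeneous_mult[OF F(2) F'(1)]])
    show "homogeneous N (d + e) (G * G')" by (rule homogeneous_mult[OF F(2) F'(2)])
  qed (use F(3,4) F'(3,4) in \<open>auto simp: peval_add peval_mult field_simps simp del: Union_iff\<close>)
qed

lemma regular_mult:
  assumes "regular f" "regular g"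
  shows "regular (\<lambda>y. f y * g y)"
proof -
  from assms obtain F G F' G' where r: "represents N X p F G f" "represents N X p F' G' g"
    unfolding regular_iff by (elim exE)
  obtain d where F: "homogeneous N d F" "homogeneous N d G" "peval G p \<noteq> 0"
    "\<And>v. v \<in> \<Union>X \<Longrightarrow> peval G v \<noteq> 0 \<Longrightarrow> f (ppoint v) = peval F v / peval G v"
    by (rule representsE[OF r(1)]) (rule that)
  obtain e where F': "homogeneous N e F'" "homogeneous N e G'" "peval G' p \<noteq> 0"
    "\<And>v. v \<in> \<Union>X \<Longrightarrow> peval G' v \<noteq> 0 \<Longrightarrow> g (ppoint v) = peval F' v / peval G' v"
    by (rule representsE[OF r(2)]) (rule that)
  show ?thesis
  proof (rule regular_of_represents[OF representsI])
    show "homogeneous N (d + e) (F * F')" by (rule homogeneous_mult[OF F(1) F'(1)])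
    show "homogeneous N (d + e) (G * G')" by (rule homogeneous_mult[OF F(2) F'(2)])
  qed (use F(3,4) F'(3,4) in \<open>auto simp: peval_mult simp del: Union_iff\<close>)
qed

lemma regular_inverse:
  assumes "regular f" "f (ppoint p) \<noteq> 0"
  shows "regular (\<lambda>y. inverse (f y))" "near_zero N X p (\<lambda>y. inverse (f y) * f y - 1)"
proof -
  from assms obtain F G where r: "represents N X p F G f"
    unfolding regular_iff by (elim exE)
  obtain d where F: "homogeneous N d F" "homogeneous N d G" "peval G p \<noteq> 0"
    "\<And>v. v \<in> \<Union>X \<Longrightarrow> peval G v \<noteq> 0 \<Longrightarrow> f (ppoint v) = peval F v / peval G v"
    by (rule representsE[OF r]) (rule that)
  have Fp: "peval F p \<noteq> 0" using F(3) F(4)[OF p] assms(2) by auto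
  \<comment> \<open>The fraction G G / (F G) instead of G / F: its denominator is nonzero only where
    the formula for \<open>f\<close> is valid as well.\<close>
  show "regular (\<lambda>y. inverse (f y))"
  proof (rule regular_of_represents[OF representsI])
    show "homogeneous N (d + d) (G * G)" by (rule homogeneous_mult[OF F(2) F(2)])
    show "homogeneous N (d + d) (F * G)" by (rule homogeneous_mult[OF F(1) F(2)])
  qed (use F(3,4) Fp in \<open>auto simp: peval_mult simp del: Union_iff\<close>)
  show "near_zero N X p (\<lambda>y. inverse (f y) * f y - 1)"
  proof (rule near_zeroI)
    show "homogeneous N (d + d) (F * G)" by (rule homogeneous_mult[OF F(1) F(2)])
  qed (use F(3,4) Fp in \<open>auto simp: peval_mult simp del: Union_iff\<close>)
qed

lemma regs_simps:
  "f \<in> carrier regs \<longleftrightarrow> regular f" "f \<otimes>\<^bsub>regs\<^esub> g = (\<lambda>y. f y * g y)"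
  "f \<oplus>\<^bsub>regs\<^esub> g = (\<lambda>y. f y + g y)" "\<one>\<^bsub>regs\<^esub> = (\<lambda>_. 1)" "\<zero>\<^bsub>regs\<^esub> = (\<lambda>_. 0)"
  by (simp_all add: regular_ring_def)

lemma regular_uminus: "regular f \<Longrightarrow> regular (\<lambda>y. - f y)"
  using regular_mult[OF regular_const[of "-1"], of f] by simp

lemma regular_diff: "regular f \<Longrightarrow> regular g \<Longrightarrow> regular (\<lambda>y. f y - g y)"
  using regular_add[OF _ regular_uminus, of f g] by simp

lemma cring_regs: "cring regs"
proof (rule cringI)
  show "abelian_group regs"
  proof (rule abelian_groupI)
    fix f assume "f \<in> carrier regs"
    then show "\<exists>g\<in>carrier regs. g \<oplus>\<^bsub>regs\<^esub> f = \<zero>\<^bsub>regs\<^esub>"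
      using regular_uminus[of f] by (intro bexI[of _ "\<lambda>y. - f y"]) (simp_all add: regs_simps)
  qed (simp_all add: regs_simps regular_add regular_const add_ac)
  show "comm_monoid regs"
    by (rule comm_monoidI) (simp_all add: regs_simps regular_mult regular_const mult_ac)
qed (simp add: regs_simps distrib_right)

lemma regs_minus: "regular f \<Longrightarrow> regular g \<Longrightarrow> f \<ominus>\<^bsub>regs\<^esub> g = (\<lambda>y. f y - g y)"
proof -
  interpret R: cring regs by (rule cring_regs)
  assume fg: "regular f" "regular g"
  have "\<ominus>\<^bsub>regs\<^esub> g = (\<lambda>y. - g y)"
    by (rule R.minus_equality) (use fg(2) in \<open>simp_all add: regs_simps regular_uminus\<close>)
  then show ?thesis by (simp add: a_minus_def regs_simps)
qed

lemma ideal_germs: "ideal (germ_ideal N X (ppoint p)) regs"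
proof (rule idealI)
  interpret R: cring regs by (rule cring_regs)
  show "ring regs" ..
  have z: "(\<lambda>_. 0) \<in> germ_ideal N X (ppoint p)"
    using near_zeroI[OF homogeneous_const[of N 1], of p X "\<lambda>_. 0"] regular_const[of 0]
    by (simp add: germ_ideal_iff peval_const[of 1, simplified])
  show "subgroup (germ_ideal N X (ppoint p)) (add_monoid regs)"
  proof (rule R.add.subgroupI)
    show "germ_ideal N X (ppoint p) \<subseteq> carrier regs"
      by (auto simp: germ_ideal_iff regs_simps)
    fix f assume f: "f \<in> germ_ideal N X (ppoint p)"
    then have "\<ominus>\<^bsub>regs\<^esub> f = (\<lambda>y. - f y)"
      by (intro R.minus_equality) (simp_all add: regs_simps regular_uminus germ_ideal_iff)
    then show "\<ominus>\<^bsub>regs\<^esub> f \<in> germ_ideal N X (ppoint p)"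
      using f near_zero_mult[of f "\<lambda>_. -1"] by (simp add: germ_ideal_iff regular_uminus)
    fix g assume "g \<in> germ_ideal N X (ppoint p)"
    with f show "f \<oplus>\<^bsub>regs\<^esub> g \<in> germ_ideal N X (ppoint p)"
      by (simp add: germ_ideal_iff regs_simps near_zero_add regular_add)
  qed (use z in blast)
  fix f g assume fg: "f \<in> germ_ideal N X (ppoint p)" "g \<in> carrier regs"
  then show "g \<otimes>\<^bsub>regs\<^esub> f \<in> germ_ideal N X (ppoint p)"
    by (simp add: germ_ideal_iff regs_simps near_zero_mult regular_mult)
  then show "f \<otimes>\<^bsub>regs\<^esub> g \<in> germ_ideal N X (ppoint p)"
    by (simp add: regs_simps mult.commute)
qed

lemma cring_locals: "cring locals"
  unfolding local_ring_def by (rule ideal.quotient_is_cring[OF ideal_germs cring_regs])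

lemma carrier_locals: "carrier locals = germ ` {f. regular f}"
  unfolding local_ring_def FactRing_def germ_def A_RCOSETS_def' by (auto simp: regs_simps)

lemma germ_mem: "regular f \<Longrightarrow> germ f \<in> carrier locals"
  unfolding carrier_locals by blast

lemma germ_eq_iff:
  assumes "regular f" "regular g"
  shows "germ f = germ g \<longleftrightarrow> near_zero N X p (\<lambda>y. f y - g y)"
proof -
  interpret R: cring regs by (rule cring_regs)
  show ?thesis
    using R.quotient_eq_iff_same_a_r_cos[OF ideal_germs, of f g] assms
    unfolding germ_def regs_minus[OF assms] germ_ideal_iff by (simp add: regs_simps regular_diff)
qed

lemma germ_self:
  assumes "regular f"
  shows "f \<in> germ f"
proof -
  interpret R: cring regs by (rule cring_regs)
  interpret I: ideal "germ_ideal N X (ppoint p)" regs by (rule ideal_germs)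
  show ?thesis unfolding germ_def using I.a_rcos_self assms by (simp add: regs_simps)
qed

lemma mem_germ:
  assumes "regular f" "g \<in> germ f"
  shows "regular g" "near_zero N X p (\<lambda>y. g y - f y)"
proof -
  from assms(2) obtain h where h: "h \<in> germ_ideal N X (ppoint p)" "g = (\<lambda>y. h y + f y)"
    unfolding germ_def a_r_coset_def' by (auto simp: regs_simps)
  then show "regular g" "near_zero N X p (\<lambda>y. g y - f y)"
    using regular_add[of h f] assms(1) by (simp_all add: germ_ideal_iff)
qed

lemma germ_ring_hom: "germ \<in> ring_hom regs locals"
  using ideal.rcos_ring_hom[OF ideal_germs] unfolding local_ring_def germ_def .

lemma germ_add: "regular f \<Longrightarrow> regular g \<Longrightarrow> germ (\<lambda>y. f y + g y) = germ f \<oplus>\<^bsub>locals\<^esub> germ g"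
  using ring_hom_add[OF germ_ring_hom, of f g] by (simp add: regs_simps)

lemma germ_mult: "regular f \<Longrightarrow> regular g \<Longrightarrow> germ (\<lambda>y. f y * g y) = germ f \<otimes>\<^bsub>locals\<^esub> germ g"
  using ring_hom_mult[OF germ_ring_hom, of f g] by (simp add: regs_simps)

lemma germ_one: "germ (\<lambda>_. 1) = \<one>\<^bsub>locals\<^esub>"
  using ring_hom_one[OF germ_ring_hom] by (simp add: regs_simps)

lemma germ_zero: "germ (\<lambda>_. 0) = \<zero>\<^bsub>locals\<^esub>"
  using ring_hom_zero[OF germ_ring_hom] cring_regs cring_locals
  by (simp add: regs_simps cring_def)

end

section \<open>Linear projections and differentials\<close>

lemma homogeneous_power: "homogeneous N d F \<Longrightarrow> homogeneous N (d * k) (F ^ k)"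
proof (induction k)
  case 0
  then show ?case using homogeneous_const[of N 1] by simp
qed (use homogeneous_mult in \<open>fastforce simp: algebra_simps\<close>)

lemma homogeneous_prod:
  "finite I \<Longrightarrow> (\<And>i. i \<in> I \<Longrightarrow> homogeneous N (d i) (F i)) \<Longrightarrow>
    homogeneous N (\<Sum>i\<in>I. d i) (\<Prod>i\<in>I. F i)"
proof (induction I rule: finite_induct)
  case empty
  then show ?case using homogeneous_const[of N 1] by simp
qed (use homogeneous_mult in simp)

lemma peval_one: "peval 1 v = 1"
  using peval_const[of 1 v] by simp

lemma peval_power: "peval (F ^ k) v = peval F v ^ k"
  by (induction k) (simp_all add: peval_one peval_mult)

lemma peval_prod: "peval (\<Prod>i\<in>I. F i) v = (\<Prod>i\<in>I. peval (F i) v)"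
  by (induction I rule: infinite_finite_induct) (simp_all add: peval_one peval_mult)

lemma linear_form_exists: "\<exists>F. homogeneous N 1 F \<and> (\<forall>v. peval F v = (\<Sum>i\<le>N. a i * v i))"
proof (rule exI[of _ "\<Sum>i\<le>N. Poly_Mapping.single 0 (a i) * Poly_Mapping.single (Poly_Mapping.single i 1) 1"],
    rule conjI)
  show "homogeneous N 1 (\<Sum>i\<le>N. Poly_Mapping.single 0 (a i) * Poly_Mapping.single (Poly_Mapping.single i 1) 1)"
  proof (rule homogeneous_sum)
    fix i assume "i \<in> {..N}"
    then show "homogeneous N 1 (Poly_Mapping.single 0 (a i) * Poly_Mapping.single (Poly_Mapping.single i 1) 1)"
      using homogeneous_mult[OF homogeneous_const homogeneous_coord, of i N "a i"] by simp
  qed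
qed (simp add: peval_sum peval_mult peval_const peval_coord del: One_nat_def mult_single)

lemma linear_substitution:
  assumes F: "homogeneous M d F"
  shows "\<exists>G. homogeneous N d G \<and> (\<forall>v. peval G v = peval F (mat_app M N A v))"
proof -
  have "\<forall>j. \<exists>F. homogeneous N 1 F \<and> (\<forall>v. peval F v = (\<Sum>i\<le>N. A j i * v i))"
    by (rule allI) (rule linear_form_exists)
  from choice[OF this] obtain l where
    l: "\<forall>j. homogeneous N 1 (l j) \<and> (\<forall>v. peval (l j) v = (\<Sum>i\<le>N. A j i * v i))" ..
  define G where "G = (\<Sum>m\<in>Poly_Mapping.keys F. Poly_Mapping.single 0 (Poly_Mapping.lookup F m) *
    (\<Prod>i\<in>Poly_Mapping.keys m. l i ^ Poly_Mapping.lookup m i))"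
  have "homogeneous N d G"
    unfolding G_def
  proof (rule homogeneous_sum)
    fix m assume m: "m \<in> Poly_Mapping.keys F"
    have "homogeneous N (\<Sum>i\<in>Poly_Mapping.keys m. 1 * Poly_Mapping.lookup m i)
        (\<Prod>i\<in>Poly_Mapping.keys m. l i ^ Poly_Mapping.lookup m i)"
      by (rule homogeneous_prod[OF finite_keys homogeneous_power]) (use l in blast)
    from homogeneous_mult[OF homogeneous_const this, of "Poly_Mapping.lookup F m"] F m
    show "homogeneous N d (Poly_Mapping.single 0 (Poly_Mapping.lookup F m) *
        (\<Prod>i\<in>Poly_Mapping.keys m. l i ^ Poly_Mapping.lookup m i))"
      by (simp add: homogeneous_def[of M])
  qed
  moreover have "peval G v = peval F (mat_app M N A v)" for v
    unfolding G_def peval_sum peval_mult peval_prod peval_power peval_const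
    unfolding peval_def[of F] monom_eval_def
  proof (intro sum.cong prod.cong arg_cong2[of _ _ _ _ times] arg_cong2[of _ _ _ _ power] refl)
    fix m i assume "m \<in> Poly_Mapping.keys F" "i \<in> Poly_Mapping.keys m"
    then have "i \<le> M" using F unfolding homogeneous_def by blast
    then show "peval (l i) v = mat_app M N A v i" using l by (simp add: mat_app_def)
  qed
  ultimately show ?thesis by blast
qed

lemma mat_app_scale: "mat_app M N A (cscale c v) = cscale c (mat_app M N A v)"
  by (auto simp: mat_app_def cscale_def sum_distrib_left mult_ac)

lemma mat_app_cvec: "mat_app M N A v \<in> cvec M"
  by (simp add: mat_app_def cvec_def)

lemma polyfun_mat_app: "(\<lambda>v. mat_app M N A v j) \<in> polyfun (Suc N)"
  by (cases "j \<le> M") (auto simp: mat_app_def intro!: polyfun_intros)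

lemma dd_mat_app: "dd (Suc N) (\<lambda>v. mat_app M N A v j) v u = mat_app M N A u j"
proof (cases "j \<le> M")
  case True
  have "dd (Suc N) (\<lambda>v. \<Sum>i\<le>N. A j i * v i) v u = (\<Sum>i\<le>N. dd (Suc N) (\<lambda>v. A j i * v i) v u)"
    by (rule dd_sum[where m = "Suc N"]) (auto intro!: polyfun_intros)
  also have "\<dots> = (\<Sum>i\<le>N. A j i * u i)"
  proof (rule sum.cong[OF refl])
    fix i assume "i \<in> {..N}"
    then show "dd (Suc N) (\<lambda>v. A j i * v i) v u = A j i * u i"
      using dd_mult[OF polyfun.const[of "A j i"] polyfun.coord[of i "Suc N"], of "Suc N" v u]
      by (simp add: dd_coord)
  qed
  finally show ?thesis using True by (simp add: mat_app_def)
qed (simp add: mat_app_def)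

section \<open>First-order jets of regular functions along a direction\<close>

context pointed_set
begin

text \<open>Value and derivative along \<open>q\<close> of a fraction at \<open>p\<close>, by the
  quotient rule. It is a relation because the derivative is computed from a chosen fraction.\<close>

definition jet :: "(nat \<Rightarrow> complex) \<Rightarrow> (point \<Rightarrow> complex) \<Rightarrow> complex \<Rightarrow> complex \<Rightarrow> bool" where
  "jet q f a b \<longleftrightarrow> (\<exists>F G. represents N X p F G f \<and> a = peval F p / peval G p \<and>
     b = (dd (Suc N) (peval F) p q - a * dd (Suc N) (peval G) p q) / peval G p)"

lemma jetE:
  assumes "jet q f a b"
  obtains d F G where "homogeneous N d F" "homogeneous N d G" "peval G p \<noteq> 0"
    "\<And>v. v \<in> \<Union>X \<Longrightarrow> peval G v \<noteq> 0 \<Longrightarrow> f (ppoint v) = peval F v / peval G v"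
    "peval F p = a * peval G p"
    "dd (Suc N) (peval F) p q = a * dd (Suc N) (peval G) p q + b * peval G p"
proof -
  from assms obtain F G where r: "represents N X p F G f" and ab: "a = peval F p / peval G p"
     "b = (dd (Suc N) (peval F) p q - a * dd (Suc N) (peval G) p q) / peval G p"
    unfolding jet_def by (elim exE conjE)
  obtain d where F: "homogeneous N d F" "homogeneous N d G" "peval G p \<noteq> 0"
    "\<And>v. v \<in> \<Union>X \<Longrightarrow> peval G v \<noteq> 0 \<Longrightarrow> f (ppoint v) = peval F v / peval G v"
    by (rule representsE[OF r]) (rule that)
  show ?thesis
    by (rule that[OF F]) (use ab F(3) in \<open>auto simp: field_simps\<close>)
qed

lemma jetI:
  assumes "represents N X p F G f" "peval F p = a * peval G p"
    "dd (Suc N) (peval F) p q = a * dd (Suc N) (peval G) p q + b * peval G p"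
  shows "jet q f a b"
proof -
  have "peval G p \<noteq> 0" using assms(1) by (simp add: represents_def)
  then show ?thesis
    unfolding jet_def using assms by (intro exI[of _ F] exI[of _ G]) simp
qed

lemma jet_exists:
  assumes "regular f"
  shows "\<exists>a b. jet q f a b"
proof -
  from assms obtain F G where "represents N X p F G f" unfolding regular_iff by (elim exE)
  then show ?thesis unfolding jet_def by blast
qed

text \<open>Independence of the fraction is where tangency of \<open>q\<close> is used: the cross
  difference \<open>J\<close> times \<open>K\<close> is an equation of the cone, and
  \<open>K\<close> is nonzero at \<open>p\<close>, so \<open>J\<close> and its derivative along
  \<open>q\<close> vanish there.\<close>

lemma jet_unique:
  assumes q: "q \<in> tv (\<Union>X) (Suc N) p" and "jet q f a b" "jet q g a' b'"
    and z: "near_zero N X p (\<lambda>y. f y - g y)"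
  shows "a = a' \<and> b = b'"
proof -
  obtain d F G where F: "homogeneous N d F" "homogeneous N d G" "peval G p \<noteq> 0"
    "\<And>v. v \<in> \<Union>X \<Longrightarrow> peval G v \<noteq> 0 \<Longrightarrow> f (ppoint v) = peval F v / peval G v"
    and ab: "peval F p = a * peval G p"
    "dd (Suc N) (peval F) p q = a * dd (Suc N) (peval G) p q + b * peval G p"
    by (rule jetE[OF assms(2)]) (rule that)
  obtain d' F' G' where F': "homogeneous N d' F'" "homogeneous N d' G'" "peval G' p \<noteq> 0"
    "\<And>v. v \<in> \<Union>X \<Longrightarrow> peval G' v \<noteq> 0 \<Longrightarrow> g (ppoint v) = peval F' v / peval G' v"
    and ab': "peval F' p = a' * peval G' p"
    "dd (Suc N) (peval F') p q = a' * dd (Suc N) (peval G') p q + b' * peval G' p"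
    by (rule jetE[OF assms(3)]) (rule that)
  obtain e H where H: "homogeneous N e H" "peval H p \<noteq> 0"
    and h: "\<And>v. v \<in> \<Union>X \<Longrightarrow> peval H v \<noteq> 0 \<Longrightarrow> f (ppoint v) - g (ppoint v) = 0"
    by (rule near_zeroE[OF z]) (rule that)
  note pf = peval_polyfun[OF F(1)] peval_polyfun[OF F(2)] peval_polyfun[OF F'(1)]
    peval_polyfun[OF F'(2)] peval_polyfun[OF H(1)]
  define J where "J v = peval F v * peval G' v - peval F' v * peval G v" for v
  define K where "K v = peval G v * peval G' v * peval H v" for v
  have J: "J \<in> polyfun (Suc N)" and K: "K \<in> polyfun (Suc N)"
    unfolding J_def[abs_def] K_def[abs_def] by (intro polyfun_intros pf)+
  have JK: "J v * K v = 0" if v: "v \<in> \<Union>X" for v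
  proof (cases "K v = 0")
    case False
    then have nz: "peval G v \<noteq> 0" "peval G' v \<noteq> 0" "peval H v \<noteq> 0" by (simp_all add: K_def)
    have "peval F v / peval G v = peval F' v / peval G' v"
      using h[OF v nz(3)] F(4)[OF v nz(1)] F'(4)[OF v nz(2)] by simp
    then have "J v = 0" using nz by (simp add: J_def field_simps)
    then show ?thesis by simp
  qed simp
  have Kp: "K p \<noteq> 0" using F(3) F'(3) H(2) by (simp add: K_def)
  then have Jp: "J p = 0" using JK[OF p] by simp
  then have a: "a = a'" using ab(1) ab'(1) F(3) F'(3) by (simp add: J_def)
  have "dd (Suc N) (\<lambda>v. J v * K v) p q = 0"
    using tvD[OF q polyfun.mult[OF J K]] JK by blast
  then have "dd (Suc N) J p q = 0"
    unfolding dd_mult[OF J K] using Jp Kp by simp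
  moreover have "dd (Suc N) J p q = peval F p * dd (Suc N) (peval G') p q + peval G' p * dd (Suc N) (peval F) p q
      - (peval F' p * dd (Suc N) (peval G) p q + peval G p * dd (Suc N) (peval F') p q)"
    unfolding J_def[abs_def]
    by (subst dd_diff[of _ "Suc N"], intro polyfun_intros pf, intro polyfun_intros pf)
      (subst dd_mult[of _ "Suc N"], rule pf, rule pf, subst dd_mult[of _ "Suc N"], rule pf, rule pf, rule refl)
  ultimately have "(b - b') * (peval G p * peval G' p) = 0"
    unfolding ab ab' a by (simp add: algebra_simps)
  then show ?thesis using a F(3) F'(3) by simp
qed

lemma dd_peval_add:
  "homogeneous N d F \<Longrightarrow> homogeneous N e G \<Longrightarrow>
    dd (Suc N) (peval (F + G)) v u = dd (Suc N) (peval F) v u + dd (Suc N) (peval G) v u"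
  using dd_add[OF peval_polyfun peval_polyfun] by (simp add: peval_add[abs_def])

lemma dd_peval_mult:
  "homogeneous N d F \<Longrightarrow> homogeneous N e G \<Longrightarrow>
    dd (Suc N) (peval (F * G)) v u = peval F v * dd (Suc N) (peval G) v u + peval G v * dd (Suc N) (peval F) v u"
  using dd_mult[OF peval_polyfun peval_polyfun] by (simp add: peval_mult[abs_def])

lemma jet_add:
  assumes "jet q f a b" "jet q g a' b'"
  shows "jet q (\<lambda>y. f y + g y) (a + a') (b + b')"
proof -
  obtain d F G where F: "homogeneous N d F" "homogeneous N d G" "peval G p \<noteq> 0"
    "\<And>v. v \<in> \<Union>X \<Longrightarrow> peval G v \<noteq> 0 \<Longrightarrow> f (ppoint v) = peval F v / peval G v"
    and ab: "peval F p = a * peval G p"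
    "dd (Suc N) (peval F) p q = a * dd (Suc N) (peval G) p q + b * peval G p"
    by (rule jetE[OF assms(1)]) (rule that)
  obtain d' F' G' where F': "homogeneous N d' F'" "homogeneous N d' G'" "peval G' p \<noteq> 0"
    "\<And>v. v \<in> \<Union>X \<Longrightarrow> peval G' v \<noteq> 0 \<Longrightarrow> g (ppoint v) = peval F' v / peval G' v"
    and ab': "peval F' p = a' * peval G' p"
    "dd (Suc N) (peval F') p q = a' * dd (Suc N) (peval G') p q + b' * peval G' p"
    by (rule jetE[OF assms(2)]) (rule that)
  note m = homogeneous_mult[OF F(1) F'(2)] homogeneous_mult[OF F(2) F'(1)]
  show ?thesis
  proof (rule jetI[of "F * G' + G * F'" "G * G'", OF representsI])
    show "homogeneous N (d + d') (F * G' + G * F')" by (rule homogeneous_add[OF m])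
    show "homogeneous N (d + d') (G * G')" by (rule homogeneous_mult[OF F(2) F'(2)])
    show "dd (Suc N) (peval (F * G' + G * F')) p q =
        (a + a') * dd (Suc N) (peval (G * G')) p q + (b + b') * peval (G * G') p"
      unfolding dd_peval_add[OF m] dd_peval_mult[OF F(1) F'(2)] dd_peval_mult[OF F(2) F'(1)]
        dd_peval_mult[OF F(2) F'(2)] ab ab' peval_mult by (simp add: algebra_simps)
  qed (use F(3,4) F'(3,4) ab ab' in \<open>auto simp: peval_add peval_mult field_simps simp del: Union_iff\<close>)
qed

lemma jet_mult:
  assumes "jet q f a b" "jet q g a' b'"
  shows "jet q (\<lambda>y. f y * g y) (a * a') (a * b' + a' * b)"
proof -
  obtain d F G where F: "homogeneous N d F" "homogeneous N d G" "peval G p \<noteq> 0"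
    "\<And>v. v \<in> \<Union>X \<Longrightarrow> peval G v \<noteq> 0 \<Longrightarrow> f (ppoint v) = peval F v / peval G v"
    and ab: "peval F p = a * peval G p"
    "dd (Suc N) (peval F) p q = a * dd (Suc N) (peval G) p q + b * peval G p"
    by (rule jetE[OF assms(1)]) (rule that)
  obtain d' F' G' where F': "homogeneous N d' F'" "homogeneous N d' G'" "peval G' p \<noteq> 0"
    "\<And>v. v \<in> \<Union>X \<Longrightarrow> peval G' v \<noteq> 0 \<Longrightarrow> g (ppoint v) = peval F' v / peval G' v"
    and ab': "peval F' p = a' * peval G' p"
    "dd (Suc N) (peval F') p q = a' * dd (Suc N) (peval G') p q + b' * peval G' p"
    by (rule jetE[OF assms(2)]) (rule that)
  show ?thesis
  proof (rule jetI[of "F * F'" "G * G'", OF representsI])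
    show "homogeneous N (d + d') (F * F')" by (rule homogeneous_mult[OF F(1) F'(1)])
    show "homogeneous N (d + d') (G * G')" by (rule homogeneous_mult[OF F(2) F'(2)])
    show "dd (Suc N) (peval (F * F')) p q =
        a * a' * dd (Suc N) (peval (G * G')) p q + (a * b' + a' * b) * peval (G * G') p"
      unfolding dd_peval_mult[OF F(1) F'(1)]
        dd_peval_mult[OF F(2) F'(2)] ab ab' peval_mult by (simp add: algebra_simps)
  qed (use F(3,4) F'(3,4) ab ab' in \<open>auto simp: peval_mult simp del: Union_iff\<close>)
qed

lemma jet_one: "jet q (\<lambda>_. 1) 1 0"
  by (rule jetI[of 1 1, OF representsI])
    (use homogeneous_const[of N 1] in \<open>auto simp: peval_one\<close>)

end

locale projected_set = pointed_set N X p for N X p +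
  fixes M :: nat and q :: "nat \<Rightarrow> complex" and A :: "nat \<Rightarrow> nat \<Rightarrow> complex" and f :: "point \<Rightarrow> point"
  assumes N_eq: "N = Suc M" and q: "q \<in> cvec N" "q \<noteq> 0" and q_notin: "ppoint q \<notin> X"
    and kernel: "v \<in> cvec N \<Longrightarrow> mat_app M N A v = 0 \<longleftrightarrow> v = 0 \<or> v \<in> ppoint q"
    and f: "x \<in> pspace N \<Longrightarrow> x \<noteq> ppoint q \<Longrightarrow> f x = mat_app M N A ` x"
begin

abbreviation "L \<equiv> mat_app M N A"

lemma L_nonzero:
  assumes "v \<in> \<Union>X"
  shows "L v \<noteq> 0"
proof
  assume "L v = 0"
  moreover note v = mem[OF assms]
  ultimately have "v \<in> ppoint q" using kernel[OF conjunct1[OF v]] by simp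
  from ppoint_eq[OF this] v q_notin show False by simp
qed

lemma L_q: "L q = 0"
  by (rule iffD2[OF kernel[OF q(1)] disjI2[OF ppoint_mem]])

lemma f_ppoint:
  assumes "v \<in> \<Union>X"
  shows "f (ppoint v) = ppoint (L v)"
proof -
  have image: "ppoint u = (\<lambda>c. cscale c u) ` {c. c \<noteq> 0}" for u
    unfolding ppoint_def by blast
  have v: "ppoint v \<in> X" using mem[OF assms] by simp
  have "f (ppoint v) = L ` ppoint v"
    by (rule f[OF subsetD[OF X v]]) (use v q_notin in metis)
  also have "\<dots> = ppoint (L v)"
    unfolding image image_image mat_app_scale ..
  finally show ?thesis .
qed

lemma pspace_mem: "u \<in> \<Union>(pspace M) \<longleftrightarrow> u \<in> cvec M \<and> u \<noteq> 0"
proof -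
  have "u \<in> cvec M \<Longrightarrow> u \<noteq> 0 \<Longrightarrow> ppoint u \<in> pspace M"
    unfolding pspace_def by (intro CollectI exI[of _ u] conjI refl)
  then show ?thesis using Union_pspace[OF subset_refl, of u M] by (simp del: Union_iff) argo
qed

lemma L_mem: "v \<in> \<Union>X \<Longrightarrow> L v \<in> \<Union>(pspace M)"
  unfolding pspace_mem by (rule conjI[OF mat_app_cvec L_nonzero])

sublocale T: pointed_set M "pspace M" "L p"
  by unfold_locales (rule subset_refl, rule L_mem[OF p])

lemma represents_pullback:
  assumes r: "represents M (pspace M) (L p) F G g"
  shows "\<exists>F' G'. represents N X p F' G' (g \<circ> f) \<and> (\<forall>v. peval F' v = peval F (L v)) \<and>
    (\<forall>v. peval G' v = peval G (L v))"
proof -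
  obtain d where F: "homogeneous M d F" "homogeneous M d G" "peval G (L p) \<noteq> 0"
    "\<And>v. v \<in> \<Union>(pspace M) \<Longrightarrow> peval G v \<noteq> 0 \<Longrightarrow> g (ppoint v) = peval F v / peval G v"
    by (rule representsE[OF r]) (rule that)
  from linear_substitution[OF F(1), of N A] obtain F' where
    F': "homogeneous N d F'" "\<forall>v. peval F' v = peval F (L v)" by (elim exE conjE)
  from linear_substitution[OF F(2), of N A] obtain G' where
    G': "homogeneous N d G'" "\<forall>v. peval G' v = peval G (L v)" by (elim exE conjE)
  have "represents N X p F' G' (g \<circ> f)"
  proof (rule representsI[OF F'(1) G'(1)])
    show "peval G' p \<noteq> 0" using G'(2) F(3) by simp
    fix v assume v: "v \<in> \<Union>X" "peval G' v \<noteq> 0"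
    then show "(g \<circ> f) (ppoint v) = peval F' v / peval G' v"
      using F(4)[OF L_mem[OF v(1)]] F'(2) G'(2) by (simp add: f_ppoint)
  qed
  then show ?thesis using F'(2) G'(2) by (intro exI[of _ F'] exI[of _ G'] conjI)
qed

lemma regular_pullback: "T.regular g \<Longrightarrow> regular (g \<circ> f)"
  unfolding T.regular_iff regular_iff
  by (elim exE, drule represents_pullback, elim exE conjE) (rule exI, rule exI)

lemma near_zero_pullback:
  assumes "near_zero M (pspace M) (L p) g"
  shows "near_zero N X p (g \<circ> f)"
proof -
  obtain d H where H: "homogeneous M d H" "peval H (L p) \<noteq> 0"
    and g: "\<And>v. v \<in> \<Union>(pspace M) \<Longrightarrow> peval H v \<noteq> 0 \<Longrightarrow> g (ppoint v) = 0"
    by (rule near_zeroE[OF assms]) (rule that)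
  from linear_substitution[OF H(1), of N A] obtain H' where
    H': "homogeneous N d H'" "\<forall>v. peval H' v = peval H (L v)" by (elim exE conjE)
  show ?thesis
  proof (rule near_zeroI[OF H'(1)])
    fix v assume v: "v \<in> \<Union>X" "peval H' v \<noteq> 0"
    then show "(g \<circ> f) (ppoint v) = 0"
      using g[OF L_mem[OF v(1)]] H'(2) by (simp add: f_ppoint)
  qed (use H H' in simp)
qed

abbreviation "pull \<equiv> pullback N X (ppoint p) f"

lemma pull_germ:
  assumes "T.regular g"
  shows "pull (T.germ g) = germ (g \<circ> f)"
proof -
  have "germ (h \<circ> f) = germ (g \<circ> f)" if h: "h \<in> T.germ g" for h
    using germ_eq_iff[OF regular_pullback[OF T.mem_germ(1)[OF assms h]] regular_pullback[OF assms]]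
      near_zero_pullback[OF T.mem_germ(2)[OF assms h]] by (simp add: comp_def)
  then have "(\<lambda>h. germ (h \<circ> f)) ` T.germ g = {germ (g \<circ> f)}"
    using T.germ_self[OF assms] by blast
  then show ?thesis unfolding pullback_def germ_def[symmetric] by simp
qed

lemma pull_closed: "a \<in> carrier T.locals \<Longrightarrow> pull a \<in> carrier locals"
  unfolding T.carrier_locals using pull_germ germ_mem regular_pullback by auto

lemma ramified_iff:
  "ppoint p \<in> ramification_locus N X M f \<longleftrightarrow>
    carrier (kaehler_differentials T.locals locals pull) \<noteq> {\<one>\<^bsub>kaehler_differentials T.locals locals pull\<^esub>}"
  using mem[OF p] by (simp add: ramification_locus_def Let_def f_ppoint[OF p])

lemma mat_app_form:
  "\<exists>F. homogeneous N 1 F \<and> (\<forall>v. peval F v = L v j)"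
proof (cases "j \<le> M")
  case True
  then show ?thesis using linear_form_exists[of N "A j"] by (simp add: mat_app_def)
next
  case False
  then show ?thesis using linear_form_exists[of N "\<lambda>_. 0"] by (simp add: mat_app_def)
qed

text \<open>The coordinates of a point, normalised so that the \<open>j\<close>-th coordinate of its projection is \<open>1\<close>
  (all are \<open>0\<close> if that coordinate vanishes).\<close>

definition ratio :: "nat \<Rightarrow> point \<Rightarrow> nat \<Rightarrow> complex" where
  "ratio j y = (\<lambda>i. (SOME v. v \<in> y) i / L (SOME v. v \<in> y) j)"

lemma ratio_ppoint: "ratio j (ppoint v) = (\<lambda>i. v i / L v j)"
proof -
  have "(SOME u. u \<in> ppoint v) \<in> ppoint v" by (rule someI[of "\<lambda>u. u \<in> ppoint v", OF ppoint_mem])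
  then obtain c where c: "(SOME u. u \<in> ppoint v) = cscale c v" "c \<noteq> 0"
    unfolding ppoint_def by blast
  then show ?thesis by (simp add: ratio_def mat_app_scale) (simp add: cscale_def)
qed

lemma regular_ratio:
  assumes j: "L p j \<noteq> 0" and F: "F \<in> polyfun (Suc N)"
  shows "regular (\<lambda>y. F (ratio j y))"
  using F
proof (induction rule: polyfun.induct)
  case (coord i)
  from mat_app_form[of j] obtain l where l: "homogeneous N 1 l" "\<forall>v. peval l v = L v j"
    by (elim exE conjE)
  have i: "i \<le> N" using coord by simp
  show ?case
    by (rule regular_of_represents[OF representsI[OF homogeneous_coord[OF i] l(1)]])
      (simp_all add: l(2) j peval_coord ratio_ppoint del: One_nat_def)
qed (simp_all add: regular_const regular_add regular_mult)

lemma ramified_of_tangent: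
  assumes tv: "q \<in> tv (\<Union>X) (Suc N) p"
  shows "ppoint p \<in> ramification_locus N X M f"
proof -
  interpret R: cring locals by (rule cring_locals)
  \<comment> \<open>Germs are cosets, so value and derivative are read off from any member;
    \<open>jet_unique\<close> makes the descriptions definite.\<close>
  define val where "val C = (THE a. \<exists>g b. g \<in> C \<and> jet q g a b)" for C
  define der where "der C = (THE b. \<exists>g a. g \<in> C \<and> jet q g a b)" for C
  have vd: "val (germ g) = a \<and> der (germ g) = b" if g: "regular g" and jet: "jet q g a b" for g a b
  proof -
    have uniq: "a' = a \<and> b' = b" if h: "h \<in> germ g" "jet q h a' b'" for h a' b'
      by (rule jet_unique[OF tv h(2) jet mem_germ(2)[OF g h(1)]])
    have "val (germ g) = a"
      unfolding val_def
    proof (rule the_equality)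
      show "\<exists>h b. h \<in> germ g \<and> jet q h a b"
        using germ_self[OF g] jet by (intro exI[of _ g] exI[of _ b] conjI)
    qed (use uniq in blast)
    moreover have "der (germ g) = b"
      unfolding der_def
    proof (rule the_equality)
      show "\<exists>h a. h \<in> germ g \<and> jet q h a b"
        using germ_self[OF g] jet by (intro exI[of _ g] exI[of _ a] conjI)
    qed (use uniq in blast)
    ultimately show ?thesis by (rule conjI)
  qed
  have ops: "val (B \<oplus>\<^bsub>locals\<^esub> C) = val B + val C \<and> val (B \<otimes>\<^bsub>locals\<^esub> C) = val B * val C \<and>
      der (B \<oplus>\<^bsub>locals\<^esub> C) = der B + der C \<and> der (B \<otimes>\<^bsub>locals\<^esub> C) = val B * der C + val C * der B"
    if BC: "B \<in> carrier locals" "C \<in> carrier locals" for B C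
  proof -
    from BC obtain g h where g: "regular g" "B = germ g" and h: "regular h" "C = germ h"
      unfolding carrier_locals by (elim imageE CollectE)
    from jet_exists[OF g(1), of q] obtain a b where ab: "jet q g a b" by (elim exE)
    from jet_exists[OF h(1), of q] obtain a' b' where ab': "jet q h a' b'" by (elim exE)
    show ?thesis
      unfolding g h germ_add[OF g(1) h(1), symmetric] germ_mult[OF g(1) h(1), symmetric]
      using vd[OF g(1) ab] vd[OF h(1) ab'] vd[OF regular_add[OF g(1) h(1)] jet_add[OF ab ab']]
        vd[OF regular_mult[OF g(1) h(1)] jet_mult[OF ab ab']] by simp
  qed
  have der_pull: "der (pull a) = 0" if a: "a \<in> carrier T.locals" for a
  proof -
    from a obtain g where g: "T.regular g" "a = T.germ g"
      unfolding T.carrier_locals by (elim imageE CollectE)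
    from g(1) obtain F G where r: "represents M (pspace M) (L p) F G g"
      unfolding T.regular_iff by (elim exE)
    from represents_pullback[OF r] obtain F' G' where r': "represents N X p F' G' (g \<circ> f)"
      and F': "\<forall>v. peval F' v = peval F (L v)" and G': "\<forall>v. peval G' v = peval G (L v)"
      by (elim exE conjE)
    obtain d where F: "homogeneous M d F" "homogeneous M d G"
      by (rule representsE[OF r]) (rule that)
    have nz: "peval G' p \<noteq> 0" using r' by (simp add: represents_def)
    have "dd (Suc N) (\<lambda>v. h (L v)) p q = 0" if "h \<in> polyfun (Suc M)" for h
      unfolding dd_compose[OF that polyfun_mat_app] dd_mat_app L_q
      by (simp add: zero_fun_def)
    moreover have "peval F' = (\<lambda>v. peval F (L v))" "peval G' = (\<lambda>v. peval G (L v))"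
      by (rule ext, rule F'[THEN spec]) (rule ext, rule G'[THEN spec])
    ultimately have "dd (Suc N) (peval F') p q = 0" "dd (Suc N) (peval G') p q = 0"
      using peval_polyfun[OF F(1)] peval_polyfun[OF F(2)] by simp_all
    then have "jet q (g \<circ> f) (peval F' p / peval G' p) 0"
      using nz by (intro jetI[OF r']) simp_all
    then show ?thesis
      using vd[OF regular_pullback[OF g(1)]] pull_germ[OF g(1)] g(2) by simp
  qed
  have "\<exists>j. L p j \<noteq> 0" using L_nonzero[OF p] by (auto simp: fun_eq_iff)
  then obtain j where j: "L p j \<noteq> 0" ..
  have "\<exists>i. q i \<noteq> 0" using q(2) by (auto simp: fun_eq_iff)
  then obtain i where i: "q i \<noteq> 0" ..
  then have iN: "i \<le> N" using q(1) unfolding cvec_def by (auto simp: not_less[symmetric])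
  from mat_app_form[of j] obtain l where l: "homogeneous N 1 l" "\<forall>v. peval l v = L v j"
    by (elim exE conjE)
  define g where "g y = ratio j y i" for y
  have g_reg: "regular g"
    unfolding g_def[abs_def] by (rule regular_ratio[OF j polyfun.coord]) (use iN in simp)
  have pl: "peval l = (\<lambda>v. L v j)" using l(2) by (simp add: fun_eq_iff)
  have pc: "peval (Poly_Mapping.single (Poly_Mapping.single i 1) 1) = (\<lambda>v. v i)"
    by (simp add: peval_coord fun_eq_iff del: One_nat_def)
  \<comment> \<open>A coordinate in which \<open>q\<close> is nonzero, divided by a linear form of
    the projection. That form is killed by \<open>q\<close>, so the derivative is just
    \<open>q i\<close> over its value.\<close>
  have "jet q g (p i / L p j) (q i / L p j)"
    by (rule jetI[OF representsI[OF homogeneous_coord[OF iN] l(1)]])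
      (use j iN in \<open>simp_all add: pl pc g_def ratio_ppoint dd_coord dd_mat_app L_q del: One_nat_def\<close>)
  from vd[OF g_reg this] have "der (germ g) \<noteq> 0" using i j by simp
  then show ?thesis
    unfolding ramified_iff
    by (intro R.kaehler_differentials_nontrivial[where ev = val and D = der and x = "germ g"])
      (use ops der_pull pull_closed vd[OF regular_const jet_one] germ_one germ_mem[OF g_reg] in auto)
qed

end

section \<open>At a ramification point the centre is tangent\<close>

context projected_set
begin

text \<open>The map sending \<open>v\<close> to \<open>L v\<close> and \<open>v i0\<close> is an
  isomorphism: the kernel of \<open>L\<close> is the line of \<open>q\<close>, on which coordinate
  \<open>i0\<close> is injective. The \<open>s i j\<close> are preimages of unit vectors with
  coordinate \<open>i0\<close> equal to 0.\<close>

lemma coordinates_from_projection: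
  assumes i0: "q i0 \<noteq> 0"
  shows "\<exists>s. \<forall>i. \<forall>v\<in>cvec N. v i = (\<Sum>j\<le>M. s i j * L v j) + q i * (v i0 / q i0)"
proof -
  have i0N: "i0 \<le> N" using i0 q(1) unfolding cvec_def by (auto simp: not_less[symmetric])
  have zero: "u = 0" if u: "u \<in> cvec N" "L u = 0" "u i0 = 0" for u
  proof (rule ccontr)
    assume "u \<noteq> 0"
    then have "u \<in> ppoint q" using kernel[OF u(1)] u(2) by simp
    then obtain c where c: "u = cscale c q" "c \<noteq> 0" unfolding ppoint_def by (elim CollectE exE conjE)
    then show False using u(3) i0 by (simp add: cscale_def)
  qed
  let ?I = "{..N} - {i0}"
  define ext where "ext x = (\<lambda>i. if i \<in> ?I then x i else 0)" for x :: "nat \<Rightarrow> complex"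
  have ext: "ext x \<in> cvec N" "ext x i0 = 0" for x
    by (auto simp: ext_def cvec_def)
  have L_ext: "L (ext x) j = (\<Sum>i\<in>?I. A j i * x i)" if "j \<le> M" for x j
  proof -
    have "(\<Sum>i\<le>N. A j i * ext x i) = (\<Sum>i\<in>?I. A j i * ext x i)"
      by (rule sum.mono_neutral_right) (auto simp: ext_def)
    then show ?thesis using that by (simp add: mat_app_def ext_def)
  qed
  have "\<exists>x. \<forall>b\<in>{..M}. (\<Sum>i\<in>?I. A b i * x i) = (if b = j then 1 else 0)" for j
  proof (rule inj_imp_surj)
    show "card {..M} = card ?I" using i0N N_eq by simp
    fix x assume x: "\<And>b. b \<in> {..M} \<Longrightarrow> (\<Sum>i\<in>?I. A b i * x i) = 0"
    have "L (ext x) b = 0" for b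
    proof (cases "b \<le> M")
      case True
      then show ?thesis using L_ext[OF True, of x] x[of b] by simp
    qed (simp add: mat_app_def)
    then have "L (ext x) = 0" by (simp add: fun_eq_iff)
    from zero[OF ext(1) this ext(2)] have "ext x = 0" .
    show "\<forall>i\<in>?I. x i = 0"
    proof
      fix i assume "i \<in> ?I"
      then have "x i = ext x i" unfolding ext_def by simp
      then show "x i = 0" using \<open>ext x = 0\<close> by simp
    qed
  qed simp_all
  then have "\<forall>j. \<exists>x. \<forall>b\<in>{..M}. (\<Sum>i\<in>?I. A b i * x i) = (if b = j then 1 else 0)" by (rule allI)
  from choice[OF this] obtain X where
    X: "\<forall>j. \<forall>b\<in>{..M}. (\<Sum>i\<in>?I. A b i * X j i) = (if b = j then 1 else 0)" ..
  show ?thesis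
  proof (rule exI[of _ "\<lambda>i j. ext (X j) i"], intro allI ballI)
    fix i v assume v: "v \<in> cvec N"
    define u where "u = (\<lambda>i. v i - ((\<Sum>j\<le>M. ext (X j) i * L v j) + q i * (v i0 / q i0)))"
    have u: "u \<in> cvec N"
      using v q(1) ext(1) unfolding u_def cvec_def by simp
    have Lu: "L u b = 0" for b
    proof (cases "b \<le> M")
      case True
      have "L u b = (\<Sum>i\<le>N. A b i * v i) - (\<Sum>i\<le>N. A b i * (\<Sum>j\<le>M. ext (X j) i * L v j))
          - (v i0 / q i0) * (\<Sum>i\<le>N. A b i * q i)"
        using True by (simp add: mat_app_def u_def sum_subtractf sum_distrib_left algebra_simps)
          (simp add: sum.distrib)
      moreover have "(\<Sum>i\<le>N. A b i * q i) = 0"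
        using fun_cong[OF L_q, of b] True by (simp add: mat_app_def)
      moreover have "(\<Sum>i\<le>N. A b i * (\<Sum>j\<le>M. ext (X j) i * L v j)) = (\<Sum>j\<le>M. L (ext (X j)) b * L v j)"
        using True unfolding sum_distrib_left
        by (subst sum.swap) (simp add: mat_app_def[of _ _ _ "ext _"] sum_distrib_left sum_distrib_right mult_ac)
      moreover have "\<dots> = L v b"
        using True by (simp add: L_ext X sum.delta' if_distrib[of "\<lambda>t. t * _"] cong: if_cong)
      ultimately show ?thesis using True by (simp add: mat_app_def)
    qed (simp add: mat_app_def)
    have "L u = 0" unfolding fun_eq_iff using Lu by simp
    moreover have "u i0 = 0" using i0 ext(2) by (simp add: u_def)
    ultimately have "u = 0" by (rule zero[OF u])
    then have "u i = 0" by simp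
    then show "v i = (\<Sum>j\<le>M. ext (X j) i * L v j) + q i * (v i0 / q i0)"
      unfolding u_def by simp
  qed
qed

lemma germ_cong: "regular g \<Longrightarrow> regular h \<Longrightarrow> (\<And>v. v \<in> \<Union>X \<Longrightarrow> g (ppoint v) = h (ppoint v)) \<Longrightarrow> germ g = germ h"
  by (subst germ_eq_iff, assumption, assumption,
      rule near_zeroI[OF homogeneous_const[of N 1]]) (simp_all add: peval_one)

text \<open>In coordinates normalised by the projection, each coordinate is a pulled back function
  plus \<open>q i\<close> times \<open>t\<close>. Hence its differential is \<open>q i\<close> dt,
  and the product rule gives the derivative along \<open>q\<close> for every
  \<open>F\<close>.\<close>

lemma follows_ratio:
  assumes j: "L p j \<noteq> 0" and i0: "q i0 \<noteq> 0"
    and H: "kaehler_submodule locals H T.locals pull (germ (\<lambda>y. ratio j y i0 / q i0))"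
    and F: "F \<in> polyfun (Suc N)"
  shows "kaehler_submodule.follows locals H
    (germ (\<lambda>y. ratio j y i0 / q i0)) (germ (\<lambda>y. F (ratio j y))) (germ (\<lambda>y. dd (Suc N) F (ratio j y) q))"
proof -
  define \<tau> where "\<tau> = (\<lambda>y. ratio j y i0 / q i0)"
  interpret K: kaehler_submodule locals "free_module locals (carrier locals)" H T.locals pull "germ \<tau>"
    using H unfolding \<tau>_def .
  have i0N: "i0 \<le> N" using i0 q(1) unfolding cvec_def by (auto simp: not_less[symmetric])
  have \<tau>: "regular \<tau>"
    using regular_ratio[OF j polyfun.mult[OF polyfun.const[of "1 / q i0"] polyfun.coord[of i0 "Suc N"]]] i0N
    unfolding \<tau>_def by simp
  have jM: "j \<le> M" using j by (auto simp: mat_app_def split: if_splits)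
  have fconst: "K.follows (germ (\<lambda>_. c)) (germ (\<lambda>_. 0))" for c
  proof -
    have "K.follows (pull (T.germ (\<lambda>_. c))) (\<zero>\<^bsub>locals\<^esub>)"
      by (rule K.follows_phi) (rule T.germ_mem[OF T.regular_const])
    then show ?thesis
      unfolding pull_germ[OF T.regular_const] germ_zero by (simp add: comp_def)
  qed
  have fadd: "K.follows (germ (\<lambda>y. g y + h y)) (germ (\<lambda>y. g' y + h' y))"
    if "regular g" "regular h" "regular g'" "regular h'"
      "K.follows (germ g) (germ g')" "K.follows (germ h) (germ h')" for g h g' h'
    unfolding germ_add[OF that(1,2)] germ_add[OF that(3,4)] by (rule K.follows_add[OF that(5,6)])
  have fmult: "K.follows (germ (\<lambda>y. g y * h y)) (germ (\<lambda>y. g y * h' y + h y * g' y))"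
    if "regular g" "regular h" "regular g'" "regular h'"
      "K.follows (germ g) (germ g')" "K.follows (germ h) (germ h')" for g h g' h'
    unfolding germ_mult[OF that(1,2)] germ_add[OF regular_mult[OF that(1,4)] regular_mult[OF that(2,3)]]
      germ_mult[OF that(1,4)] germ_mult[OF that(2,3)]
    by (rule K.follows_mult[OF that(5,6)])
  from coordinates_from_projection[OF i0] obtain s where
    s: "\<forall>i. \<forall>v\<in>cvec N. v i = (\<Sum>j\<le>M. s i j * L v j) + q i * (v i0 / q i0)" ..
  have fcoord: "K.follows (germ (\<lambda>y. ratio j y i)) (germ (\<lambda>_. q i))" if i: "i \<le> N" for i
  proof -
    define g where "g y = (\<Sum>k\<le>M. s i k * (SOME v. v \<in> y) k) / (SOME v. v \<in> y) j"
      for y :: point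
    have g_pt: "g (ppoint u) = (\<Sum>k\<le>M. s i k * u k) / u j" for u
    proof -
      have "(SOME v. v \<in> ppoint u) \<in> ppoint u" by (rule someI[of "\<lambda>v. v \<in> ppoint u", OF ppoint_mem])
      then obtain c where c: "(SOME v. v \<in> ppoint u) = cscale c u" "c \<noteq> 0"
        unfolding ppoint_def by (elim CollectE exE conjE)
      have "(\<Sum>k\<le>M. s i k * (c * u k)) = c * (\<Sum>k\<le>M. s i k * u k)"
        by (simp add: sum_distrib_left mult_ac)
      then show ?thesis using c(2) unfolding g_def c(1) by (simp add: cscale_def)
    qed
    from linear_form_exists[of M "s i"] obtain l where
      l: "homogeneous M 1 l" "\<forall>v. peval l v = (\<Sum>k\<le>M. s i k * v k)" by (elim exE conjE)
    have g: "T.regular g"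
      by (rule T.regular_of_represents[OF representsI[OF l(1) homogeneous_coord[OF jM]]])
        (simp_all add: j l(2) peval_coord g_pt del: One_nat_def)
    have gf: "K.follows (germ (g \<circ> f)) (germ (\<lambda>_. 0))"
      unfolding pull_germ[OF g, symmetric] germ_zero by (rule K.follows_phi[OF T.germ_mem[OF g]])
    have self: "K.follows (germ \<tau>) (germ (\<lambda>_. 1))" unfolding germ_one by (rule K.follows_self)
    have "K.follows (germ (\<lambda>y. (g \<circ> f) y + q i * \<tau> y)) (germ (\<lambda>y. 0 + (q i * 1 + \<tau> y * 0)))"
      by (rule fadd[OF regular_pullback[OF g] regular_mult[OF regular_const \<tau>] regular_const _ gf
            fmult[OF regular_const \<tau> regular_const regular_const fconst self]])
        (simp add: regular_const)
    moreover have "germ (\<lambda>y. ratio j y i) = germ (\<lambda>y. (g \<circ> f) y + q i * \<tau> y)"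
    proof (rule germ_cong)
      show "regular (\<lambda>y. ratio j y i)" by (rule regular_ratio[OF j polyfun.coord]) (use i in simp)
      show "regular (\<lambda>y. (g \<circ> f) y + q i * \<tau> y)"
        by (rule regular_add[OF regular_pullback[OF g] regular_mult[OF regular_const \<tau>]])
      fix v assume v: "v \<in> \<Union>X"
      have "v i = (\<Sum>k\<le>M. s i k * L v k) + q i * (v i0 / q i0)" using s mem[OF v] by simp
      then show "ratio j (ppoint v) i = (g \<circ> f) (ppoint v) + q i * \<tau> (ppoint v)"
        by (simp add: ratio_ppoint f_ppoint[OF v] g_pt \<tau>_def add_divide_distrib)
    qed
    ultimately show ?thesis by simp
  qed
  note reg = regular_ratio[OF j] and regd = regular_ratio[OF j polyfun_dd[OF _ polyfun.const]]
  show ?thesis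
    unfolding \<tau>_def[symmetric] using F
  proof (induction rule: polyfun.induct)
    case (const c)
    then show ?case using fconst by simp
  next
    case (coord i)
    then show ?case using fcoord by (simp add: dd_coord)
  next
    case (add F G)
    then show ?case unfolding dd_add[OF add.hyps]
      using fadd[OF reg[OF add.hyps(1)] reg[OF add.hyps(2)] regd[OF add.hyps(1)] regd[OF add.hyps(2)] add.IH] by simp
  next
    case (mult F G)
    then show ?case unfolding dd_mult[OF mult.hyps]
      using fmult[OF reg[OF mult.hyps(1)] reg[OF mult.hyps(2)] regd[OF mult.hyps(1)] regd[OF mult.hyps(2)] mult.IH] by simp
  qed
qed

lemma tangent_of_ramified:
  assumes ram: "ppoint p \<in> ramification_locus N X M f"
  shows "q \<in> tv (\<Union>X) (Suc N) p"
proof (rule ccontr)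
  assume notin: "q \<notin> tv (\<Union>X) (Suc N) p"
  interpret R: cring locals by (rule cring_locals)
  have "\<exists>j. L p j \<noteq> 0" using L_nonzero[OF p] by (auto simp: fun_eq_iff)
  then obtain j where j: "L p j \<noteq> 0" ..
  have "\<exists>i. q i \<noteq> 0" using q(2) by (auto simp: fun_eq_iff)
  then obtain i0 where i0: "q i0 \<noteq> 0" ..
  then have i0N: "i0 \<le> N" using q(1) unfolding cvec_def by (auto simp: not_less[symmetric])
  define \<tau> where "\<tau> = (\<lambda>y. ratio j y i0 / q i0)"
  have \<tau>: "regular \<tau>"
    using regular_ratio[OF j polyfun.mult[OF polyfun.const[of "1 / q i0"] polyfun.coord[of i0 "Suc N"]]] i0N
    unfolding \<tau>_def by simp
  have scaled: "ratio j (ppoint v) = cscale (1 / L v j) v" for v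
    by (simp add: ratio_ppoint cscale_def)
  \<comment> \<open>The representative of the point at which the normalised coordinates are
    evaluated; the tangent space does not depend on the representative.\<close>
  define p' where "p' = cscale (1 / L p j) p"
  have "ppoint p' = ppoint p" unfolding p'_def by (rule ppoint_scale) (use j in simp)
  then have "cvec N \<inter> tv (\<Union>X) (Suc N) p' = cvec N \<inter> tv (\<Union>X) (Suc N) p"
    using affine_tangent_space_tv[OF X] by metis
  then have "q \<notin> tv (\<Union>X) (Suc N) p'" using notin q(1) by blast
  then obtain h where h: "h \<in> polyfun (Suc N)" "\<forall>x\<in>\<Union>X. h x = 0" "dd (Suc N) h p' q \<noteq> 0"
    unfolding tv_def by blast
  define dh where "dh v = dd (Suc N) h v q" for v
  have dh: "dh \<in> polyfun (Suc N)"
    unfolding dh_def[abs_def] by (rule polyfun_dd[OF h(1) polyfun.const])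
  from mat_app_form[of j] obtain l where l: "homogeneous N 1 l" "\<forall>v. peval l v = L v j"
    by (elim exE conjE)
  \<comment> \<open>\<open>h\<close> is an equation of the cone, so \<open>follows_ratio\<close> for
    \<open>h\<close> reads d0 = \<open>dh\<close> dt.\<close>
  have hz: "germ (\<lambda>y. h (ratio j y)) = \<zero>\<^bsub>locals\<^esub>"
    unfolding germ_zero[symmetric] germ_eq_iff[OF regular_ratio[OF j h(1)] regular_const]
  proof (rule near_zeroI[OF l(1)])
    fix v assume v: "v \<in> \<Union>X" "peval l v \<noteq> 0"
    then have "1 / L v j \<noteq> 0" using l(2) by simp
    from bspec[OF h(2) Union_pspace_scale[OF X v(1) this]] show "h (ratio j (ppoint v)) - 0 = 0"
      unfolding scaled by simp
  qed (use j l(2) in simp)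
  have unit: "\<exists>w. w \<in> carrier locals \<and> w \<otimes>\<^bsub>locals\<^esub> germ g = \<one>\<^bsub>locals\<^esub>"
    if g: "regular g" "g (ppoint p) \<noteq> 0" for g
  proof (rule exI[of _ "germ (\<lambda>y. inverse (g y))"], rule conjI)
    note inv = regular_inverse[OF g]
    show "germ (\<lambda>y. inverse (g y)) \<in> carrier locals" by (rule germ_mem[OF inv(1)])
    have "germ (\<lambda>y. inverse (g y) * g y) = germ (\<lambda>_. 1)"
      unfolding germ_eq_iff[OF regular_mult[OF inv(1) g(1)] regular_const] by (rule inv(2))
    then show "germ (\<lambda>y. inverse (g y)) \<otimes>\<^bsub>locals\<^esub> germ g = \<one>\<^bsub>locals\<^esub>"
      unfolding germ_mult[OF inv(1) g(1)] germ_one .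
  qed
  have "carrier (kaehler_differentials T.locals locals pull) =
      {\<one>\<^bsub>kaehler_differentials T.locals locals pull\<^esub>}"
  proof (rule R.kaehler_differentials_trivial[OF pull_closed])
    fix H C
    assume sub: "submodule H locals (free_module locals (carrier locals))"
      and rel: "kaehler_relators T.locals locals pull \<subseteq> H" and C: "C \<in> carrier locals"
    interpret K: kaehler_submodule locals "free_module locals (carrier locals)" H T.locals pull "germ \<tau>"
      by (intro kaehler_submodule.intro kaehler_submodule_axioms.intro cring_locals sub rel
          pull_closed germ_mem \<tau>) simp_all
    note follows = follows_ratio[OF j i0, folded \<tau>_def, OF K.kaehler_submodule_axioms]
    have "dh (ratio j (ppoint p)) \<noteq> 0"
      using h(3) unfolding dh_def scaled p'_def .
    from unit[OF regular_ratio[OF j dh] this] obtain w where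
      w: "w \<in> carrier locals" "w \<otimes>\<^bsub>locals\<^esub> germ (\<lambda>y. dh (ratio j y)) = \<one>\<^bsub>locals\<^esub>" by (elim exE conjE)
    have t: "free_gen locals (germ \<tau>) \<in> H"
      by (rule K.self_mem_of_unit[OF _ w]) (use follows[OF h(1)] in \<open>simp add: hz dh_def\<close>)
    have all: "free_gen locals (germ (\<lambda>y. F (ratio j y))) \<in> H" if "F \<in> polyfun (Suc N)" for F
      by (rule K.mem_of_follows[OF follows[OF that] t])
    from C obtain g where g: "regular g" "C = germ g"
      unfolding carrier_locals by (elim imageE CollectE)
    from g(1) obtain F G where r: "represents N X p F G g" unfolding regular_iff by (elim exE)
    obtain d where F: "homogeneous N d F" "homogeneous N d G" "peval G p \<noteq> 0"
      "\<And>v. v \<in> \<Union>X \<Longrightarrow> peval G v \<noteq> 0 \<Longrightarrow> g (ppoint v) = peval F v / peval G v"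
      by (rule representsE[OF r]) (rule that)
    note pf = peval_polyfun[OF F(1)] and pg = peval_polyfun[OF F(2)]
    \<comment> \<open>Numerator and denominator have equal degree, so evaluating both at normalised
      coordinates does not change the quotient. Every germ thus arises from functions of these
      coordinates and one inverse.\<close>
    define \<gamma> where "\<gamma> y = peval G (ratio j y)" for y
    have \<gamma>: "regular \<gamma>" unfolding \<gamma>_def[abs_def] by (rule regular_ratio[OF j pg])
    have \<gamma>p: "\<gamma> (ppoint p) \<noteq> 0"
      unfolding \<gamma>_def scaled peval_scale[OF F(2)] using j F(3) by simp
    note inv = regular_inverse[OF \<gamma> \<gamma>p]
    have inv_eq: "germ (\<lambda>y. inverse (\<gamma> y)) \<otimes>\<^bsub>locals\<^esub> germ \<gamma> = \<one>\<^bsub>locals\<^esub>"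
      unfolding germ_mult[OF inv(1) \<gamma>, symmetric] germ_one[symmetric]
        germ_eq_iff[OF regular_mult[OF inv(1) \<gamma>] regular_const] by (rule inv(2))
    have inv_mem: "free_gen locals (germ (\<lambda>y. inverse (\<gamma> y))) \<in> H"
      by (rule K.mem_inverse[OF germ_mem[OF \<gamma>] _ germ_mem[OF inv(1)] inv_eq])
        (use all[OF pg] in \<open>simp add: \<gamma>_def[abs_def]\<close>)
    have "germ g = germ (\<lambda>y. peval F (ratio j y) * inverse (\<gamma> y))"
      unfolding germ_eq_iff[OF g(1) regular_mult[OF regular_ratio[OF j pf] inv(1)]]
    proof (rule near_zeroI[OF homogeneous_mult[OF F(2) l(1)]])
      fix v assume v: "v \<in> \<Union>X" "peval (G * l) v \<noteq> 0"
      then have "peval G v \<noteq> 0" "L v j \<noteq> 0" using l(2) by (simp_all add: peval_mult)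
      then show "g (ppoint v) - peval F (ratio j (ppoint v)) * inverse (\<gamma> (ppoint v)) = 0"
        using F(4)[OF v(1)]
        by (simp add: \<gamma>_def scaled peval_scale[OF F(1)] peval_scale[OF F(2)] field_simps)
    qed (use F(3) j l(2) in \<open>simp add: peval_mult\<close>)
    then show "free_gen locals C \<in> H"
      unfolding g(2) germ_mult[OF regular_ratio[OF j pf] inv(1)]
      by (simp only:) (rule K.mem_mult[OF germ_mem[OF regular_ratio[OF j pf]] germ_mem[OF inv(1)] all[OF pf] inv_mem])
  qed
  then show False using ram unfolding ramified_iff by (rule notE[rotated])
qed

end

lemma ramification_iff_tangent:
  assumes X: "X \<subseteq> pspace N" and N: "N \<ge> 1" and P: "P \<in> pspace N - X" "q \<in> P"
    and proj: "linear_projection N P f" and p: "p \<in> \<Union>X"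
  shows "ppoint p \<in> ramification_locus N X (N - 1) f \<longleftrightarrow> q \<in> tv (\<Union>X) (Suc N) p"
proof -
  from P(1) have "P \<in> pspace N" by simp
  from pspace_rep[OF this P(2)] have q: "q \<in> cvec N" "q \<noteq> 0" "P = ppoint q" by simp_all
  obtain A where A: "\<forall>v\<in>cvec N. mat_app (N - 1) N A v = 0 \<longleftrightarrow> v = 0 \<or> v \<in> P"
    "\<forall>x\<in>pspace N - {P}. f x = mat_app (N - 1) N A ` x"
    using proj unfolding linear_projection_def by (elim exE conjE)
  interpret projected_set N X p "N - 1" q A f
    by unfold_locales (use X p N q P(1) A in auto)
  show ?thesis using ramified_of_tangent tangent_of_ramified by blast
qed

section \<open>Recovering the centre of projection\<close>

lemma zero_on_cone_component:
  assumes F: "\<And>d. homogeneous N d (F d)"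
    and van: "\<And>c. c \<noteq> 0 \<Longrightarrow> (\<Sum>d<D. peval (F d) (cscale c v)) = 0" and "d < D"
  shows "peval (F d) v = 0"
proof -
  have "(\<Sum>d<D. peval (F d) v * c ^ d) * (\<Sum>d<1. 1 * c ^ d) = 0" if "c \<noteq> 0" for c
    using van[OF that] by (simp add: peval_scale[OF F] mult.commute)
  from coeffs_zero_of_nonzero_args[OF this] show ?thesis using \<open>d < D\<close> by auto
qed

definition trunc :: "nat \<Rightarrow> (nat \<Rightarrow> complex) \<Rightarrow> nat \<Rightarrow> complex" where
  "trunc N v = (\<lambda>i. if i \<le> N then v i else 0)"

lemma trunc_cvec: "trunc N v \<in> cvec N"
  by (simp add: trunc_def cvec_def)

lemma polyfun_trunc: "f \<in> polyfun (Suc N) \<Longrightarrow> f (trunc N v) = f v"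
  by (rule polyfun_cong) (auto simp: trunc_def)

text \<open>Values do not change under truncation to \<open>cvec N\<close>. Requiring coordinate 0
  to be nonzero as a third condition keeps the truncated vector away from 0.\<close>

lemma nonzero_on_cvec:
  assumes f: "f \<in> polyfun (Suc N)" "f a \<noteq> 0" and g: "g \<in> polyfun (Suc N)" "g b \<noteq> 0"
  shows "\<exists>v\<in>cvec N. v \<noteq> 0 \<and> f v \<noteq> 0 \<and> g v \<noteq> 0"
proof -
  from prime_onD[where f = f and g = g and x = a and y = b, OF prime_on_UNIV f(1) g(1) UNIV_I f(2) UNIV_I g(2)]
  obtain z where z: "f z \<noteq> 0" "g z \<noteq> 0" by (elim bexE conjE)
  have fg: "(\<lambda>v. f v * g v) \<in> polyfun (Suc N)" by (rule polyfun.mult[OF f(1) g(1)])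
  have c0: "(\<lambda>v. v 0) \<in> polyfun (Suc N)" by (rule polyfun.coord) simp
  have one: "(\<lambda>v. v 0) (\<lambda>_. 1 :: complex) \<noteq> 0" by simp
  from prime_onD[where f = "\<lambda>v. f v * g v" and g = "\<lambda>v. v 0" and x = z, OF prime_on_UNIV fg c0 UNIV_I _ UNIV_I one]
  obtain y where y: "f y * g y \<noteq> 0" "y 0 \<noteq> 0" using z by auto
  have "trunc N y \<noteq> 0" using y(2) by (auto simp: trunc_def fun_eq_iff)
  then show ?thesis
    using trunc_cvec y(1) polyfun_trunc[OF f(1)] polyfun_trunc[OF g(1)]
    by (intro bexI[of _ "trunc N y"]) simp_all
qed

lemma smooth_pointD:
  assumes X: "X \<subseteq> pspace N" and dim: "var_dim N X = enat n" and x: "smooth_point N X x" "p \<in> x"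
  shows "p \<in> \<Union>X" "affine_tangent_space N X x = tang (\<Union>X) N p" "cfun.dim (tang (\<Union>X) N p) = Suc n"
proof -
  have xX: "x \<in> X" and d: "enat (cfun.dim (affine_tangent_space N X x)) = enat n + 1"
    using x(1) dim by (simp_all add: smooth_point_def)
  show "p \<in> \<Union>X" using xX x(2) by blast
  have "x = ppoint p" using pspace_rep[OF subsetD[OF X xX] x(2)] by simp
  then show a: "affine_tangent_space N X x = tang (\<Union>X) N p"
    unfolding tang_def using affine_tangent_space_tv[OF X] by simp
  have "enat n + 1 = enat (Suc n)" by (simp add: one_enat_def)
  then show "cfun.dim (tang (\<Union>X) N p) = Suc n" using d unfolding a by simp
qed

text \<open>The homogeneous components of \<open>G\<close> vanish on all tangent spaces at smooth
  points, since these are closed under scaling; the zero locus of a form is closed, so it contains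
  the tangent variety.\<close>

lemma smooth_points_dense:
  assumes X: "X \<subseteq> pspace N" and dim: "var_dim N X = enat n" and Tan: "tangent_variety N X = pspace N"
    and G: "G \<in> polyfun (Suc N)"
    and van: "\<And>p w. p \<in> \<Union>X \<Longrightarrow> cfun.dim (tang (\<Union>X) N p) = Suc n \<Longrightarrow> w \<in> tang (\<Union>X) N p \<Longrightarrow> G w = 0"
  shows "G z = 0"
proof -
  define V where "V = (\<Union>x\<in>{x. smooth_point N X x}. tangent_space N X x)"
  have V: "zariski N closure_of V = pspace N" using Tan unfolding tangent_variety_def V_def .
  obtain D F where F: "\<forall>d. homogeneous N d (F d)" and GF: "\<forall>v. G v = (\<Sum>d<D. peval (F d) v)"
    using polyfun_homogeneous_sum[OF G] by (elim exE conjE)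
  have FV: "peval (F d) v = 0" if "y \<in> V" "v \<in> y" "d < D" for y v d
  proof (rule zero_on_cone_component[OF _ _ \<open>d < D\<close>])
    from that(1) obtain x where x: "smooth_point N X x" "y \<in> tangent_space N X x"
      unfolding V_def by (elim UN_E CollectE)
    have "x \<in> pspace N" using x(1) X by (auto simp: smooth_point_def)
    from pspace_nonempty[OF this] obtain p where p: "p \<in> x" ..
    note sm = smooth_pointD[OF X dim x(1) p]
    have "v \<in> tang (\<Union>X) N p" using x(2) that(2) sm(2) unfolding tangent_space_def by blast
    from van[OF sm(1,3) cscale_tang[OF this]] show "(\<Sum>d<D. peval (F d) (cscale c v)) = 0" for c
      using GF by simp
    show "homogeneous N d (F d)" for d using F by (rule spec)
  qed
  have all: "peval (F d) v = 0" if v: "v \<in> cvec N" "v \<noteq> 0" and d: "d < D" for d v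
  proof -
    let ?Z = "{x \<in> pspace N. vanishes_at (F d) x}"
    note Fd = spec[OF F, of d]
    have "V \<subseteq> ?Z"
    proof
      fix y assume y: "y \<in> V"
      then have "y \<in> pspace N" unfolding V_def tangent_space_def by blast
      then show "y \<in> ?Z" using FV[OF y _ d] unfolding vanishes_at_def by blast
    qed
    then have "zariski N closure_of V \<subseteq> ?Z"
      by (rule closure_of_minimal) (simp add: closedin_zariski zariski_closed_hypersurface[OF Fd])
    moreover have "ppoint v \<in> pspace N" using v unfolding pspace_def by blast
    ultimately have "vanishes_at (F d) (ppoint v)" using V by blast
    then show ?thesis using vanishes_at_iff[OF Fd] by simp
  qed
  show ?thesis
  proof (rule ccontr)
    assume "G z \<noteq> 0"
    from nonzero_on_cvec[OF G this polyfun.const[of 1]] obtain v where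
      "v \<in> cvec N" "v \<noteq> 0" "G v \<noteq> 0" by auto
    then show False using GF all by simp
  qed
qed

lemma tangential_cone_of_subvariety:
  assumes "n \<ge> 1" "N = 2 * n" and var: "subvariety N X" and dim: "var_dim N X = enat n"
    and Tan: "tangent_variety N X = pspace N"
  shows "tangential_cone (\<Union>X) N n"
proof -
  have cl: "zariski_closed N X" and irr: "irreducible_space (subtopology (zariski N) X)"
    using var by (simp_all add: subvariety_def closedin_zariski)
  have X: "X \<subseteq> pspace N" by (rule zariski_closed_subset[OF cl])
  show ?thesis
  proof
    show "prime_on (\<Union>X) (polyfun (Suc N))" by (rule irreducible_prime_on[OF cl irr])
    show "\<Union>X \<subseteq> cvec N" using Union_pspace[OF X] by blast
    show "x \<noteq> 0" if "x \<in> \<Union>X" for x using Union_pspace[OF X] that by blast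
    show "cscale c x \<in> \<Union>X" if "x \<in> \<Union>X" "c \<noteq> 0" for x c by (rule Union_pspace_scale[OF X that])
    show "v \<in> \<Union>X" if "v \<in> cvec N" "v \<noteq> 0" "v \<in> zcl (\<Union>X) (Suc N)" for v
    proof (rule zariski_closed_mem[OF cl that(1,2)])
      fix f assume "f \<in> polyfun (Suc N)" "\<forall>x\<in>\<Union>X. f x = 0"
      then show "f v = 0" using that(3) unfolding zcl_def by (simp del: Union_iff)
    qed
    show "\<exists>f. (\<forall>i<Suc n. f i \<in> polyfun (Suc N)) \<and> indep_funs (\<Union>X) (Suc n) f"
      by (rule indep_funs_var_dim[OF var dim assms(1)])
    show "G z = 0" if "G \<in> polyfun (Suc N)"
      "\<And>p w. p \<in> \<Union>X \<Longrightarrow> cfun.dim (tang (\<Union>X) N p) = Suc n \<Longrightarrow> w \<in> tang (\<Union>X) N p \<Longrightarrow> G w = 0" for G z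
      by (rule smooth_points_dense[OF X dim Tan that])
  qed (rule assms)+
qed

text \<open>If C were the whole space, all tangent spaces would be everything, and two of them could
  not meet in a line only; the first two unit vectors show this.\<close>

lemma (in tangential_cone) cone_proper: "\<exists>v\<in>cvec N. v \<noteq> 0 \<and> v \<notin> C"
proof (rule ccontr)
  assume "\<not> ?thesis"
  then have C: "v \<in> C" if "v \<in> cvec N" "v \<noteq> 0" for v using that by blast
  have van: "f = (\<lambda>_. 0)" if f: "f \<in> polyfun (Suc N)" "\<forall>x\<in>C. f x = 0" for f
  proof (rule ccontr)
    assume "f \<noteq> (\<lambda>_. 0)"
    then obtain z where "f z \<noteq> 0" by (auto simp: fun_eq_iff)
    from nonzero_on_cvec[OF f(1) this polyfun.const[of 1]] obtain v where
      "v \<in> cvec N" "v \<noteq> 0" "f v \<noteq> 0" by auto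
    then show False using f(2) C by blast
  qed
  have tang: "w \<in> tang C N x" if w: "w \<in> cvec N" for w x
    unfolding tang_def
  proof (rule IntI[OF w], rule tvI)
    fix f assume f: "f \<in> polyfun (Suc N)" and "\<And>x. x \<in> C \<Longrightarrow> f x = 0"
    then have "\<forall>x\<in>C. f x = 0" by blast
    then have "f = (\<lambda>_. 0)" by (rule van[OF f])
    then show "dd (Suc N) f x w = 0" by simp
  qed
  from bexE[OF generic_spanning_pair] obtain u where u: "u \<in> polyfun (Suc N)" and
    up: "(\<exists>p. u p \<noteq> 0) \<and> (\<forall>P\<in>cvec N. P \<noteq> 0 \<longrightarrow> u P \<noteq> 0 \<longrightarrow>
      (\<exists>x\<in>C. \<exists>y\<in>C. P \<in> tang C N x \<inter> tang C N y \<and>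
        (\<forall>w\<in>tang C N x \<inter> tang C N y. \<exists>c. w = cscale c P)))" .
  from conjunct1[OF up] obtain p where "u p \<noteq> 0" ..
  from nonzero_on_cvec[OF u this polyfun.const[of 1]] obtain P where
    P: "P \<in> cvec N" "P \<noteq> 0" "u P \<noteq> 0" by auto
  from mp[OF mp[OF bspec[OF conjunct2[OF up] P(1)] P(2)] P(3)] obtain x y where
    span: "\<forall>w\<in>tang C N x \<inter> tang C N y. \<exists>c. w = cscale c P" by (elim bexE conjE)
  have e: "\<exists>c. (\<lambda>i. if i = k then 1 else 0) = cscale c P" if "k \<le> N" for k
    by (rule bspec[OF span], rule IntI; rule tang) (use that in \<open>simp_all add: cvec_def\<close>)
  from e[of 0] obtain c where c: "(\<lambda>i. if i = 0 then 1 else 0) = cscale c P" by auto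
  from e[of 1] N_eq n_pos obtain c' where c': "(\<lambda>i. if i = 1 then 1 else 0) = cscale c' P" by auto
  show False
    using fun_cong[OF c, of 0] fun_cong[OF c, of 1] fun_cong[OF c', of 1] by (auto simp: cscale_def)
qed

theorem theorem2p2:
  fixes n N :: nat and X :: "point set"
  assumes "n \<ge> 1" and "N = 2 * n"
    and "subvariety N X" and "var_dim N X = enat n"
    and "tangent_variety N X = pspace N"
  shows "\<exists>U. openin (zariski N) U \<and> U \<noteq> {} \<and> U \<subseteq> pspace N - X \<and>
    (\<forall>P\<in>U. \<forall>Q\<in>pspace N - X. \<forall>\<pi>\<^sub>P \<pi>\<^sub>Q.
       linear_projection N P \<pi>\<^sub>P \<and> linear_projection N Q \<pi>\<^sub>Q \<and>
       ramification_locus N X (N - 1) \<pi>\<^sub>Q = ramification_locus N X (N - 1) \<pi>\<^sub>P \<longrightarrow>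
       Q = P)"
proof -
  define C where "C = \<Union>X"
  interpret tangential_cone C N n
    unfolding C_def by (rule tangential_cone_of_subvariety[OF assms])
  have cl: "zariski_closed N X" using assms(3) by (simp add: subvariety_def closedin_zariski)
  have X: "X \<subseteq> pspace N" by (rule zariski_closed_subset[OF cl])
  have N1: "N \<ge> 1" using assms(1,2) by simp
  from bexE[OF generic_spanning_pair] obtain u where u: "u \<in> polyfun (Suc N)" and
    up: "(\<exists>p. u p \<noteq> 0) \<and> (\<forall>P\<in>cvec N. P \<noteq> 0 \<longrightarrow> u P \<noteq> 0 \<longrightarrow>
      (\<exists>x\<in>C. \<exists>y\<in>C. P \<in> tang C N x \<inter> tang C N y \<and>
        (\<forall>w\<in>tang C N x \<inter> tang C N y. \<exists>c. w = cscale c P)))" .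
  from conjunct1[OF up] obtain p where p: "u p \<noteq> 0" ..
  obtain D F where F: "\<forall>d. homogeneous N d (F d)" and uF: "\<forall>v. u v = (\<Sum>d<D. peval (F d) v)"
    using polyfun_homogeneous_sum[OF u] by (elim exE conjE)
  have "\<exists>d<D. peval (F d) p \<noteq> 0"
  proof (rule ccontr)
    assume "\<not> ?thesis"
    then have "u p = 0" using uF by simp
    with p show False by contradiction
  qed
  then obtain d where d: "d < D" "peval (F d) p \<noteq> 0" by (elim exE conjE)
  note Fd = spec[OF F, of d]
  \<comment> \<open>\<open>u\<close> need not be homogeneous, while open sets are cut out by forms.
    Where one of its components is nonzero, \<open>u\<close> is nonzero at some multiple of the
    coordinate vector, and this multiple spans the same point.\<close>
  define U where "U = {x \<in> pspace N. \<not> vanishes_at (F d) x} \<inter> (pspace N - X)"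
  have "openin (zariski N) (pspace N - X)"
    using cl X by (simp add: openin_zariski double_diff)
  then have U_open: "openin (zariski N) U"
    unfolding U_def by (rule openin_Int[OF openin_nonvanishing[OF Fd]])
  have U_nonempty: "U \<noteq> {}"
  proof -
    from cone_proper obtain v where v: "v \<in> cvec N" "v \<noteq> 0" "v \<notin> C" by (elim bexE conjE)
    have "\<exists>h\<in>polyfun (Suc N). (\<forall>x\<in>C. h x = 0) \<and> h v \<noteq> 0"
    proof (rule ccontr)
      assume none: "\<not> ?thesis"
      have "v \<in> \<Union>X"
      proof (rule zariski_closed_mem[OF cl v(1,2)])
        fix f assume "f \<in> polyfun (Suc N)" "\<forall>x\<in>\<Union>X. f x = 0"
        with none show "f v = 0" unfolding C_def[symmetric] by blast
      qed
      with v(3) show False unfolding C_def by contradiction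
    qed
    then obtain h where h: "h \<in> polyfun (Suc N)" "\<forall>x\<in>C. h x = 0" "h v \<noteq> 0" by (elim bexE conjE)
    from nonzero_on_cvec[OF peval_polyfun[OF Fd] d(2) h(1,3)] obtain w where
      w: "w \<in> cvec N" "w \<noteq> 0" "peval (F d) w \<noteq> 0" "h w \<noteq> 0" by (elim bexE conjE)
    have "ppoint w \<in> pspace N" using w(1,2) unfolding pspace_def by blast
    moreover have "ppoint w \<notin> X"
    proof
      assume "ppoint w \<in> X"
      then have "w \<in> C" unfolding C_def by (rule UnionI[OF _ ppoint_mem])
      with h(2) w(4) show False by blast
    qed
    ultimately have "ppoint w \<in> U" unfolding U_def using vanishes_at_iff[OF Fd] w(3) by simp
    then show ?thesis by blast
  qed
  have determined: "Q = P"
    if P: "P \<in> U" and Q: "Q \<in> pspace N - X" and projP: "linear_projection N P \<pi>\<^sub>P"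
      and projQ: "linear_projection N Q \<pi>\<^sub>Q"
      and ram: "ramification_locus N X (N - 1) \<pi>\<^sub>Q = ramification_locus N X (N - 1) \<pi>\<^sub>P"
    for P Q \<pi>\<^sub>P \<pi>\<^sub>Q
  proof -
    have PX: "P \<in> pspace N - X" and nv: "\<not> vanishes_at (F d) P"
      using P by (simp_all add: U_def)
    then obtain v where v: "v \<in> P" "peval (F d) v \<noteq> 0" unfolding vanishes_at_def by blast
    from PX have "P \<in> pspace N" by simp
    note vP = pspace_rep[OF this v(1)]
    have "\<exists>c. c \<noteq> 0 \<and> u (cscale c v) \<noteq> 0"
    proof (rule ccontr)
      assume "\<not> ?thesis"
      then have "(\<Sum>d<D. peval (F d) (cscale c v)) = 0" if "c \<noteq> 0" for c
        using that uF by auto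
      from zero_on_cone_component[OF spec[OF F] this d(1)] v(2) show False by contradiction
    qed
    then obtain c where c: "c \<noteq> 0" "u (cscale c v) \<noteq> 0" by (elim exE conjE)
    define w where "w = cscale c v"
    have w: "w \<in> cvec N" "w \<noteq> 0" "u w \<noteq> 0" and Pw: "P = ppoint w"
      using vP c unfolding w_def by (simp_all add: cscale_cvec ppoint_scale)
    from mp[OF mp[OF bspec[OF conjunct2[OF up] w(1)] w(2)] w(3)] obtain x y where
      xy: "x \<in> C" "y \<in> C" "w \<in> tang C N x \<inter> tang C N y"
      and span: "\<forall>t\<in>tang C N x \<inter> tang C N y. \<exists>c. t = cscale c w" by (elim bexE conjE)
    from Q have "Q \<in> pspace N" by simp
    from pspace_nonempty[OF this] obtain t where t: "t \<in> Q" ..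
    note tQ = pspace_rep[OF \<open>Q \<in> pspace N\<close> t]
    have wP: "w \<in> P" unfolding Pw by (rule ppoint_mem)
    \<comment> \<open>Only two points of the ramification locus are used, \<open>x\<close> and
      \<open>y\<close>. Equality of the loci puts \<open>Q\<close> into both tangent spaces, whose
      intersection is the line of \<open>P\<close>.\<close>
    have "t \<in> tang C N z" if z: "z \<in> C" "w \<in> tang C N z" for z
    proof -
      have "ppoint z \<in> ramification_locus N X (N - 1) \<pi>\<^sub>P"
        using ramification_iff_tangent[OF X N1 PX wP projP, of z] z unfolding C_def tang_def by simp
      then have "t \<in> tv C (Suc N) z"
        using ramification_iff_tangent[OF X N1 Q t projQ, of z] z ram unfolding C_def by simp
      then show ?thesis using tQ by (simp add: tang_def)
    qed
    then have "t \<in> tang C N x \<inter> tang C N y" using xy by blast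
    from bspec[OF span this] obtain k where k: "t = cscale k w" ..
    then have "k \<noteq> 0" using tQ by (auto simp: cscale_def fun_eq_iff)
    then show "Q = P" using tQ k Pw by (simp add: ppoint_scale)
  qed
  show ?thesis
  proof (intro exI[of _ U] conjI ballI allI impI)
    show "U \<subseteq> pspace N - X" unfolding U_def by blast
  qed (rule U_open U_nonempty | elim conjE determined; assumption)+
qed

end
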